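(* For each integer $m\equiv 1\pmod{24}$ (positive or negative) there is a unique $h_m\in H^!_{5/2}(\varepsilon)$ with a Fourier expansion of the form $$h_m(z)=q^{\frac{m}{24}}+\sum_{0<n\equiv 1\,(24)}p_m^+(n)\,q^{\frac{n}{24}}\qquad\text{if } m<0,$$ and $$h_m(z)=\sum_{0<n\equiv 1\,(24)}p_m^+(n)\,q^{\frac{n}{24}}+i\,\beta(-my)\,q^{\frac{m}{24}}+\sum_{0<n\equiv -1\,(24)}p_m^-(n)\,\beta(ny)\,q^{-\frac{n}{24}}\qquad\text{if } m>0,$$ with coefficients $p_m^{\pm}(n)\in\mathbb{C}$. The set $\{h_m: m\equiv 1\pmod{24}\}$ forms a basis for $H^!_{5/2}(\varepsilon)$. For $m<0$ we have $h_m\in M^!_{5/2}(\varepsilon)$, while for $m>0$ we have $$\xi_{5/2}(h_m)=\left(\frac{6}{\pi m}\right)^{3/2} g_m\in M^!_{-1/2}(\overline{\varepsilon}).$$ Furthermore, for $m\neq n$, the coefficients $p_m^+(n)$ are real.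
   Context: Write $z=x+iy\in\mathbb{H}$, $q=e^{2\pi i z}$, $q^{r}=e^{2\pi i r z}$ for $r\in\mathbb{Q}$; powers $\tau^k$ use the principal branch ($\arg\tau\in(-\pi,\pi]$). The eta function $\eta(z)=q^{1/24}\prod_{n\ge1}(1-q^n)$ satisfies $\eta(\gamma z)=\varepsilon(\gamma)(cz+d)^{1/2}\eta(z)$ for $\gamma=\begin{pmatrix}a&b\\c&d\end{pmatrix}\in \mathrm{SL}_2(\mathbb{Z})$, which defines the multiplier system $\varepsilon$ (values in 24th roots of unity). $M_k^!(\nu)$ denotes the space of weakly holomorphic modular forms (holomorphic on $\mathbb{H}$, meromorphic at $\infty$) of weight $k$ and multiplier $\nu$ on $\mathrm{SL}_2(\mathbb{Z})$, i.e. $f(\gamma z)=\nu(\gamma)(cz+d)^kf(z)$. For $k=5/2$, $H_k^!(\varepsilon)$ (weak harmonic Maass forms) is the complex vector space of real analytic $f:\mathbb{H}\to\mathbb{C}$ such that $f(\gamma z)=\varepsilon(\gamma)(cz+d)^kf(z)$ for all $\gamma\in\mathrm{SL}_2(\mathbb{Z})$, $\Delta_kf=0$ where $\Delta_k=-y^2\left(\frac{\partial^2}{\partial x^2}+\frac{\partial^2}{\partial y^2}\right)+iky\left(\frac{\partial}{\partial x}+i\frac{\partial}{\partial y}\right)$, and such that in the Fourier expansion (which such functions automatically have) $$f(z)=\sum_{n\equiv1\,(24)}a^+(n)q^{n/24}+\sum_{n\equiv-1\,(24)}a^-(n)\,\Gamma\!\left(1-k,\tfrac{\pi ny}{6}\right)q^{-n/24}$$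 only finitely many $a^{\pm}(n)$ with $n\le0$ are nonzero. The operator $\xi_k$ is $\xi_k(f)=2iy^k\,\overline{\frac{\partial f}{\partial\bar z}}$. $\beta(y)=\Gamma\!\left(-\tfrac32,\tfrac{\pi y}{6}\right)$, where $\Gamma(s,y)=\int_y^\infty e^{-t}t^{s-1}dt$ is the incomplete gamma function; for negative real argument $y$ the principal branch is used ($\arg y=\pi$, i.e. the path of integration from $y$ to $+\infty$ passes through the upper half plane). For positive $m\equiv1\pmod{24}$, $g_m\in M^!_{-1/2}(\overline{\varepsilon})$ is the unique form $g_m=\eta^{-1}P_m(j)$, with $P_m$ a monic polynomial in the modular $j$-function $j=q^{-1}+744+\cdots$, such that $g_m=q^{-m/24}+O(q^{23/24})$; in particular $g_1=\eta^{-1}$. *)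

theory Defs
  imports
    "HOL-Complex_Analysis.Complex_Analysis"
    "HOL-Computational_Algebra.Polynomial"
    "HOL-Number_Theory.Cong"
    "HOL-Library.Function_Algebras"
    "HOL-Library.Landau_Symbols"
begin

text \<open>
  A function on the upper half-plane is represented by a function on \<^typ>\<open>complex\<close> that vanishes
  off the half-plane, so that equality of functions is equality on the half-plane. An element of
  SL(2,Z) is given by its entries \<open>a b c d\<close> with \<open>a * d - b * c = 1\<close>, and a multiplier system by a
  function of the four entries.
\<close>

definition uhp :: "complex set" where
  "uhp = {z. Im z > 0}"

definition on_uhp :: "(complex \<Rightarrow> complex) \<Rightarrow> complex \<Rightarrow> complex" where
  "on_uhp f = (\<lambda>z. if z \<in> uhp then f z else 0)"

definition qpow :: "real \<Rightarrow> complex \<Rightarrow> complex" where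
  "qpow r z = exp (2 * of_real pi * \<i> * of_real r * z)"

definition moebius_int :: "int \<Rightarrow> int \<Rightarrow> int \<Rightarrow> int \<Rightarrow> complex \<Rightarrow> complex" where
  "moebius_int a b c d z = (of_int a * z + of_int b) / (of_int c * z + of_int d)"

definition eta :: "complex \<Rightarrow> complex" where
  "eta z = qpow (1/24) z * (\<Prod>n. 1 - qpow 1 z ^ Suc n)"

text \<open>Complex \<open>powr\<close> uses the principal branch of the logarithm, with argument in \<open>(-\<pi>, \<pi>]\<close>.\<close>

definition eta_mult :: "int \<Rightarrow> int \<Rightarrow> int \<Rightarrow> int \<Rightarrow> complex" where
  "eta_mult a b c d = (THE e. \<forall>z\<in>uhp.
     eta (moebius_int a b c d z) = e * (of_int c * z + of_int d) powr (1/2) * eta z)"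

definition eta_mult_cnj :: "int \<Rightarrow> int \<Rightarrow> int \<Rightarrow> int \<Rightarrow> complex" where
  "eta_mult_cnj a b c d = cnj (eta_mult a b c d)"

definition transforms_like ::
  "real \<Rightarrow> (int \<Rightarrow> int \<Rightarrow> int \<Rightarrow> int \<Rightarrow> complex) \<Rightarrow> (complex \<Rightarrow> complex) \<Rightarrow> bool" where
  "transforms_like k \<nu> f \<longleftrightarrow> (\<forall>a b c d. a * d - b * c = 1 \<longrightarrow>
     (\<forall>z\<in>uhp. f (moebius_int a b c d z) =
        \<nu> a b c d * (of_int c * z + of_int d) powr (of_real k) * f z))"

text \<open>
  If \<open>\<nu> 1 1 0 1 = e\<^sup>2\<^sup>\<pi>\<^sup>i\<^sup>\<kappa>\<close>, then the transformation law makes \<open>f z * q\<^sup>-\<^sup>\<kappa>\<close> periodic with period 1,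
  hence a function of \<open>q\<close>; being meromorphic at infinity means that this function is meromorphic
  at \<open>q = 0\<close>. The choice of \<open>\<kappa>\<close> modulo 1 is immaterial.
\<close>

definition meromorphic_at_cusp ::
  "(int \<Rightarrow> int \<Rightarrow> int \<Rightarrow> int \<Rightarrow> complex) \<Rightarrow> (complex \<Rightarrow> complex) \<Rightarrow> bool" where
  "meromorphic_at_cusp \<nu> f \<longleftrightarrow> (\<exists>(\<kappa>::real) F. \<nu> 1 1 0 1 = cis (2 * pi * \<kappa>) \<and>
     F meromorphic_on {0} \<and> (\<forall>z\<in>uhp. f z = qpow \<kappa> z * F (qpow 1 z)))"

definition weakly_holomorphic_forms ::
  "real \<Rightarrow> (int \<Rightarrow> int \<Rightarrow> int \<Rightarrow> int \<Rightarrow> complex) \<Rightarrow> (complex \<Rightarrow> complex) set" where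
  "weakly_holomorphic_forms k \<nu> = {f. (\<forall>z. z \<notin> uhp \<longrightarrow> f z = 0) \<and>
     f holomorphic_on uhp \<and> transforms_like k \<nu> f \<and> meromorphic_at_cusp \<nu> f}"

definition real_analytic_on_uhp :: "(complex \<Rightarrow> complex) \<Rightarrow> bool" where
  "real_analytic_on_uhp f \<longleftrightarrow> (\<forall>w\<in>uhp. \<exists>r>0. \<exists>a :: nat \<Rightarrow> nat \<Rightarrow> complex. \<forall>z\<in>ball w r.
     ((\<lambda>(m, n). a m n * of_real ((Re z - Re w) ^ m * (Im z - Im w) ^ n)) has_sum f z) UNIV)"

definition dx :: "(complex \<Rightarrow> complex) \<Rightarrow> complex \<Rightarrow> complex" where
  "dx f z = vector_derivative (\<lambda>t. f (z + of_real t)) (at 0)"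

definition dy :: "(complex \<Rightarrow> complex) \<Rightarrow> complex \<Rightarrow> complex" where
  "dy f z = vector_derivative (\<lambda>t. f (z + \<i> * of_real t)) (at 0)"

definition dzbar :: "(complex \<Rightarrow> complex) \<Rightarrow> complex \<Rightarrow> complex" where
  "dzbar f z = (dx f z + \<i> * dy f z) / 2"

definition hyp_laplacian :: "real \<Rightarrow> (complex \<Rightarrow> complex) \<Rightarrow> complex \<Rightarrow> complex" where
  "hyp_laplacian k f z = - of_real ((Im z)\<^sup>2) * (dx (dx f) z + dy (dy f) z)
     + \<i> * of_real (k * Im z) * (dx f z + \<i> * dy f z)"

definition xi_op :: "real \<Rightarrow> (complex \<Rightarrow> complex) \<Rightarrow> complex \<Rightarrow> complex" where
  "xi_op k f = on_uhp (\<lambda>z. 2 * \<i> * of_real (Im z powr k) * cnj (dzbar f z))"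

text \<open>
  The incomplete Gamma function \<open>\<Gamma>(s, x)\<close> for real \<open>x \<noteq> 0\<close>. For \<open>x < 0\<close> the path of integration
  runs from \<open>x\<close> (where the argument is \<open>\<pi>\<close>) through the upper half-plane along the semicircle to
  \<open>-x\<close>, and then along the real axis to infinity.
\<close>

definition inc_Gamma :: "real \<Rightarrow> real \<Rightarrow> complex" where
  "inc_Gamma s x =
     (if x < 0 then contour_integral (part_circlepath 0 \<bar>x\<bar> pi 0)
                      (\<lambda>t. exp (- t) * t powr (of_real (s - 1)))
      else 0)
     + of_real (integral {\<bar>x\<bar>..} (\<lambda>t. exp (- t) * t powr (s - 1)))"

definition beta_fun :: "real \<Rightarrow> complex" where
  "beta_fun y = inc_Gamma (- 3/2) (pi * y / 6)"

definition weak_harmonic_Maass_forms :: "real \<Rightarrow> (complex \<Rightarrow> complex) set" where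
  "weak_harmonic_Maass_forms k = {f. (\<forall>z. z \<notin> uhp \<longrightarrow> f z = 0) \<and>
     real_analytic_on_uhp f \<and> transforms_like k eta_mult f \<and>
     (\<forall>z\<in>uhp. hyp_laplacian k f z = 0) \<and>
     (\<exists>ap am :: int \<Rightarrow> complex.
        finite {n. n \<le> 0 \<and> [n = 1] (mod 24) \<and> ap n \<noteq> 0} \<and>
        finite {n. n \<le> 0 \<and> [n = -1] (mod 24) \<and> am n \<noteq> 0} \<and>
        (\<forall>z\<in>uhp. \<exists>s t.
           ((\<lambda>n. ap n * qpow (of_int n / 24) z) has_sum s) {n. [n = 1] (mod 24)} \<and>
           ((\<lambda>n. am n * inc_Gamma (1 - k) (pi * of_int n * Im z / 6) * qpow (- of_int n / 24) z)
              has_sum t) {n. [n = -1] (mod 24)} \<and>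
           f z = s + t))}"

definition E4 :: "complex \<Rightarrow> complex" where
  "E4 z = 1 + 240 * (\<Sum>n. of_nat (\<Sum>d | d dvd Suc n. d ^ 3) * qpow 1 z ^ Suc n)"

text \<open>The usual \<open>j = E\<^sub>4\<^sup>3 / \<Delta>\<close> with \<open>\<Delta> = \<eta>\<^sup>2\<^sup>4\<close>, normalised so that \<open>j = q\<^sup>-\<^sup>1 + 744 + \<dots>\<close>.\<close>

definition j_fun :: "complex \<Rightarrow> complex" where
  "j_fun z = E4 z ^ 3 / eta z ^ 24"

definition g_form :: "int \<Rightarrow> complex \<Rightarrow> complex" where
  "g_form m = (THE g. \<exists>P :: complex poly. lead_coeff P = 1 \<and>
     g = on_uhp (\<lambda>z. poly P (j_fun z) / eta z) \<and>
     (\<lambda>z. g z - qpow (- of_int m / 24) z) \<in> O[filtercomap Im at_top](qpow (23/24)))"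

definition has_h_expansion ::
  "int \<Rightarrow> (complex \<Rightarrow> complex) \<Rightarrow> (int \<Rightarrow> complex) \<Rightarrow> (int \<Rightarrow> complex) \<Rightarrow> bool" where
  "has_h_expansion m f pp pm \<longleftrightarrow> (\<forall>z\<in>uhp.
     if m < 0 then
       \<exists>s. ((\<lambda>n. pp n * qpow (of_int n / 24) z) has_sum s) {n. 0 < n \<and> [n = 1] (mod 24)} \<and>
           f z = qpow (of_int m / 24) z + s
     else
       \<exists>s t. ((\<lambda>n. pp n * qpow (of_int n / 24) z) has_sum s) {n. 0 < n \<and> [n = 1] (mod 24)} \<and>
           ((\<lambda>n. pm n * beta_fun (of_int n * Im z) * qpow (- of_int n / 24) z) has_sum t)
             {n. 0 < n \<and> [n = -1] (mod 24)} \<and>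
           f z = s + \<i> * beta_fun (- of_int m * Im z) * qpow (of_int m / 24) z + t)"

definition is_h_form :: "int \<Rightarrow> (complex \<Rightarrow> complex) \<Rightarrow> bool" where
  "is_h_form m h \<longleftrightarrow>
     h \<in> weak_harmonic_Maass_forms (5/2) \<and> (\<exists>pp pm. has_h_expansion m h pp pm)"

definition h_form :: "int \<Rightarrow> complex \<Rightarrow> complex" where
  "h_form m = (THE h. is_h_form m h)"

definition cscale :: "complex \<Rightarrow> (complex \<Rightarrow> complex) \<Rightarrow> complex \<Rightarrow> complex" where
  "cscale c f = (\<lambda>z. c * f z)"

global_interpretation cfun: vector_space cscale
  by unfold_locales (auto simp: cscale_def fun_eq_iff algebra_simps)

end

theory Submission
  imports Defs
begin

text \<open>
  Uniqueness: for a harmonic form \<open>f\<close> the shadow times \<open>\<eta>\<close> has weight 0 and \<open>f / \<eta>\<close> has weight 2, so a form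
  without principal part has shadow 0, is holomorphic, and vanishes because there is no holomorphic form of weight 2
  on the full modular group. For \<open>m < 0\<close> a suitable polynomial in \<open>j\<close> times \<open>\<eta> j'\<close> is the required form.

  Existence for \<open>m > 0\<close>: put \<open>r = m / 24\<close>, \<open>a = 4 \<pi> r\<close>. The usual Poincare series in weight 5/2 is replaced by
  \<open>\<eta>\<close> times a weight 2 series with kernel \<open>v(y) q\<^sup>r / \<eta>\<close>, where \<open>v' = y\<^bsup>-5/2\<^esup> e\<^bsup>ay\<^esup> w(y)\<close> and \<open>w(y)\<close> is the integral of
  \<open>s\<^bsup>1/2\<^esup> e\<^bsup>-as\<^esup>\<close> from 0 to \<open>y\<close>; the factor \<open>w\<close> makes the series converge absolutely. Its antiholomorphic derivative is
  the series with kernel \<open>w q\<^bsup>-r\<^esup> \<eta>\<close>, whose own antiholomorphic derivative is the weight 2 series of \<open>q\<^sup>r / \<eta>\<close>, which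
  vanishes. Hence the shadow is holomorphic, and comparing principal parts identifies it with a multiple of \<open>g\<^sub>m\<close>.
\<close>

section \<open>Modular substitutions\<close>

text \<open>The obstacle is convergence. Let J = |cz + d|, so that Im z becomes Im z/J^2 at the row
  (c, d). A kernel with derivative y^(-5/2) e^(ay) is of size y^(-3/2) near 0, and the terms of its
  weight 2 series would be of size J^3 J^(-5/2). Since w(y) <= y^(3/2), the derivative of v is
  O(1/y), v is logarithmic, and the terms are of size J^(-5/2) up to a small power; this is summable
  over pairs of integers because 5/2 > 2. The price is a shadow that is not visibly holomorphic. The
  integrand s^(1/2) e^(-as) of w is dictated by this: e^(-as) turns q^(-r) into the conjugate of
  q^r, while Im^(1/2) |eta|^2 is invariant and leaves the sum, so that the conjugate of the series
  of q^r/eta remains. As y tends to infinity, w tends to a constant W > 0; W, with a factor 2 for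
  the two signs of a row, is the constant between that series and \<open>g_form\<close>. The law of
  \<open>eta\<close> is derived from the inversion of the weight 2 Eisenstein series, which comes
  from cotangent sums. The factor i in h_m comes from (-1)^(-5/2) = -i for the argument pi.\<close>

abbreviation (input) moeb :: "int => int => int => int => complex => complex" where "moeb \<equiv> moebius_int"

abbreviation (input) gam :: "int => complex => complex" where "gam n z \<equiv> inc_Gamma (1 - 5/2) (pi * of_int n*Im z/6)"

abbreviation (input) nonhol :: "(int => complex) => int => complex => complex" where
 "nonhol am n z \<equiv> am n*gam n z*qpow (- of_int n/24) z"

lemmas has_sum_congD = has_sum_cong[THEN iffD1, rotated]

lemma uhp_iff: "z : uhp \<longleftrightarrow> Im z > 0"
 by (simp add: uhp_def)

lemma open_uhp [simp]: "open uhp"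
 unfolding uhp_def by (rule open_halfspace_Im_gt)

lemma convex_uhp: "convex uhp"
 unfolding uhp_def by (rule convex_halfspace_Im_gt)

lemma connected_uhp: "connected uhp"
 using convex_uhp convex_connected by blast

definition jf :: "int => int => complex => complex" where
 "jf c d z = of_int c*z + of_int d"

lemma jf_nonzero:
 assumes "z : uhp" "c ~= 0 \<or> d ~= 0" shows "jf c d z ~= 0"
proof
 assume "jf c d z = 0"
 then have "Im (jf c d z) = 0" "Re (jf c d z) = 0" by auto
 then have "of_int c*Im z = 0" "of_int c * Re z + of_int d = 0" by (auto simp: jf_def)
 with assms show False by (auto simp: uhp_iff)
qed

lemma det_jf_nonzero:
 assumes "z : uhp" "a * d - b * c = (1::int)" shows "jf c d z ~= 0"
 using jf_nonzero[of z c d] assms by force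

lemma moebius_jf: "moeb a b c d z = jf a b z/jf c d z"
 by (simp add: moebius_int_def jf_def)

lemma Im_moebius:
 assumes "a * d - b * c = 1"
 shows "Im (moeb a b c d z) = Im z/(norm (jf c d z))\<^sup>2"
proof -
 have "real_of_int a * real_of_int d - real_of_int b * real_of_int c = 1"
  using assms by (metis of_int_1 of_int_diff of_int_mult)
 then have e: "real_of_int a * real_of_int d = 1 + real_of_int b * real_of_int c" by linarith
 have "Im (moeb a b c d z) =
   (of_int a*Im z*(of_int c * Re z + of_int d) - (of_int a * Re z + of_int b)*(of_int c*Im z))/(norm (jf c d z))\<^sup>2"
  by (simp add: moebius_jf Im_divide jf_def cmod_power2)
 also have "of_int a*Im z*(of_int c * Re z + of_int d) - (of_int a * Re z + of_int b)*(of_int c*Im z)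
   = Im z*(of_int a * of_int d - of_int b * of_int c)" by (simp add: algebra_simps)
 finally show ?thesis using e by simp
qed

lemma moebius_in_uhp:
 assumes "a * d - b * c = 1" "z : uhp" shows "moeb a b c d z : uhp"
 using assms Im_moebius[OF assms(1), of z] det_jf_nonzero[OF assms(2,1)] by (simp add: uhp_iff)

lemma jf_compose:
 assumes "a * d - b * c = 1" "z : uhp"
 shows "jf c' d' (moeb a b c d z)*jf c d z = jf (c' * a + d' * c) (c' * b + d' * d) z"
 using det_jf_nonzero[OF assms(2,1)]
 by (simp add: moebius_jf jf_def field_simps)

lemma moebius_compose:
 assumes "a * d - b * c = 1" "a' * d' - b' * c' = 1" "z : uhp"
 shows "moeb a' b' c' d' (moeb a b c d z)
  = moeb (a' * a + b' * c) (a' * b + b' * d) (c' * a + d' * c) (c' * b + d' * d) z"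
proof -
 have 1: "jf c' d' (moeb a b c d z) ~= 0" "jf c d z ~= 0"
  using assms det_jf_nonzero moebius_in_uhp by blast+
 have "moeb a' b' c' d' (moeb a b c d z)
  = (jf a' b' (moeb a b c d z)*jf c d z)/(jf c' d' (moeb a b c d z)*jf c d z)"
  using 1 by (simp add: moebius_jf[of a' b'])
 then show ?thesis unfolding jf_compose[OF assms(1,3)] by (simp add: moebius_jf)
qed

lemma det_compose:
 fixes a :: int
 assumes "a * d - b * c = 1" "a' * d' - b' * c' = 1"
 shows "(a' * a + b' * c)*(c' * b + d' * d) - (a' * b + b' * d)*(c' * a + d' * c) = 1"
proof -
 have "(a' * a + b' * c)*(c' * b + d' * d) - (a' * b + b' * d)*(c' * a + d' * c)
  = (a * d - b * c)*(a' * d' - b' * c')" by (simp add: algebra_simps)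
 then show ?thesis using assms by simp
qed

lemma moebius_has_field_derivative:
 assumes "a * d - b * c = 1" "z : uhp"
 shows "(moeb a b c d has_field_derivative 1/(jf c d z)\<^sup>2) (at z)"
proof -
 have "of_int a * of_int d - of_int b * of_int c = (1::complex)"
  using assms by (metis of_int_1 of_int_diff of_int_mult)
 then have e: "of_int a * of_int d = 1 + of_int b*(of_int c::complex)" by (simp add: algebra_simps)
 have nz: "of_int c*z + of_int d ~= 0" using det_jf_nonzero[OF assms(2,1)] by (simp add: jf_def)
 have "((%z. (of_int a*z + of_int b)/(of_int c*z + of_int d)) has_field_derivative
  (of_int a*(of_int c*z + of_int d) - (of_int a*z + of_int b) * of_int c)
   /((of_int c*z + of_int d)*(of_int c*z + of_int d))) (at z)"
  using nz by (auto intro!: derivative_eq_intros)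
 moreover have "of_int a*(of_int c*z + of_int d) - (of_int a*z + of_int b) * of_int c = 1"
  using e by (simp add: algebra_simps)
 ultimately show ?thesis
  by (simp add: moebius_int_def[abs_def] jf_def power2_eq_square)
qed

text \<open>The product of one matrix with the inverse of the other has bottom row (0, 1), hence is
  a translation. This makes a sum over bottom rows well defined for a periodic kernel.\<close>

lemma moebius_same_bottom:
 assumes "a * d - b * c = 1" "a' * d - b' * c = 1" "z : uhp"
 shows "\<exists>n. moeb a' b' c d z = moeb a b c d z + of_int n"
proof -
 \<comment> \<open>Minus the upper right entry of that product, so the translation is by -n.\<close>
 define n where "n = a' * b - a * b'"
 have "a' - a = (a' - a)*(a * d - b * c)" using assms by simp
 also have "... = a*(a' * d - a * d) - (a' - a) * b * c" by (simp add: algebra_simps)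
 also have "... = a*(b' * c - b * c) - (a' - a) * b * c" using assms(1,2) by (simp add: algebra_simps)
 also have "... = - n * c" by (simp add: n_def algebra_simps)
 finally have a: "a' = a+(-n) * c" by simp
 have "b' - b = (b' - b)*(a * d - b * c)" using assms by simp
 also have "... = a * d * b' - a * b * d - b*(b' * c - b * c)" by (simp add: algebra_simps)
 also have "... = a * d * b' - a * b * d - b*(a' * d - a * d)" using assms(1,2) by (simp add: algebra_simps)
 also have "... = - n * d" by (simp add: n_def algebra_simps)
 finally have b: "b' = b+(-n) * d" by simp
 have "jf c d z ~= 0" using assms det_jf_nonzero by blast
 then have "moeb a' b' c d z = moeb a b c d z + of_int (-n)"
  unfolding a b by (simp add: moebius_jf jf_def field_simps)
 then show ?thesis by blast
qed

lemma periodic_int: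
 assumes "!!z. z : uhp ==> f (z+1) = f z" "z : uhp"
 shows "f (z + of_int n) = f z"
proof -
 have nat: "f (z + of_nat k) = f z" if "z : uhp" for z k
  using that
 proof (induction k)
  case (Suc k)
  have "z + of_nat k : uhp" using Suc.prems by (simp add: uhp_iff)
  from assms(1)[OF this] Suc show ?case by (simp add: add_ac)
 qed simp
 show ?thesis
 proof (cases "n >= 0")
  case True
  then show ?thesis using nat[OF assms(2), of "nat n"] by simp
 next
  case False
  have "z + of_int n : uhp" using assms(2) by (simp add: uhp_iff)
  from nat[OF this, of "nat (-n)"] show ?thesis using False by simp
 qed
qed

text \<open>Euclidean algorithm on the bottom row: the induction is on the modulus of
  \<open>c\<close>, and for \<open>c = 0\<close> the map is a translation.\<close>

lemma invariant_from_generators: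
 assumes T: "!!z. z : uhp ==> f (z+1) = f z" and S: "!!z. z : uhp ==> f (- 1/z) = f z"
 shows "a * d - b * c = 1 ==> z : uhp ==> f (moeb a b c d z) = f z"
proof (induction "nat \<bar>c\<bar>" arbitrary: a b c d z rule: less_induct)
 case less
 show ?case
 proof (cases "c = 0")
  case True
  then have "a * d = 1" using less.prems by simp
  then have "a = 1 & d = 1 \<or> a = -1 & d = -1" by (simp add: zmult_eq_1_iff)
  then have "moeb a b c d z = z + of_int b \<or> moeb a b c d z = z + of_int (-b)"
   using True by (auto simp: moebius_int_def algebra_simps)
  then show ?thesis using periodic_int[of f, OF T less.prems(2)] by metis
 next
  case False
  \<comment> \<open>Passing from z to -1/(z + n) replaces the row (c, d) by (-(d mod c), c), whose
    first entry is smaller in modulus.\<close>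
  define n where "n = d div c"
  have r: "d - n * c = d mod c" by (simp add: n_def minus_div_mult_eq_mod)
  have lt: "nat \<bar>- (d - n * c)\<bar> < nat \<bar>c\<bar>"
   using False abs_mod_less[of c d] by (simp add: r)
  have det: "(- (b - n * a)) * c - a*(- (d - n * c)) = 1"
   using less.prems(1) by (simp add: algebra_simps)
  have zn: "z + of_int n : uhp" using less.prems by (simp add: uhp_iff)
  have eq1: "moeb 0 (-1) 1 0 (z + of_int n) = - 1/(z + of_int n)" by (simp add: moebius_int_def)
  have S1: "- 1/(z + of_int n) : uhp" unfolding eq1[symmetric] by (rule moebius_in_uhp) (use zn in auto)
  have "f (moeb (- (b - n * a)) a (- (d - n * c)) c (- 1/(z + of_int n))) = f (- 1/(z + of_int n))"
   by (rule less.hyps[OF lt det S1])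
  also have "... = f z" using S[OF zn] periodic_int[of f, OF T less.prems(2)] by simp
  also have "moeb (- (b - n * a)) a (- (d - n * c)) c (- 1/(z + of_int n)) = moeb a b c d z"
   unfolding eq1[symmetric] using zn det_jf_nonzero[OF less.prems(2,1)]
   by (subst moebius_compose) (use det in \<open>auto simp: moebius_int_def algebra_simps\<close>)
  finally show ?thesis .
 qed
qed

section \<open>Reduction to a fundamental domain, and weight 0 forms that vanish at the cusp\<close>

lemma finite_bounded_jf:
 assumes "z : uhp" shows "finite {(c,d). norm (jf c d z)<=R}"
proof -
 define C where "C = \<lceil>R/Im z\<rceil>"
 define D where "D = \<lceil>R + R/Im z*norm z\<rceil>"
 have y: "Im z > 0" using assms by (simp add: uhp_iff)
 have "{(c,d). norm (jf c d z)<=R} \<subseteq> {-C..C} \<times> {-D..D}"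
 proof safe
  fix c d assume h: "norm (jf c d z)<=R"
  have "\<bar>of_int c*Im z\<bar><=norm (jf c d z)"
   using abs_Im_le_cmod[of "jf c d z"] by (simp add: jf_def)
  then have "\<bar>of_int c\<bar>*Im z<=R" using h y by (simp add: abs_mult)
  then have c: "\<bar>of_int c\<bar><=R/Im z" using y by (simp add: field_simps)
  have "\<bar>of_int d\<bar> = norm (jf c d z - of_int c*z)" by (simp add: jf_def)
  also have "...<=norm (jf c d z) + norm (of_int c*z)" by (rule norm_triangle_ineq4)
  also have "...<=R + R/Im z*norm z"
   using h mult_right_mono[OF c, of "norm z"] by (simp add: norm_mult)
  finally have d: "\<bar>of_int d\<bar><=R + R/Im z*norm z" .
  have "of_int \<bar>c\<bar><=R/Im z" using c by simp
  also have "...<=of_int C" unfolding C_def by (rule le_of_int_ceiling)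
  finally have C: "\<bar>c\<bar><=C" by linarith
  have "of_int \<bar>d\<bar><=R + R/Im z*norm z" using d by simp
  also have "...<=of_int D" unfolding D_def by (rule le_of_int_ceiling)
  finally have "\<bar>d\<bar><=D" by linarith
  then show "c : {-C..C}" "d : {-D..D}" using C by auto
 qed
 then show ?thesis by (rule finite_subset) auto
qed

lemma coprime_row:
 assumes "coprime c (d::int)" shows "\<exists>a b. a * d - b * c = 1"
proof -
 obtain u v where "u * c + v * d = 1" using bezout_int[of c d] assms by auto
 then have "v * d - (-u) * c = 1" by simp
 then show ?thesis by blast
qed

lemma det_coprime:
 assumes "a * d - b * c = (1::int)" shows "coprime c d" "coprime a b"
proof -
 have "e dvd 1" if "e dvd c" "e dvd d" for e using assms that by (metis dvd_diff dvd_mult)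
 then show "coprime c d" by (simp add: coprime_def)
 have "e dvd 1" if "e dvd a" "e dvd b" for e using assms that by (metis dvd_diff dvd_mult2)
 then show "coprime a b" by (simp add: coprime_def)
qed

text \<open>A row with minimal |cz + d| gives the largest imaginary part. After translation into the
  strip, minimality against the row (a, b) forces |w| >= 1, and then (Im w)^2 >= 3/4 > 1/4.\<close>

lemma exists_reduced:
 assumes "z : uhp"
 obtains a b c d where "a * d - b * c = 1" "Im (moeb a b c d z) > 1/2"
  "\<bar>Re (moeb a b c d z)\<bar><=1/2"
proof -
 \<comment> \<open>Comparison with the row (0, 1) makes the set of candidates finite and
   nonempty.\<close>
 define A where "A = {(c,d). coprime c d & norm (jf c d z)<=norm (jf 0 1 z)}"
 have "finite A" unfolding A_def by (rule finite_subset[OF _ finite_bounded_jf[OF assms]]) auto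
 moreover have "(0,1) : A" by (simp add: A_def)
 ultimately have "\<exists>cd\<in>A. \<forall>x\<in>A. norm (jf (fst cd) (snd cd) z)<=norm (jf (fst x) (snd x) z)"
  using arg_min_if_finite[of A "%x. norm (jf (fst x) (snd x) z)"]
  by (intro bexI[of _ "arg_min_on (%x. norm (jf (fst x) (snd x) z)) A"]) (auto simp: not_less[symmetric])
 then obtain cd where cd: "cd : A" "!!x. x : A ==> norm (jf (fst cd) (snd cd) z)<=norm (jf (fst x) (snd x) z)"
  by blast
 obtain c d where cd': "cd = (c,d)" by force
 have cop: "coprime c d" and le: "norm (jf c d z)<=norm (jf 0 1 z)" using cd cd' by (auto simp: A_def)
 have min: "norm (jf c d z)<=norm (jf c' d' z)" if "coprime c' d'" for c' d'
  using cd(2)[of "(c',d')"] that le cd' by (cases "(c',d') : A") (auto simp: A_def)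
 obtain a0 b0 where ab0: "a0 * d - b0 * c = 1" using coprime_row[OF cop] by blast
 define w0 where "w0 = moeb a0 b0 c d z"
 define n where "n = - round (Re w0)"
 define a b where "a = a0 + n * c" and "b = b0 + n * d"
 have ab: "a * d - b * c = 1" using ab0 by (simp add: a_def b_def algebra_simps)
 have nz: "jf c d z ~= 0" using det_jf_nonzero[OF assms ab] .
 define w where "w = moeb a b c d z"
 have w: "w = w0 + of_int n"
  using nz by (simp add: w_def w0_def moebius_jf a_def b_def jf_def field_simps)
 have re: "\<bar>Re w\<bar><=1/2" unfolding w n_def
  using of_int_round_abs_le[of "Re w0"] by (simp add: abs_minus_commute)
 have wu: "w : uhp" unfolding w_def using moebius_in_uhp[OF ab assms] .
 have "norm w >= 1"
 proof (rule ccontr)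
  assume "\<not> norm w >= 1"
  then have lt: "norm w < 1" by simp
  have "norm (jf a b z) = norm w*norm (jf c d z)"
   using nz by (simp add: w_def moebius_jf norm_divide)
  also have "... < norm (jf c d z)" using lt nz by simp
  finally show False using min[OF det_coprime(2)[OF ab]] by linarith
 qed
 then have "1<=(norm w)\<^sup>2" by (simp add: one_le_power)
 also have "... = (Re w)\<^sup>2+(Im w)\<^sup>2" by (simp add: cmod_power2)
 finally have "1<=(Re w)\<^sup>2+(Im w)\<^sup>2" .
 moreover have "(Re w)\<^sup>2<=1/4" using power_mono[OF re, of 2] by (simp add: power2_eq_square)
 ultimately have "(Im w)\<^sup>2 > (1/2)\<^sup>2" by (simp add: power2_eq_square)
 then have "Im w > 1/2" using wu power2_less_imp_less[of "1/2" "Im w"] by (simp add: uhp_iff)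
 then show ?thesis using that[of a d b c] ab re by (simp add: w_def)
qed

definition tendsto_cusp :: "(complex => complex) => bool" where
 "tendsto_cusp f \<longleftrightarrow> (\<forall>e>0. \<exists>Y. \<forall>z. Im z > Y \<longrightarrow> norm (f z) < e)"

text \<open>Near the cusp |f| stays below |f z0|, so the supremum of |f| is attained on the compact
  part of the reduced strip. By the maximum modulus principle f is constant, which contradicts its
  smallness near the cusp.\<close>

lemma weight0_vanishing:
 assumes hol: "f holomorphic_on uhp"
  and inv: "!!a b c d z. a * d - b * c = 1 ==> z : uhp ==> f (moeb a b c d z) = f z"
  and lim: "tendsto_cusp f" and z0: "z0 : uhp"
 shows "f z0 = 0"
proof (rule ccontr)
 assume nz: "f z0 ~= 0"
 then obtain Y0 where Y0: "!!z. Im z > Y0 ==> norm (f z) < norm (f z0)"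
  using lim unfolding tendsto_cusp_def by (metis zero_less_norm_iff)
 define Y where "Y = max Y0 1"
 have Y: "norm (f z) < norm (f z0)" if "Im z > Y" for z using Y0 that by (simp add: Y_def)
 define K where "K = cbox (Complex (-1/2) (1/2)) (Complex (1/2) Y)"
 have Ku: "K \<subseteq> uhp" by (auto simp: K_def in_cbox_complex_iff uhp_iff)
 have ne: "K ~= {}" unfolding K_def by (auto simp: box_ne_empty Basis_complex_def Y_def inner_complex_def)
 have "continuous_on K (%z. norm (f z))"
  by (intro continuous_on_norm continuous_on_subset[OF holomorphic_on_imp_continuous_on[OF hol] Ku])
 then obtain z1 where z1: "z1 : K" "!!z. z : K ==> norm (f z)<=norm (f z1)"
  using continuous_attains_sup[of K "%z. norm (f z)"] ne by (auto simp: K_def)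
 have red: "norm (f z) < norm (f z0) \<or> norm (f z)<=norm (f z1)" if "z : uhp" for z
 proof -
  obtain a b c d where *: "a * d - b * c = 1" "Im (moeb a b c d z) > 1/2"
   "\<bar>Re (moeb a b c d z)\<bar><=1/2" using exists_reduced[OF \<open>z : uhp\<close>] by metis
  have "Im (moeb a b c d z) > Y \<or> moeb a b c d z : K"
   using * by (auto simp: K_def in_cbox_complex_iff)
  then show ?thesis using Y[of "moeb a b c d z"] z1(2)[of "moeb a b c d z"] inv[OF *(1) that] by auto
 qed
 have max: "norm (f z)<=norm (f z1)" if "z : uhp" for z
  using red[OF that] red[OF z0] by linarith
 have "f constant_on uhp"
  by (rule maximum_modulus_principle[OF hol open_uhp connected_uhp open_uhp order_refl, of z1])
   (use max z1 Ku in auto)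
 then obtain k where k: "!!z. z : uhp ==> f z = k" unfolding constant_on_def by blast
 have "Complex 0 (Y+1) : uhp" by (simp add: uhp_iff Y_def)
 then show False using k[of "Complex 0 (Y+1)"] k[OF z0] Y[of "Complex 0 (Y+1)"] by simp
qed

section \<open>Sums over integers and over lattice points\<close>

lemma has_sum_int_nonzero:
 fixes f :: "int => 'a::topological_comm_monoid_add"
 assumes "((%n. f (int (Suc n))) has_sum a) UNIV" "((%n. f (- int (Suc n))) has_sum b) UNIV"
 shows "(f has_sum (a + b)) (-{0})"
proof -
 have disj: "range (%n. int (Suc n)) \<inter> range (%n. - int (Suc n)) = {}" by auto
 have 1: "inj (%n. int (Suc n))" "inj (%n. - int (Suc n))" by (auto intro!: injI)
 have "x : range (%n. int (Suc n))" if "x > 0" for x :: int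
  using that by (intro image_eqI[of _ _ "nat (x - 1)"]) auto
 moreover have "x : range (%n. - int (Suc n))" if "x < 0" for x :: int
  using that by (intro image_eqI[of _ _ "nat (- x - 1)"]) auto
 ultimately have "-{0::int} = range (%n. int (Suc n)) \<union> range (%n. - int (Suc n))"
  by (auto simp: neq_iff) (metis linorder_neqE)+
 moreover have "(f has_sum a) (range (%n. int (Suc n)))" "(f has_sum b) (range (%n. - int (Suc n)))"
  unfolding has_sum_reindex[OF 1(1)] has_sum_reindex[OF 1(2)] o_def by (rule assms)+
 ultimately show ?thesis by (metis has_sum_Un_disjoint disj)
qed

lemma has_sum_int:
 fixes f :: "int => 'a::topological_comm_monoid_add"
 assumes "((%n. f (int n)) has_sum a) UNIV" "((%n. f (- int (Suc n))) has_sum b) UNIV"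
 shows "(f has_sum (a + b)) UNIV"
proof -
 have disj: "range (%n. int n) \<inter> range (%n. - int (Suc n)) = {}" by auto
 have 1: "inj (%n. int n)" "inj (%n. - int (Suc n))" by (auto intro!: injI)
 have "x : range (%n. int n)" if "x >= 0" for x :: int
  using that by (intro image_eqI[of _ _ "nat x"]) auto
 moreover have "x : range (%n. - int (Suc n))" if "x < 0" for x :: int
  using that by (intro image_eqI[of _ _ "nat (- x - 1)"]) auto
 ultimately have "UNIV = range (%n. int n) \<union> range (%n. - int (Suc n))"
  by (metis UNIV_eq_I UnCI linorder_not_less)
 moreover have "(f has_sum a) (range (%n. int n))" "(f has_sum b) (range (%n. - int (Suc n)))"
  unfolding has_sum_reindex[OF 1(1)] has_sum_reindex[OF 1(2)] o_def by (rule assms)+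
 ultimately show ?thesis by (metis has_sum_Un_disjoint disj)
qed

lemma summable_powr_shift: "s > 1 ==> (%n::nat. (1 + real n) powr (-s)) summable_on UNIV"
proof -
 assume "s > 1"
 then have "summable (%n. real n powr (-s))" by (simp add: summable_real_powr_iff)
 then have "summable (%n. real (Suc n) powr (-s))" by (subst summable_Suc_iff)
 then show ?thesis by (intro norm_summable_imp_summable_on) (simp add: add.commute)
qed

lemma summable_int_powr:
 assumes "s > 1" shows "(%n::int. (1+\<bar>of_int n\<bar>) powr (-s) :: real) summable_on UNIV"
proof -
 have 1: "(%n. (1+\<bar>of_int (int n)\<bar>) powr (-s) :: real) summable_on UNIV"
  using summable_powr_shift[OF assms] by simp
 have "summable (%n. (1 + real (Suc n)) powr (-s))"
  using summable_on_imp_summable[OF summable_powr_shift[OF assms]] by (subst summable_Suc_iff)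
 then have 2: "(%n. (1+\<bar>of_int (- int (Suc n))\<bar>) powr (-s) :: real) summable_on UNIV"
  by (intro norm_summable_imp_summable_on) (simp add: add_ac)
 show ?thesis using 1 2 has_sum_int[of "%n. (1+\<bar>of_int n\<bar>) powr (-s)"] unfolding summable_on_def by blast
qed

text \<open>A norm on rows that is independent of z and comparable with |cz + d| locally uniformly
  in z, so that one majorant serves a whole neighbourhood.\<close>

definition rowsize :: "int \<times> int => real" where
 "rowsize p = of_int (max \<bar>fst p\<bar> \<bar>snd p\<bar>)"

lemma rowsize_ge_1: "p ~= (0,0) ==> rowsize p >= 1"
 by (cases p) (auto simp: rowsize_def)

text \<open>Away from (0, 0), both 1 + |c| and 1 + |d| are at most twice the maximum, so the sum is
  dominated by a product of two sums over the integers with exponent s/2 > 1. The pair (0, 0)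
  contributes 0, because \<open>0 powr x = 0\<close>.\<close>

lemma summable_rowsize:
 assumes "s > 2" shows "(%p. rowsize p powr (-s)) summable_on UNIV"
proof (rule summable_on_comparison_test)
 have "(%(c,d). (1+\<bar>of_int c\<bar>) powr (-(s/2))*((1+\<bar>of_int d\<bar>) powr (-(s/2)) :: real)) summable_on UNIV \<times> UNIV"
 proof (rule summable_on_SigmaI)
  fix c :: int
  show "((%d::int. case (c,d) of (c,d) => (1+\<bar>of_int c\<bar>) powr (-(s/2))*((1+\<bar>of_int d\<bar>) powr (-(s/2)) :: real))
   has_sum ((1+\<bar>of_int c\<bar>) powr (-(s/2))*(\<Sum>\<^sub>\<infinity>d::int. (1+\<bar>of_int d\<bar>) powr (-(s/2))))) UNIV"
   using summable_int_powr[of "s/2"] assms by (auto intro!: has_sum_cmult_right has_sum_infsum)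
 qed (use summable_int_powr[of "s/2"] assms in \<open>auto intro!: summable_on_cmult_left\<close>)
 then have "(%(c,d). (1+\<bar>of_int c\<bar>) powr (-(s/2))*((1+\<bar>of_int d\<bar>) powr (-(s/2)) :: real)) summable_on UNIV"
  by simp
 then show "(%p. 2 powr s*(case p of (c,d) => (1+\<bar>of_int c\<bar>) powr (-(s/2))*((1+\<bar>of_int d\<bar>) powr (-(s/2)) :: real))) summable_on UNIV"
  by (rule summable_on_cmult_right)
 fix p :: "int \<times> int"
 obtain c d where p: "p = (c,d)" by force
 show "rowsize p powr - s<=2 powr s*(case p of (c,d) => (1+\<bar>of_int c\<bar>) powr (-(s/2))*((1+\<bar>of_int d\<bar>) powr (-(s/2)) :: real))"
 proof (cases "p = (0,0)")
  case False
  have N: "rowsize p >= 1" using rowsize_ge_1[OF False] .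
  have "1+\<bar>of_int c\<bar><=2 * rowsize p" "1+\<bar>of_int d\<bar><=2 * rowsize p"
   using N by (auto simp: rowsize_def p)
  then have "(2 * rowsize p) powr (-(s/2))*(2 * rowsize p) powr (-(s/2))<=(1+\<bar>of_int c\<bar>) powr (-(s/2))*((1+\<bar>of_int d\<bar>) powr (-(s/2)) :: real)"
   using assms by (intro mult_mono powr_mono2') auto
  moreover have "(2 * rowsize p) powr (-(s/2))*(2 * rowsize p) powr (-(s/2)) = 2 powr (-s) * rowsize p powr (-s)"
   using N unfolding powr_add[symmetric] by (simp add: powr_mult)
  ultimately have "2 powr (-s) * rowsize p powr (-s)<=(1+\<bar>of_int c\<bar>) powr (-(s/2))*(1+\<bar>of_int d\<bar>) powr (-(s/2))"
   by simp
  from mult_left_mono[OF this, of "2 powr s"] show ?thesis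
   by (simp add: p mult.assoc[symmetric] powr_add[symmetric])
 qed (auto simp: rowsize_def)
qed auto

text \<open>The imaginary part c Im z of cz + d controls c, and then d = (cz + d) - cz is controlled
  as well.\<close>

lemma rowsize_le_jf:
 assumes "Im z >= y" "y > 0" "norm z<=R"
 shows "rowsize (c,d)<=(1/y+1 + R/y)*norm (jf c d z)"
proof -
 have R: "R >= 0" using assms norm_ge_zero order_trans by blast
 have "\<bar>of_int c\<bar>*y<=\<bar>of_int c\<bar>*Im z" using assms by (intro mult_left_mono) auto
 also have "... = \<bar>Im (jf c d z)\<bar>" using assms by (simp add: jf_def abs_mult)
 also have "...<=norm (jf c d z)" by (rule abs_Im_le_cmod)
 finally have c: "\<bar>of_int c\<bar><=norm (jf c d z)/y" using assms by (simp add: field_simps)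
 have "\<bar>of_int d\<bar> = norm (jf c d z - of_int c*z)" by (simp add: jf_def)
 also have "...<=norm (jf c d z) + norm (of_int c*z)" by (rule norm_triangle_ineq4)
 also have "norm (of_int c*z)<=norm (jf c d z)/y * R"
  unfolding norm_mult norm_of_int using c assms R by (intro mult_mono) auto
 finally have d: "\<bar>of_int d\<bar><=norm (jf c d z) + norm (jf c d z)/y * R" by simp
 have "0<=norm (jf c d z)/y * R" "0<=norm (jf c d z)/y" using R assms by auto
 then have "rowsize (c,d)<=norm (jf c d z)/y + norm (jf c d z) + norm (jf c d z)/y * R"
  using c d norm_ge_zero[of "jf c d z"] unfolding rowsize_def fst_conv snd_conv of_int_max of_int_abs
  by (intro max.boundedI) linarith+
 then show ?thesis by (simp add: algebra_simps)
qed

lemma jf_le_rowsize: "norm (jf c d z)<=(1 + norm z) * rowsize (c,d)"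
proof -
 have "norm (jf c d z)<=\<bar>of_int c\<bar>*norm z+\<bar>of_int d\<bar>"
  unfolding jf_def using norm_triangle_ineq[of "of_int c*z" "of_int d"] by (simp add: norm_mult)
 also have "...<=rowsize (c,d)*norm z + rowsize (c,d)"
  by (intro add_mono mult_right_mono) (auto simp: rowsize_def)
 finally show ?thesis by (simp add: algebra_simps)
qed

lemma jf_inverse_power_le:
 assumes "z : uhp"
 obtains K where "K > 0" "!!c d. (c,d) ~= (0,0) ==> norm (1/jf c d z)<=K/rowsize (c,d)"
proof
 let ?K = "1/Im z+1 + norm z/Im z"
 have y: "Im z > 0" using assms by (simp add: uhp_iff)
 then show "?K > 0" by (intro add_pos_nonneg) auto
 fix c d :: int assume nz: "(c,d) ~= (0,0)"
 have "norm (jf c d z) > 0" using jf_nonzero[OF assms] nz by auto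
 then show "norm (1/jf c d z)<=?K/rowsize (c,d)"
  using rowsize_le_jf[of "Im z" z "norm z" c d] y rowsize_ge_1[OF nz]
  by (simp add: norm_divide divide_simps mult_ac)
qed

lemma summable_jf_power:
 assumes "z : uhp" "k >= 3"
 shows "(%(c,d). 1/jf c d z^k) summable_on (-{(0,0)})"
proof -
 obtain K where K: "K > 0" "!!c d. (c,d) ~= (0,0) ==> norm (1/jf c d z)<=K/rowsize (c,d)"
  using jf_inverse_power_le[OF assms(1)] by blast
 have "(%p. K^k * rowsize p powr (- real k)) summable_on (-{(0,0)})"
  using summable_rowsize[of "real k"] assms by (intro summable_on_cmult_right) (auto intro: summable_on_subset_banach)
 then have "(%p. norm (case p of (c,d) => 1/jf c d z^k)) summable_on (-{(0,0)})"
 proof (rule summable_on_comparison_test)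
  fix p :: "int \<times> int" assume p: "p : -{(0,0)}"
  obtain c d where cd: "p = (c,d)" by force
  have N: "rowsize p >= 1" using p rowsize_ge_1 by auto
  have "norm (1/jf c d z)^k<=(K/rowsize p)^k"
   using K(2)[of c d] p cd by (intro power_mono) auto
  also have "... = K^k * rowsize p powr (- real k)"
   using N by (simp add: powr_minus powr_realpow field_simps)
  finally show "norm (case p of (c,d) => 1/jf c d z^k)<=K^k * rowsize p powr (- real k)"
   by (simp add: cd norm_divide norm_power power_one_over)
 qed auto
 then show ?thesis by (rule abs_summable_summable)
qed

lemma bij_rows:
 assumes "a * d - b * c = (1::int)"
 shows "bij_betw (%(x,y). (x * a + y * c, x * b + y * d)) (-{(0,0)}) (-{(0,0)})"
proof (rule bij_betwI[of _ _ _ "%(x,y). (x * d - y * c, - x * b + y * a)"])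
 have "(x * a + y * c) * d - (x * b + y * d) * c = x*(a * d - b * c)" for x y by (simp add: algebra_simps)
 moreover have "- (x * a + y * c) * b+(x * b + y * d) * a = y*(a * d - b * c)" for x y by (simp add: algebra_simps)
 moreover have "(x * d - y * c) * a+(- x * b + y * a) * c = x*(a * d - b * c)" for x y by (simp add: algebra_simps)
 moreover have "(x * d - y * c) * b+(- x * b + y * a) * d = y*(a * d - b * c)" for x y by (simp add: algebra_simps)
 ultimately have e: "(x * a + y * c) * d - (x * b + y * d) * c = x" "- (x * a + y * c) * b+(x * b + y * d) * a = y"
  "(x * d - y * c) * a+(- x * b + y * a) * c = x" "(x * d - y * c) * b+(- x * b + y * a) * d = y" for x y
  using assms by simp_all
 show "(%(x,y). (x * a + y * c, x * b + y * d)) : - {(0, 0)} \<rightarrow> - {(0, 0)}"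
 proof clarsimp
  fix x y assume "x * a + y * c = 0" "x * b + y * d = 0" "x = 0 \<longrightarrow> y ~= 0"
  then show False using e(1)[of x y] e(2)[of x y] by simp
 qed
 show "(%(x,y). (x * d - y * c, - x * b + y * a)) : - {(0, 0)} \<rightarrow> - {(0, 0)}"
 proof (rule Pi_I)
  fix p :: "int \<times> int" assume p: "p : - {(0,0)}"
  obtain x y where xy: "p = (x,y)" by force
  have "x * d - y * c ~= 0 \<or> - x * b + y * a ~= 0"
   using e(3)[of x y] e(4)[of x y] p xy by (metis Compl_iff mult_zero_left add_0 singletonI)
  then show "(case p of (x,y) => (x * d - y * c, - x * b + y * a)) : - {(0,0)}" by (auto simp: xy)
 qed
 show "(%(x,y). (x * d - y * c, - x * b + y * a)) ((%(x,y). (x * a + y * c, x * b + y * d)) p) = p" for p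
  by (cases p) (simp only: prod.case e)
 show "(%(x,y). (x * a + y * c, x * b + y * d)) ((%(x,y). (x * d - y * c, - x * b + y * a)) p) = p" for p
  by (cases p) (simp only: prod.case e)
qed

section \<open>The Eisenstein series of weight 4\<close>

text \<open>The polylogarithm of order -k, on which x d/dx acts by raising k. For k = 0 the term n =
  0 is \<open>0 ^ 0 = 1\<close>, so the value is 1/(1 - x).\<close>

definition powsum :: "nat => complex => complex" where
 "powsum k x = (\<Sum>n. of_nat n^k*x^n)"

lemma summable_powsum: "norm (x::complex) < 1 ==> summable (%n. norm (of_nat n^k*x^n))"
proof -
 assume x: "norm x < 1"
 have "summable (%n. of_nat n^k*(y::real)^n)" if "norm y < 1" for y
  using that
 proof (induction k arbitrary: y)
  case 0
  then show ?case by simp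
 next
  case (Suc k)
  have "summable (%n. diffs (%n. of_nat n^k) n*y^n)"
   by (rule termdiff_converges[OF Suc.prems]) (rule Suc.IH)
  then have "summable (%n. y*(diffs (%n. of_nat n^k) n*y^n))" by (rule summable_mult)
  then have "summable (%n. of_nat (Suc n)^Suc k*y^Suc n)"
   by (simp add: diffs_def algebra_simps)
  then show ?case by (subst (asm) summable_Suc_iff)
 qed
 from this[of "norm x"] x show ?thesis by (simp add: norm_mult norm_power)
qed

lemma powsum_has_sum: "norm x < 1 ==> ((%n. of_nat n^k*x^n) has_sum powsum k x) UNIV"
 unfolding powsum_def using summable_powsum[of x k]
 by (intro norm_summable_imp_has_sum) (auto intro: summable_norm_cancel summable_sums)

lemma powsum_0: "norm x < 1 ==> powsum 0 x = 1/(1 - x)"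
 by (simp add: powsum_def suminf_geometric)

lemma powsum_Suc_has_sum:
 assumes "norm x < 1" "k > 0"
 shows "((%n. of_nat (Suc n)^k*x^Suc n) has_sum powsum k x) UNIV"
proof -
 have "bij_betw Suc UNIV (-{0::nat})"
  by (rule bij_betwI[of _ _ _ "%n. n - 1"]) auto
 moreover have "((%n. of_nat n^k*x^n) has_sum powsum k x) (-{0})"
  using powsum_has_sum[OF assms(1), of k] assms(2)
  by (subst has_sum_cong_neutral[of UNIV "-{0}" _ "%n. of_nat n^k*x^n"]) auto
 ultimately show ?thesis by (subst has_sum_reindex_bij_betw)
qed

lemma powsum_deriv:
 assumes "norm x < 1" "x ~= 0"
 shows "(powsum k has_field_derivative powsum (Suc k) x/x) (at x)"
proof -
 have "((%x. \<Sum>n. of_nat n^k*x^n) has_field_derivative (\<Sum>n. diffs (%n. of_nat n^k) n*x^n)) (at x)"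
  by (rule termdiffs_strong'[where K=1]) (use assms summable_norm_cancel[OF summable_powsum] in auto)
 moreover have "x*(\<Sum>n. diffs (%n. of_nat n^k) n*x^n) = (\<Sum>n. x*(diffs (%n. of_nat n^k) n*x^n))"
  by (rule suminf_mult[symmetric], rule termdiff_converges[where K=1])
   (use assms summable_norm_cancel[OF summable_powsum] in auto)
 moreover have "... = (\<Sum>n. of_nat (Suc n)^Suc k*x^Suc n)"
  by (simp add: diffs_def algebra_simps)
 moreover have "... = powsum (Suc k) x"
  using has_sum_imp_sums[OF powsum_Suc_has_sum[OF assms(1), of "Suc k"]] by (simp add: sums_iff)
 ultimately show ?thesis using assms unfolding powsum_def[of k, abs_def] by (metis nonzero_mult_div_cancel_left)
qed

lemma norm_qpow: "norm (qpow r z) = exp (- 2*pi * r*Im z)"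
 by (simp add: qpow_def)

lemma qpow_less_1: "z : uhp ==> norm (qpow 1 z) < 1"
 by (simp add: norm_qpow uhp_iff)

lemma qpow_nonzero [simp]: "qpow r z ~= 0"
 by (simp add: qpow_def)

lemma qpow_deriv: "(qpow r has_field_derivative 2 * of_real pi*\<i> * of_real r*qpow r z) (at z)"
 unfolding qpow_def[abs_def] by (auto intro!: derivative_eq_intros)

lemma powsum_qpow_deriv:
 assumes "z : uhp"
 shows "((%z. powsum k (qpow 1 z)) has_field_derivative 2 * of_real pi*\<i>*powsum (Suc k) (qpow 1 z)) (at z)"
 using DERIV_chain2[OF powsum_deriv[OF qpow_less_1[OF assms] qpow_nonzero] qpow_deriv[of 1 z]]
 by (simp add: mult_ac)

section \<open>The cotangent, polygamma functions and Lipschitz's formula\<close>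

definition cotf :: "complex => complex" where
 "cotf w = Digamma (1 - w) - Digamma w"

lemma uhp_not_nonpos_Ints: "w : uhp ==> w \<notin> \<int>\<^sub>\<le>\<^sub>0 & 1 - w \<notin> \<int>\<^sub>\<le>\<^sub>0"
proof -
 assume w: "w : uhp"
 have "Im x = 0" if "x : \<int>\<^sub>\<le>\<^sub>0" for x :: complex using that by (auto elim!: nonpos_Ints_cases)
 from this[of w] this[of "1 - w"] show ?thesis using w by (auto simp: uhp_iff)
qed

text \<open>\<open>cotf w\<close> is pi cot(pi w), the logarithmic derivative of the reflection
  formula for \<open>rGamma\<close>. With u = exp(i pi w) the cotangent is a rational function of
  u^2 = q.\<close>

lemma cotf_eq:
 assumes "w : uhp" shows "cotf w = of_real pi*\<i> - 2 * of_real pi*\<i>*powsum 0 (qpow 1 w)"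
proof -
 note ni = uhp_not_nonpos_Ints[OF assms]
 have g: "rGamma w ~= 0" "rGamma (1 - w) ~= 0" using ni by (simp_all add: rGamma_eq_zero_iff)
 have d1: "((%w. rGamma w * rGamma (1 - w)) has_field_derivative
   - rGamma w*Digamma w * rGamma (1 - w) + rGamma w*(rGamma (1 - w)*Digamma (1 - w))) (at w)"
  using ni by (auto intro!: derivative_eq_intros DERIV_chain2[of rGamma])
 have d2: "((%w. sin (of_real pi*w)/of_real pi) has_field_derivative cos (of_real pi*w)) (at w)"
  by (auto intro!: derivative_eq_intros)
 have eq: "rGamma w * rGamma (1 - w) * cotf w = cos (of_real pi*w)"
  using DERIV_unique[OF d1[unfolded rGamma_reflection_complex] d2] by (simp add: cotf_def algebra_simps)
 have s: "rGamma w * rGamma (1 - w) = sin (of_real pi*w)/of_real pi" by (rule rGamma_reflection_complex)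
 have s0: "sin (of_real pi*w) ~= 0" using g s by auto
 have c: "cotf w = of_real pi * cos (of_real pi*w)/sin (of_real pi*w)"
  using eq s0 unfolding s by (simp add: field_simps)
 define u where "u = exp (\<i>*(of_real pi*w))"
 have u: "u ~= 0" "exp (- (\<i>*(of_real pi*w))) = 1/u" by (simp_all add: u_def exp_minus field_simps)
 have q: "qpow 1 w = u*u" by (simp add: qpow_def u_def exp_add[symmetric] algebra_simps)
 have q1: "u*u ~= 1" using qpow_less_1[OF assms] q by auto
 have "cotf w = of_real pi*((u+1/u)/2)/((u - 1/u)/(2*\<i>))"
  unfolding c cos_exp_eq sin_exp_eq u_def[symmetric] u(2) ..
 also have "... = of_real pi*\<i>*(u*u+1)/(u*u - 1)"
  using u(1) q1 by (simp add: field_simps)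
 also have "... = of_real pi*\<i> - 2 * of_real pi*\<i>*(1/(1 - u*u))"
 proof -
  have "u*u - 1 ~= 0" "1 - u*u ~= 0" using q1 by auto
  then show ?thesis by (simp add: field_simps)
 qed
 also have "1/(1 - u*u) = powsum 0 (qpow 1 w)" using powsum_0[OF qpow_less_1[OF assms]] by (simp add: q)
 finally show ?thesis .
qed

text \<open>Differentiate the cotangent expansion k times: each step contributes a factor 2 pi i and
  raises the order of \<open>powsum\<close>, and the constant pi i survives only for k = 0.\<close>

lemma Polygamma_lipschitz:
 assumes "w : uhp"
 shows "(-1)^k*Polygamma k (1 - w) - Polygamma k w
  = (if k = 0 then of_real pi*\<i> else 0) - (2 * of_real pi*\<i>)^Suc k*powsum k (qpow 1 w)"
 using assms
proof (induction k arbitrary: w)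
 case 0
 then show ?case using cotf_eq[OF 0] by (simp add: cotf_def)
next
 case (Suc k)
 note ni = uhp_not_nonpos_Ints[OF Suc.prems]
 have 1: "((%w. (-1)^k*Polygamma k (1 - w) - Polygamma k w) has_field_derivative
  (-1)^k*(- Polygamma (Suc k) (1 - w)) - Polygamma (Suc k) w) (at w)"
  using ni by (auto intro!: derivative_eq_intros)
 have 2: "((%w. (if k = 0 then of_real pi*\<i> else 0) - (2 * of_real pi*\<i>)^Suc k*powsum k (qpow 1 w))
   has_field_derivative 0 - (2 * of_real pi*\<i>)^Suc k*(2 * of_real pi*\<i>*powsum (Suc k) (qpow 1 w))) (at w)"
  by (intro DERIV_diff DERIV_const DERIV_cmult powsum_qpow_deriv[OF Suc.prems])
 have "((%w. (-1)^k*Polygamma k (1 - w) - Polygamma k w)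
   has_field_derivative 0 - (2 * of_real pi*\<i>)^Suc k*(2 * of_real pi*\<i>*powsum (Suc k) (qpow 1 w))) (at w)"
  by (rule has_field_derivative_transform_within_open[OF 2 open_uhp Suc.prems]) (simp add: Suc.IH)
 from DERIV_unique[OF 1 this] show ?case by (simp add: algebra_simps)
qed

text \<open>The halves d >= 0 and d < 0 of the sum are polygamma values at w and at 1 - w; as k is
  odd, the power k + 1 is even and does not see the sign of w + d.\<close>

lemma lipschitz_has_sum:
 assumes "w : uhp" "k > 0" "odd k"
 shows "((%d::int. 1/(w + of_int d)^Suc k) has_sum (2 * of_real pi*\<i>)^Suc k/fact k*powsum k (qpow 1 w)) UNIV"
proof -
 note ni = uhp_not_nonpos_Ints[OF assms(1)]
 have abs: "summable (%n. norm (inverse ((x + of_nat n)^Suc k)))" for x :: complex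
 proof (rule summable_comparison_test_ev)
  show "summable (%n. 4 * inverse (real n^2))" by (intro summable_mult inverse_power_summable) simp
  show "eventually (%n. norm (norm (inverse ((x + of_nat n)^Suc k)))<=4 * inverse (real n^2)) sequentially"
   using eventually_ge_at_top[of "nat \<lceil>2*norm x+2\<rceil>"]
  proof eventually_elim
   case (elim n)
   then have n: "real n >= 2*norm x+2" by linarith
   then have n2: "real n >= 2" using norm_ge_zero[of x] by linarith
   have "real n = norm ((x + of_nat n) - x)" by simp
   also have "...<=norm (x + of_nat n) + norm x" by (rule norm_triangle_ineq4)
   finally have m: "real n/2<=norm (x + of_nat n)" using n by linarith
   have "(real n/2)^2<=(real n/2)^Suc k" using n2 assms(2) by (intro power_increasing) auto
   also have "...<=norm (x + of_nat n)^Suc k" using m n2 by (intro power_mono) auto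
   finally have "inverse (norm (x + of_nat n)^Suc k)<=inverse ((real n/2)^2)"
    using n2 by (intro le_imp_inverse_le) auto
   then show ?case by (simp add: norm_inverse norm_power norm_mult norm_divide power_divide inverse_eq_divide)
  qed
 qed
 have 1: "((%n. inverse ((x + of_nat n)^Suc k)) has_sum (Polygamma k x/fact k)) UNIV" if "x ~= 0" for x :: complex
  using Polygamma_LIMSEQ[OF that assms(2)] assms(3) by (intro norm_summable_imp_has_sum abs) simp
 have a: "((%n. 1/(w + of_int (int n))^Suc k) has_sum (Polygamma k w/fact k)) UNIV"
  using 1[of w] ni by (auto simp: inverse_eq_divide)
 have "inverse ((1 - w + of_nat n)^Suc k) = 1/(w + of_int (- int (Suc n)))^Suc k" for n
 proof -
  have "1 - w + of_nat n = - (w + of_int (- int (Suc n)))" by simp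
  moreover have "even (Suc k)" using assms(3) by simp
  ultimately have "(1 - w + of_nat n)^Suc k = (w + of_int (- int (Suc n)))^Suc k"
   by (metis power_minus_even)
  then show ?thesis by (simp only: inverse_eq_divide)
 qed
 note e = this
 have b: "((%n. 1/(w + of_int (- int (Suc n)))^Suc k) has_sum (Polygamma k (1 - w)/fact k)) UNIV"
 proof -
  have "1 - w ~= 0" using ni by (metis zero_in_nonpos_Ints)
  from 1[OF this] show ?thesis by (simp only: e)
 qed
 have "Polygamma k w/fact k + Polygamma k (1 - w)/fact k = - ((-1)^k*Polygamma k (1 - w) - Polygamma k w)/fact k"
  using assms(3) by (simp add: field_simps)
 also have "... = (2 * of_real pi*\<i>)^Suc k/fact k*powsum k (qpow 1 w)"
  unfolding Polygamma_lipschitz[OF assms(1)] using assms(2) by simp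
 finally show ?thesis using has_sum_int[OF a b] by simp
qed

text \<open>The intervals are half-open so that summands f d - f (d + 1) telescope to the boundary
  terms at exactly -N and N.\<close>

lemma tendsto_symmetric_sum:
 fixes f :: "int => complex"
 assumes "(f has_sum s) UNIV"
 shows "(%N. \<Sum>d\<in>{- int N..<int N}. f d) \<longlonglongrightarrow> s"
proof -
 have "filterlim (%N. {- int N..<int N}) (finite_subsets_at_top UNIV) sequentially"
  unfolding filterlim_finite_subsets_at_top
 proof safe
  fix X :: "int set" assume X: "finite X"
  define M where "M = Max (insert 0 ((%x. nat \<bar>x\<bar>) ` X))"
  have M: "nat \<bar>x\<bar><=M" if "x : X" for x unfolding M_def using X that by (intro Max_ge) auto
  show "\<forall>\<^sub>F N in sequentially. finite {- int N..<int N} & X \<subseteq> {- int N..<int N} & {- int N..<int N} \<subseteq> UNIV"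
   using eventually_gt_at_top[of M]
  proof eventually_elim
   case (elim N)
   have "x : {- int N..<int N}" if "x : X" for x using M[OF that] elim by auto
   then show ?case by auto
  qed
 qed
 then show ?thesis using assms unfolding has_sum_def by (rule filterlim_compose[rotated])
qed

lemma row_has_sum:
 assumes "z : uhp" "c ~= 0" "k > 0" "odd k"
 shows "((%d. 1/jf c d z^Suc k) has_sum
  (2 * of_real pi*\<i>)^Suc k/fact k*powsum k (qpow 1 z^nat \<bar>c\<bar>)) UNIV"
proof -
 define n where "n = nat \<bar>c\<bar>"
 have n: "n > 0" using assms by (simp add: n_def)
 have u: "of_nat n*z : uhp" using assms n by (simp add: uhp_iff)
 have q: "qpow 1 (of_nat n*z) = qpow 1 z^n"
  by (simp add: qpow_def exp_of_nat_mult[symmetric] mult_ac)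
 have h: "((%d. 1/(of_nat n*z + of_int d)^Suc k) has_sum
  (2 * of_real pi*\<i>)^Suc k/fact k*powsum k (qpow 1 z^n)) UNIV"
  using lipschitz_has_sum[OF u assms(3,4)] by (simp only: q)
 show ?thesis
 proof (cases "c > 0")
  case True
  then show ?thesis using h by (simp add: jf_def n_def)
 next
  case False
  \<comment> \<open>For negative c the substitution d -> -d changes cz + d into its negative for
    |c|, which the even power does not see.\<close>
  have b: "bij_betw (%d::int. - d) UNIV UNIV" by (rule bij_betwI[of _ _ _ "%d. - d"]) auto
  have "of_nat n*z + of_int (- d) = - jf c d z" for d using False by (simp add: jf_def n_def)
  then have "1/(of_nat n*z + of_int (- d))^Suc k = 1/jf c d z^Suc k" for d
   using power_minus_even[of "Suc k" "jf c d z"] assms(4) by simp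
  then show ?thesis
   using has_sum_reindex_bij_betw[OF b, THEN iffD2, OF h] by (simp add: n_def)
 qed
qed

lemma summable_lambert:
 fixes x :: complex
 assumes "norm x < 1"
 shows "(%(c,n). of_nat (Suc n)^k*x^(Suc c * Suc n)) summable_on UNIV"
proof -
 define r where "r = norm x"
 have r: "0<=r" "r < 1" using assms by (auto simp: r_def)
 have rn: "r^Suc n<=r" for n using r power_decreasing[of 1 "Suc n" r] by simp
 have "(%(n,c). real (Suc n)^k * r^(Suc c * Suc n)) summable_on UNIV \<times> UNIV"
 proof (rule summable_on_SigmaI)
  fix n :: nat
  have "((%c. (r^Suc n) ^ c) has_sum 1/(1 - r^Suc n)) UNIV"
   using rn[of n] r by (intro norm_summable_imp_has_sum) (auto intro!: summable_geometric geometric_sums simp del: power_Suc)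
  then have "((%c. real (Suc n)^k * r^Suc n*(r^Suc n) ^ c) has_sum (real (Suc n)^k * r^Suc n*(1/(1 - r^Suc n)))) UNIV"
   by (rule has_sum_cmult_right)
  moreover have "r^(Suc c * Suc n) = r^Suc n*(r^Suc n) ^ c" for c
   by (metis mult.commute power_Suc power_mult)
  ultimately show "((%c. case (n,c) of (n,c) => real (Suc n)^k * r^(Suc c * Suc n)) has_sum
   (real (Suc n)^k * r^Suc n*(1/(1 - r^Suc n)))) UNIV" by (simp only: mult.assoc prod.case)
 next
  have 0: "summable (%n. norm ((of_nat (Suc n) :: complex)^k*x^Suc n))"
   using summable_powsum[OF assms, of k] by (subst summable_Suc_iff)
  have "summable (%n. real (Suc n)^k * r^Suc n*(1/(1 - r)))"
   using summable_mult2[OF 0, of "1/(1 - r)"]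
   by (simp only: norm_mult norm_power r_def[symmetric] norm_of_nat)
  then have "(%n. real (Suc n)^k * r^Suc n*(1/(1 - r))) summable_on UNIV"
   using r by (intro norm_summable_imp_summable_on) simp
  then show "(%n. real (Suc n)^k * r^Suc n*(1/(1 - r^Suc n))) summable_on UNIV"
  proof (rule summable_on_comparison_test)
   fix n
   have "1/(1 - r^Suc n)<=1/(1 - r)" using rn[of n] r by (intro divide_left_mono mult_pos_pos) auto
   then show "real (Suc n)^k * r^Suc n*(1/(1 - r^Suc n))<=real (Suc n)^k * r^Suc n*(1/(1 - r))"
    using r by (intro mult_left_mono) auto
   show "0<=real (Suc n)^k * r^Suc n*(1/(1 - r^Suc n))" using r rn[of n] by auto
  qed
 qed (use r in auto)
 then have "(%(c,n). real (Suc n)^k * r^(Suc c * Suc n)) summable_on UNIV \<times> UNIV"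
  by (subst summable_on_swap) (simp add: case_prod_unfold)
 then have "(%p. norm (case p of (c,n) => (of_nat (Suc n) :: complex)^k*x^(Suc c * Suc n))) summable_on UNIV"
  by (simp only: case_prod_unfold norm_mult norm_power r_def[symmetric] norm_of_nat UNIV_Times_UNIV)
 then show ?thesis by (rule abs_summable_summable)
qed

text \<open>One absolutely convergent double series over (c, n), summed by c, by n, and along the
  hyperbolas (c + 1)(n + 1) = N + 1. The first form is what Lipschitz's formula produces, the second
  is the logarithmic derivative of the eta product, the third has the divisor sums of
  \<open>E4\<close>.\<close>

lemma lambert_rows:
 fixes x :: complex
 assumes "norm x < 1" "k > 0"
 defines "T \<equiv> (\<Sum>\<^sub>\<infinity>(c,n). of_nat (Suc n)^k*x^(Suc c * Suc n))"
 shows "((%c. powsum k (x^Suc c)) has_sum T) UNIV"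
  "((%n. of_nat (Suc n)^k*x^Suc n/(1 - x^Suc n)) has_sum T) UNIV"
  "((%N. of_nat (\<Sum>d | d dvd Suc N. d^k)*x^Suc N) has_sum T) UNIV"
proof -
 have T: "((%(c,n). of_nat (Suc n)^k*x^(Suc c * Suc n)) has_sum T) UNIV"
  unfolding T_def using summable_lambert[OF assms(1)] by (rule has_sum_infsum)
 have xn: "norm (x^Suc c) < 1" for c
  using assms(1) power_Suc_less_one[of "norm x" c] by (cases "x = 0") (simp_all add: norm_power norm_mult)
 show "((%c. powsum k (x^Suc c)) has_sum T) UNIV"
 proof (rule has_sum_SigmaD)
  show "((%(c,n). of_nat (Suc n)^k*x^(Suc c * Suc n)) has_sum T) (UNIV \<times> UNIV)" using T by simp
  fix c
  show "((%n. case (c,n) of (c,n) => of_nat (Suc n)^k*x^(Suc c * Suc n)) has_sum powsum k (x^Suc c)) UNIV"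
   using powsum_Suc_has_sum[OF xn[of c] assms(2)] by (simp only: prod.case power_mult)
 qed
 have T2: "((%(n,c). of_nat (Suc n)^k*x^(Suc c * Suc n)) has_sum T) (UNIV \<times> UNIV)"
  using T by (subst has_sum_swap) (simp add: case_prod_unfold)
 show "((%n. of_nat (Suc n)^k*x^Suc n/(1 - x^Suc n)) has_sum T) UNIV"
 proof (rule has_sum_SigmaD[OF T2])
  fix n :: nat
  have "((%c. (x^Suc n) ^ c) has_sum 1/(1 - x^Suc n)) UNIV"
  proof (rule norm_summable_imp_has_sum)
   show "summable (%c. norm ((x^Suc n) ^ c))"
    unfolding norm_power[of "x^Suc n"] using xn[of n] by (intro summable_geometric) simp
  qed (rule geometric_sums[OF xn])
  then have "((%c. of_nat (Suc n)^k*x^Suc n*(x^Suc n) ^ c) has_sum (of_nat (Suc n)^k*x^Suc n*(1/(1 - x^Suc n)))) UNIV"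
   by (rule has_sum_cmult_right)
  moreover have "x^(Suc c * Suc n) = x^Suc n*(x^Suc n) ^ c" for c
   by (metis mult.commute power_Suc power_mult)
  ultimately show "((%c. case (n,c) of (n,c) => of_nat (Suc n)^k*x^(Suc c * Suc n)) has_sum
   of_nat (Suc n)^k*x^Suc n/(1 - x^Suc n)) UNIV" by (simp only: mult.assoc prod.case times_divide_eq_right mult_1_right)
 qed
 have b: "bij_betw (%(N,d). (Suc N div d - 1, d - 1)) (Sigma UNIV (%N. {d. d dvd Suc N})) (UNIV :: (nat \<times> nat) set)"
 proof (rule bij_betwI[of _ _ _ "%(c,n). (Suc c * Suc n - 1, Suc n)"])
  show "(%(c,n). (Suc c * Suc n - 1, Suc n)) ((%(N,d). (Suc N div d - 1, d - 1)) p) = p"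
   if "p : Sigma UNIV (%N. {d. d dvd Suc N})" for p :: "nat \<times> nat"
  proof -
   obtain N d where p: "p = (N,d)" by force
   have d: "d dvd Suc N" using that p by simp
   then have d0: "d > 0" by (auto intro: Nat.gr0I)
   obtain e where e: "Suc N = d*e" using d by (rule dvdE)
   then have e0: "e > 0" by (auto intro: Nat.gr0I)
   have "Suc N div d = e" "Suc (e - 1) = e" "Suc (d - 1) = d" using d0 e0 e by auto
   moreover have "e * d - 1 = N" using e by (simp add: mult.commute)
   ultimately show ?thesis by (simp only: p prod.case)
  qed
  show "(%(c,n). (Suc c * Suc n - 1, Suc n)) : UNIV \<rightarrow> Sigma UNIV (%N. {d. d dvd Suc N})"
  proof (rule Pi_I)
   fix p :: "nat \<times> nat"
   obtain c n where p: "p = (c,n)" by force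
   have "Suc (Suc c * Suc n - 1) = Suc c * Suc n" by simp
   then show "(case p of (c,n) => (Suc c * Suc n - 1, Suc n)) : Sigma UNIV (%N. {d. d dvd Suc N})"
    by (simp only: p prod.case mem_Sigma_iff mem_Collect_eq UNIV_I simp_thms dvd_triv_right)
  qed
  show "(%(N,d). (Suc N div d - 1, d - 1)) ((%(c,n). (Suc c * Suc n - 1, Suc n)) p) = p" for p :: "nat \<times> nat"
  proof -
   obtain c n where p: "p = (c,n)" by force
   have "Suc (Suc c * Suc n - 1) = Suc c * Suc n" by simp
   moreover have "Suc c * Suc n div Suc n = Suc c" by (rule nonzero_mult_div_cancel_right) simp
   ultimately show ?thesis by (simp only: p prod.case) simp
  qed
 qed auto
 have "((%p. (%(c,n). of_nat (Suc n)^k*x^(Suc c * Suc n)) ((%(N,d). (Suc N div d - 1, d - 1)) p)) has_sum T)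
  (Sigma UNIV (%N. {d. d dvd Suc N}))"
  unfolding has_sum_reindex_bij_betw[OF b] by (rule T)
 then show "((%N. of_nat (\<Sum>d | d dvd Suc N. d^k)*x^Suc N) has_sum T) UNIV"
 proof (rule has_sum_SigmaD)
  fix N :: nat
  have fin: "finite {d. d dvd Suc N}" by simp
  have eq: "of_nat (Suc (d - 1))^k*x^(Suc (Suc N div d - 1) * Suc (d - 1)) = of_nat (d^k)*x^Suc N"
   if "d dvd Suc N" for d
  proof -
   have dd: "d dvd Suc N" by (rule that)
   then have d0: "d > 0" by (auto intro: Nat.gr0I)
   obtain e where e: "Suc N = d*e" using dd by (rule dvdE)
   then have e0: "e > 0" by (auto intro: Nat.gr0I)
   show ?thesis using d0 e0 e by (simp add: mult.commute)
  qed
  have "((%d. of_nat (Suc (d - 1))^k*x^(Suc (Suc N div d - 1) * Suc (d - 1))) has_sum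
   (\<Sum>d\<in>{d. d dvd Suc N}. of_nat (Suc (d - 1))^k*x^(Suc (Suc N div d - 1) * Suc (d - 1)))) {d. d dvd Suc N}"
   by (rule has_sum_finite[OF fin])
  also have "(\<Sum>d\<in>{d. d dvd Suc N}. of_nat (Suc (d - 1))^k*x^(Suc (Suc N div d - 1) * Suc (d - 1)))
   = (\<Sum>d | d dvd Suc N. of_nat (d^k)*x^Suc N)"
   by (rule sum.cong[OF refl], rule eq) simp
  also have "... = of_nat (\<Sum>d | d dvd Suc N. d^k)*x^Suc N"
   by (simp only: of_nat_sum sum_distrib_right)
  finally show "((%d. case case (N,d) of (N,d) => (Suc N div d - 1, d - 1) of (c,n) => of_nat (Suc n)^k*x^(Suc c * Suc n))
   has_sum of_nat (\<Sum>d | d dvd Suc N. d^k)*x^Suc N) {d. d dvd Suc N}" by simp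
 qed
qed

text \<open>Three applications of x d/dx to 1/(1 - x). The closed form allows x to tend to -1, where
  the power series itself diverges.\<close>

lemma powsum_3:
 assumes "norm x < 1" "x ~= 0"
 shows "powsum 3 x = x*(1+4*x + x\<^sup>2)/(1 - x)^4"
proof -
 have ne: "1 - x ~= 0" if "norm x < 1" for x :: complex using that by auto
 have op: "open {x::complex. norm x < 1 & x ~= 0}"
  by (intro open_Collect_conj open_Collect_less open_Collect_neq continuous_intros)
 have step: "powsum (Suc k) x = x*D" if "!!x. norm x < 1 ==> x ~= 0 ==> powsum k x = f x"
  "(f has_field_derivative D) (at x)" "norm x < 1" "x ~= 0" for k f D x
 proof -
  have "(f has_field_derivative powsum (Suc k) x/x) (at x)"
   by (rule has_field_derivative_transform_within_open[OF powsum_deriv[OF that(3,4)] op]) (use that in auto)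
  from DERIV_unique[OF this that(2)] that(4) show ?thesis by (simp add: field_simps)
 qed
 have 1: "powsum 1 x = x/(1 - x)^2" if x: "norm x < 1" "x ~= 0" for x
 proof -
  have d: "((%x. 1/(1 - x)) has_field_derivative 1/(1 - x)^2) (at x)"
   using ne[OF x(1)] by (auto intro!: derivative_eq_intros simp: power2_eq_square)
  have "powsum (Suc 0) x = x*(1/(1 - x)^2)"
   by (rule step[OF _ d x]) (use powsum_0 in auto)
  then show ?thesis by simp
 qed
 have 2: "powsum 2 x = x*(1 + x)/(1 - x)^3" if x: "norm x < 1" "x ~= 0" for x
 proof -
  have n: "1 - x ~= 0" by (rule ne[OF x(1)])
  have d: "((%x. x/(1 - x)^2) has_field_derivative ((1 - x)*(1 - x) - x*(2*x - 2))/((1 - x)*(1 - x)*((1 - x)*(1 - x)))) (at x)"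
   using n by (auto intro!: derivative_eq_intros simp: power2_eq_square)
  have "powsum (Suc 1) x = x*(((1 - x)*(1 - x) - x*(2*x - 2))/((1 - x)*(1 - x)*((1 - x)*(1 - x))))"
   by (rule step[OF _ d x]) (use 1 in auto)
  also have "(1 - x)*(1 - x) - x*(2*x - 2) = (1 + x)*(1 - x)" by (simp add: algebra_simps)
  also have "x*((1 + x)*(1 - x)/((1 - x)*(1 - x)*((1 - x)*(1 - x)))) = x*(1 + x)/(1 - x)^3"
   using n by (simp add: power3_eq_cube)
  finally show ?thesis by (simp add: numeral_2_eq_2)
 qed
 have n: "1 - x ~= 0" by (rule ne[OF assms(1)])
 have d1: "((%x. x*(1 + x)) has_field_derivative (1+2*x)) (at x)"
  by (auto intro!: derivative_eq_intros simp: algebra_simps)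
 have d2: "((%x. (1 - x)^3) has_field_derivative (- 3*(1 - x)^2)) (at x)"
  by (rule derivative_eq_intros refl | simp)+
 have d: "((%x. x*(1 + x)/(1 - x)^3) has_field_derivative
   ((1+2*x)*(1 - x)^3 - x*(1 + x)*(- 3*(1 - x)^2))/((1 - x)^3*(1 - x)^3)) (at x)"
  by (rule DERIV_divide[OF d1 d2]) (use n in simp)
 have "powsum (Suc 2) x = x*(((1+2*x)*(1 - x)^3 - x*(1 + x)*(- 3*(1 - x)^2))/((1 - x)^3*(1 - x)^3))"
  by (rule step[OF _ d assms]) (use 2 in auto)
 also have "(1+2*x)*(1 - x)^3 - x*(1 + x)*(- 3*(1 - x)^2) = (1+4*x + x\<^sup>2)*(1 - x)^2"
  by (simp add: power2_eq_square power3_eq_cube algebra_simps)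
 also have "x*((1+4*x + x\<^sup>2)*(1 - x)^2/((1 - x)^3*(1 - x)^3)) = x*(1+4*x + x\<^sup>2)/(1 - x)^4"
 proof -
  have h: "(1 - x)^3*(1 - x)^3 = (1 - x)^4*(1 - x)^2" by (simp add: power_add[symmetric])
  have c: "(1 - x)^2 ~= 0" using n by simp
  have "(1+4*x + x\<^sup>2)*(1 - x)^2/((1 - x)^4*(1 - x)^2) = (1+4*x + x\<^sup>2)/(1 - x)^4"
   by (rule nonzero_mult_divide_mult_cancel_right[OF c])
  then show ?thesis by (simp only: h times_divide_eq_right)
 qed
 finally show ?thesis by (simp add: numeral_3_eq_3)
qed

text \<open>The Lipschitz identity is available only in the open half-plane, hence the points 1/2 +
  i/(n + 1). In the limit 1 - w and w coincide and q = -1, so the identity becomes an equation for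
  the single value at 1/2.\<close>

lemma Polygamma_3_half: "Polygamma 3 (1/2 :: complex) = of_real (pi^4)"
proof -
 define w where "w n = 1/2+\<i>/of_nat (Suc n)" for n :: nat
 define R :: "complex => complex" where "R x = x*(1+4*x + x\<^sup>2)/(1 - x)^4" for x
 have wu: "w n : uhp" for n by (simp add: w_def uhp_iff Im_divide)
 have "(%n. inverse (of_nat (Suc n)) :: complex) \<longlonglongrightarrow> 0" by (rule LIMSEQ_Suc[OF lim_inverse_n])
 then have "(%n. \<i>/of_nat (Suc n)) \<longlonglongrightarrow> 0"
  unfolding divide_inverse by (rule tendsto_mult_right_zero)
 from tendsto_add[OF tendsto_const[of "1/2"] this] have wl: "w \<longlonglongrightarrow> 1/2"
  unfolding w_def by (simp only: add_0_right)
 have h: "(1/2::complex) \<notin> \<int>\<^sub>\<le>\<^sub>0"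
 proof
  assume "(1/2::complex) : \<int>\<^sub>\<le>\<^sub>0"
  then obtain n where "(1/2::complex) = of_int n" "n<=0" by (auto elim!: nonpos_Ints_cases)
  from arg_cong[OF this(1), of Re] this(2) show False by simp
 qed
 have "qpow 1 (1/2) = exp (\<i> * of_real pi)" by (simp add: qpow_def mult_ac)
 then have q1: "qpow 1 (1/2) = -1" by simp
 have ql: "(%n. qpow 1 (w n)) \<longlonglongrightarrow> -1"
  using isCont_tendsto_compose[OF DERIV_isCont[OF qpow_deriv[of 1 "1/2"]] wl] by (simp add: q1)
 have l1: "(%n. (-1)^3*Polygamma 3 (1 - w n) - Polygamma 3 (w n)) \<longlonglongrightarrow> (-1)^3*Polygamma 3 (1 - 1/2) - Polygamma 3 (1/2)"
  using wl h by (intro tendsto_intros) auto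
 have l2: "(%n. (-1)^3*Polygamma 3 (1 - w n) - Polygamma 3 (w n)) = (%n. - ((2 * of_real pi*\<i>)^4) * R (qpow 1 (w n)))"
  using Polygamma_lipschitz[OF wu, of 3] powsum_3[OF qpow_less_1[OF wu] qpow_nonzero]
  by (simp add: R_def)
 have l3: "(%n. - ((2 * of_real pi*\<i>)^4) * R (qpow 1 (w n))) \<longlonglongrightarrow> - ((2 * of_real pi*\<i>)^4) * R (-1)"
  unfolding R_def by (intro tendsto_intros ql) auto
 have "(-1)^3*Polygamma 3 (1 - 1/2) - Polygamma 3 (1/2) = - ((2 * of_real pi*\<i>)^4) * R (-1)"
  by (rule LIMSEQ_unique[OF l1[unfolded l2] l3])
 then show ?thesis by (simp add: R_def power_mult_distrib)
qed

lemma summable_inverse_Suc_power: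
 assumes "k >= 2" shows "summable (%n. norm (1/(of_nat (Suc n) :: complex)^k))"
proof -
 have "summable (%n. inverse (real (Suc n)^k))"
  by (subst summable_Suc_iff) (rule inverse_power_summable[OF assms])
 then show ?thesis by (simp only: norm_divide norm_power norm_of_nat norm_one inverse_eq_divide)
qed

text \<open>The polygamma value at 1/2 gives pi^4/96 for the sum over odd integers. Splitting off
  the even integers yields Z = pi^4/96 + Z/16.\<close>

lemma zeta4_sums: "(%n. 1/(of_nat (Suc n) :: complex)^4) sums of_real (pi^4/90)"
proof -
 have "(%k. inverse ((1/2 + of_nat k)^Suc 3)) sums ((-1)^Suc 3*Polygamma 3 (1/2 :: complex)/fact 3)"
  by (rule Polygamma_LIMSEQ) auto
 then have "(%k. inverse ((1/2 + of_nat k :: complex)^4)) sums (of_real (pi^4)/6)"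
  by (simp add: Polygamma_3_half fact_numeral)
 then have "(%k. (1/16) * inverse ((1/2 + of_nat k :: complex)^4)) sums ((1/16)*(of_real (pi^4)/6))"
  by (rule sums_mult)
 moreover have "(1/16) * inverse ((1/2 + of_nat k :: complex)^4) = 1/of_nat (2 * k+1)^4" for k
 proof -
  have h: "(1/2 + of_nat k :: complex) = of_nat (2 * k+1)/2" by (simp add: field_simps)
  show ?thesis unfolding h by (simp add: power_divide)
 qed
 ultimately have odd: "(%k. 1/(of_nat (2 * k+1) :: complex)^4) sums (of_real (pi^4)/96)" by simp
 have "summable (%n. norm (1/(of_nat (Suc n) :: complex)^4))" by (rule summable_inverse_Suc_power) simp
 then have "summable (%n. 1/(of_nat (Suc n) :: complex)^4)" by (rule summable_norm_cancel)
 then obtain Z where Z: "(%n. 1/(of_nat (Suc n) :: complex)^4) sums Z"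
  unfolding summable_def by blast
 have "(%n. sum (%n. 1/(of_nat (Suc n) :: complex)^4) {n*2..<n*2+2}) sums Z"
  by (rule sums_group[OF Z]) simp
 moreover have "sum (%n. 1/(of_nat (Suc n) :: complex)^4) {n*2..<n*2+2}
  = 1/(of_nat (2*n+1))^4+(1/16)*(1/(of_nat (Suc n))^4)" for n
 proof -
  have "{n*2..<n*2+2} = {n*2, Suc (n*2)}" by auto
  moreover have "(of_nat (Suc (Suc (n*2))) :: complex) = 2 * of_nat (Suc n)" by simp
  ultimately show ?thesis by (simp add: power_mult_distrib mult_ac del: of_nat_Suc)
 qed
 ultimately have "(%n. 1/(of_nat (2*n+1))^4+(1/16)*(1/(of_nat (Suc n) :: complex)^4)) sums Z" by simp
 moreover have "(%n. 1/(of_nat (2*n+1))^4+(1/16)*(1/(of_nat (Suc n) :: complex)^4)) sums (of_real (pi^4)/96+(1/16) * Z)"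
  by (intro sums_add sums_mult odd Z)
 ultimately have "Z = of_real (pi^4)/96+(1/16) * Z" using sums_unique2 by blast
 then have "Z = of_real (pi^4/90)" by (simp add: field_simps)
 then show ?thesis using Z by (simp only:)
qed

lemma has_sum_neg:
 fixes f :: "'a => complex"
 assumes "(f has_sum s) A" shows "((%x. - f x) has_sum (- s)) A"
 using has_sum_cmult_right[OF assms, of "-1"] by simp

lemma has_sum_finite_sum:
 fixes f :: "'i => 'a => complex"
 assumes "finite I" "!!i. i : I ==> (f i has_sum s i) A"
 shows "((%x. \<Sum>i\<in>I. f i x) has_sum (\<Sum>i\<in>I. s i)) A"
 using assms
proof (induction I rule: finite_induct)
 case (insert i I)
 then show ?case by (simp add: has_sum_add)
qed simp

lemma jf_zero_has_sum:
 assumes "(%n. 1/(of_nat (Suc n) :: complex)^k) sums s" "even k" "k >= 2"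
 shows "((%d. 1/jf 0 d z^k) has_sum (2 * s)) (-{0})"
proof -
 have "summable (%n. norm (1/(of_nat (Suc n) :: complex)^k))" by (rule summable_inverse_Suc_power[OF assms(3)])
 then have 1: "((%n. 1/(of_nat (Suc n) :: complex)^k) has_sum s) UNIV"
  using assms(1) by (rule norm_summable_imp_has_sum)
 have e: "1/jf 0 (int (Suc n)) z^k = 1/of_nat (Suc n)^k" for n
  by (simp add: jf_def)
 have "jf 0 (- int (Suc n)) z = - of_nat (Suc n)" for n by (simp add: jf_def)
 then have e': "1/jf 0 (- int (Suc n)) z^k = 1/of_nat (Suc n)^k" for n
  using assms(2) by (metis power_minus_even)
 have "((%d. 1/jf 0 d z^k) has_sum (s + s)) (-{0})"
  by (rule has_sum_int_nonzero) (simp_all only: e e' 1)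
 then show ?thesis by simp
qed

text \<open>Summation by rows: the row c = 0 gives 2 zeta(4) = pi^4/45, and Lipschitz's formula with
  the divisor sums gives all the others. The point of the lattice form is that modularity becomes a
  permutation of the summands.\<close>

lemma E4_lattice:
 assumes "z : uhp"
 shows "((%(c,d). 1/jf c d z^4) has_sum (of_real (pi^4/45)*E4 z)) (-{(0,0)})"
proof -
 define S where "S = (\<Sum>\<^sub>\<infinity>(c,d)\<in>-{(0,0)}. 1/jf c d z^4)"
 define q where "q = qpow 1 z"
 have q: "norm q < 1" using qpow_less_1[OF assms] by (simp add: q_def)
 define K where "K = (2 * of_real pi*\<i>)^4/fact 3"
 define g where "g c = (if c = 0 then of_real (pi^4/45) else K*powsum 3 (q^nat \<bar>c\<bar>))" for c :: int
 have S: "((%(c,d). 1/jf c d z^4) has_sum S) (-{(0,0)})"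
  unfolding S_def using summable_jf_power[OF assms, of 4] by (intro has_sum_infsum) auto
 have sig: "-{(0,0)} = Sigma UNIV (%c::int. if c = 0 then -{0::int} else UNIV)" by (auto split: if_splits)
 have gS: "(g has_sum S) UNIV"
 proof (rule has_sum_SigmaD[OF S[unfolded sig]])
  fix c :: int
  show "((%d. case (c,d) of (c,d) => 1/jf c d z^4) has_sum g c) (if c = 0 then -{0} else UNIV)"
  proof (cases "c = 0")
   case True
   then show ?thesis using jf_zero_has_sum[OF zeta4_sums, of z] by (simp add: g_def)
  next
   case False
   then show ?thesis using row_has_sum[OF assms False, of 3] by (simp add: g_def K_def q_def)
  qed
 qed
 have 2: "(g has_sum (S - g 0)) (-{0})"
  using has_sum_Diff[OF gS has_sum_finite[of "{0}" g]]
  by (simp add: Compl_eq_Diff_UNIV)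
 obtain T where T: "((%c. powsum 3 (q^Suc c)) has_sum T) UNIV"
   "((%N. of_nat (\<Sum>d | d dvd Suc N. d^3)*q^Suc N) has_sum T) UNIV"
  using lambert_rows[OF q, of 3] by auto
 have "((%c. K*powsum 3 (q^Suc c)) has_sum (K * T)) UNIV" by (rule has_sum_cmult_right[OF T(1)])
 then have "(g has_sum (K * T + K * T)) (-{0})"
  by (intro has_sum_int_nonzero) (simp_all add: g_def nat_add_distrib)
 from has_sum_unique[OF this 2] have "S = g 0+2*(K * T)" by simp
 also have "T = (\<Sum>n. of_nat (\<Sum>d | d dvd Suc n. d^3)*q^Suc n)"
  using has_sum_imp_sums[OF T(2)] by (simp add: sums_iff)
 also have "g 0+2*(K * ...) = of_real (pi^4/45)*E4 z"
  by (simp add: g_def K_def E4_def q_def fact_numeral power_mult_distrib algebra_simps)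
 finally show ?thesis using S by (simp only:)
qed

text \<open>Right multiplication by the matrix permutes the nonzero lattice vectors, and
  \<open>has_sum\<close> is insensitive to the order.\<close>

lemma E4_transform:
 assumes "a * d - b * c = 1" "z : uhp"
 shows "E4 (moeb a b c d z) = jf c d z^4*E4 z"
proof -
 let ?w = "moeb a b c d z"
 have w: "?w : uhp" using moebius_in_uhp assms by blast
 have nz: "jf c d z ~= 0" using det_jf_nonzero assms by blast
 have "((%p. (%(x,y). 1/jf x y z^4) ((%(x,y). (x * a + y * c, x * b + y * d)) p)) has_sum (of_real (pi^4/45)*E4 z)) (-{(0,0)})"
  unfolding has_sum_reindex_bij_betw[OF bij_rows[OF assms(1)]] by (rule E4_lattice[OF assms(2)])
 then have "((%p. jf c d z^4*(%(x,y). 1/jf x y z^4) ((%(x,y). (x * a + y * c, x * b + y * d)) p)) has_sum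
   (jf c d z^4*(of_real (pi^4/45)*E4 z))) (-{(0,0)})" by (rule has_sum_cmult_right)
 moreover have "jf c d z^4*(%(x,y). 1/jf x y z^4) ((%(x,y). (x * a + y * c, x * b + y * d)) p)
   = (case p of (x,y) => 1/jf x y ?w^4)" for p
 proof -
  obtain x y where p: "p = (x,y)" by force
  have "jf (x * a + y * c) (x * b + y * d) z = jf x y ?w*jf c d z"
   using jf_compose[OF assms, of x y] by simp
  then show ?thesis using nz by (simp add: p power_mult_distrib)
 qed
 ultimately have "((%p. case p of (x,y) => 1/jf x y ?w^4) has_sum (jf c d z^4*(of_real (pi^4/45)*E4 z))) (-{(0,0)})"
  by simp
 from has_sum_unique[OF this E4_lattice[OF w]] show ?thesis by simp
qed

section \<open>The weight 2 Eisenstein series and its inversion formula\<close>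

definition e2 :: "complex => complex" where
 "e2 z = of_real (pi\<^sup>2/3) - 8 * of_real (pi\<^sup>2)*(\<Sum>\<^sub>\<infinity>c. powsum 1 (qpow 1 z^Suc c))"

text \<open>The rows of c and -c agree, and -8 pi^2 = 2 (2 pi i)^2. With the row c = 0, equal to 2
  zeta(2) = pi^2/3, this shows \<open>e2\<close> to be 2 zeta(2) times the normalised series 1 - 24
  q - ....\<close>

lemma e2_row_sum:
 assumes "z : uhp"
 shows "((%c. (2 * of_real pi*\<i>)\<^sup>2*powsum 1 (qpow 1 z^nat \<bar>c\<bar>)) has_sum (e2 z - of_real (pi\<^sup>2/3))) (-{0})"
proof -
 let ?q = "qpow 1 z"
 let ?T = "\<Sum>\<^sub>\<infinity>c. powsum 1 (?q^Suc c)"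
 have "((%c. powsum 1 (?q^Suc c)) has_sum ?T) UNIV"
  by (rule has_sum_infsum[OF has_sum_imp_summable[OF lambert_rows(1)[OF qpow_less_1[OF assms]]]]) simp
 then have "((%c. (2 * of_real pi*\<i>)\<^sup>2*powsum 1 (?q^Suc c)) has_sum ((2 * of_real pi*\<i>)\<^sup>2 * ?T)) UNIV"
  by (rule has_sum_cmult_right)
 then have "((%c. (2 * of_real pi*\<i>)\<^sup>2*powsum 1 (?q^nat \<bar>c\<bar>)) has_sum ((2 * of_real pi*\<i>)\<^sup>2 * ?T+(2 * of_real pi*\<i>)\<^sup>2 * ?T)) (-{0})"
  by (intro has_sum_int_nonzero) (simp_all add: nat_add_distrib)
 then show ?thesis by (simp add: e2_def power_mult_distrib mult.assoc)
qed

lemma zeta2_sums: "(%n. 1/(of_nat (Suc n) :: complex)^2) sums of_real (pi\<^sup>2/6)"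
proof -
 have "(%n. complex_of_real (1/(real n+1)\<^sup>2)) sums complex_of_real (pi\<^sup>2/6)"
  unfolding sums_of_real_iff using inverse_squares_sums by (simp add: add.commute)
 moreover have "complex_of_real (1/(real n+1)\<^sup>2) = 1/(of_nat (Suc n) :: complex)^2" for n by (simp add: add.commute)
 ultimately show ?thesis by (simp only:)
qed

text \<open>
 \<open>e2\<close> is the sum of \<open>(c z + d)\<^sup>-\<^sup>2\<close> over \<open>d\<close> first; subtracting the telescoping terms below
 makes the double series absolutely convergent, and the two orders of summation differ by the
 telescoped boundary terms.
\<close>

lemma telescoping_summable:
 assumes "z : uhp"
 shows "(%(c,d). 1/jf c d z^2 - 1/(jf c d z*jf c (d+1) z)) summable_on ((-{0}) \<times> UNIV)"
proof -
 obtain K where K: "K > 0" "!!c d. (c,d) ~= (0,0) ==> norm (1/jf c d z)<=K/rowsize (c,d)"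
  using jf_inverse_power_le[OF assms(1)] by blast
 have y: "Im z > 0" using assms by (simp add: uhp_iff)
 have "(%p. K^3*(1+1/Im z) * rowsize p powr (- 3)) summable_on ((-{0}) \<times> UNIV)"
  using summable_rowsize[of 3] by (intro summable_on_cmult_right) (auto intro: summable_on_subset_banach)
 then have "(%p. norm (case p of (c,d) => 1/jf c d z^2 - 1/(jf c d z*jf c (d+1) z))) summable_on ((-{0}) \<times> UNIV)"
 proof (rule summable_on_comparison_test)
  fix p :: "int \<times> int" assume p: "p : (-{0}) \<times> UNIV"
  obtain c d where cd: "p = (c,d)" by force
  with p have c: "c ~= 0" by auto
  have N: "rowsize p >= 1" using p rowsize_ge_1 by auto
  have nz: "jf c d z ~= 0" "jf c (d+1) z ~= 0" using jf_nonzero[OF assms] c by auto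
  have "Im z*1<=Im z*\<bar>of_int c\<bar>" using c y by (intro mult_left_mono) linarith+
  then have "Im z<=\<bar>Im (jf c (d+1) z)\<bar>" using y by (simp add: jf_def abs_mult mult.commute)
  also have "...<=norm (jf c (d+1) z)" by (rule abs_Im_le_cmod)
  finally have im: "Im z<=norm (jf c (d+1) z)" .
  have "norm (jf c d z) = norm (jf c (d+1) z - 1)" by (simp add: jf_def)
  also have "...<=norm (jf c (d+1) z)+1" using norm_triangle_ineq4[of "jf c (d+1) z" 1] by simp
  also have "1<=norm (jf c (d+1) z)/Im z" using im y by simp
  finally have "norm (jf c d z)<=(1+1/Im z)*norm (jf c (d+1) z)" by (simp add: algebra_simps)
  then have j: "norm (1/jf c (d+1) z)<=(1+1/Im z)*norm (1/jf c d z)"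
   using nz by (simp add: norm_divide field_simps)
  have "1/jf c d z^2 - 1/(jf c d z*jf c (d+1) z) = (1/jf c d z)*(1/jf c d z)*(1/jf c (d+1) z)"
   using nz by (simp add: field_simps power2_eq_square) (simp add: jf_def algebra_simps)
  then have "norm (1/jf c d z^2 - 1/(jf c d z*jf c (d+1) z)) = norm (1/jf c d z)*norm (1/jf c d z)*norm (1/jf c (d+1) z)"
   by (simp only: norm_mult)
  also have "...<=norm (1/jf c d z)*norm (1/jf c d z)*((1+1/Im z)*norm (1/jf c d z))"
   using j by (intro mult_left_mono) auto
  also have "... = (1+1/Im z)*norm (1/jf c d z)^3" by (simp add: power3_eq_cube)
  also have "...<=(1+1/Im z)*(K/rowsize p)^3"
   using K(2)[of c d] c y cd by (intro mult_left_mono power_mono) auto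
  also have "... = K^3*(1+1/Im z) * rowsize p powr (- 3)"
   using N by (simp add: powr_minus powr_realpow[of _ 3, simplified] power_divide field_simps)
  finally show "norm (case p of (c,d) => 1/jf c d z^2 - 1/(jf c d z*jf c (d+1) z))<=K^3*(1+1/Im z) * rowsize p powr (- 3)"
   by (simp add: cd)
 qed auto
 then show ?thesis by (rule abs_summable_summable)
qed

lemma jf_telescope:
 assumes "z : uhp" "c ~= 0"
 shows "1/(jf c d z*jf c (d+1) z) = 1/jf c d z - 1/jf c (d+1) z"
 using jf_nonzero[OF assms(1), of c d] jf_nonzero[OF assms(1), of c "d+1"] assms(2)
 by (simp add: field_simps) (simp add: jf_def algebra_simps)

lemma sum_int_telescope:
 fixes f :: "int => complex"
 shows "(\<Sum>d\<in>{- int N..<int N}. f d - f (d+1)) = f (- int N) - f (int N)"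
proof (induction N)
 case (Suc N)
 have "{- int (Suc N)..<int (Suc N)} = insert (- int N - 1) (insert (int N) {- int N..<int N})" by auto
 moreover have "- int N - 1 = - int (Suc N)" by simp
 ultimately show ?case using Suc by (simp add: add.commute)
qed simp

lemma tendsto_inverse_jf:
 assumes "z : uhp" "c ~= 0"
 shows "(%N. 1/jf c (int N) z) \<longlonglongrightarrow> 0" "(%N. 1/jf c (- int N) z) \<longlonglongrightarrow> 0"
proof -
 have 1: "filterlim (%N. of_int c*z + of_nat N) at_infinity sequentially"
  by (rule tendsto_add_filterlim_at_infinity[OF tendsto_const tendsto_of_nat])
 have "filterlim (%N. - of_nat N :: complex) at_infinity sequentially"
  using tendsto_of_nat[where 'a = complex] by (simp add: filterlim_at_infinity_conv_norm_at_top)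
 then have 2: "filterlim (%N. of_int c*z + - of_nat N) at_infinity sequentially"
  by (rule tendsto_add_filterlim_at_infinity[OF tendsto_const])
 show "(%N. 1/jf c (int N) z) \<longlonglongrightarrow> 0" "(%N. 1/jf c (- int N) z) \<longlonglongrightarrow> 0"
  using tendsto_divide_0[OF tendsto_const 1] tendsto_divide_0[OF tendsto_const 2] by (simp_all add: jf_def)
qed

section \<open>The eta function\<close>

lemma uhp_neg_div:
 assumes "z : uhp" "t > 0" shows "- of_real t/z : uhp"
proof -
 have "(Re z)\<^sup>2+(Im z)\<^sup>2 > 0" using assms by (intro add_nonneg_pos) (auto simp: uhp_iff)
 then show ?thesis using assms by (simp add: uhp_iff Im_divide)
qed

lemma uhp_neg_nat_div: "z : uhp ==> N > 0 ==> - of_nat N/z : uhp"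
 using uhp_neg_div[of z "real N"] by simp

text \<open>For fixed c the subtracted terms telescope in d, with boundary terms tending to 0, so
  the row keeps the value given by Lipschitz's formula.\<close>

lemma telescoping_row:
 assumes "z : uhp" "c ~= 0"
 shows "((%d. 1/jf c d z^2 - 1/(jf c d z*jf c (d+1) z)) has_sum
  ((2 * of_real pi*\<i>)\<^sup>2*powsum 1 (qpow 1 z^nat \<bar>c\<bar>))) UNIV"
proof -
 define r where "r = (2 * of_real pi*\<i>)\<^sup>2*powsum 1 (qpow 1 z^nat \<bar>c\<bar>)"
 define t where "t = (\<Sum>\<^sub>\<infinity>d. 1/jf c d z^2 - 1/(jf c d z*jf c (d+1) z))"
 have r: "((%d. 1/jf c d z^2) has_sum r) UNIV"
  using row_has_sum[OF assms, of 1] by (simp add: r_def numeral_2_eq_2)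
 have t: "((%d. 1/jf c d z^2 - 1/(jf c d z*jf c (d+1) z)) has_sum t) UNIV"
  unfolding t_def using summable_on_SigmaD1[OF telescoping_summable[OF assms(1)], of c] assms(2) by simp
 have "((%d. 1/jf c d z^2 + - (1/jf c d z^2 - 1/(jf c d z*jf c (d+1) z))) has_sum (r + - t)) UNIV"
  by (intro has_sum_add r has_sum_neg t)
 then have "((%d. 1/jf c d z - 1/jf c (d+1) z) has_sum (r - t)) UNIV"
  using jf_telescope[OF assms] by simp
 from tendsto_symmetric_sum[OF this] have "(%N. 1/jf c (- int N) z - 1/jf c (int N) z) \<longlonglongrightarrow> r - t"
  by (simp only: sum_int_telescope[of "%d. 1/jf c d z"])
 moreover have "(%N. 1/jf c (- int N) z - 1/jf c (int N) z) \<longlonglongrightarrow> 0 - 0"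
  by (intro tendsto_diff tendsto_inverse_jf[OF assms])
 ultimately have "r - t = 0 - 0" by (rule LIMSEQ_unique)
 then show ?thesis using t by (simp add: r_def)
qed

text \<open>Partial fractions of pi cot(pi w). The digamma series pair w + n with w - (n + 1);
  subtracting a telescoping series with sum 1/w moves the first member to w + (n + 1).\<close>

lemma cotf_sums:
 assumes "w : uhp"
 shows "(%n. 1/(w + of_nat (Suc n))+1/(w - of_nat (Suc n))) sums (cotf w - 1/w)"
proof -
 have w0: "w ~= 0" "1 - w ~= 0" using assms by (auto simp: uhp_iff)
 have "(%n. (inverse (of_nat (Suc n)) - inverse (1 - w + of_nat n)) - (inverse (of_nat (Suc n)) - inverse (w + of_nat n)))
  sums ((Digamma (1 - w) + euler_mascheroni) - (Digamma w + euler_mascheroni))"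
  using summable_Digamma[OF w0(1)] summable_Digamma[OF w0(2)]
  by (intro sums_diff) (simp_all add: Digamma_def summable_sums)
 then have 1: "(%n. inverse (w + of_nat n) - inverse (1 - w + of_nat n)) sums cotf w"
  by (simp add: cotf_def)
 have "filterlim (%N. w + of_nat N) at_infinity sequentially"
  by (rule tendsto_add_filterlim_at_infinity[OF tendsto_const tendsto_of_nat])
 then have "(%N. inverse (w + of_nat N)) \<longlonglongrightarrow> 0"
  by (rule filterlim_compose[OF tendsto_inverse_0])
 then have 2: "(%n. inverse (w + of_nat n) - inverse (w + of_nat (Suc n))) sums (inverse (w + of_nat 0) - 0)"
  by (rule telescope_sums')
 have e: "inverse (1 - w + of_nat n) = - (1/(w - of_nat (Suc n)))" for n
 proof -
  have "1 - w + of_nat n = - (w - of_nat (Suc n))" by simp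
  then show ?thesis by (metis inverse_eq_divide inverse_minus_eq)
 qed
 show ?thesis using sums_diff[OF 1 2] by (simp only: e) (simp add: inverse_eq_divide add.commute)
qed

text \<open>These are the boundary terms left by telescoping in d, summed over c. Factoring out z
  turns them into the partial fractions of the cotangent at w = -N/z, and the signs of c contribute
  equally.\<close>

lemma column_difference_has_sum:
 assumes "z : uhp" "N > 0" "((%c. 1/jf c (- int N) z - 1/jf c (int N) z) has_sum s) (-{0})"
 shows "s = 2/z*(cotf (- of_nat N/z) + z/of_nat N)"
proof -
 define f where "f c = 1/jf c (- int N) z - 1/jf c (int N) z" for c
 define w where "w = - of_nat N/z"
 have z0: "z ~= 0" using assms by (auto simp: uhp_iff)
 have wu: "w : uhp" unfolding w_def by (rule uhp_neg_nat_div[OF assms(1,2)])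
 have f: "f (int (Suc n)) = 1/z*(1/(w + of_nat (Suc n))+1/(w - of_nat (Suc n)))" for n
 proof -
  have nn: "w + of_nat (Suc n) ~= 0" "w - of_nat (Suc n) ~= 0" using wu by (auto simp: uhp_iff complex_eq_iff)
  have "jf (int (Suc n)) (- int N) z = z*(w + of_nat (Suc n))"
   using z0 by (simp add: jf_def w_def field_simps)
  moreover have "jf (int (Suc n)) (int N) z = - (z*(w - of_nat (Suc n)))"
   using z0 by (simp add: jf_def w_def field_simps)
  ultimately show ?thesis using nn z0 unfolding f_def by (simp only:) (simp add: divide_simps)
 qed
 have fm: "f (- int (Suc n)) = f (int (Suc n))" for n
 proof -
  have "jf (- int (Suc n)) (- int N) z = - jf (int (Suc n)) (int N) z"
   "jf (- int (Suc n)) (int N) z = - jf (int (Suc n)) (- int N) z" by (simp_all add: jf_def algebra_simps)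
  then show ?thesis unfolding f_def by simp
 qed
 have "f summable_on (-{0})" using assms(3) unfolding f_def summable_on_def by blast
 then have "f summable_on ((%n. int (Suc n)) ` UNIV)" by (rule summable_on_subset_banach) auto
 then have "(%n. f (int (Suc n))) summable_on UNIV" by (subst (asm) summable_on_reindex) (auto intro!: injI simp: o_def)
 then obtain u where u: "((%n. f (int (Suc n))) has_sum u) UNIV" unfolding summable_on_def by blast
 have "(%n. f (int (Suc n))) sums (1/z*(cotf w - 1/w))"
  unfolding f by (intro sums_mult cotf_sums[OF wu])
 then have ueq: "u = 1/z*(cotf w - 1/w)" using has_sum_imp_sums[OF u] sums_unique2 by blast
 have "(f has_sum (u + u)) (-{0})" by (rule has_sum_int_nonzero) (simp_all only: fm u)
 then have "s = u + u" using assms(3) has_sum_unique unfolding f_def by blast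
 then have "s = 2/z*(cotf w - 1/w)" using ueq by simp
 moreover have "1/w = - (z/of_nat N)" using assms(2) z0 by (simp add: w_def)
 ultimately show ?thesis by (simp add: w_def)
qed

text \<open>The source of the anomaly of the weight 2 series: Im (-N/z) tends to infinity, where pi
  cot tends to -pi i, and the term z/N disappears.\<close>

lemma cotf_tendsto:
 assumes "z : uhp"
 shows "(%N. 2/z*(cotf (- of_nat N/z) + z/of_nat N)) \<longlonglongrightarrow> - 2 * of_real pi*\<i>/z"
proof -
 have z0: "z ~= 0" using assms by (auto simp: uhp_iff)
 define p where "p = qpow 1 (- 1/z)"
 have pu: "- 1/z : uhp" using uhp_neg_nat_div[OF assms, of 1] by simp
 have p: "norm p < 1" unfolding p_def by (rule qpow_less_1[OF pu])
 have q: "qpow 1 (- of_nat N/z) = p^N" for N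
  by (simp add: p_def qpow_def exp_of_nat_mult[symmetric] mult_ac)
 have c: "cotf (- of_nat N/z) = of_real pi*\<i> - 2 * of_real pi*\<i>*(1/(1 - p^N))" if "N > 0" for N
 proof -
  have u: "- of_nat N/z : uhp" by (rule uhp_neg_nat_div[OF assms that])
  show ?thesis unfolding cotf_eq[OF u] using powsum_0[OF qpow_less_1[OF u]] by (simp only: q)
 qed
 have pl: "(%N. p^N) \<longlonglongrightarrow> 0" using p by (rule LIMSEQ_power_zero)
 have nl: "(%N. z/of_nat N) \<longlonglongrightarrow> 0" by (rule tendsto_divide_0[OF tendsto_const tendsto_of_nat])
 have "(%N. 2/z*((of_real pi*\<i> - 2 * of_real pi*\<i>*(1/(1 - p^N))) + z/of_nat N)) \<longlonglongrightarrow>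
   2/z*((of_real pi*\<i> - 2 * of_real pi*\<i>*(1/(1 - 0)))+0)"
  by (intro tendsto_intros pl nl) auto
 also have "2/z*((of_real pi*\<i> - 2 * of_real pi*\<i>*(1/(1 - 0)))+0) = - 2 * of_real pi*\<i>/z" by (simp add: field_simps)
 finally show ?thesis
  by (rule Lim_transform_eventually) (use eventually_gt_at_top[of 0] in \<open>eventually_elim, simp only: c\<close>)
qed

lemma e2_inversion:
 assumes "z : uhp"
 shows "e2 (- 1/z) = z\<^sup>2*e2 z - 2 * of_real pi*\<i>*z"
proof -
 define z' where "z' = - 1/z"
 have z0: "z ~= 0" using assms by (auto simp: uhp_iff)
 have z': "z' : uhp" using uhp_neg_nat_div[OF assms, of 1] by (simp add: z'_def)
 define a where "a c d = 1/jf c d z^2 - 1/(jf c d z*jf c (d+1) z)" for c d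
 have summ: "(%(c,d). a c d) summable_on ((-{0}) \<times> UNIV)"
  using telescoping_summable[OF assms] by (simp add: a_def)
 define A where "A = (\<Sum>\<^sub>\<infinity>(c,d)\<in>(-{0}) \<times> UNIV. a c d)"
 have A: "((%(c,d). a c d) has_sum A) ((-{0}) \<times> UNIV)"
  unfolding A_def by (rule has_sum_infsum[OF summ])
 have "((%c. (2 * of_real pi*\<i>)\<^sup>2*powsum 1 (qpow 1 z^nat \<bar>c\<bar>)) has_sum A) (-{0})"
  by (rule has_sum_SigmaD[OF A]) (use telescoping_row[OF assms] in \<open>auto simp: a_def\<close>)
 from has_sum_unique[OF this e2_row_sum[OF assms]] have Aeq: "A = e2 z - of_real (pi\<^sup>2/3)" .

 \<comment> \<open>The sum of (cz + d)^(-2) over c with c nonzero. It is row -d for the point z' =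
   -1/z, divided by z^2, with the entry c = 0 removed when d is nonzero.\<close>
 define R where "R d = (if d = 0 then of_real (pi\<^sup>2/3)/z\<^sup>2
  else (2 * of_real pi*\<i>)\<^sup>2*powsum 1 (qpow 1 z'^nat \<bar>d\<bar>)/z\<^sup>2 - 1/of_int d^2)" for d :: int
 have jfswap: "jf c d z = z*jf (-d) c z'" for c d using z0 by (simp add: jf_def z'_def field_simps)
 have Rd: "((%c. 1/jf c d z^2) has_sum R d) (-{0})" for d
 proof (cases "d = 0")
  case True
  have "((%c. 1/z\<^sup>2*(1/jf 0 c z'^2)) has_sum (1/z\<^sup>2*(2 * of_real (pi\<^sup>2/6)))) (-{0})"
   by (intro has_sum_cmult_right jf_zero_has_sum zeta2_sums) auto
  moreover have "R d = 1/z\<^sup>2*(2 * of_real (pi\<^sup>2/6))" by (simp add: R_def True)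
  ultimately show ?thesis by (simp only:) (simp add: True jfswap power_mult_distrib)
 next
  case False
  have "((%c. 1/jf (-d) c z'^Suc 1) has_sum (2 * of_real pi*\<i>)^Suc 1/fact 1*powsum 1 (qpow 1 z'^nat \<bar>-d\<bar>)) UNIV"
   using row_has_sum[OF z', of "-d" 1] False by simp
  then have "((%c. 1/z\<^sup>2*(1/jf (-d) c z'^2)) has_sum (1/z\<^sup>2*((2 * of_real pi*\<i>)\<^sup>2*powsum 1 (qpow 1 z'^nat \<bar>d\<bar>)))) UNIV"
   by (intro has_sum_cmult_right) (simp add: numeral_2_eq_2)
  then have "((%c. 1/jf c d z^2) has_sum (1/z\<^sup>2*((2 * of_real pi*\<i>)\<^sup>2*powsum 1 (qpow 1 z'^nat \<bar>d\<bar>)))) UNIV"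
   by (simp add: jfswap power_mult_distrib)
  moreover have "((%c. 1/jf c d z^2) has_sum (1/of_int d^2)) {0}"
   using has_sum_finite[of "{0}" "%c. 1/jf c d z^2"] by (simp add: jf_def)
  ultimately have "((%c. 1/jf c d z^2) has_sum (1/z\<^sup>2*((2 * of_real pi*\<i>)\<^sup>2*powsum 1 (qpow 1 z'^nat \<bar>d\<bar>)) - 1/of_int d^2)) (UNIV - {0})"
   by (rule has_sum_Diff) auto
  then show ?thesis using False by (simp add: R_def Compl_eq_Diff_UNIV)
 qed
 have Rsum: "(R has_sum ((e2 z' - of_real (pi\<^sup>2/3))/z\<^sup>2 - of_real (pi\<^sup>2/3) + of_real (pi\<^sup>2/3)/z\<^sup>2)) UNIV"
 proof -
  have "((%d. 1/z\<^sup>2*((2 * of_real pi*\<i>)\<^sup>2*powsum 1 (qpow 1 z'^nat \<bar>d\<bar>))) has_sum (1/z\<^sup>2*(e2 z' - of_real (pi\<^sup>2/3)))) (-{0})"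
   by (intro has_sum_cmult_right e2_row_sum[OF z'])
  moreover have "((%d. 1/of_int d^2) has_sum (2 * complex_of_real (pi\<^sup>2/6))) (-{0})"
   using jf_zero_has_sum[OF zeta2_sums, of z'] by (simp add: jf_def)
  ultimately have "((%d. 1/z\<^sup>2*((2 * of_real pi*\<i>)\<^sup>2*powsum 1 (qpow 1 z'^nat \<bar>d\<bar>)) + - (1/of_int d^2)) has_sum
    (1/z\<^sup>2*(e2 z' - of_real (pi\<^sup>2/3)) + - (2 * complex_of_real (pi\<^sup>2/6)))) (-{0})"
   by (intro has_sum_add has_sum_neg)
  then have "(R has_sum (1/z\<^sup>2*(e2 z' - of_real (pi\<^sup>2/3)) + - (2 * complex_of_real (pi\<^sup>2/6)))) (-{0})"
   by (rule has_sum_congD) (simp add: R_def)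
  moreover have "(R has_sum (of_real (pi\<^sup>2/3)/z\<^sup>2)) {0}" using has_sum_finite[of "{0}" R] by (simp add: R_def)
  ultimately have "(R has_sum (1/z\<^sup>2*(e2 z' - of_real (pi\<^sup>2/3)) + - (2 * complex_of_real (pi\<^sup>2/6)) + of_real (pi\<^sup>2/3)/z\<^sup>2)) (-{0} \<union> {0})"
   by (rule has_sum_Un_disjoint) auto
  then show ?thesis by (simp add: insert_absorb Compl_insert)
 qed
 define t where "t d = (\<Sum>\<^sub>\<infinity>c\<in>-{0}. a c d)" for d
 have A': "((%(d,c). a c d) has_sum A) (UNIV \<times> (-{0}))"
  using A by (subst has_sum_swap) (simp add: case_prod_unfold)
 then have "(%(d,c). a c d) summable_on (UNIV \<times> (-{0}))" unfolding summable_on_def by blast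
 then have td: "((%c. a c d) has_sum t d) (-{0})" for d
  unfolding t_def using summable_on_SigmaD1[of "%d c. a c d" UNIV "%_. -{0}" d] by (intro has_sum_infsum) simp
 have tA: "(t has_sum A) UNIV" by (rule has_sum_SigmaD[OF A']) (use td in auto)
 have Ud: "((%c. 1/jf c d z - 1/jf c (d+1) z) has_sum (R d + - t d)) (-{0})" for d
 proof -
  have "((%c. 1/jf c d z^2 + - a c d) has_sum (R d + - t d)) (-{0})"
   by (intro has_sum_add Rd has_sum_neg td)
  then show ?thesis
   by (rule has_sum_congD) (use jf_telescope[OF assms] in \<open>auto simp: a_def\<close>)
 qed
 \<comment> \<open>Column d of the telescoping terms. Its total over d is expressed by
   \<open>e2\<close> at z and at z', whereas its partial sums over {-N..<N} are cotangent values;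
   comparing the two gives the formula.\<close>
 define U where "U d = R d + - t d" for d
 have Usum: "(U has_sum ((e2 z' - of_real (pi\<^sup>2/3))/z\<^sup>2 - of_real (pi\<^sup>2/3) + of_real (pi\<^sup>2/3)/z\<^sup>2 + - A)) UNIV"
  unfolding U_def by (intro has_sum_add Rsum has_sum_neg tA)
 have part: "(\<Sum>d\<in>{- int N..<int N}. U d) = 2/z*(cotf (- of_nat N/z) + z/of_nat N)" if "N > 0" for N
 proof (rule column_difference_has_sum[OF assms that])
  have "((%c. \<Sum>d\<in>{- int N..<int N}. 1/jf c d z - 1/jf c (d+1) z) has_sum (\<Sum>d\<in>{- int N..<int N}. U d)) (-{0})"
   by (rule has_sum_finite_sum) (use Ud in \<open>simp_all add: U_def\<close>)
  then show "((%c. 1/jf c (- int N) z - 1/jf c (int N) z) has_sum (\<Sum>d\<in>{- int N..<int N}. U d)) (-{0})"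
   by (simp only: sum_int_telescope[of "%d. 1/jf _ d z"])
 qed
 have "(%N. 2/z*(cotf (- of_nat N/z) + z/of_nat N)) \<longlonglongrightarrow>
  (e2 z' - of_real (pi\<^sup>2/3))/z\<^sup>2 - of_real (pi\<^sup>2/3) + of_real (pi\<^sup>2/3)/z\<^sup>2 + - A"
  by (rule Lim_transform_eventually[OF tendsto_symmetric_sum[OF Usum]])
   (use eventually_gt_at_top[of 0] in \<open>eventually_elim, simp only: part\<close>)
 from LIMSEQ_unique[OF this cotf_tendsto[OF assms]]
 have "(e2 z' - of_real (pi\<^sup>2/3))/z\<^sup>2 - of_real (pi\<^sup>2/3) + of_real (pi\<^sup>2/3)/z\<^sup>2 + - A = - 2 * of_real pi*\<i>/z" .
 then have "e2 z'/z\<^sup>2 - e2 z = - 2 * of_real pi*\<i>/z" by (simp add: Aeq diff_divide_distrib)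
 then have "e2 z'/z\<^sup>2 = e2 z - 2 * of_real pi*\<i>/z" by (simp add: algebra_simps)
 then have "z\<^sup>2*(e2 z'/z\<^sup>2) = z\<^sup>2*(e2 z - 2 * of_real pi*\<i>/z)" by (simp only:)
 moreover have "z\<^sup>2*(e2 z - 2 * of_real pi*\<i>/z) = z\<^sup>2*e2 z - 2 * of_real pi*\<i>*z"
  using z0 by (simp add: power2_eq_square right_diff_distrib)
 ultimately show ?thesis using z0 unfolding z'_def by simp
qed

section \<open>Euler's product and the multiplier system of the eta function\<close>

definition ephi :: "complex => complex" where
 "ephi x = (\<Prod>n. 1 - x^Suc n)"

lemma eta_ephi: "eta z = qpow (1/24) z*ephi (qpow 1 z)"
 by (simp add: eta_def ephi_def)

lemma ephi_convergent:
 assumes "norm (x::complex) < 1" shows "convergent_prod (%n. 1 - x^Suc n)"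
proof -
 have "summable (%n. norm x^Suc n)" using assms by (subst summable_Suc_iff) simp
 then have "abs_convergent_prod (%n. 1 - x^Suc n)"
  by (simp add: abs_convergent_prod_conv_summable norm_power norm_mult)
 then show ?thesis by (rule abs_convergent_prod_imp_convergent_prod)
qed

lemma ephi_nonzero:
 assumes "norm x < 1" shows "ephi x ~= 0"
proof -
 have "1 - x^Suc n ~= 0" for n
 proof
  assume "1 - x^Suc n = 0"
  then have "norm x^Suc n = 1" by (metis eq_iff_diff_eq_0 norm_one norm_power)
  moreover have "norm x^Suc n < 1" using assms power_less_one_iff[of "norm x" "Suc n"] by auto
  ultimately show False by simp
 qed
 then show ?thesis unfolding ephi_def by (intro prodinf_nonzero ephi_convergent[OF assms])
qed

lemma ephi_uniform_limit:
 assumes "r < 1"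
 shows "uniform_limit (cball 0 r) (%n x. \<Prod>k<n. 1 - x^Suc k) ephi sequentially"
proof (cases "r >= 0")
 case True
 have "uniformly_convergent_on (cball 0 r) (%N x. \<Prod>n<N. 1 - x^Suc n :: complex)"
 proof (rule Infinite_Products.uniformly_convergent_on_prod')
  have "summable (%n. r^Suc n)" using assms True by (subst summable_Suc_iff) simp
  then show "uniformly_convergent_on (cball 0 r) (%N x. \<Sum>n<N. norm (1 - x^Suc n - 1 :: complex))"
   by (intro Weierstrass_m_test'[where M = "%n. r^Suc n"])
    (auto simp: norm_power norm_mult simp del: power_Suc intro!: power_mono)
 qed (auto intro!: continuous_intros)
 then obtain l where l: "uniform_limit (cball 0 r) (%N x. \<Prod>n<N. 1 - x^Suc n :: complex) l sequentially"
  unfolding uniformly_convergent_on_def by blast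
 have le: "l x = ephi x" if "x : cball 0 r" for x :: complex
 proof (rule LIMSEQ_unique)
  show "(%N. \<Prod>n<N. 1 - x^Suc n) \<longlonglongrightarrow> l x" by (rule tendsto_uniform_limitI[OF l that])
  have "norm x < 1" using that assms by simp
  from convergent_prod_LIMSEQ[OF ephi_convergent[OF this]]
  have "(%N. \<Prod>n\<le>N. 1 - x^Suc n) \<longlonglongrightarrow> ephi x" by (simp add: ephi_def)
  then have "(%N. \<Prod>n<Suc N. 1 - x^Suc n) \<longlonglongrightarrow> ephi x" by (simp only: lessThan_Suc_atMost)
  then show "(%N. \<Prod>n<N. 1 - x^Suc n) \<longlonglongrightarrow> ephi x" by (rule LIMSEQ_imp_Suc)
 qed
 show ?thesis
 proof (rule uniform_limitI)
  fix e :: real assume "e > 0"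
  from uniform_limitD[OF l this]
  show "\<forall>\<^sub>F n in sequentially. \<forall>x\<in>cball 0 r. dist (\<Prod>k<n. 1 - x^Suc k) (ephi x) < e"
   by (rule eventually_mono) (simp add: le)
 qed
qed auto

lemma ephi_holomorphic: "ephi holomorphic_on ball 0 1"
proof (rule holomorphic_uniform_sequence[OF open_ball])
 show "(%x. \<Prod>k<n. 1 - x^Suc k) holomorphic_on ball 0 1" for n by (intro holomorphic_intros)
 fix x :: complex assume x: "x : ball 0 1"
 define d where "d = (1 - norm x)/2"
 have d: "d > 0" using x by (simp add: d_def)
 have sub: "cball x d \<subseteq> cball 0 (norm x + d)"
  by (auto simp: dist_norm) (smt (verit) norm_triangle_sub dist_norm norm_minus_commute)
 have "cball x d \<subseteq> ball 0 1" using sub x by (force simp: d_def field_simps)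
 moreover have "uniform_limit (cball x d) (%n x. \<Prod>k<n. 1 - x^Suc k) ephi sequentially"
  by (rule uniform_limit_on_subset[OF ephi_uniform_limit sub]) (use x in \<open>simp add: d_def field_simps\<close>)
 ultimately show "\<exists>d>0. cball x d \<subseteq> ball 0 1 & uniform_limit (cball x d) (%n x. \<Prod>k<n. 1 - x^Suc k) ephi sequentially"
  using d by blast
qed

lemma ephi_0 [simp]: "ephi 0 = 1"
 by (simp add: ephi_def)

lemma ephi_logderiv:
 assumes "norm x < 1"
 shows "(%n. - (of_nat (Suc n)*x^n)/(1 - x^Suc n)) sums (deriv ephi x/ephi x)"
proof -
 define r where "r = (1 + norm x)/2"
 have r: "r < 1" "norm x < r" using assms by (auto simp: r_def)
 have "(%k. deriv (%x. 1 - x^Suc k) x/(1 - x^Suc k)) sums (deriv ephi x/ephi x)"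
 proof (rule logderiv_prodinf_complex_uniform_limit[where A = "ball 0 r"])
  show "uniform_limit (ball 0 r) (%n x. \<Prod>k<n. 1 - x^Suc k) ephi sequentially"
   by (rule uniform_limit_on_subset[OF ephi_uniform_limit[OF r(1)] ball_subset_cball])
  show "ephi x ~= 0" by (rule ephi_nonzero[OF assms])
 qed (use r in \<open>auto intro!: holomorphic_intros\<close>)
 moreover have "deriv (%x. 1 - x^Suc k) x = - (of_nat (Suc k)*x^k)" for k
  by (rule DERIV_imp_deriv) (rule derivative_eq_intros refl | simp)+
 ultimately show ?thesis by simp
qed

lemma eta_nonzero: "z : uhp ==> eta z ~= 0"
 using ephi_nonzero[OF qpow_less_1] by (simp add: eta_ephi)

text \<open>Logarithmic differentiation of the product gives the Lambert series summed over n;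
  \<open>lambert_rows\<close> identifies it with the series over c that defines
  \<open>e2\<close>.\<close>

lemma eta_has_deriv:
 assumes "z : uhp"
 shows "(eta has_field_derivative \<i>/(4 * of_real pi)*e2 z*eta z) (at z)"
proof -
 define x where "x = qpow 1 z"
 have x: "norm x < 1" unfolding x_def by (rule qpow_less_1[OF assms])
 have xd: "(ephi has_field_derivative deriv ephi x) (at x)"
  by (rule holomorphic_derivI[OF ephi_holomorphic]) (use x in auto)
 define T where "T = (\<Sum>\<^sub>\<infinity>(c,n). of_nat (Suc n)^1*x^(Suc c * Suc n))"
 have T1: "((%c. powsum 1 (x^Suc c)) has_sum T) UNIV"
  unfolding T_def by (rule lambert_rows(1)[OF x]) simp
 have T2: "((%n. of_nat (Suc n)^1*x^Suc n/(1 - x^Suc n)) has_sum T) UNIV"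
  unfolding T_def by (rule lambert_rows(2)[OF x]) simp
 have e2: "e2 z = of_real (pi\<^sup>2/3) - 8 * of_real (pi\<^sup>2) * T"
  using infsumI[OF T1] by (simp add: e2_def x_def)
 have "(%n. x*(- (of_nat (Suc n)*x^n)/(1 - x^Suc n))) sums (x*(deriv ephi x/ephi x))"
  by (rule sums_mult[OF ephi_logderiv[OF x]])
 moreover have "(%n. - (of_nat (Suc n)^1*x^Suc n/(1 - x^Suc n))) sums (- T)"
  by (rule sums_minus[OF has_sum_imp_sums[OF T2]])
 moreover have "x*(- (of_nat (Suc n)*x^n)/(1 - x^Suc n)) = - (of_nat (Suc n)^1*x^Suc n/(1 - x^Suc n))" for n
  by simp
 ultimately have "x*(deriv ephi x/ephi x) = - T" using sums_unique2 by (simp only:)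
 then have dx: "x * deriv ephi x = - T*ephi x" using ephi_nonzero[OF x] by (simp add: field_simps)
 have "((%z. qpow (1/24) z*ephi (qpow 1 z)) has_field_derivative
   (2 * of_real pi*\<i> * of_real (1/24)*qpow (1/24) z)*ephi (qpow 1 z)
  +(deriv ephi x*(2 * of_real pi*\<i> * of_real 1*qpow 1 z))*qpow (1/24) z) (at z)"
  by (intro DERIV_mult qpow_deriv DERIV_chain2[of ephi] xd[unfolded x_def]) (simp add: xd[unfolded x_def] x_def)
 also have "(deriv ephi x*(2 * of_real pi*\<i> * of_real 1*qpow 1 z)) = 2 * of_real pi*\<i>*(x * deriv ephi x)"
  by (simp add: x_def)
 also have "(2 * of_real pi*\<i> * of_real (1/24)*qpow (1/24) z)*ephi (qpow 1 z)+2 * of_real pi*\<i>*(x * deriv ephi x)*qpow (1/24) z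
  = \<i>/(4 * of_real pi)*e2 z*eta z"
  unfolding dx e2 eta_ephi x_def[symmetric] by (simp add: field_simps power2_eq_square)
 finally show ?thesis by (simp add: eta_ephi[abs_def])
qed

lemma eta_holomorphic: "eta holomorphic_on uhp"
 unfolding holomorphic_on_def field_differentiable_def
 using eta_has_deriv has_field_derivative_at_within by blast

text \<open>The quotient \<open>F\<close> has derivative 0 by \<open>e2_inversion\<close>, so it is
  constant, and the fixed point i of the inversion gives the constant. Squares avoid the choice of a
  root of z.\<close>

lemma eta_inversion:
 assumes "z : uhp" shows "(eta (- 1/z))\<^sup>2 = - \<i>*z*(eta z)\<^sup>2"
proof -
 define F where "F z = (eta (- 1/z))\<^sup>2/(z*(eta z)\<^sup>2)" for z
 have inv: "- 1/z : uhp" if "z : uhp" for z using uhp_neg_nat_div[OF that, of 1] by simp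
 have dF: "(F has_field_derivative 0) (at z)" if z: "z : uhp" for z
 proof -
  have z0: "z ~= 0" "eta z ~= 0" using z eta_nonzero by (auto simp: uhp_iff)
  define p where "p = eta (- 1/z)"
  define k :: complex where "k = \<i>/(4 * of_real pi)"
  have d0: "((%z. - 1/z) has_field_derivative 1/z\<^sup>2) (at z)"
   using z0 by (auto intro!: derivative_eq_intros simp: power2_eq_square)
  have d1: "((%z. eta (- 1/z)) has_field_derivative k*e2 (- 1/z)*p*(1/z\<^sup>2)) (at z)"
   using DERIV_chain2[OF eta_has_deriv[OF inv[OF z]] d0] by (simp add: p_def k_def)
  have d2: "(eta has_field_derivative k*e2 z*eta z) (at z)"
   using eta_has_deriv[OF z] by (simp add: k_def)
  have "(F has_field_derivative ((of_nat 2*((k*e2 (- 1/z)*p*(1/z\<^sup>2))*p^(2 - Suc 0)))*(z*(eta z)\<^sup>2)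
   - p\<^sup>2*(1*(eta z)\<^sup>2+(of_nat 2*((k*e2 z*eta z)*eta z^(2 - Suc 0)))*z))/((z*(eta z)\<^sup>2)*(z*(eta z)\<^sup>2))) (at z)"
   unfolding F_def[abs_def] p_def
   by (intro DERIV_divide DERIV_power DERIV_mult DERIV_ident d1[unfolded p_def] d2) (use z0 in simp)
  \<comment> \<open>The anomaly of \<open>e2\<close> becomes 1/(2z); doubled by the square, it
    cancels the logarithmic derivative of the factor z in the denominator.\<close>
  moreover have "k*e2 (- 1/z)*(1/z\<^sup>2) = k*e2 z+1/(2*z)"
   unfolding e2_inversion[OF z] k_def using z0 by (simp add: field_simps power2_eq_square)
  then have "k*e2 (- 1/z)*p*(1/z\<^sup>2) = (k*e2 z+1/(2*z))*p" by (metis mult.commute mult.assoc)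
  ultimately have "(F has_field_derivative ((of_nat 2*(((k*e2 z+1/(2*z))*p)*p^(2 - Suc 0)))*(z*(eta z)\<^sup>2)
   - p\<^sup>2*(1*(eta z)\<^sup>2+(of_nat 2*((k*e2 z*eta z)*eta z^(2 - Suc 0)))*z))/((z*(eta z)\<^sup>2)*(z*(eta z)\<^sup>2))) (at z)"
   by (simp only:)
  moreover have "(of_nat 2*(((k*e2 z+1/(2*z))*p)*p^(2 - Suc 0)))*(z*(eta z)\<^sup>2)
   - p\<^sup>2*(1*(eta z)\<^sup>2+(of_nat 2*((k*e2 z*eta z)*eta z^(2 - Suc 0)))*z) = 0"
   using z0 by (simp add: field_simps power2_eq_square)
  ultimately show ?thesis by (simp only: div_0)
 qed
 have "\<exists>c. \<forall>x\<in>uhp. F x = c"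
  by (rule has_field_derivative_zero_constant[OF convex_uhp]) (use dF has_field_derivative_at_within in blast)
 then obtain K where K: "!!x. x : uhp ==> F x = K" by blast
 have iu: "\<i> : uhp" by (simp add: uhp_iff)
 have "- 1/\<i> = \<i>" by (simp add: field_simps)
 then have "F \<i> = 1/\<i>" using eta_nonzero[OF iu] by (simp add: F_def)
 then have "K = - \<i>" using K[OF iu] by simp
 then have "F z = - \<i>" using K[OF assms] by simp
 moreover have "z*(eta z)\<^sup>2 ~= 0" using assms eta_nonzero[OF assms] by (auto simp: uhp_iff)
 ultimately show ?thesis unfolding F_def by (simp add: field_simps)
qed

lemma eta_translate: "eta (z+1) = cis (pi/12)*eta z"
proof -
 have "qpow 1 (z+1) = qpow 1 z" by (simp add: qpow_def exp_add distrib_left)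
 moreover have "qpow (1/24) (z+1) = cis (pi/12)*qpow (1/24) z"
  by (simp add: qpow_def cis_conv_exp exp_add[symmetric] field_simps)
 ultimately show ?thesis by (simp add: eta_ephi)
qed

text \<open>|eta|^4 Im^2 would have weight 0 after squaring the identity, but already |eta|^4 Im
  scales correctly under both generators: |eta|^4 acquires |z|^2 and Im acquires |z|^(-2).\<close>

lemma norm_eta_moebius:
 assumes "a * d - b * c = 1" "z : uhp"
 shows "norm (eta (moeb a b c d z))^2 = norm (jf c d z)*norm (eta z)^2"
proof -
 define f where "f z = norm (eta z)^4*Im z" for z
 have "f (moeb a b c d z) = f z"
 proof (rule invariant_from_generators[OF _ _ assms])
  fix z assume z: "z : uhp"
  then have z0: "z ~= 0" by (auto simp: uhp_iff)
  show "f (z+1) = f z" by (simp add: f_def eta_translate norm_mult)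
  have "norm (eta (- 1/z))^2 = norm ((eta (- 1/z))\<^sup>2)" by (simp add: norm_power)
  also have "... = norm z*norm (eta z)^2" unfolding eta_inversion[OF z] by (simp add: norm_mult norm_power)
  finally have "(norm (eta (- 1/z))^2)^2 = (norm z*norm (eta z)^2)^2" by simp
  then have "norm (eta (- 1/z))^4 = norm z^2*norm (eta z)^4"
   by (simp add: power_mult_distrib power_mult[symmetric])
  moreover have "Im (- 1/z) = Im z/norm z^2" by (simp add: Im_divide cmod_power2)
  ultimately show "f (- 1/z) = f z" using z0 by (simp add: f_def)
 qed
 moreover have nz: "norm (jf c d z) > 0" using det_jf_nonzero[OF assms(2,1)] by simp
 ultimately have "norm (eta (moeb a b c d z))^4 = norm (jf c d z)^2*norm (eta z)^4"
  using assms(2) unfolding f_def Im_moebius[OF assms(1)] by (simp add: uhp_iff field_simps)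
 then have "(norm (eta (moeb a b c d z))^2)^2 = (norm (jf c d z)*norm (eta z)^2)^2"
  by (simp add: power_mult_distrib power_mult[symmetric])
 then show ?thesis by (rule power2_eq_imp_eq) auto
qed

lemma jf_not_nonpos_Reals:
 assumes "z : uhp" "c ~= 0" shows "jf c d z \<notin> \<real>\<^sub>\<le>\<^sub>0"
proof
 assume "jf c d z : \<real>\<^sub>\<le>\<^sub>0"
 then have "Im (jf c d z) = 0" by (simp add: complex_nonpos_Reals_iff)
 then show False using assms by (simp add: jf_def uhp_iff)
qed

lemma jf_powr_holomorphic: "(%z. jf c d z powr s) holomorphic_on uhp"
proof (cases "c = 0")
 case False
 then show ?thesis using jf_not_nonpos_Reals
  unfolding jf_def by (intro holomorphic_intros) auto
qed (simp add: jf_def)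

text \<open>The quotient is holomorphic, and by \<open>norm_eta_moebius\<close> it has modulus 1
  everywhere, hence it is constant. The multiplier is thus obtained without being computed.\<close>

lemma eta_mult_exists:
 assumes "a * d - b * c = 1"
 shows "\<exists>e. norm e = 1 & (\<forall>z\<in>uhp. eta (moeb a b c d z) = e*jf c d z powr (1/2)*eta z)"
proof -
 define g where "g z = eta (moeb a b c d z)/(jf c d z powr (1/2)*eta z)" for z
 have nz: "jf c d z powr (1/2)*eta z ~= 0" if "z : uhp" for z
  using that eta_nonzero det_jf_nonzero[OF that assms] by simp
 have "moeb a b c d holomorphic_on uhp"
  unfolding holomorphic_on_def field_differentiable_def
  using moebius_has_field_derivative[OF assms] has_field_derivative_at_within by blast
 moreover have "moeb a b c d ` uhp \<subseteq> uhp" using moebius_in_uhp[OF assms] by auto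
 ultimately have "(%z. eta (moeb a b c d z)) holomorphic_on uhp"
  using holomorphic_on_compose_gen[OF _ eta_holomorphic] by (simp add: o_def)
 then have hol: "g holomorphic_on uhp" unfolding g_def[abs_def]
  using nz by (intro holomorphic_intros jf_powr_holomorphic eta_holomorphic) auto
 have ng: "norm (g z) = 1" if z: "z : uhp" for z
 proof -
  have "norm (g z)^2 = norm (jf c d z)*norm (eta z)^2/(norm (jf c d z powr (1/2))^2*norm (eta z)^2)"
   unfolding g_def norm_divide norm_mult power_divide power_mult_distrib norm_eta_moebius[OF assms z] ..
  also have "norm (jf c d z powr (1/2))^2 = norm (jf c d z)"
  proof -
   have "(jf c d z powr (1/2))^2 = jf c d z"
    using det_jf_nonzero[OF z assms] by (simp add: power2_eq_square powr_add[symmetric])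
   then show ?thesis by (metis norm_power)
  qed
  finally have "norm (g z)^2 = 1^2" using nz[OF z] by (auto simp: divide_simps)
  then show ?thesis by (rule power2_eq_imp_eq) auto
 qed
 have iu: "\<i> : uhp" by (simp add: uhp_iff)
 have "g constant_on uhp"
  by (rule maximum_modulus_principle[OF hol open_uhp connected_uhp open_uhp order_refl iu]) (use ng iu in auto)
 then obtain e where e: "!!z. z : uhp ==> g z = e" unfolding constant_on_def by blast
 have "norm e = 1" using e[OF iu] ng[OF iu] by simp
 moreover have "eta (moeb a b c d z) = e*jf c d z powr (1/2)*eta z" if z: "z : uhp" for z
  using e[OF z] nz[OF z] by (auto simp: g_def field_simps)
 ultimately show ?thesis by blast
qed

lemma eta_mult_eqI:
 assumes "a * d - b * c = 1" "!!z. z : uhp ==> eta (moeb a b c d z) = e*jf c d z powr (1/2)*eta z"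
 shows "eta_mult a b c d = e"
 unfolding eta_mult_def
proof (rule the_equality)
 show "\<forall>z\<in>uhp. eta (moeb a b c d z) = e*(of_int c*z + of_int d) powr (1/2)*eta z"
  using assms(2) by (simp add: jf_def)
 fix e' assume e': "\<forall>z\<in>uhp. eta (moeb a b c d z) = e'*(of_int c*z + of_int d) powr (1/2)*eta z"
 have iu: "\<i> : uhp" by (simp add: uhp_iff)
 have "jf c d \<i> powr (1/2)*eta \<i> ~= 0"
  using eta_nonzero[OF iu] det_jf_nonzero[OF iu assms(1)] by simp
 moreover have "eta (moeb a b c d \<i>) = e'*(jf c d \<i> powr (1/2)*eta \<i>)"
  using e'[rule_format, OF iu] by (simp only: jf_def mult.assoc)
 then have "e'*(jf c d \<i> powr (1/2)*eta \<i>) = e*(jf c d \<i> powr (1/2)*eta \<i>)"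
  using assms(2)[OF iu] by (simp only: mult.assoc)
 ultimately show "e' = e" using mult_right_cancel by blast
qed

lemma eta_mult_transform:
 assumes "a * d - b * c = 1" "z : uhp"
 shows "eta (moeb a b c d z) = eta_mult a b c d*jf c d z powr (1/2)*eta z"
  and norm_eta_mult: "norm (eta_mult a b c d) = 1"
proof -
 obtain e where e: "norm e = 1" "\<forall>z\<in>uhp. eta (moeb a b c d z) = e*jf c d z powr (1/2)*eta z"
  using eta_mult_exists[OF assms(1)] by blast
 then have eq: "eta_mult a b c d = e" by (intro eta_mult_eqI[OF assms(1)]) auto
 show "eta (moeb a b c d z) = eta_mult a b c d*jf c d z powr (1/2)*eta z" using e assms eq by auto
 show "norm (eta_mult a b c d) = 1" using e eq by simp
qed

lemma eta_mult_T: "eta_mult 1 1 0 1 = cis (pi/12)"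
 by (rule eta_mult_eqI) (simp_all add: moebius_int_def jf_def eta_translate)

section \<open>Expansions at the cusp\<close>

definition log_q :: "complex => complex" where
 "log_q q = Ln q/(2 * of_real pi*\<i>)"

lemma qpow_log_q: "q ~= 0 ==> qpow 1 (log_q q) = q"
 by (simp add: qpow_def log_q_def)

lemma Im_log_q: "q ~= 0 ==> Im (log_q q) = - ln (norm q)/(2*pi)"
 by (simp add: log_q_def Im_divide power2_eq_square)

lemma log_q_in_uhp: "q ~= 0 ==> norm q < 1 ==> log_q q : uhp"
 by (simp add: uhp_iff Im_log_q field_simps)

lemma qpow_eq_iff: "qpow 1 z = qpow 1 w \<longleftrightarrow> (\<exists>n::int. z = w + of_int n)"
proof -
 have "2 * of_real pi*\<i>*z = 2 * of_real pi*\<i>*w + of_real (of_int (2*n)*pi)*\<i> \<longleftrightarrow> z = w + of_int n" for n :: int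
 proof -
  have "2 * of_real pi*\<i>*w + of_real (of_int (2*n)*pi)*\<i> = 2 * of_real pi*\<i>*(w + of_int n)"
   by (simp add: algebra_simps)
  then show ?thesis by simp
 qed
 then show ?thesis by (simp add: qpow_def exp_eq)
qed

lemma periodic_eq:
 assumes "!!z. z : uhp ==> f (z+1) = f z" "z : uhp" "w : uhp" "qpow 1 z = qpow 1 w"
 shows "f z = f w"
 using assms(4) periodic_int[of f, OF assms(1,3)] unfolding qpow_eq_iff by auto

text \<open>\<open>log_q\<close> jumps across the negative axis. There the function agrees, by
  periodicity, with the one built from \<open>log_q (- q) + 1/2\<close>, whose cut is the positive
  axis; the two slit discs cover the punctured disc.\<close>

lemma periodic_q_function:
 assumes hol: "f holomorphic_on uhp" and per: "!!z. z : uhp ==> f (z+1) = f z"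
 shows "(%q. f (log_q q)) holomorphic_on (ball 0 1 - {0})"
  and "!!z. z : uhp ==> f z = f (log_q (qpow 1 z))"
proof -
 show "f z = f (log_q (qpow 1 z))" if "z : uhp" for z
  by (rule periodic_eq[of f, OF per that]) (use that in \<open>simp_all add: qpow_log_q log_q_in_uhp qpow_less_1\<close>)
 have 1: "(%q. f (log_q q)) holomorphic_on (ball 0 1 - \<real>\<^sub>\<le>\<^sub>0)"
 proof -
  have "log_q holomorphic_on (ball 0 1 - \<real>\<^sub>\<le>\<^sub>0)" unfolding log_q_def[abs_def] by (intro holomorphic_intros) auto
  moreover have "log_q ` (ball 0 1 - \<real>\<^sub>\<le>\<^sub>0) \<subseteq> uhp" proof safe
   fix q :: complex assume "q : ball 0 1" "q \<notin> \<real>\<^sub>\<le>\<^sub>0"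
   then show "log_q q : uhp" by (intro log_q_in_uhp) auto
  qed
  ultimately show ?thesis using holomorphic_on_compose_gen[OF _ hol] by (simp add: o_def)
 qed
 have 2: "(%q. f (log_q q)) holomorphic_on (ball 0 1 - \<real>\<^sub>\<ge>\<^sub>0)"
 proof -
  have "(%q. log_q (- q)+1/2) holomorphic_on (ball 0 1 - \<real>\<^sub>\<ge>\<^sub>0)" unfolding log_q_def[abs_def]
   by (intro holomorphic_intros) (auto simp: complex_nonpos_Reals_iff complex_nonneg_Reals_iff)
  moreover have u: "log_q (- q)+1/2 : uhp" if "q : ball 0 1 - \<real>\<^sub>\<ge>\<^sub>0" for q
  proof -
   have "q ~= 0" "norm (- q) < 1" using that by auto
   then show ?thesis using log_q_in_uhp[of "-q"] by (simp add: uhp_iff)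
  qed
  ultimately have h: "(%q. f (log_q (- q)+1/2)) holomorphic_on (ball 0 1 - \<real>\<^sub>\<ge>\<^sub>0)"
   using holomorphic_on_compose_gen[OF _ hol, of "%q. log_q (- q)+1/2"] by (simp add: o_def image_subset_iff)
  show ?thesis
  proof (rule holomorphic_transform[OF h])
   fix q :: complex assume q: "q : ball 0 1 - \<real>\<^sub>\<ge>\<^sub>0"
   then have q0: "q ~= 0" by (auto simp: complex_nonneg_Reals_iff)
   have "qpow 1 (log_q (- q)+1/2) = qpow 1 (log_q (- q))*exp (of_real pi*\<i>)"
    by (simp add: qpow_def distrib_left exp_add)
   also have "... = q" using q0 by (simp add: qpow_log_q)
   finally have "qpow 1 (log_q (- q)+1/2) = qpow 1 (log_q q)" using q0 by (simp add: qpow_log_q)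
   then show "f (log_q (- q)+1/2) = f (log_q q)"
    using periodic_eq[of f, OF per u[OF q] log_q_in_uhp] q q0 by auto
  qed
 qed
 have "(%q. f (log_q q)) holomorphic_on ((ball 0 1 - \<real>\<^sub>\<le>\<^sub>0) \<union> (ball 0 1 - \<real>\<^sub>\<ge>\<^sub>0))"
  by (intro holomorphic_on_Un 1 2 open_Diff) auto
 moreover have "(ball 0 1 - \<real>\<^sub>\<le>\<^sub>0) \<union> (ball 0 1 - \<real>\<^sub>\<ge>\<^sub>0) = ball 0 1 - {0::complex}"
  by (auto simp: complex_nonpos_Reals_iff complex_nonneg_Reals_iff complex_eq_iff)
 ultimately show "(%q. f (log_q q)) holomorphic_on (ball 0 1 - {0})" by simp
qed

lemma tendsto_cusp_at_0:
 assumes "tendsto_cusp f"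
 shows "((%q. f (log_q q)) \<longlongrightarrow> 0) (at 0)"
proof (rule tendstoI)
 fix e :: real assume "e > 0"
 then obtain Y where Y: "!!z. Im z > Y ==> norm (f z) < e" using assms unfolding tendsto_cusp_def by blast
 have "eventually (%q. q : ball 0 (exp (- 2*pi * Y))) (at (0::complex))"
  by (intro eventually_at_in_open') auto
 moreover have "eventually (%q::complex. q ~= 0) (at 0)" by (simp add: eventually_at_filter)
 ultimately show "eventually (%q. dist (f (log_q q)) 0 < e) (at 0)"
 proof eventually_elim
  case (elim q)
  then have "ln (norm q) < - 2*pi * Y" by (metis dist_0_norm exp_gt_zero ln_exp ln_less_cancel_iff mem_ball zero_less_norm_iff)
  then have "Im (log_q q) > Y" using elim by (simp add: Im_log_q field_simps)
  then show ?case using Y by simp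
 qed
qed

text \<open>The cusp condition says that q times the function of q tends to 0, which is the
  hypothesis of Riemann's theorem on removable singularities. It admits any growth slower than that
  of 1/q.\<close>

lemma qexpansion_exists:
 assumes "f holomorphic_on uhp" "!!z. z : uhp ==> f (z+1) = f z" "tendsto_cusp (%z. qpow 1 z*f z)"
 obtains G where "G holomorphic_on ball 0 1" "!!z. z : uhp ==> f z = G (qpow 1 z)"
proof -
 have "((%q. qpow 1 (log_q q)*f (log_q q)) \<longlongrightarrow> 0) (at 0)" using tendsto_cusp_at_0[OF assms(3)] .
 then have "((%q. (q - 0)*f (log_q q)) \<longlongrightarrow> 0) (at 0)"
  by (rule Lim_transform_eventually) (auto simp: eventually_at_filter qpow_log_q)
 then obtain G where G: "G holomorphic_on ball 0 1" "\<forall>q\<in>ball 0 1 - {0}. G q = f (log_q q)"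
  using holomorphic_on_extend_lim[OF periodic_q_function(1)[OF assms(1,2)]] by auto
 show ?thesis
  by (rule that[OF G(1)]) (use G(2) periodic_q_function(2)[OF assms(1,2)] qpow_less_1 in auto)
qed

lemma q_function_bounded:
 assumes "G holomorphic_on ball 0 1"
 obtains C where "C > 0" "!!z. Im z >= 1 ==> norm (G (qpow 1 z))<=C"
proof -
 have "continuous_on (cball 0 (1/2)) G"
  by (rule continuous_on_subset[OF holomorphic_on_imp_continuous_on[OF assms]]) auto
 then have "bounded (G ` cball 0 (1/2))" by (intro compact_imp_bounded compact_continuous_image) auto
 then obtain C where C: "C > 0" "!!q. q : cball 0 (1/2) ==> norm (G q)<=C"
  unfolding bounded_pos by blast
 have "norm (qpow 1 z)<=1/2" if "Im z >= 1" for z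
 proof -
  have p: "pi > 3" using pi_gt3 .
  have "norm (qpow 1 z) = inverse (exp (2*pi*Im z))" by (simp add: norm_qpow exp_minus)
  also have "2<=exp (2*pi*Im z)"
  proof -
   have "1<=pi*Im z" using p that mult_mono[of 1 pi 1 "Im z"] by simp
   then show ?thesis using exp_ge_add_one_self[of "2*pi*Im z"] by linarith
  qed
  then have "inverse (exp (2*pi*Im z))<=inverse 2" by (intro le_imp_inverse_le) auto
  finally show ?thesis by simp
 qed
 then show ?thesis using that[OF C(1)] C(2) by auto
qed

lemma tendsto_cusp_exp:
 assumes "!!z. Im z >= 1 ==> norm (f z)<=C*exp (- b*Im z)" "b > 0"
 shows "tendsto_cusp f"
 unfolding tendsto_cusp_def
proof safe
 fix e :: real assume e: "e > 0"
 have "((%y. C*exp (- b*y)) \<longlongrightarrow> 0) at_top" using assms(2) by real_asymp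
 then have "eventually (%y. C*exp (- b*y) < e) at_top" by (rule order_tendstoD) (rule e)
 then obtain Y where Y: "!!y. y >= Y ==> C*exp (- b*y) < e" by (auto simp: eventually_at_top_linorder)
 have "norm (f z) < e" if "max 1 Y < Im z" for z
  using assms(1)[of z] Y[of "Im z"] that by simp
 then show "\<exists>Y. \<forall>z. Y < Im z \<longrightarrow> norm (f z) < e" by blast
qed

lemma tendsto_cusp_q_multiple:
 assumes "G holomorphic_on ball 0 1" "!!z. z : uhp ==> f z = qpow r z*G (qpow 1 z)" "r > 0"
 shows "tendsto_cusp f"
proof -
 obtain C where C: "C > 0" "!!z. Im z >= 1 ==> norm (G (qpow 1 z))<=C"
  using q_function_bounded[OF assms(1)] by blast
 show ?thesis
 proof (rule tendsto_cusp_exp)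
  fix z assume z: "Im z >= 1"
  then have "z : uhp" by (simp add: uhp_iff)
  then show "norm (f z)<=C*exp (- (2*pi * r)*Im z)"
   using C(2)[OF z] by (simp add: assms(2) norm_mult norm_qpow)
 qed (use assms(3) in simp)
qed

lemma ball_power_series:
 assumes "G holomorphic_on ball 0 1" "norm q < 1"
 shows "((%n. (deriv ^^ n) G 0/fact n*q^n) has_sum G q) UNIV"
proof (rule norm_summable_imp_has_sum)
 have s: "(%n. (deriv ^^ n) G 0/fact n*q^n) sums G q" if "norm q < 1" for q
  using holomorphic_power_series[OF assms(1), of q] that by simp
 show "(%n. (deriv ^^ n) G 0/fact n*q^n) sums G q" by (rule s[OF assms(2)])
 define p where "p = (1 + norm q)/2"
 have p: "p < 1" "norm q < p" "p > 0" using assms(2) by (auto simp: p_def intro: add_pos_nonneg)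
 have "summable (%n. (deriv ^^ n) G 0/fact n*(of_real p)^n)" using s[of "of_real p"] p by (auto simp: sums_iff)
 then show "summable (%n. norm ((deriv ^^ n) G 0/fact n*q^n))"
  by (rule powser_insidea) (use p in simp)
qed

lemma taylor_remainder:
 assumes "U holomorphic_on ball 0 1"
 shows "\<exists>u R. R holomorphic_on ball 0 1 & (\<forall>q\<in>ball 0 1. U q = (\<Sum>i<n. u i*q ^ i) + q^n * R q) & (n > 0 \<longrightarrow> u 0 = U 0)"
 using assms
proof (induction n arbitrary: U)
 case 0
 then show ?case by auto
next
 case (Suc n)
 define V where "V = (%q. if q = 0 then deriv U 0 else (U q - U 0)/(q - 0))"
 have "V holomorphic_on ball 0 1" unfolding V_def by (rule pole_lemma_open[OF Suc.prems open_ball])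
 from Suc.IH[OF this] obtain u R where uR: "R holomorphic_on ball 0 1"
  "\<forall>q\<in>ball 0 1. V q = (\<Sum>i<n. u i*q ^ i) + q^n * R q" by blast
 have UV: "U q = U 0 + q * V q" for q by (auto simp: V_def)
 define u' where "u' i = (if i = 0 then U 0 else u (i - 1))" for i
 have "U q = (\<Sum>i<Suc n. u' i*q ^ i) + q^Suc n * R q" if "q : ball 0 1" for q
 proof -
  have "(\<Sum>i<Suc n. u' i*q ^ i) = U 0 + q*(\<Sum>i<n. u i*q ^ i)"
   by (simp only: sum.lessThan_Suc_shift sum_distrib_left) (simp add: u'_def mult_ac)
  then show ?thesis using UV[of q] uR(2)[rule_format, OF that] by (simp add: algebra_simps)
 qed
 then show ?case using uR(1) by (intro exI[of _ u'] exI[of _ R]) (auto simp: u'_def)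
qed

text \<open>Triangular elimination: \<open>f i\<close> has a pole of order exactly i with leading
  coefficient 1, so all lower terms of \<open>f N\<close>, including the constant one, can be
  removed by means of the combinations already found.\<close>

lemma laurent_elimination:
 fixes f :: "nat => complex => complex"
 assumes "!!i. \<exists>U. U holomorphic_on ball 0 1 & U 0 = 1 & (\<forall>z\<in>uhp. f i z = U (qpow 1 z)/qpow 1 z ^ i)"
 shows "\<exists>c R. c N = 1 & (\<forall>i>N. c i = 0) & R holomorphic_on ball 0 1 \<and>
  (\<forall>z\<in>uhp. (\<Sum>i\<le>N. c i*f i z) = 1/qpow 1 z^N + qpow 1 z * R (qpow 1 z))"
proof (induction N rule: less_induct)
 case (less N)
 obtain U where U: "U holomorphic_on ball 0 1" "U 0 = 1" "!!z. z : uhp ==> f N z = U (qpow 1 z)/qpow 1 z^N"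
  using assms[of N] by blast
 obtain u R0 where R0: "R0 holomorphic_on ball 0 1"
  "!!q. q : ball 0 1 ==> U q = (\<Sum>i<Suc N. u i*q ^ i) + q^Suc N * R0 q" "u 0 = 1"
  using taylor_remainder[OF U(1), of "Suc N"] U(2) by auto
 define Q where "Q M p \<longleftrightarrow> fst p M = 1 & (\<forall>i>M. fst p i = 0) & snd p holomorphic_on ball 0 1 \<and>
  (\<forall>z\<in>uhp. (\<Sum>i\<le>M. fst p i*f i z) = 1/qpow 1 z ^ M + qpow 1 z * snd p (qpow 1 z))"
  for M and p :: "(nat => complex) \<times> (complex => complex)"
 have "\<exists>p. Q M p" if "M < N" for M using less[OF that] unfolding Q_def by simp
 then have "\<forall>M. \<exists>p. M < N \<longrightarrow> Q M p" by blast
 then obtain p where p: "!!M. M < N ==> Q M (p M)" using choice[of "%M p. M < N \<longrightarrow> Q M p"] by blast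
 define C where "C M = fst (p M)" for M
 define R where "R M = snd (p M)" for M
 have CR: "!!M. M < N ==> C M M = (1::complex)" "!!M i. M < N ==> i > M ==> C M i = 0"
  "!!M. M < N ==> R M holomorphic_on ball 0 1"
  "!!M z. M < N ==> z : uhp ==> (\<Sum>i\<le>M. C M i*f i z) = 1/qpow 1 z ^ M + qpow 1 z * R M (qpow 1 z)"
  using p unfolding Q_def C_def R_def by blast+
 \<comment> \<open>The coefficient of q^(-M) in \<open>f N\<close> is the Taylor coefficient
   \<open>u (N - M)\<close>; that multiple of the reduced combination with pole order M is
   subtracted.\<close>
 define c where "c j = (if j = N then 1 else 0) - (\<Sum>M<N. u (N - M)*C M j)" for j
 define R' where "R' q = R0 q - (\<Sum>M<N. u (N - M) * R M q)" for q
 have "c N = 1" by (simp add: c_def CR(2))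
 moreover have "\<forall>i>N. c i = 0" by (simp add: c_def CR(2))
 moreover have "R' holomorphic_on ball 0 1" unfolding R'_def[abs_def]
  by (intro holomorphic_intros R0 CR(3)) auto
 moreover have "(\<Sum>i\<le>N. c i*f i z) = 1/qpow 1 z^N + qpow 1 z * R' (qpow 1 z)" if z: "z : uhp" for z
 proof -
  define q where "q = qpow 1 z"
  have q: "q ~= 0" "q : ball 0 1" using qpow_less_1[OF z] by (auto simp: q_def)
  have "(\<Sum>i\<le>N. c i*f i z) = (\<Sum>i\<le>N. (if i = N then 1 else 0)*f i z) - (\<Sum>i\<le>N. \<Sum>M<N. u (N - M)*C M i*f i z)"
   by (simp add: c_def left_diff_distrib sum_subtractf sum_distrib_right)
  also have "(\<Sum>i\<le>N. (if i = N then 1 else 0)*f i z) = f N z"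
   by (simp add: if_distrib[of "%x. x * _"] sum.delta cong: if_cong)
  also have "(\<Sum>i\<le>N. \<Sum>M<N. u (N - M)*C M i*f i z) = (\<Sum>M<N. u (N - M)*(\<Sum>i\<le>N. C M i*f i z))"
   by (subst sum.swap) (simp add: sum_distrib_left mult.assoc)
  also have "... = (\<Sum>M<N. u (N - M)*(1/q ^ M + q * R M q))"
  proof (intro sum.cong refl)
   fix M assume M: "M : {..<N}"
   have "(\<Sum>i\<le>N. C M i*f i z) = (\<Sum>i\<le>M. C M i*f i z)"
    by (rule sum.mono_neutral_right) (use M CR(2) in auto)
   then show "u (N - M)*(\<Sum>i\<le>N. C M i*f i z) = u (N - M)*(1/q ^ M + q * R M q)"
    using CR(4)[of M z] M z by (simp add: q_def)
  qed
  also have "f N z = U q/q^N" using U(3)[OF z] by (simp add: q_def)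
  also have "U q = (\<Sum>i\<le>N. u i*q ^ i) + q^Suc N * R0 q" using R0(2)[OF q(2)] by (simp only: lessThan_Suc_atMost)
  also have "(\<Sum>i\<le>N. u i*q ^ i) = (\<Sum>M\<le>N. u (N - M)*q^(N - M))"
   by (rule sum.reindex_bij_witness[of _ "%i. N - i" "%i. N - i"]) auto
  also have "... = 1+(\<Sum>M<N. u (N - M)*q^(N - M))"
   using R0(3) q by (simp only: lessThan_Suc_atMost[symmetric] sum.lessThan_Suc) simp
  also have "(1+(\<Sum>M<N. u (N - M)*q^(N - M)) + q^Suc N * R0 q)/q^N
    = 1/q^N+(\<Sum>M<N. u (N - M)*(1/q ^ M)) + q * R0 q"
  proof -
   have "(\<Sum>M<N. u (N - M)*q^(N - M))/q^N = (\<Sum>M<N. u (N - M)*(1/q ^ M))"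
    unfolding sum_divide_distrib using q by (intro sum.cong refl) (simp add: power_diff)
   then show ?thesis using q by (simp add: add_divide_distrib)
  qed
  finally show ?thesis
   by (simp add: R'_def q_def[symmetric] algebra_simps sum.distrib sum_distrib_left)
 qed
 ultimately show ?case by blast
qed

section \<open>Forms of integral weight without multiplier; vanishing in weights 4 and 2\<close>

definition mweight :: "nat => (complex => complex) => bool" where
 "mweight k f \<longleftrightarrow> (\<forall>a b c d z. a * d - b * c = 1 \<longrightarrow> z : uhp \<longrightarrow>
  f (moeb a b c d z) = jf c d z^k*f z)"

lemma modular_weightD:
 "mweight k f ==> a * d - b * c = 1 ==> z : uhp ==> f (moeb a b c d z) = jf c d z^k*f z"
 unfolding mweight_def by blast

lemma mweight_T: "mweight k f ==> z : uhp ==> f (z+1) = f z"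
 using modular_weightD[of k f 1 1 1 0 z] by (simp add: moebius_int_def jf_def)

lemma mweight_S: "mweight k f ==> z : uhp ==> f (- 1/z) = z^k*f z"
 using modular_weightD[of k f 0 0 "-1" 1 z] by (simp add: moebius_int_def jf_def)

lemma mweight_E4: "mweight 4 E4"
 unfolding mweight_def using E4_transform by blast

lemma eta_power_24: "eta z^24 = qpow 1 z*ephi (qpow 1 z)^24"
proof -
 have "qpow (1/24) z^24 = exp (of_nat 24*(2 * of_real pi*\<i> * of_real (1/24)*z))"
  by (simp only: qpow_def exp_of_nat_mult)
 also have "of_nat 24*(2 * of_real pi*\<i> * of_real (1/24)*z) = 2 * of_real pi*\<i> * of_real 1*z" by simp
 finally show ?thesis by (simp only: eta_ephi power_mult_distrib qpow_def)
qed

text \<open>The cube has weight 12, like eta^24. Invariance is tested on the two generators, where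
  the factors \<open>cis (pi/12)\<close> and \<open>- \<i>\<close> of \<open>eta\<close> disappear
  in the powers 24 and 12.\<close>

lemma weight4_cube_invariant:
 assumes "mweight 4 f"
 shows "mweight 0 (%z. f z^3/eta z^24)"
 unfolding mweight_def
proof (intro allI impI)
 fix a b c d :: int and z assume *: "a * d - b * c = 1" "z : uhp"
 have "f (moeb a b c d z)^3/eta (moeb a b c d z)^24 = f z^3/eta z^24"
 proof (rule invariant_from_generators[OF _ _ *])
  fix z assume z: "z : uhp"
  have "cis (pi/12)^24 = cis (real 24*(pi/12))" by (rule Complex.DeMoivre)
  also have "... = 1" by simp
  finally have "cis (pi/12)^24 = 1" .
  then show "f (z+1)^3/eta (z+1)^24 = f z^3/eta z^24"
   using mweight_T[OF assms z] by (simp add: eta_translate power_mult_distrib)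
  have "eta (- 1/z)^24 = ((eta (- 1/z))\<^sup>2)^12" by (simp add: power_mult[symmetric])
  also have "... = (- \<i>)^12*z^12*eta z^24"
   unfolding eta_inversion[OF z] by (simp only: power_mult_distrib) (simp add: power_mult[symmetric])
  also have "(- \<i>)^12 = ((- \<i>)\<^sup>2)^6" by (simp only: power_mult[symmetric]) simp
  also have "... = 1" by simp
  finally have e: "eta (- 1/z)^24 = z^12*eta z^24" by simp
  have "z ~= 0" using z by (auto simp: uhp_iff)
  moreover have "(z^4*f z)^3 = z^12*f z^3" by (simp add: power_mult_distrib power_mult[symmetric])
  ultimately show "f (- 1/z)^3/eta (- 1/z)^24 = f z^3/eta z^24"
   unfolding e mweight_S[OF assms z] by simp
 qed
 then show "f (moeb a b c d z)^3/eta (moeb a b c d z)^24 = jf c d z^0*(f z^3/eta z^24)" by simp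
qed

lemma weight0_tendsto_cusp_zero:
 assumes "f holomorphic_on uhp" "mweight 0 f" "tendsto_cusp f" "z : uhp"
 shows "f z = 0"
 using weight0_vanishing[OF assms(1) _ assms(3,4)] assms(2) by (simp add: mweight_def)

definition E4q :: "complex => complex" where
 "E4q q = 1+240*(\<Sum>n. of_nat (\<Sum>d | d dvd Suc n. d^3)*q^Suc n)"

lemma E4_E4q: "E4 z = E4q (qpow 1 z)"
 by (simp add: E4_def E4q_def)

lemma E4q_0: "E4q 0 = 1"
 by (simp add: E4q_def)

lemma E4q_holomorphic: "E4q holomorphic_on ball 0 1"
proof (rule power_series_holomorphic)
 fix q :: complex assume "q : ball 0 1"
 then have q: "norm q < 1" by simp
 define a where "a n = (if n = 0 then 1 else 240 * of_nat (\<Sum>d | d dvd n. d^3) :: complex)" for n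
 obtain T where "((%N. of_nat (\<Sum>d | d dvd Suc N. d^3)*q^Suc N) has_sum T) UNIV"
  using lambert_rows(3)[OF q, of 3] by auto
 from has_sum_imp_sums[OF this]
 have T: "(%N. of_nat (\<Sum>d | d dvd Suc N. d^3)*q^Suc N) sums T" .
 have "(%n. a (Suc n)*q^Suc n) sums (240 * T)"
  using sums_mult[OF T, of 240] by (simp add: a_def mult.assoc del: power_Suc of_nat_sum)
 then have "(%n. a n*q^n) sums (240 * T + a 0*q^0)" by (subst (asm) sums_Suc_iff) simp
 moreover have "240 * T + a 0*q^0 = E4q q" using sums_unique[OF T] by (simp add: E4q_def a_def)
 ultimately show "(%n. a n*(q - 0)^n) sums E4q q" by simp
qed

lemma qpow_holomorphic: "qpow r holomorphic_on A"
 unfolding qpow_def[abs_def] by (intro holomorphic_intros)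

lemma q_compose_holomorphic:
 assumes "G holomorphic_on ball 0 1" shows "(%z. G (qpow 1 z)) holomorphic_on uhp"
 using holomorphic_on_compose_gen[OF qpow_holomorphic assms] qpow_less_1 by (auto simp: o_def image_subset_iff)

lemma E4_holomorphic: "E4 holomorphic_on uhp"
 unfolding E4_E4q[abs_def] by (rule q_compose_holomorphic[OF E4q_holomorphic])

text \<open>At i the variable q = e^(-2 pi) is a positive real, so the series adds only nonnegative
  terms to 1.\<close>

lemma E4_i_nonzero: "E4 \<i> ~= 0"
proof -
 define r where "r = exp (- 2*pi)"
 have r: "0 < r" "r < 1" by (auto simp: r_def)
 have q: "qpow 1 \<i> = of_real r" by (simp add: qpow_def r_def exp_of_real[symmetric] algebra_simps)
 obtain T where T: "((%N. of_nat (\<Sum>d | d dvd Suc N. d^3) * complex_of_real r^Suc N) has_sum T) UNIV"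
  using lambert_rows(3)[of "complex_of_real r" 3] r by auto
 have "((%N. Re (of_nat (\<Sum>d | d dvd Suc N. d^3) * complex_of_real r^Suc N)) has_sum Re T) UNIV"
  by (rule has_sum_Re[OF T])
 then have "Re T >= 0"
 proof (rule has_sum_nonneg)
  fix N
  have "of_nat (\<Sum>d | d dvd Suc N. d^3) * complex_of_real r^Suc N = of_real (real (\<Sum>d | d dvd Suc N. d^3) * r^Suc N)"
   by simp
  then show "0<=Re (of_nat (\<Sum>d | d dvd Suc N. d^3) * complex_of_real r^Suc N)"
   using r by (simp del: power_Suc of_nat_sum of_real_mult)
 qed
 moreover have "E4 \<i> = 1+240 * T"
  using has_sum_imp_sums[OF T] unfolding E4_def q by (simp add: sums_iff)
 ultimately have "Re (E4 \<i>) >= 1" by simp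
 then show ?thesis by auto
qed

text \<open>The cube of a form without constant term is divisible by q^3 and eta^24 only by q, so
  the weight 0 quotient tends to 0 at the cusp like q^2 and must vanish.\<close>

lemma weight4_cusp_vanishing:
 assumes hol: "f holomorphic_on uhp" and mod: "mweight 4 f"
  and G: "G holomorphic_on ball 0 1" "!!z. z : uhp ==> f z = G (qpow 1 z)" "G 0 = 0" and z: "z : uhp"
 shows "f z = 0"
proof -
 have "(%z. f z^3/eta z^24) holomorphic_on uhp"
  by (intro holomorphic_intros hol eta_holomorphic) (simp add: eta_nonzero)
 moreover obtain u R where uR: "R holomorphic_on ball 0 1 & (\<forall>q\<in>ball 0 1. G q = (\<Sum>i<1. u i*q ^ i) + q^1 * R q)
   & (1 > (0::nat) \<longrightarrow> u 0 = G 0)"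
  using taylor_remainder[OF G(1), of 1] by (elim exE)
 have R: "R holomorphic_on ball 0 1" "u 0 = 0" using uR G(3) by auto
 have GR: "G q = q * R q" if "q : ball 0 1" for q using uR[THEN conjunct2, THEN conjunct1, rule_format, OF that] R(2) by simp
 have "tendsto_cusp (%z. f z^3/eta z^24)"
 proof (rule tendsto_cusp_q_multiple[of "%q. R q^3/ephi q^24" _ 2])
  show "(%q. R q^3/ephi q^24) holomorphic_on ball 0 1"
   by (intro holomorphic_intros R ephi_holomorphic) (auto simp: ephi_nonzero)
  fix z assume z: "z : uhp"
  note e = eta_power_24[of z]
  have gen: "(q * R)^3/(q*E) = q*q*(R^3/E)" if "q ~= 0" for q R E :: complex
   using that by (simp add: power_mult_distrib power3_eq_cube)
  have "qpow 2 z = qpow 1 z*qpow 1 z" by (simp add: qpow_def exp_add[symmetric] mult_ac)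
  moreover have "f z = qpow 1 z * R (qpow 1 z)"
   using G(2)[OF z] GR[of "qpow 1 z"] qpow_less_1[OF z] by simp
  ultimately show "f z^3/eta z^24 = qpow 2 z*(R (qpow 1 z)^3/ephi (qpow 1 z)^24)"
   unfolding e using gen[OF qpow_nonzero] by simp
 qed simp
 ultimately have "f z^3/eta z^24 = 0"
  using weight0_tendsto_cusp_zero[OF _ weight4_cube_invariant[OF mod]] z by blast
 then show ?thesis using eta_nonzero[OF z] by simp
qed

text \<open>
 Subtracting a multiple of \<open>E4\<close> from the square leaves a cusp form of weight 4, so
 \<open>f\<^sup>2 = c\<^sup>2 E4\<close>; at \<open>z = \<i>\<close> the transformation law forces \<open>f \<i> = 0\<close> whereas \<open>E4 \<i> > 0\<close>.
\<close>

lemma weight2_vanishing: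
 assumes hol: "f holomorphic_on uhp" and mod: "mweight 2 f"
  and cusp: "tendsto_cusp (%z. qpow 1 z*f z)" and z: "z : uhp"
 shows "f z = 0"
proof -
 obtain G where G: "G holomorphic_on ball 0 1" "!!z. z : uhp ==> f z = G (qpow 1 z)"
  using qexpansion_exists[OF hol mweight_T[OF mod] cusp] by blast
 define c where "c = G 0"
 define F where "F z = f z^2 - c^2*E4 z" for z
 have F0: "F z = 0" if "z : uhp" for z
 proof (rule weight4_cusp_vanishing[where f = F and G = "%q. G q^2 - c^2*E4q q"])
  show "F holomorphic_on uhp" unfolding F_def[abs_def] by (intro holomorphic_intros hol E4_holomorphic)
  show "mweight 4 F"
   using modular_weightD[OF mod] modular_weightD[OF mweight_E4]
   by (auto simp: mweight_def F_def power_mult_distrib algebra_simps power_mult[symmetric])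
  show "(%q. G q^2 - c^2*E4q q) holomorphic_on ball 0 1" by (intro holomorphic_intros G E4q_holomorphic)
 qed (use that G(2) in \<open>simp_all add: F_def E4_E4q c_def E4q_0\<close>)
 have iu: "\<i> : uhp" by (simp add: uhp_iff)
 have "- 1/\<i> = \<i>" by (simp add: field_simps)
 then have "f \<i> = 0" using mweight_S[OF mod iu] by simp
 then have "c = 0" using F0[OF iu] E4_i_nonzero by (simp add: F_def)
 then show ?thesis using F0[OF z] by (simp add: F_def)
qed

section \<open>Removing the multiplier by means of eta\<close>

lemma jf_powr_52:
 assumes "x ~= (0::complex)" shows "x powr of_real (5/2) = x powr (1/2)*x^2"
proof -
 have "x powr (1/2 + of_nat 2) = x powr (1/2)*x powr of_nat 2" by (rule powr_add)
 also have "x powr of_nat 2 = x^2" using assms by (simp add: powr_nat')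
 finally show ?thesis by simp
qed

text \<open>On principal branches (cz + d)^(5/2) = (cz + d)^(1/2) (cz + d)^2, so the law of
  \<open>eta\<close> absorbs the multiplier together with the square root.\<close>

lemma transforms_like_52:
 "transforms_like (5/2) eta_mult f \<longleftrightarrow> mweight 2 (%z. f z/eta z)"
proof -
 have "f (moeb a b c d z) = eta_mult a b c d*(of_int c*z + of_int d) powr of_real (5/2)*f z
  \<longleftrightarrow> f (moeb a b c d z)/eta (moeb a b c d z) = jf c d z^2*(f z/eta z)"
  if *: "a * d - b * c = 1" "z : uhp" for a b c d z
 proof -
  have nz: "jf c d z ~= 0" "eta z ~= 0" "eta (moeb a b c d z) ~= 0"
   using det_jf_nonzero eta_nonzero moebius_in_uhp * by blast+
  have "jf c d z^2*(f z/eta z)*eta (moeb a b c d z) = eta_mult a b c d*jf c d z powr of_real (5/2)*f z"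
   unfolding eta_mult_transform[OF *] jf_powr_52[OF nz(1)] using nz by simp
  moreover have "f (moeb a b c d z)/eta (moeb a b c d z) = jf c d z^2*(f z/eta z)
   \<longleftrightarrow> f (moeb a b c d z) = jf c d z^2*(f z/eta z)*eta (moeb a b c d z)"
   using nz by (simp add: divide_eq_eq)
  ultimately show ?thesis by (simp only: jf_def)
 qed
 then show ?thesis unfolding transforms_like_def mweight_def by blast
qed

text \<open>The multiplier has modulus 1, so its conjugate is its inverse and is cancelled by
  multiplication with \<open>eta\<close>.\<close>

lemma transforms_like_m12:
 "transforms_like (- 1/2) eta_mult_cnj f \<longleftrightarrow> mweight 0 (%z. f z*eta z)"
proof -
 have "f (moeb a b c d z) = eta_mult_cnj a b c d*(of_int c*z + of_int d) powr of_real (- 1/2)*f z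
  \<longleftrightarrow> f (moeb a b c d z)*eta (moeb a b c d z) = jf c d z^0*(f z*eta z)"
  if *: "a * d - b * c = 1" "z : uhp" for a b c d z
 proof -
  have nz: "jf c d z ~= 0" "eta z ~= 0" "eta (moeb a b c d z) ~= 0"
   using det_jf_nonzero eta_nonzero moebius_in_uhp * by blast+
  have "eta_mult a b c d * cnj (eta_mult a b c d) = 1"
   using norm_eta_mult[OF *] by (simp add: complex_norm_square[symmetric])
  then have e: "eta_mult a b c d ~= 0" "cnj (eta_mult a b c d) = 1/eta_mult a b c d"
   by (auto simp: eq_divide_eq mult.commute)
  have p: "jf c d z powr of_real (- 1/2) = 1/jf c d z powr (1/2)"
   using powr_minus[of "jf c d z" "1/2"] by (simp add: inverse_eq_divide)
  have "eta_mult_cnj a b c d*jf c d z powr of_real (- 1/2)*f z*eta (moeb a b c d z) = f z*eta z"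
   unfolding eta_mult_transform[OF *] p eta_mult_cnj_def e(2) using nz e(1) by (simp add: field_simps)
  moreover have "f (moeb a b c d z) = eta_mult_cnj a b c d*jf c d z powr of_real (- 1/2)*f z
   \<longleftrightarrow> f (moeb a b c d z)*eta (moeb a b c d z) = eta_mult_cnj a b c d*jf c d z powr of_real (- 1/2)*f z*eta (moeb a b c d z)"
   using nz by simp
  ultimately show ?thesis by (simp only: jf_def power_0 mult_1)
 qed
 then show ?thesis unfolding transforms_like_def mweight_def by blast
qed

text \<open>q times j as a function of q: holomorphic on the disc, with value 1 at 0.\<close>

definition jq :: "complex => complex" where
 "jq q = E4q q^3/ephi q^24"

lemma jq_0: "jq 0 = 1"
 by (simp add: jq_def E4q_0)

lemma jq_holomorphic: "jq holomorphic_on ball 0 1"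
 unfolding jq_def[abs_def] by (intro holomorphic_intros E4q_holomorphic ephi_holomorphic) (auto simp: ephi_nonzero)

lemma j_fun_jq: "j_fun z = jq (qpow 1 z)/qpow 1 z"
 by (simp add: j_fun_def jq_def E4_E4q eta_power_24)

lemma mweight_j: "mweight 0 j_fun"
 unfolding j_fun_def[abs_def] by (rule weight4_cube_invariant[OF mweight_E4])

lemma j_fun_holomorphic: "j_fun holomorphic_on uhp"
 unfolding j_fun_def[abs_def] by (intro holomorphic_intros E4_holomorphic eta_holomorphic) (simp add: eta_nonzero)

lemma mweight_deriv_j: "mweight 2 (deriv j_fun)"
 unfolding mweight_def
proof (intro allI impI)
 fix a b c d :: int and z assume *: "a * d - b * c = 1" "z : uhp"
 note w = moebius_in_uhp[OF *]
 have d: "(j_fun has_field_derivative deriv j_fun x) (at x)" if "x : uhp" for x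
  by (rule holomorphic_derivI[OF j_fun_holomorphic open_uhp that])
 have "((%z. j_fun (moeb a b c d z)) has_field_derivative deriv j_fun (moeb a b c d z)*(1/(jf c d z)\<^sup>2)) (at z)"
  by (rule DERIV_chain2[OF d[OF w] moebius_has_field_derivative[OF *]])
 moreover have "((%z. j_fun (moeb a b c d z)) has_field_derivative deriv j_fun z) (at z)"
  by (rule has_field_derivative_transform_within_open[OF d[OF *(2)] open_uhp *(2)])
   (use modular_weightD[OF mweight_j *(1)] in auto)
 ultimately have "deriv j_fun (moeb a b c d z)*(1/(jf c d z)\<^sup>2) = deriv j_fun z" by (rule DERIV_unique)
 then show "deriv j_fun (moeb a b c d z) = jf c d z^2 * deriv j_fun z"
  using det_jf_nonzero[OF *(2,1)] by (simp add: field_simps)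
qed

text \<open>This is -q^2 dj/dq. The factor removes the double pole and normalises the value at 0 to
  1, as \<open>laurent_elimination\<close> requires.\<close>

definition djq :: "complex => complex" where
 "djq q = jq q - q * deriv jq q"

lemma djq_holomorphic: "djq holomorphic_on ball 0 1"
 unfolding djq_def[abs_def] by (intro holomorphic_intros jq_holomorphic) auto

lemma deriv_j_fun:
 assumes "z : uhp" shows "deriv j_fun z = - 2 * of_real pi*\<i> * djq (qpow 1 z)/qpow 1 z"
proof (rule DERIV_imp_deriv)
 have d: "(jq has_field_derivative deriv jq (qpow 1 z)) (at (qpow 1 z))"
  by (rule holomorphic_derivI[OF jq_holomorphic]) (use qpow_less_1[OF assms] in auto)
 note q = qpow_deriv[of 1 z]
 have "((%z. jq (qpow 1 z)/qpow 1 z) has_field_derivative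
  (deriv jq (qpow 1 z)*(2 * of_real pi*\<i> * of_real 1*qpow 1 z)*qpow 1 z - jq (qpow 1 z)*(2 * of_real pi*\<i> * of_real 1*qpow 1 z))/(qpow 1 z*qpow 1 z)) (at z)"
  by (rule DERIV_divide[OF DERIV_chain2[OF d q] q]) simp
 also have "(deriv jq (qpow 1 z)*(2 * of_real pi*\<i> * of_real 1*qpow 1 z)*qpow 1 z - jq (qpow 1 z)*(2 * of_real pi*\<i> * of_real 1*qpow 1 z))/(qpow 1 z*qpow 1 z)
  = - 2 * of_real pi*\<i> * djq (qpow 1 z)/qpow 1 z" by (simp add: djq_def field_simps)
 finally show "(j_fun has_field_derivative - 2 * of_real pi*\<i> * djq (qpow 1 z)/qpow 1 z) (at z)"
  by (simp add: j_fun_jq[abs_def])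
qed

lemma holomorphic_imp_meromorphic_at_0:
 assumes "R holomorphic_on ball 0 1" shows "(R :: complex => complex) meromorphic_on {0}"
 using assms analytic_on_holomorphic by (intro analytic_on_imp_meromorphic_on) (metis analytic_on_open analytic_on_subset centre_in_ball empty_subsetI insert_subset open_ball zero_less_one)

lemma qpow_add: "qpow (a + b) z = qpow a z*qpow b z"
 by (simp add: qpow_def exp_add[symmetric] algebra_simps)

lemma qpow_nat: "qpow (of_nat n) z = qpow 1 z^n"
 by (simp add: qpow_def exp_of_nat_mult[symmetric] mult_ac)

lemma qpow_minus: "qpow (- a) z = 1/qpow a z"
 by (simp add: qpow_def exp_minus inverse_eq_divide)

lemma qpow_minus_nat: "qpow (- of_nat n) z = 1/qpow 1 z^n"
 by (simp only: qpow_minus qpow_nat)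

text \<open>Eliminate among the functions j^i/\<open>ephi\<close> and multiply by q^(-1/24). Removal
  of the constant term makes the remainder begin at q^(1 - 1/24).\<close>

lemma shadow_form_exists:
 obtains P R where "lead_coeff P = 1" "R holomorphic_on ball 0 1"
  "!!z. z : uhp ==> poly P (j_fun z)/eta z = qpow (- (of_nat N) - 1/24) z + qpow (23/24) z * R (qpow 1 z)"
proof -
 have "\<exists>U. U holomorphic_on ball 0 1 & U 0 = 1 & (\<forall>z\<in>uhp. j_fun z ^ i/ephi (qpow 1 z) = U (qpow 1 z)/qpow 1 z ^ i)" for i
  by (rule exI[of _ "%q. jq q ^ i/ephi q"])
   (auto intro!: holomorphic_intros jq_holomorphic ephi_holomorphic simp: ephi_nonzero jq_0 j_fun_jq power_divide)
 from laurent_elimination[of "%i z. j_fun z ^ i/ephi (qpow 1 z)", OF this, of N]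
 obtain c R where c: "c N = 1" "\<forall>i>N. c i = 0" "R holomorphic_on ball 0 1"
  "!!z. z : uhp ==> (\<Sum>i\<le>N. c i*(j_fun z ^ i/ephi (qpow 1 z))) = 1/qpow 1 z^N + qpow 1 z * R (qpow 1 z)" by blast
 define P where "P = (\<Sum>i\<le>N. monom (c i) i)"
 have cf: "coeff P n = c n" for n
  using c(2) by (cases "n<=N") (auto simp: P_def coeff_sum coeff_monom sum.delta)
 have "degree P = N"
  by (rule antisym[OF degree_le le_degree]) (use c in \<open>auto simp: cf\<close>)
 then have "lead_coeff P = 1" by (simp add: cf c)
 moreover have "poly P (j_fun z)/eta z = qpow (- (of_nat N) - 1/24) z + qpow (23/24) z * R (qpow 1 z)" if z: "z : uhp" for z
 proof -
  have "poly P (j_fun z)/eta z = (\<Sum>i\<le>N. c i*(j_fun z ^ i/ephi (qpow 1 z)))/qpow (1/24) z"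
   by (simp add: P_def poly_sum poly_monom eta_ephi sum_divide_distrib mult_ac)
  also have "... = (qpow (- of_nat N) z + qpow 1 z * R (qpow 1 z))*qpow (- (1/24)) z"
   unfolding c(4)[OF z] by (simp only: qpow_minus_nat qpow_minus[of "1/24"]) simp
  also have "... = qpow (- of_nat N + - (1/24)) z + qpow (1 + - (1/24)) z * R (qpow 1 z)"
   by (simp only: qpow_add) (simp add: algebra_simps)
  finally show ?thesis by simp
 qed
 ultimately show ?thesis using that c(3) by blast
qed

section \<open>The incomplete Gamma function\<close>

text \<open>The integrand e^(-t) t^(-5/2) with its branch cut turned to the ray from 0 through -i.
  The negative axis, where the argument is pi, then lies inside the domain of holomorphy.\<close>

definition ig_kernel :: "complex => complex" where
 "ig_kernel t = exp (- t)*((- \<i> * t) powr of_real (- 5/2)*\<i> powr of_real (- 5/2))"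

lemma powr_rotate:
 assumes "t ~= 0" "- pi/2 < Arg t" "Arg t<=pi"
 shows "(- \<i> * t) powr s*\<i> powr s = t powr s"
proof -
 have "Ln (- \<i> * t) = Ln t - \<i> * of_real pi/2"
  using assms Ln_times[of "- \<i>" t] by (simp add: Arg_eq_Im_Ln[symmetric] Ln_minus_ii)
 then have "s*(Ln (- \<i> * t) + Ln \<i>) = s*Ln t" by simp
 then have "s*Ln (- \<i> * t) + s*Ln \<i> = s*Ln t" by (simp only: distrib_left)
 then show ?thesis using assms by (simp add: powr_def exp_add[symmetric])
qed

lemma ig_kernel_eq:
 assumes "t ~= 0" "- pi/2 < Arg t" "Arg t<=pi"
 shows "ig_kernel t = exp (- t) * t powr of_real (- 5/2)"
 unfolding ig_kernel_def using powr_rotate[OF assms] by (simp only:)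

lemma ig_kernel_pos:
 assumes "x > 0" shows "ig_kernel (of_real x) = of_real (exp (- x)*x powr (- 5/2))"
proof -
 have "complex_of_real x powr complex_of_real (- 5/2) = complex_of_real (x powr (- 5/2))"
  using assms by (intro powr_of_real) simp
 then show ?thesis using assms
  by (subst ig_kernel_eq) (simp_all add: exp_of_real[symmetric])
qed

text \<open>On the negative axis the argument is pi, and exp(-5 pi i/2) = -i. This unit is what the
  factor i in front of beta compensates.\<close>

lemma ig_kernel_neg:
 assumes "x < 0" shows "ig_kernel (of_real x) = - \<i> * of_real (exp (- x)*\<bar>x\<bar> powr (- 5/2))"
proof -
 have h: "- pi/2 < pi" using pi_gt_zero by linarith
 have "Arg (complex_of_real x) = pi" using assms by (simp add: Arg_of_real)
 then have "ig_kernel (of_real x) = exp (- of_real x) * complex_of_real x powr of_real (- 5/2)"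
  using assms h by (intro ig_kernel_eq) auto
 also have "complex_of_real x powr of_real (- 5/2) = exp (of_real (- 5/2)*(of_real (ln \<bar>x\<bar>)+\<i> * of_real pi))"
  using assms by (simp add: powr_def Ln_of_real' mult.commute)
 also have "... = exp (of_real (- 5/2 * ln \<bar>x\<bar>))*exp (\<i> * of_real (- pi/2) + of_real (-2*1*pi)*\<i>)"
  by (simp add: exp_add[symmetric] algebra_simps)
 also have "exp (\<i> * of_real (- pi/2) + of_real (-2*1*pi)*\<i>) = exp (\<i> * of_real (- pi/2))"
  unfolding exp_eq by (intro exI[of _ "-1"]) (simp add: algebra_simps)
 also have "exp (\<i> * of_real (- pi/2)) = cis (- pi/2)" by (rule cis_conv_exp[symmetric])
 also have "... = - \<i>" by (simp add: complex_eq_iff)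
 also have "exp (of_real (- 5/2 * ln \<bar>x\<bar>)) = complex_of_real (\<bar>x\<bar> powr (- 5/2))"
  using assms by (simp only: exp_of_real) (simp add: powr_def)
 finally show ?thesis using assms by (simp add: exp_of_real[symmetric])
qed

definition ig_domain :: "complex set" where
 "ig_domain = {t. - \<i> * t \<notin> \<real>\<^sub>\<le>\<^sub>0}"

lemma ig_domain_iff: "t : ig_domain \<longleftrightarrow> Re t ~= 0 \<or> Im t > 0"
 by (auto simp: ig_domain_def complex_nonpos_Reals_iff)

lemma open_inc_gamma_domain: "open ig_domain"
proof -
 have "ig_domain = - ((%t. - \<i> * t) -` \<real>\<^sub>\<le>\<^sub>0)" by (auto simp: ig_domain_def)
 moreover have "closed ((%t::complex. - \<i> * t) -` \<real>\<^sub>\<le>\<^sub>0)"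
  by (intro closed_vimage closed_nonpos_Reals_complex continuous_intros)
 ultimately show ?thesis by (metis open_Compl)
qed

lemma starlike_inc_gamma_domain: "starlike ig_domain"
 unfolding starlike_def
proof (rule bexI[of _ \<i>], rule ballI, rule subsetI)
 fix x y assume x: "x : ig_domain" and "y : closed_segment \<i> x"
 then obtain u where u: "0<=u" "u<=1" "y = (1 - u) *\<^sub>R \<i> + u *\<^sub>R x" unfolding closed_segment_def by blast
 have re: "Re y = u * Re x" "Im y = (1 - u) + u*Im x" using u by auto
 show "y : ig_domain"
 proof (cases "u = 0 \<or> Re x = 0")
  case False
  then show ?thesis by (simp add: ig_domain_iff re)
 next
  case True
  then have "Im y > 0"
  proof
   assume r: "Re x = 0"
   then have "Im x > 0" using x by (simp add: ig_domain_iff)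
   then show "Im y > 0" using u unfolding re
    by (cases "u = 1") (auto intro: add_pos_nonneg)
  qed (simp add: re)
  then show ?thesis by (simp add: ig_domain_iff)
 qed
qed (simp add: ig_domain_iff)

lemma ig_kernel_holomorphic: "ig_kernel holomorphic_on ig_domain"
 unfolding ig_kernel_def[abs_def] ig_domain_def by (intro holomorphic_intros) auto

lemma inc_gamma_integrable:
 assumes "c > 0" shows "(%t. exp (- t) * t powr (- 5/2 :: real)) integrable_on {c..}"
proof -
 have "(%t. exp (- t) * t powr (- 5/2)) absolutely_integrable_on {c..}"
 proof (rule measurable_bounded_by_integrable_imp_absolutely_integrable)
  show "(%t. exp (- t) * t powr (- 5/2)) : borel_measurable (lebesgue_on {c..})"
   using assms by (intro continuous_imp_measurable_on_sets_lebesgue continuous_intros) auto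
  show "(%t. c powr (- 5/2)*exp (-1 * t)) integrable_on {c..}"
   by (intro integrable_on_mult_right integrable_on_exp_minus_to_infinity) simp
  fix t assume "t : {c..}"
  then have "t powr (- 5/2)<=c powr (- 5/2)" using assms by (intro powr_mono2') auto
  then show "norm (exp (- t) * t powr (- 5/2))<=c powr (- 5/2)*exp (-1 * t)"
   by (simp add: mult.commute)
 qed simp
 then show ?thesis by (rule set_lebesgue_integral_eq_integral(1))
qed

definition ig_real :: "real => real" where
 "ig_real x = integral {x..} (%t. exp (- t) * t powr (- 5/2))"

lemma ig_real_bounds:
 assumes "x > 0"
 shows "0<=ig_real x" "ig_real x<=x powr (- 5/2)*exp (- x)"
proof -
 show "0<=ig_real x" unfolding ig_real_def
  by (intro Henstock_Kurzweil_Integration.integral_nonneg inc_gamma_integrable assms) auto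
 have i: "((%t. x powr (- 5/2)*exp (-1 * t)) has_integral (x powr (- 5/2)*(exp (-1*x)/1))) {x..}"
  by (intro has_integral_mult_right has_integral_exp_minus_to_infinity) simp
 have "ig_real x<=integral {x..} (%t. x powr (- 5/2)*exp (-1 * t))"
  unfolding ig_real_def
 proof (rule integral_le[OF inc_gamma_integrable[OF assms]])
  show "(%t. x powr (- 5/2)*exp (-1 * t)) integrable_on {x..}" using i by blast
  fix t assume "t : {x..}"
  then have "t powr (- 5/2)<=x powr (- 5/2)" using assms by (intro powr_mono2') auto
  then show "exp (- t) * t powr (- 5/2)<=x powr (- 5/2)*exp (-1 * t)" by (simp add: mult.commute)
 qed
 also have "... = x powr (- 5/2)*exp (- x)" using integral_unique[OF i] by simp
 finally show "ig_real x<=x powr (- 5/2)*exp (- x)" .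
qed

lemma ig_real_deriv:
 assumes "x > 0"
 shows "(ig_real has_real_derivative - (exp (- x)*x powr (- 5/2))) (at x)"
proof -
 define g where "g t = exp (- t) * t powr (- 5/2)" for t :: real
 have g: "g integrable_on {c..}" if "c > 0" for c unfolding g_def by (rule inc_gamma_integrable[OF that])
 have ig: "ig_real u = integral {u..} g" for u unfolding ig_real_def g_def ..
 have split: "ig_real u = integral {u..x+1} g + ig_real (x+1)" if "u : {x/2..x+1}" for u
 proof -
  have u: "u > 0" "u<=x+1" using that assms by auto
  have "(g has_integral (integral {u..x+1} g + integral {x+1..} g)) ({u..x+1} \<union> {x+1..})"
  proof (rule has_integral_Un)
   show "(g has_integral integral {u..x+1} g) {u..x+1}"
    by (rule integrable_integral, rule integrable_on_subinterval[OF g[OF u(1)]]) auto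
   show "(g has_integral integral {x+1..} g) {x+1..}"
    by (rule integrable_integral, rule g) (use assms in simp)
   have "{u..x+1} \<inter> {x+1..} = {x+1}" using u by auto
   then show "negligible ({u..x+1} \<inter> {x+1..})" by simp
  qed
  moreover have "{u..x+1} \<union> {x+1..} = {u..}" using u by auto
  ultimately have "(g has_integral (integral {u..x+1} g + integral {x+1..} g)) {u..}" by (simp only:)
  then show ?thesis unfolding ig by (rule integral_unique)
 qed
 have c: "continuous_on {x/2..x+1} g" unfolding g_def using assms by (intro continuous_intros) auto
 have "((%u. integral {u..x+1} g + ig_real (x+1)) has_real_derivative (- g x+0)) (at x within {x/2..x+1})"
  by (intro DERIV_add DERIV_const integral_has_real_derivative'[OF c]) (use assms in auto)
 moreover have "at x within {x/2..x+1} = at x" using assms by (intro at_within_Icc_at) auto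
 ultimately have "((%u. integral {u..x+1} g + ig_real (x+1)) has_real_derivative (- g x)) (at x)"
  by (simp only: add_0_right)
 then have "(ig_real has_real_derivative (- g x)) (at x)"
 proof (rule has_field_derivative_transform_within_open[of _ _ _ "{x/2<..<x+1}"])
  fix u assume "u : {x/2<..<x+1}"
  then show "integral {u..x+1} g + ig_real (x+1) = ig_real u" by (intro split[symmetric]) auto
 qed (use assms in auto)
 then show ?thesis by (simp add: g_def)
qed

lemma inc_Gamma_pos: "x > 0 ==> inc_Gamma (- 3/2) x = of_real (ig_real x)"
 by (simp add: inc_Gamma_def ig_real_def)

text \<open>
 One function that is holomorphic off the ray \<open>- \<i> [0, \<infinity>)\<close> and agrees with the incomplete
 Gamma function on both half-lines.
\<close>

lemma inc_Gamma_holomorphic_extension: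
 obtains g where "!!t. t : ig_domain ==> (g has_field_derivative - ig_kernel t) (at t)"
  "!!x. x ~= 0 ==> inc_Gamma (- 3/2) x = g (of_real x)"
proof -
 obtain Q where Q: "!!t. t : ig_domain ==> (Q has_field_derivative ig_kernel t) (at t)"
  using holomorphic_starlike_primitive[OF holomorphic_on_imp_continuous_on[OF ig_kernel_holomorphic]
    starlike_inc_gamma_domain open_inc_gamma_domain finite.emptyI]
   ig_kernel_holomorphic open_inc_gamma_domain by (metis Diff_empty at_within_open holomorphic_on_open field_differentiable_def)
 \<comment> \<open>A primitive of the kernel and the real integral have opposite derivatives, so
   their sum is constant on the positive axis. This fixes the constant of integration, and the
   semicircle carries the identity to the negative axis.\<close>
 define F where "F x = Q (of_real x) + of_real (ig_real x)" for x
 have d: "(F has_vector_derivative 0) (at x within {0<..})" if x: "x : {0<..}" for x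
 proof -
  have "((%x. Q (of_real x)) has_vector_derivative ig_kernel (of_real x)) (at x)"
   using has_vector_derivative_real_field[OF Q[of "of_real x"]] x by (simp add: ig_domain_iff o_def)
  moreover have "((%x. complex_of_real (ig_real x)) has_vector_derivative of_real (- (exp (- x)*x powr (- 5/2)))) (at x)"
   using ig_real_deriv[of x] x by (intro has_vector_derivative_of_real) (simp add: has_real_derivative_iff_has_vector_derivative)
  ultimately have "((%x. Q (of_real x) + of_real (ig_real x)) has_vector_derivative
    (ig_kernel (of_real x) + of_real (- (exp (- x)*x powr (- 5/2))))) (at x)"
   by (rule has_vector_derivative_add)
  then show ?thesis unfolding F_def
   using x by (auto simp: ig_kernel_pos intro: has_vector_derivative_at_within)
 qed
 have "convex {0::real<..}" by simp
 then obtain k where k': "!!x. x : {0<..} ==> F x = k"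
  using has_vector_derivative_zero_constant[OF _ d] by blast
 then have k: "Q (of_real x) + of_real (ig_real x) = k" if "x > 0" for x
  using k'[of x] that by (simp add: F_def)
 show ?thesis
 proof (rule that[of "%t. k - Q t"])
  show "((%t. k - Q t) has_field_derivative - ig_kernel t) (at t)" if "t : ig_domain" for t
   using DERIV_diff[OF DERIV_const Q[OF that], of k] by simp
  fix x :: real assume x: "x ~= 0"
  show "inc_Gamma (- 3/2) x = k - Q (of_real x)"
  proof (cases "x > 0")
   case True
   then show ?thesis unfolding inc_Gamma_pos[OF True] using k[OF True] by (simp add: algebra_simps)
  next
   case False
   then have neg: "x < 0" using x by simp
   define r where "r = \<bar>x\<bar>"
   have r: "r > 0" "x = - r" using neg by (auto simp: r_def)
   let ?\<gamma> = "part_circlepath 0 r pi 0"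
   have im: "t : ig_domain" if "t : path_image ?\<gamma>" for t
   proof -
    have "t : (%x. 0 + r * cis x) ` closed_segment pi 0"
     using that by (simp only: path_image_part_circlepath')
    moreover have "closed_segment pi 0 = {0..pi}" using pi_gt_zero by (simp add: closed_segment_eq_real_ivl not_le)
    ultimately have "t : (%x. 0 + r * cis x) ` {0..pi}" by simp
    then obtain u where u0: "t = 0 + r * cis u" "u : {0..pi}" by (rule imageE)
    then have u: "t = r * cis u" "u : {0..pi}" by simp_all
    have "sin u >= 0" using u by (intro sin_ge_zero) auto
    moreover have "cos u ~= 0" if "sin u = 0" using sin_cos_squared_add[of u] that by auto
    ultimately have "r * cos u ~= 0 \<or> r * sin u > 0" using r by (auto simp: less_le)
    then show ?thesis by (simp add: ig_domain_iff u(1))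
   qed
   have "(ig_kernel has_contour_integral (Q (pathfinish ?\<gamma>) - Q (pathstart ?\<gamma>))) ?\<gamma>"
    by (rule contour_integral_primitive[of ig_domain])
     (use Q im in \<open>auto intro: has_field_derivative_at_within\<close>)
   moreover have "pathfinish ?\<gamma> = of_real r" "pathstart ?\<gamma> = of_real x"
    by (simp_all add: r(2) cis_conv_exp[symmetric])
   ultimately have ci: "(ig_kernel has_contour_integral (Q (of_real r) - Q (of_real x))) ?\<gamma>" by (simp only:)
   have eq: "exp (- t) * t powr of_real (- 3/2 - 1) = ig_kernel t" if "t : path_image ?\<gamma>" for t
   proof -
    have "t : (%x. 0 + r * cis x) ` closed_segment pi 0"
     using that by (simp only: path_image_part_circlepath')
    moreover have "closed_segment pi 0 = {0..pi}" using pi_gt_zero by (simp add: closed_segment_eq_real_ivl not_le)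
    ultimately have "t : (%x. 0 + r * cis x) ` {0..pi}" by simp
    then obtain u where u0: "t = 0 + r * cis u" "u : {0..pi}" by (rule imageE)
    then have u: "t = r * cis u" "u : {0..pi}" by simp_all
    have "- pi < u" using u(2) pi_gt_zero unfolding atLeastAtMost_iff by linarith
    then have "Arg t = u" using u r by (intro cis_Arg_unique[symmetric] Arg_unique) (auto simp: cis_conv_exp)
    moreover have "- pi/2 < u" using u(2) pi_gt_zero unfolding atLeastAtMost_iff by linarith
    ultimately have "ig_kernel t = exp (- t) * t powr of_real (- 5/2)"
     using u r by (intro ig_kernel_eq) auto
    then show ?thesis by simp
   qed
   have "((%t. exp (- t) * t powr of_real (- 3/2 - 1)) has_contour_integral (Q (of_real r) - Q (of_real x))) ?\<gamma>"
    by (rule has_contour_integral_eq[OF ci]) (simp only: eq)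
   then have "contour_integral ?\<gamma> (%t. exp (- t) * t powr of_real (- 3/2 - 1)) = Q (of_real r) - Q (of_real x)"
    by (rule contour_integral_unique)
   then have "inc_Gamma (- 3/2) x = Q (of_real r) - Q (of_real x) + of_real (ig_real r)"
    unfolding inc_Gamma_def ig_real_def using neg by (simp add: r_def)
   then show ?thesis using k[OF r(1)] by (simp add: algebra_simps)
  qed
 qed
qed

section \<open>Wirtinger derivatives of series\<close>

text \<open>Real differentiability with p and q the derivatives in z and in the conjugate of z. As a
  statement about the total derivative it has product and chain rules, which partial derivatives
  alone lack.\<close>

definition has_wirt :: "(complex => complex) => complex => complex => complex => bool" where
 "has_wirt f p q z \<longleftrightarrow> (f has_derivative (%h. p*h + q * cnj h)) (at z)"

lemma has_wirt_dx: "has_wirt f p q z ==> dx f z = p + q"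
proof -
 assume "has_wirt f p q z"
 then have d: "(f has_derivative (%h. p*h + q * cnj h)) (at (z + of_real 0))" by (simp add: has_wirt_def)
 have "((%t. z + of_real t) has_derivative (%t. of_real t)) (at 0)"
  by (auto intro!: derivative_eq_intros)
 from has_derivative_compose[OF this, of f "%h. p*h + q * cnj h", OF d]
 have "((%t. f (z + of_real t)) has_vector_derivative (p*1 + q * cnj 1)) (at 0)"
  unfolding has_vector_derivative_def
  by (rule has_derivative_eq_rhs) (auto simp: fun_eq_iff scaleR_conv_of_real algebra_simps)
 then show "dx f z = p + q" unfolding dx_def by (simp add: vector_derivative_at)
qed

lemma has_wirt_dy: "has_wirt f p q z ==> dy f z = \<i>*(p - q)"
proof -
 assume "has_wirt f p q z"
 then have d: "(f has_derivative (%h. p*h + q * cnj h)) (at (z+\<i> * of_real 0))" by (simp add: has_wirt_def)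
 have "((%t. z+\<i> * of_real t) has_derivative (%t. \<i> * of_real t)) (at 0)"
  by (auto intro!: derivative_eq_intros)
 from has_derivative_compose[OF this, of f "%h. p*h + q * cnj h", OF d]
 have "((%t. f (z+\<i> * of_real t)) has_vector_derivative (p*\<i> + q * cnj \<i>)) (at 0)"
  unfolding has_vector_derivative_def
  by (rule has_derivative_eq_rhs) (auto simp: fun_eq_iff scaleR_conv_of_real algebra_simps)
 then show "dy f z = \<i>*(p - q)" unfolding dy_def by (simp add: vector_derivative_at algebra_simps)
qed

lemma has_wirt_dzbar: "has_wirt f p q z ==> dzbar f z = q"
 by (simp add: dzbar_def has_wirt_dx has_wirt_dy algebra_simps)

lemma has_wirt_transform:
 "has_wirt f p q z ==> open S ==> z : S ==> (!!w. w : S ==> f w = g w) ==> has_wirt g p q z"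
 unfolding has_wirt_def by (rule has_derivative_transform_within_open)

lemma has_wirt_holomorphic: "(f has_field_derivative p) (at z) ==> has_wirt f p 0 z"
 by (simp add: has_wirt_def has_field_derivative_def)

lemma has_wirt_zero_imp_field_derivative: "has_wirt f p 0 z ==> (f has_field_derivative p) (at z)"
 by (simp add: has_wirt_def has_field_derivative_def)

lemma has_wirt_add: "has_wirt f p q z ==> has_wirt g p' q' z ==> has_wirt (%z. f z + g z) (p + p') (q + q') z"
 unfolding has_wirt_def by (drule (1) has_derivative_add) (simp add: algebra_simps)

lemma has_wirt_diff: "has_wirt f p q z ==> has_wirt g p' q' z ==> has_wirt (%z. f z - g z) (p - p') (q - q') z"
 unfolding has_wirt_def by (drule (1) has_derivative_diff) (simp add: algebra_simps)

lemma has_wirt_mult: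
 "has_wirt f p q z ==> has_wirt g p' q' z ==> has_wirt (%z. f z*g z) (f z*p' + p*g z) (f z*q' + q*g z) z"
 unfolding has_wirt_def by (drule (1) has_derivative_mult) (simp add: algebra_simps)

lemma has_wirt_cmult: "has_wirt f p q z ==> has_wirt (%z. c*f z) (c*p) (c*q) z"
 unfolding has_wirt_def by (drule has_derivative_mult_right[where x = c]) (simp add: algebra_simps)

lemma has_wirt_Im_compose:
 assumes "(V has_vector_derivative V') (at (Im z))"
 shows "has_wirt (%z. V (Im z)) (V'/(2*\<i>)) (- V'/(2*\<i>)) z"
proof -
 have "((%z. V (Im z)) has_derivative (%h. Im h *\<^sub>R V')) (at z)"
  using assms unfolding has_vector_derivative_def
  by (rule has_derivative_compose[rotated]) (intro has_derivative_Im has_derivative_ident)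
 moreover have "(%h. Im h *\<^sub>R V') = (%h. V'/(2*\<i>)*h + - V'/(2*\<i>) * cnj h)"
 proof
  fix h
  have "V'/(2*\<i>)*h + - V'/(2*\<i>) * cnj h = V'/(2*\<i>)*(h - cnj h)"
   by (simp only: right_diff_distrib) simp
  also have "... = Im h *\<^sub>R V'" unfolding complex_diff_cnj scaleR_conv_of_real by (simp add: field_simps)
  finally show "Im h *\<^sub>R V' = V'/(2*\<i>)*h + - V'/(2*\<i>) * cnj h" by simp
 qed
 ultimately show ?thesis by (simp add: has_wirt_def)
qed

lemma has_wirt_compose:
 assumes "has_wirt f p q (g z)" "(g has_field_derivative g') (at z)"
 shows "has_wirt (%z. f (g z)) (p*g') (q * cnj g') z"
proof -
 have "(g has_derivative (*) g') (at z)" using assms(2) by (simp add: has_field_derivative_def)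
 from has_derivative_compose[OF this assms(1)[unfolded has_wirt_def]]
 show ?thesis by (simp add: has_wirt_def mult.assoc)
qed

lemma has_wirt_unique: "has_wirt f p q z ==> has_wirt f p' q' z ==> p = p' & q = q'"
proof -
 assume 1: "has_wirt f p q z" and 2: "has_wirt f p' q' z"
 have q: "q = q'" using has_wirt_dzbar[OF 1] has_wirt_dzbar[OF 2] by simp
 have "p + q = p' + q'" using has_wirt_dx[OF 1] has_wirt_dx[OF 2] by simp
 with q show ?thesis by simp
qed

text \<open>The majorant \<open>M\<close> makes the differentiated series converge uniformly on the
  convex set. The countable index set is enumerated only to pass to a sequence of partial
  sums.\<close>

theorem has_wirt_series:
 fixes f :: "'i => complex => complex"
 assumes I: "countable I" "infinite I" and S: "open S" "convex S"
  and w: "!!i z. i : I ==> z : S ==> has_wirt (f i) (p i z) (q i z) z"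
  and b: "!!i z. i : I ==> z : S ==> norm (p i z) + norm (q i z)<=M i"
  and M: "M summable_on I"
  and F: "!!z. z : S ==> ((%i. f i z) has_sum F z) I"
  and z: "z : S"
 shows "has_wirt F (\<Sum>\<^sub>\<infinity>i\<in>I. p i z) (\<Sum>\<^sub>\<infinity>i\<in>I. q i z) z"
proof -
 define e where "e = from_nat_into I"
 have e: "bij_betw e UNIV I" unfolding e_def by (rule bij_betw_from_nat_into[OF I])
 have eI: "e n : I" for n using e by (auto simp: bij_betw_def)
 have Me: "(%n. M (e n)) summable_on UNIV" by (rule summable_on_reindex_bij_betw[OF e, THEN iffD2, OF M])
 have Ms: "summable (%n. M (e n))" by (rule summable_on_imp_summable[OF Me])
 have M0: "M (e n) >= 0" for n
  using b[OF eI z, of n] norm_ge_zero[of "p (e n) z"] norm_ge_zero[of "q (e n) z"] by linarith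
 have pb: "norm (p (e n) x)<=M (e n)" "norm (q (e n) x)<=M (e n)" if "x : S" for n x
  using b[OF eI that, of n] norm_ge_zero[of "p (e n) x"] norm_ge_zero[of "q (e n) x"] by linarith+
 define P where "P x = (\<Sum>n. p (e n) x)" for x
 define Q where "Q x = (\<Sum>n. q (e n) x)" for x
 have psum: "summable (%n. norm (p (e n) x))" "summable (%n. norm (q (e n) x))" if "x : S" for x
  by (rule summable_comparison_test'[OF Ms, of 0]; use pb[OF that] in simp)+
 have "\<exists>g. \<forall>x\<in>S. (%n. f (e n) x) sums (g x) & (g has_derivative (%h. P x*h + Q x * cnj h)) (at x within S)"
 proof (rule has_derivative_series[OF S(2), where f = "%n. f (e n)" and f' = "%n x h. p (e n) x*h + q (e n) x * cnj h" and g' = "%x h. P x*h + Q x * cnj h"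
    and x = z and l = "F z"])
  show "(f (e n) has_derivative (%h. p (e n) x*h + q (e n) x * cnj h)) (at x within S)" if "x : S" for n x
   using w[OF eI that] unfolding has_wirt_def by (rule has_derivative_at_withinI)
  show "z : S" by (rule z)
  show "(%n. f (e n) z) sums F z"
   using has_sum_imp_sums[OF has_sum_reindex_bij_betw[OF e, THEN iffD2, OF F[OF z]]] .
  fix r :: real assume r: "r > 0"
  have tail: "(%n. \<Sum>k. M (e (k + n))) \<longlonglongrightarrow> 0" by (rule suminf_exist_split2[OF Ms])
  have "eventually (%n. (\<Sum>k. M (e (k + n))) < r/2) sequentially" by (rule order_tendstoD(2)[OF tail]) (use r in simp)
  then show "\<forall>\<^sub>F n in sequentially. \<forall>x\<in>S. \<forall>h. norm ((\<Sum>i<n. p (e i) x*h + q (e i) x * cnj h) - (P x*h + Q x * cnj h))<=r*norm h"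
  proof eventually_elim
   case (elim n)
   have tb: "norm ((\<Sum>i<n. s (e i) x) - (\<Sum>i. s (e i) x))<=r/2"
    if "x : S" "summable (%n. norm (s (e n) x))" "!!n. norm (s (e n) x)<=M (e n)" for s :: "'i => complex => complex" and x
   proof -
    have "(\<Sum>i. s (e i) x) = (\<Sum>i. s (e (i + n)) x)+(\<Sum>i<n. s (e i) x)"
     by (rule suminf_split_initial_segment[OF summable_norm_cancel[OF that(2)]])
    then have "norm ((\<Sum>i<n. s (e i) x) - (\<Sum>i. s (e i) x)) = norm (\<Sum>i. s (e (i + n)) x)"
     by (simp add: norm_minus_commute)
    also have "...<=(\<Sum>i. norm (s (e (i + n)) x))"
     by (rule summable_norm) (use summable_ignore_initial_segment[OF that(2), of n] in simp)
    also have "...<=(\<Sum>i. M (e (i + n)))"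
     by (intro suminf_le that(3) summable_ignore_initial_segment[OF that(2)] summable_ignore_initial_segment[OF Ms])
    finally show ?thesis using elim by simp
   qed
   show ?case
   proof (intro ballI allI)
    fix x h assume x: "x : S"
    have "(\<Sum>i<n. p (e i) x*h + q (e i) x * cnj h) - (P x*h + Q x * cnj h)
      = ((\<Sum>i<n. p (e i) x) - P x)*h+((\<Sum>i<n. q (e i) x) - Q x) * cnj h"
     by (simp add: sum.distrib sum_distrib_right sum_distrib_left algebra_simps)
    also have "norm ...<=norm ((\<Sum>i<n. p (e i) x) - P x)*norm h + norm ((\<Sum>i<n. q (e i) x) - Q x)*norm h"
     by (rule order_trans[OF norm_triangle_ineq]) (simp add: norm_mult)
    also have "...<=r/2*norm h + r/2*norm h"
     unfolding P_def Q_def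
     by (intro add_mono mult_right_mono tb x psum pb) auto
    finally show "norm ((\<Sum>i<n. p (e i) x*h + q (e i) x * cnj h) - (P x*h + Q x * cnj h))<=r*norm h" by simp
   qed
  qed
 qed
 then obtain g where g: "!!x. x : S ==> (%n. f (e n) x) sums g x"
  "!!x. x : S ==> (g has_derivative (%h. P x*h + Q x * cnj h)) (at x within S)" by blast
 have gF: "g x = F x" if "x : S" for x
  using g(1)[OF that] has_sum_imp_sums[OF has_sum_reindex_bij_betw[OF e, THEN iffD2, OF F[OF that]]] by (rule sums_unique2)
 have "has_wirt g (P z) (Q z) z" using g(2)[OF z] at_within_open[OF z S(1)] by (simp add: has_wirt_def)
 then have 1: "has_wirt F (P z) (Q z) z" by (rule has_wirt_transform[OF _ S(1) z gF])
 have inf: "(\<Sum>n. s (e n) z) = (\<Sum>\<^sub>\<infinity>i\<in>I. s i z)" if "summable (%n. norm (s (e n) z))" for s :: "'i => complex => complex"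
 proof -
  have "((%n. s (e n) z) has_sum (\<Sum>n. s (e n) z)) UNIV"
   by (rule norm_summable_imp_has_sum[OF that summable_sums[OF summable_norm_cancel[OF that]]])
  then have "((%i. s i z) has_sum (\<Sum>n. s (e n) z)) I" by (rule has_sum_reindex_bij_betw[OF e, THEN iffD1])
  then show ?thesis by (rule infsumI[symmetric])
 qed
 show ?thesis using 1 inf[of p] inf[of q] psum[OF z] by (simp add: P_def Q_def)
qed

text \<open>
 \<open>ffamily w \<rho> I \<nu> C f\<close>: near \<open>w\<close> the function \<open>f\<close> is a sum of terms
 \<open>C\<^sub>i(y) e\<^sup>2\<^sup>\<pi>\<^sup>i\<^sup>\<nu>\<^sup>x\<close> whose \<open>y\<close>-dependence extends holomorphically to a complex disc.
 Differentiation in \<open>x\<close> and \<open>y\<close> stays within such families.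
\<close>

definition ffamily ::
 "complex => real => int set => (int => real) => (int => complex => complex) => (complex => complex) => bool" where
 "ffamily w \<rho> I \<nu> C f \<longleftrightarrow> \<rho> > 0 & infinite I \<and>
  (\<forall>i\<in>I. C i holomorphic_on ball (of_real (Im w)) \<rho>) \<and>
  (\<exists>S. (\<forall>i\<in>I. \<forall>y\<in>ball (of_real (Im w)) \<rho>. norm (C i y)<=S i) \<and>
    (%i. S i*exp (2*pi*\<bar>\<nu> i\<bar>*\<rho>)) summable_on I) \<and>
  (\<forall>z\<in>ball w \<rho>. ((%i. C i (of_real (Im z))*exp (2 * of_real pi*\<i> * of_real (\<nu> i * Re z))) has_sum f z) I)"

lemma Im_in_ball: "z : ball w \<rho> ==> complex_of_real (Im z) : ball (of_real (Im w)) \<rho>"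
proof -
 assume "z : ball w \<rho>"
 then have "\<bar>Im (w - z)\<bar> < \<rho>" using abs_Im_le_cmod[of "w - z"] by (simp add: dist_norm)
 then show ?thesis by (simp add: dist_norm flip: of_real_diff)
qed

lemma norm_cis_real [simp]: "norm (exp (2 * complex_of_real pi*\<i> * of_real x)) = 1"
 by simp

text \<open>A derivative in x costs a factor |t|, which is paid for by shrinking the radius, since x
  <= e^x.\<close>

lemma exp_abs_bounds:
 assumes "0 < \<rho>'" "\<rho>' < \<rho>"
 shows "\<bar>t\<bar>*exp (2*pi*\<bar>t\<bar>*\<rho>')<=1/(2*pi*(\<rho> - \<rho>'))*exp (2*pi*\<bar>t\<bar>*\<rho>)"
  "exp (2*pi*\<bar>t\<bar>*\<rho>')<=exp (2*pi*\<bar>t\<bar>*\<rho>)"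
proof -
 have "2*pi*(\<rho> - \<rho>')*\<bar>t\<bar><=exp (2*pi*(\<rho> - \<rho>')*\<bar>t\<bar>)"
  using exp_ge_add_one_self[of "2*pi*(\<rho> - \<rho>')*\<bar>t\<bar>"] by linarith
 then have "\<bar>t\<bar><=1/(2*pi*(\<rho> - \<rho>'))*exp (2*pi*(\<rho> - \<rho>')*\<bar>t\<bar>)"
  using assms by (simp add: field_simps)
 then have "\<bar>t\<bar>*exp (2*pi*\<bar>t\<bar>*\<rho>')<=1/(2*pi*(\<rho> - \<rho>'))*exp (2*pi*(\<rho> - \<rho>')*\<bar>t\<bar>)*exp (2*pi*\<bar>t\<bar>*\<rho>')"
  by (intro mult_right_mono) auto
 also have "... = 1/(2*pi*(\<rho> - \<rho>'))*exp (2*pi*\<bar>t\<bar>*\<rho>)"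
  by (simp only: mult.assoc exp_add[symmetric]) (simp add: algebra_simps)
 finally show "\<bar>t\<bar>*exp (2*pi*\<bar>t\<bar>*\<rho>')<=1/(2*pi*(\<rho> - \<rho>'))*exp (2*pi*\<bar>t\<bar>*\<rho>)" .
 show "exp (2*pi*\<bar>t\<bar>*\<rho>')<=exp (2*pi*\<bar>t\<bar>*\<rho>)" using assms by (simp add: mult_left_mono)
qed

text \<open>Cauchy's estimate on a circle of half the gap between the radii; this is the price of a
  derivative in y.\<close>

lemma deriv_bound_ball:
 assumes "f holomorphic_on ball a \<rho>" "!!y. y : ball a \<rho> ==> norm (f y)<=S" "0 < \<rho>'" "\<rho>' < \<rho>" "y : ball a \<rho>'"
 shows "norm (deriv f y)<=S*(2/(\<rho> - \<rho>'))"
proof -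
 define r where "r = (\<rho> - \<rho>')/2"
 have r: "r > 0" using assms by (simp add: r_def)
 have sub: "cball y r \<subseteq> ball a \<rho>"
 proof
  fix u assume "u : cball y r"
  then have "dist a u < \<rho>' + r" using assms(5) dist_triangle[of a u y] by simp
  also have "... < \<rho>" using assms by (simp add: r_def field_simps)
  finally show "u : ball a \<rho>" by simp
 qed
 have "norm ((deriv ^^ 1) f y)<=fact 1 * S/r^1"
 proof (rule Cauchy_inequality[OF _ _ r])
  show "f holomorphic_on ball y r" by (rule holomorphic_on_subset[OF assms(1)]) (use sub in auto)
  show "continuous_on (cball y r) f"
   by (rule continuous_on_subset[OF holomorphic_on_imp_continuous_on[OF assms(1)] sub])
  fix u assume "norm (y - u) = r"
  then have "u : cball y r" by (simp add: dist_norm)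
  then show "norm (f u)<=S" using sub assms(2) by blast
 qed
 then show ?thesis by (simp add: r_def)
qed

text \<open>Termwise differentiation: the majorants \<open>SX\<close> and \<open>SY\<close> arise
  from that of the family by giving up part of the radius. Each order of differentiation needs a
  further decrease of the radius.\<close>

lemma ffamily_wirt:
 assumes F: "ffamily w \<rho> I \<nu> C f" and r: "0 < \<rho>'" "\<rho>' < \<rho>"
 shows "!!z. z : ball w \<rho>' ==> has_wirt f ((dx f z - \<i> * dy f z)/2) ((dx f z+\<i> * dy f z)/2) z"
  and "ffamily w \<rho>' I \<nu> (%i y. 2 * of_real pi*\<i> * of_real (\<nu> i)*C i y) (dx f)"
  and "ffamily w \<rho>' I \<nu> (%i. deriv (C i)) (dy f)"
proof -
 define e where "e i z = exp (2 * of_real pi*\<i> * of_real (\<nu> i * Re z))" for i z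
 have ne [simp]: "norm (e i z) = 1" for i z by (simp add: e_def)
 have inf: "infinite I" and hol: "!!i. i : I ==> C i holomorphic_on ball (of_real (Im w)) \<rho>"
  and hs: "!!z. z : ball w \<rho> ==> ((%i. C i (of_real (Im z))*e i z) has_sum f z) I"
  using F by (auto simp: ffamily_def e_def)
 obtain S where S: "!!i y. i : I ==> y : ball (of_real (Im w)) \<rho> ==> norm (C i y)<=S i"
  "(%i. S i*exp (2*pi*\<bar>\<nu> i\<bar>*\<rho>)) summable_on I"
  using F unfolding ffamily_def by blast
 have \<rho>: "\<rho> > 0" using r by simp
 have S0: "S i >= 0" if "i : I" for i
  by (rule order_trans[OF norm_ge_zero S(1)[OF that, of "of_real (Im w)"]]) (use \<rho> in simp)
 have sub: "ball w \<rho>' \<subseteq> ball w \<rho>" "ball (complex_of_real (Im w)) \<rho>' \<subseteq> ball (of_real (Im w)) \<rho>" using r by auto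
 define X where "X i y = 2 * of_real pi*\<i> * of_real (\<nu> i)*C i y" for i y
 define SX where "SX i = 2*pi*\<bar>\<nu> i\<bar> * S i" for i
 define SY where "SY i = S i*(2/(\<rho> - \<rho>'))" for i
 have Xb: "norm (X i y)<=SX i" if "i : I" "y : ball (of_real (Im w)) \<rho>'" for i y
  using S(1)[OF that(1), of y] that(2) sub unfolding X_def SX_def norm_mult by (simp add: mult_left_mono subset_iff)
 have Yb: "norm (deriv (C i) y)<=SY i" if "i : I" "y : ball (of_real (Im w)) \<rho>'" for i y
  unfolding SY_def by (rule deriv_bound_ball[OF hol[OF that(1)] S(1)[OF that(1)] r that(2)])
 have SXs: "(%i. SX i*exp (2*pi*\<bar>\<nu> i\<bar>*\<rho>')) summable_on I"
 proof (rule summable_on_comparison_test)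
  show "(%i. (2*pi*(1/(2*pi*(\<rho> - \<rho>'))))*(S i*exp (2*pi*\<bar>\<nu> i\<bar>*\<rho>))) summable_on I"
   by (rule summable_on_cmult_right[OF S(2)])
  fix i assume i: "i : I"
  have "SX i*exp (2*pi*\<bar>\<nu> i\<bar>*\<rho>') = 2*pi * S i*(\<bar>\<nu> i\<bar>*exp (2*pi*\<bar>\<nu> i\<bar>*\<rho>'))" by (simp add: SX_def)
  also have "...<=2*pi * S i*(1/(2*pi*(\<rho> - \<rho>'))*exp (2*pi*\<bar>\<nu> i\<bar>*\<rho>))"
   by (intro mult_left_mono exp_abs_bounds r) (use S0[OF i] in auto)
  finally show "SX i*exp (2*pi*\<bar>\<nu> i\<bar>*\<rho>')<=(2*pi*(1/(2*pi*(\<rho> - \<rho>'))))*(S i*exp (2*pi*\<bar>\<nu> i\<bar>*\<rho>))"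
   by (simp only: mult_ac)
  show "0<=SX i*exp (2*pi*\<bar>\<nu> i\<bar>*\<rho>')" using S0[OF i] by (simp add: SX_def)
 qed
 have SYs: "(%i. SY i*exp (2*pi*\<bar>\<nu> i\<bar>*\<rho>')) summable_on I"
 proof (rule summable_on_comparison_test)
  show "(%i. (2/(\<rho> - \<rho>'))*(S i*exp (2*pi*\<bar>\<nu> i\<bar>*\<rho>))) summable_on I"
   by (rule summable_on_cmult_right[OF S(2)])
  fix i assume i: "i : I"
  have "SY i*exp (2*pi*\<bar>\<nu> i\<bar>*\<rho>')<=SY i*exp (2*pi*\<bar>\<nu> i\<bar>*\<rho>)"
   by (intro mult_left_mono exp_abs_bounds r) (use S0[OF i] r in \<open>auto simp: SY_def\<close>)
  then show "SY i*exp (2*pi*\<bar>\<nu> i\<bar>*\<rho>')<=(2/(\<rho> - \<rho>'))*(S i*exp (2*pi*\<bar>\<nu> i\<bar>*\<rho>))"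
   by (simp only: SY_def mult_ac)
  show "0<=SY i*exp (2*pi*\<bar>\<nu> i\<bar>*\<rho>')" using S0[OF i] r by (simp add: SY_def)
 qed
 have SXY: "(%i. SX i + SY i) summable_on I"
 proof (rule summable_on_comparison_test[OF summable_on_add[OF SXs SYs]])
  fix i assume i: "i : I"
  have E: "1<=exp (2*pi*\<bar>\<nu> i\<bar>*\<rho>')" using r by simp
  have s: "SX i >= 0" "SY i >= 0" using S0[OF i] r by (auto simp: SX_def SY_def)
  show "SX i + SY i<=SX i*exp (2*pi*\<bar>\<nu> i\<bar>*\<rho>') + SY i*exp (2*pi*\<bar>\<nu> i\<bar>*\<rho>')"
   using mult_left_mono[OF E s(1)] mult_left_mono[OF E s(2)] by simp
  show "0<=SX i + SY i" using s by simp
 qed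
 define p where "p i z = (X i (of_real (Im z)) - \<i> * deriv (C i) (of_real (Im z)))/2*e i z" for i z
 define q where "q i z = (X i (of_real (Im z))+\<i> * deriv (C i) (of_real (Im z)))/2*e i z" for i z
 have trm: "has_wirt (%z. C i (of_real (Im z))*e i z) (p i z) (q i z) z" if "i : I" "z : ball w \<rho>'" for i z
 proof -
  have y: "of_real (Im z) : ball (complex_of_real (Im w)) \<rho>" using Im_in_ball that(2) sub by blast
  have "(C i has_field_derivative deriv (C i) (of_real (Im z))) (at (of_real (Im z)))"
   by (rule holomorphic_derivI[OF hol[OF that(1)] open_ball y])
  then have "((%t. C i (of_real t)) has_vector_derivative deriv (C i) (of_real (Im z))) (at (Im z))"
   by (rule has_vector_derivative_real_field)
  note c = has_wirt_Im_compose[OF this]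
  have "((%z. exp (2 * of_real pi*\<i> * of_real (\<nu> i)*z)) has_field_derivative 2 * of_real pi*\<i> * of_real (\<nu> i)*exp (2 * of_real pi*\<i> * of_real (\<nu> i)*z)) (at z)" for z
   by (auto intro!: derivative_eq_intros)
  note ex = this[of "of_real (Re z)", unfolded has_field_derivative_def]
  have dre: "((%z. complex_of_real (Re z)) has_derivative (%h. of_real (Re h))) (at z)"
   by (intro has_derivative_of_real has_derivative_Re has_derivative_ident)
  have d: "((%z. exp (2 * of_real pi*\<i> * of_real (\<nu> i) * of_real (Re z))) has_derivative
   (%h. 2 * of_real pi*\<i> * of_real (\<nu> i)*exp (2 * of_real pi*\<i> * of_real (\<nu> i) * of_real (Re z)) * of_real (Re h))) (at z)"
   by (rule has_derivative_compose[OF dre, OF ex])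
  have "has_wirt (e i) (of_real pi*\<i> * of_real (\<nu> i)*e i z) (of_real pi*\<i> * of_real (\<nu> i)*e i z) z"
   unfolding has_wirt_def
  proof (rule has_derivative_eq_rhs)
   show "(e i has_derivative (%h. 2 * of_real pi*\<i> * of_real (\<nu> i)*e i z * of_real (Re h))) (at z)"
    using d by (simp add: e_def[abs_def] mult.assoc)
   have re: "2 * complex_of_real (Re h) = h + cnj h" for h by (simp add: complex_add_cnj)
   show "(%h. 2 * of_real pi*\<i> * of_real (\<nu> i)*e i z * of_real (Re h)) = (%h. of_real pi*\<i> * of_real (\<nu> i)*e i z*h + of_real pi*\<i> * of_real (\<nu> i)*e i z * cnj h)"
   proof
    fix h
    have "2 * of_real pi*\<i> * of_real (\<nu> i)*e i z * of_real (Re h) = of_real pi*\<i> * of_real (\<nu> i)*e i z*(2 * complex_of_real (Re h))" by simp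
    then show "2 * of_real pi*\<i> * of_real (\<nu> i)*e i z * of_real (Re h) = of_real pi*\<i> * of_real (\<nu> i)*e i z*h + of_real pi*\<i> * of_real (\<nu> i)*e i z * cnj h"
     by (simp only: re distrib_left)
   qed
  qed
  from has_wirt_mult[OF c this] show ?thesis
   by (rule back_subst[where P = "%x. has_wirt _ x _ z", OF back_subst[where P = "%x. has_wirt _ _ x z"]])
    (simp_all add: p_def q_def X_def field_simps)
 qed
 have pq: "norm (p i z) + norm (q i z)<=SX i + SY i" if "i : I" "z : ball w \<rho>'" for i z
 proof -
  have y: "of_real (Im z) : ball (complex_of_real (Im w)) \<rho>'" using Im_in_ball that(2) by blast
  have "norm (X i (of_real (Im z)) - \<i> * deriv (C i) (of_real (Im z)))<=SX i + SY i"
   by (rule order_trans[OF norm_triangle_ineq4 add_mono]) (use Xb Yb that y in \<open>auto simp: norm_mult\<close>)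
  moreover have "norm (X i (of_real (Im z))+\<i> * deriv (C i) (of_real (Im z)))<=SX i + SY i"
   by (rule order_trans[OF norm_triangle_ineq add_mono]) (use Xb Yb that y in \<open>auto simp: norm_mult\<close>)
  ultimately show ?thesis by (simp add: p_def q_def norm_mult norm_divide)
 qed
 define P where "P z = (\<Sum>\<^sub>\<infinity>i\<in>I. p i z)" for z
 define Q where "Q z = (\<Sum>\<^sub>\<infinity>i\<in>I. q i z)" for z
 have wirt: "has_wirt f (P z) (Q z) z" if "z : ball w \<rho>'" for z
  unfolding P_def Q_def
  by (rule has_wirt_series[where f = "%i z. C i (of_real (Im z))*e i z", OF _ inf open_ball convex_ball trm pq SXY hs that])
   (use sub in auto)
 have ps: "(%i. p i z) summable_on I" "(%i. q i z) summable_on I" if "z : ball w \<rho>'" for z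
 proof -
  have le: "norm (p i z)<=SX i + SY i" "norm (q i z)<=SX i + SY i" if "i : I" for i
   using pq[OF that \<open>z : ball w \<rho>'\<close>] norm_ge_zero[of "p i z"] norm_ge_zero[of "q i z"] by linarith+
  have "(%i. norm (p i z)) summable_on I"
   by (rule summable_on_comparison_test[OF SXY le(1) norm_ge_zero])
  then show "(%i. p i z) summable_on I" by (rule abs_summable_summable)
  have "(%i. norm (q i z)) summable_on I"
   by (rule summable_on_comparison_test[OF SXY le(2) norm_ge_zero])
  then show "(%i. q i z) summable_on I" by (rule abs_summable_summable)
 qed
 have pqs: "((%i. p i z) has_sum P z) I" "((%i. q i z) has_sum Q z) I" if "z : ball w \<rho>'" for z
  unfolding P_def Q_def by (rule has_sum_infsum[OF ps(1)[OF that]], rule has_sum_infsum[OF ps(2)[OF that]])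
 have dxy: "dx f z = P z + Q z" "dy f z = \<i>*(P z - Q z)" if "z : ball w \<rho>'" for z
  using has_wirt_dx[OF wirt[OF that]] has_wirt_dy[OF wirt[OF that]] by auto
 show "has_wirt f ((dx f z - \<i> * dy f z)/2) ((dx f z+\<i> * dy f z)/2) z" if "z : ball w \<rho>'" for z
 proof -
  have "(dx f z - \<i> * dy f z)/2 = P z" "(dx f z+\<i> * dy f z)/2 = Q z"
   by (simp_all add: dxy[OF that] algebra_simps)
  then show ?thesis using wirt[OF that] by simp
 qed
 have "((%i. X i (of_real (Im z))*e i z) has_sum dx f z) I" if "z : ball w \<rho>'" for z
 proof -
  have "((%i. p i z + q i z) has_sum (P z + Q z)) I" by (intro has_sum_add pqs that)
  then show ?thesis unfolding dxy[OF that] by (simp add: p_def q_def field_simps)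
 qed
 then show "ffamily w \<rho>' I \<nu> (%i y. 2 * of_real pi*\<i> * of_real (\<nu> i)*C i y) (dx f)"
  unfolding ffamily_def e_def X_def[symmetric]
  using r(1) inf Xb SXs holomorphic_on_subset[OF hol sub(2)]
  by (auto simp: X_def[abs_def] intro!: holomorphic_intros exI[of _ SX])
 have "((%i. deriv (C i) (of_real (Im z))*e i z) has_sum dy f z) I" if "z : ball w \<rho>'" for z
 proof -
  have "((%i. \<i>*(p i z + - q i z)) has_sum (\<i>*(P z + - Q z))) I"
   by (intro has_sum_cmult_right has_sum_add has_sum_neg pqs that)
  moreover have "\<i>*(p i z + - q i z) = deriv (C i) (of_real (Im z))*e i z" for i
   by (simp add: p_def q_def field_simps)
  ultimately show ?thesis unfolding dxy[OF that] by simp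
 qed
 then show "ffamily w \<rho>' I \<nu> (%i. deriv (C i)) (dy f)"
  unfolding ffamily_def e_def
  using r(1) inf Yb SYs holomorphic_deriv[OF holomorphic_on_subset[OF hol sub(2)] open_ball]
  by (auto intro!: exI[of _ SY])
qed

definition real_analytic_at :: "(complex => complex) => complex => bool" where
 "real_analytic_at f w \<longleftrightarrow> (\<exists>r>0. \<exists>a :: nat => nat => complex. \<forall>z\<in>ball w r.
  ((%(m, n). a m n * of_real ((Re z - Re w)^m*(Im z - Im w)^n)) has_sum f z) UNIV)"

lemma real_analytic_at_add:
 assumes "real_analytic_at f w" "real_analytic_at g w" shows "real_analytic_at (%z. f z + g z) w"
proof -
 obtain r a where 1: "r > 0" "!!z. z : ball w r ==> ((%(m, n). a m n * of_real ((Re z - Re w)^m*(Im z - Im w)^n)) has_sum f z) UNIV"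
  using assms(1) unfolding real_analytic_at_def by blast
 obtain r' a' where 2: "r' > 0" "!!z. z : ball w r' ==> ((%(m, n). a' m n * of_real ((Re z - Re w)^m*(Im z - Im w)^n)) has_sum g z) UNIV"
  using assms(2) unfolding real_analytic_at_def by blast
 have "((%(m, n). (a m n + a' m n) * of_real ((Re z - Re w)^m*(Im z - Im w)^n)) has_sum (f z + g z)) UNIV"
  if "z : ball w (min r r')" for z
  using has_sum_add[OF 1(2)[of z] 2(2)[of z]] that by (simp add: case_prod_unfold distrib_right)
 then show ?thesis unfolding real_analytic_at_def using 1(1) 2(1)
  by (intro exI[of _ "min r r'"] conjI exI[of _ "%m n. a m n + a' m n"]) auto
qed

text \<open>Expand the exponential in x and the coefficient in y at w. The weight exp(2 pi |nu| rho)
  in the majorant is the sum of the exponential series in absolute values, so the triple series over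
  (i, m, n) converges absolutely and may be summed over i first.\<close>

lemma ffamily_real_analytic:
 assumes F: "ffamily w \<rho> I \<nu> C f"
 shows "real_analytic_at f w"
proof -
 define e where "e i z = exp (2 * of_real pi*\<i> * of_real (\<nu> i * Re z))" for i z
 have \<rho>: "\<rho> > 0" and hol: "!!i. i : I ==> C i holomorphic_on ball (of_real (Im w)) \<rho>"
  and hs: "!!z. z : ball w \<rho> ==> ((%i. C i (of_real (Im z))*e i z) has_sum f z) I"
  using F by (auto simp: ffamily_def e_def)
 obtain S where S: "!!i y. i : I ==> y : ball (of_real (Im w)) \<rho> ==> norm (C i y)<=S i"
  "(%i. S i*exp (2*pi*\<bar>\<nu> i\<bar>*\<rho>)) summable_on I"
  using F unfolding ffamily_def by blast
 have S0: "S i >= 0" if "i : I" for i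
  by (rule order_trans[OF norm_ge_zero S(1)[OF that, of "of_real (Im w)"]]) (use \<rho> in simp)
 define b where "b i n = (deriv ^^ n) (C i) (of_real (Im w))/fact n" for i n
 define t where "t i = 2 * of_real pi*\<i> * complex_of_real (\<nu> i)" for i
 define R where "R = \<rho>/2"
 have R: "0 < R" "R < \<rho>" using \<rho> by (auto simp: R_def)
 have bb: "norm (b i n)<=S i/R^n" if "i : I" for i n
 proof -
  have "norm ((deriv ^^ n) (C i) (of_real (Im w)))<=fact n * S i/R^n"
  proof (rule Cauchy_inequality[OF _ _ R(1)])
   have sub: "cball (complex_of_real (Im w)) R \<subseteq> ball (of_real (Im w)) \<rho>" using R by auto
   show "C i holomorphic_on ball (of_real (Im w)) R" by (rule holomorphic_on_subset[OF hol[OF that]]) (use sub in auto)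
   show "continuous_on (cball (of_real (Im w)) R) (C i)"
    by (rule continuous_on_subset[OF holomorphic_on_imp_continuous_on[OF hol[OF that]] sub])
   fix u :: complex assume "norm (of_real (Im w) - u) = R"
   then show "norm (C i u)<=S i" using R by (intro S(1)[OF that]) (simp add: dist_norm)
  qed
  then show ?thesis by (simp add: b_def norm_divide field_simps)
 qed
 \<comment> \<open>Cauchy's estimates use the radius \<open>R\<close>, the expansion half of it, so
   the powers of y - Im w are dominated by a geometric series of ratio 1/2.\<close>
 define r where "r = R/2"
 have r: "0 < r" "r < \<rho>" using R by (auto simp: r_def)
 define A where "A i z m n = e i w*(t i^m/fact m) * b i n * of_real ((Re z - Re w)^m*(Im z - Im w)^n)" for i z m n
 have main: "((%(m,n). (\<Sum>\<^sub>\<infinity>i\<in>I. e i w*(t i^m/fact m) * b i n) * of_real ((Re z - Re w)^m*(Im z - Im w)^n)) has_sum f z) UNIV"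
  if z: "z : ball w r" for z
 proof -
  define s where "s = Re z - Re w"
  define u where "u = Im z - Im w"
  have "\<bar>s\<bar><=norm (z - w)" "\<bar>u\<bar><=norm (z - w)" using abs_Re_le_cmod[of "z - w"] abs_Im_le_cmod[of "z - w"] by (auto simp: s_def u_def)
  then have su: "\<bar>s\<bar> < r" "\<bar>u\<bar> < r" using z by (auto simp: dist_norm norm_minus_commute)
  have zr: "z : ball w \<rho>" using z r by auto
  have T: "norm (t i) = 2*pi*\<bar>\<nu> i\<bar>" for i by (simp add: t_def norm_mult)
  have ew: "norm (e i w) = 1" for i by (simp add: e_def)
  have mexp: "((%m. (x^m/fact m)) has_sum exp x) UNIV" for x :: complex
   by (rule norm_summable_imp_has_sum) (use summable_norm_exp[of x] exp_converges[of x] in \<open>simp_all add: scaleR_conv_of_real field_simps\<close>)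
  have mexpr: "((%m. (x^m/fact m)) has_sum exp x) UNIV" if "x >= 0" for x :: real
   by (rule norm_summable_imp_has_sum) (use summable_norm_exp[of x] exp_converges[of x] that in \<open>simp_all add: field_simps\<close>)
  have bser: "((%n. b i n * of_real u^n) has_sum C i (of_real (Im z))) UNIV" if i: "i : I" for i
  proof (rule norm_summable_imp_has_sum)
   have "(%n. b i n*(of_real (Im z) - of_real (Im w))^n) sums C i (of_real (Im z))"
    unfolding b_def by (rule holomorphic_power_series[OF hol[OF i] Im_in_ball[OF zr]])
   then show "(%n. b i n * of_real u^n) sums C i (of_real (Im z))" by (simp add: u_def)
   show "summable (%n. norm (b i n * of_real u^n))"
   proof (rule summable_comparison_test')
    show "summable (%n. S i*(1/2)^n)" by (intro summable_mult summable_geometric) simp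
    show "norm (norm (b i n * of_real u^n))<=S i*(1/2)^n" for n
    proof -
     have "norm (b i n * of_real u^n)<=S i/R^n * r^n"
      unfolding norm_mult norm_power using bb[OF i, of n] su S0[OF i] R by (intro mult_mono power_mono) auto
     also have "... = S i*(1/2)^n" using R by (simp add: r_def power_divide field_simps)
     finally show ?thesis by simp
    qed
   qed
  qed
  have bound: "norm (A i z m n)<=S i*((2*pi*\<bar>\<nu> i\<bar>*\<rho>)^m/fact m*(1/2)^n)" if i: "i : I" for i m n
  proof -
   have "norm (A i z m n) = (norm (t i)*\<bar>s\<bar>)^m/fact m*(norm (b i n)*\<bar>u\<bar>^n)"
    by (simp add: A_def norm_mult norm_divide norm_power ew s_def[symmetric] u_def[symmetric] power_mult_distrib abs_mult power_abs)
   also have "...<=(2*pi*\<bar>\<nu> i\<bar>*\<rho>)^m/fact m*(S i/R^n * r^n)"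
    unfolding T using bb[OF i, of n] su S0[OF i] R r
    by (intro mult_mono divide_right_mono power_mono) auto
   also have "S i/R^n * r^n = S i*(1/2)^n" using R by (simp add: r_def power_divide field_simps)
   finally show ?thesis by (simp add: mult_ac)
  qed
  have geo: "((%n. (1/2::real)^n) has_sum 2) UNIV"
   by (rule norm_summable_imp_has_sum) (use geometric_sums[of "1/2::real"] in \<open>auto intro!: summable_geometric\<close>)
  have inner: "((%(m,n). x^m/fact m*(1/2)^n) has_sum (exp x*2)) UNIV" if "x >= 0" for x :: real
  proof -
   have "((%(m,n). x^m/fact m*(1/2)^n) has_sum (exp x*2)) (UNIV \<times> UNIV)"
   proof (rule has_sum_SigmaI)
    show "((%n. case (m,n) of (m,n) => x^m/fact m*(1/2)^n) has_sum (x^m/fact m*2)) UNIV" for m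
     using has_sum_cmult_right[OF geo, of "x^m/fact m"] by (simp only: prod.case)
    show "((%m. x^m/fact m*2) has_sum exp x*2) UNIV" by (rule has_sum_cmult_left[OF mexpr[OF that]])
    then have g: "(%m. x^m/fact m*2) summable_on UNIV" by (rule has_sum_imp_summable)
    show "(%(m,n). x^m/fact m*(1/2)^n) summable_on UNIV \<times> UNIV"
     proof (rule summable_on_SigmaI[OF _ g])
      show "((%n. case (m,n) of (m,n) => x^m/fact m*(1/2)^n) has_sum (x^m/fact m*2)) UNIV" for m
       using has_sum_cmult_right[OF geo, of "x^m/fact m"] by (simp only: prod.case)
     qed (use that in auto)
   qed
   then show ?thesis by simp
  qed
  have x0: "0<=2*pi*\<bar>\<nu> i\<bar>*\<rho>" for i using \<rho> by simp
  have "(%(i,mn). S i*(case mn of (m,n) => (2*pi*\<bar>\<nu> i\<bar>*\<rho>)^m/fact m*(1/2)^n)) summable_on I \<times> UNIV"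
  proof (rule summable_on_SigmaI)
   show "((%mn. case (i,mn) of (i,mn) => S i*(case mn of (m,n) => (2*pi*\<bar>\<nu> i\<bar>*\<rho>)^m/fact m*(1/2)^n)) has_sum
    (S i*(exp (2*pi*\<bar>\<nu> i\<bar>*\<rho>)*2))) UNIV" for i
    using has_sum_cmult_right[OF inner[OF x0]] by simp
   show "(%i. S i*(exp (2*pi*\<bar>\<nu> i\<bar>*\<rho>)*2)) summable_on I"
    using summable_on_cmult_left[OF S(2), of 2] by (simp add: mult.assoc)
  qed (use S0 \<rho> in auto)
  then have "(%x. norm (case x of (i,(m,n)) => A i z m n)) summable_on I \<times> UNIV"
   by (rule summable_on_comparison_test) (use bound in auto)
  then have summ: "(%(i,(m,n)). A i z m n) summable_on I \<times> UNIV" by (rule abs_summable_summable)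
  have row: "((%(m,n). A i z m n) has_sum (C i (of_real (Im z))*e i z)) UNIV" if i: "i : I" for i
  proof -
   have ee: "e i z = e i w*exp (t i * of_real s)"
    by (simp add: e_def t_def s_def exp_add[symmetric] algebra_simps)
   have sl: "(%(m,n). A i z m n) summable_on UNIV \<times> UNIV"
    using summable_on_SigmaD1[of "%i (m,n). A i z m n" I "%_. UNIV", OF _ i] summ by (simp add: case_prod_unfold)
   have "((%(m,n). A i z m n) has_sum (exp (t i * of_real s)*(e i w*C i (of_real (Im z))))) (UNIV \<times> UNIV)"
   proof (rule has_sum_SigmaI[OF _ _ sl])
    fix m
    have "((%n. e i w*(t i^m/fact m) * of_real s^m*(b i n * of_real u^n)) has_sum
     (e i w*(t i^m/fact m) * of_real s^m*C i (of_real (Im z)))) UNIV"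
     by (rule has_sum_cmult_right[OF bser[OF i]])
    then show "((%n. case (m,n) of (m,n) => A i z m n) has_sum ((t i * of_real s)^m/fact m*(e i w*C i (of_real (Im z))))) UNIV"
     by (simp add: A_def s_def[symmetric] u_def[symmetric] power_mult_distrib mult_ac)
   next
    show "((%m. (t i * of_real s)^m/fact m*(e i w*C i (of_real (Im z)))) has_sum (exp (t i * of_real s)*(e i w*C i (of_real (Im z))))) UNIV"
     by (rule has_sum_cmult_left[OF mexp])
   qed
   then show ?thesis by (simp add: ee mult_ac)
  qed
  have tot: "((%(i,(m,n)). A i z m n) has_sum f z) (I \<times> UNIV)"
   by (rule has_sum_SigmaI[OF _ hs[OF zr] summ]) (use row in auto)
  then have tot': "((%(mn,i). case mn of (m,n) => A i z m n) has_sum f z) (UNIV \<times> I)"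
   by (subst has_sum_swap) (simp add: case_prod_unfold)
  have s2: "(%mn i. case mn of (m,n) => A i z m n) mn summable_on I" for mn
   by (rule summable_on_SigmaD1[of "%mn i. case mn of (m,n) => A i z m n" UNIV "%_. I"])
    (use has_sum_imp_summable[OF tot'] in auto)
  have "((%mn. \<Sum>\<^sub>\<infinity>i\<in>I. case mn of (m,n) => A i z m n) has_sum f z) UNIV"
   by (rule has_sum_SigmaD[OF tot']) (use has_sum_infsum[OF s2] in auto)
  moreover have "(\<Sum>\<^sub>\<infinity>i\<in>I. A i z m n) = (\<Sum>\<^sub>\<infinity>i\<in>I. e i w*(t i^m/fact m) * b i n) * of_real ((Re z - Re w)^m*(Im z - Im w)^n)" for m n
   unfolding A_def by (rule infsum_cmult_left')
  ultimately show ?thesis by (simp add: case_prod_unfold)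
 qed
 show ?thesis unfolding real_analytic_at_def
  by (intro exI[of _ r] conjI exI[of _ "%m n. \<Sum>\<^sub>\<infinity>i\<in>I. e i w*(t i^m/fact m) * b i n"] ballI) (use r main in auto)
qed

section \<open>Harmonic Fourier expansions\<close>

abbreviation (input) posset :: "int set" where "posset \<equiv> {n. [n = 1] (mod 24)}"
abbreviation (input) negset :: "int set" where "negset \<equiv> {n. [n = -1] (mod 24)}"

lemma posset_nonzero: "n : posset ==> n ~= 0" and negset_nonzero: "n : negset ==> n ~= 0"
 by (auto simp: cong_def)

lemma infinite_posset: "infinite posset" and infinite_negset: "infinite negset"
proof -
 have "inj (%k::nat. 24 * int k+1)" "range (%k::nat. 24 * int k+1) \<subseteq> posset"
  by (auto simp: inj_def cong_def)
 then show "infinite posset" using finite_subset range_inj_infinite by blast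
 have "inj (%k::nat. 24 * int k - 1)" "range (%k::nat. 24 * int k - 1) \<subseteq> negset"
  by (auto simp: inj_def cong_iff_dvd_diff)
 then show "infinite negset" using finite_subset range_inj_infinite by blast
qed

definition ig_ext :: "complex => complex" where
 "ig_ext = (SOME g. (\<forall>t\<in>ig_domain. (g has_field_derivative - ig_kernel t) (at t)) \<and>
  (\<forall>x. x ~= 0 \<longrightarrow> inc_Gamma (- 3/2) x = g (of_real x)))"

lemma ig_ext_deriv: "t : ig_domain ==> (ig_ext has_field_derivative - ig_kernel t) (at t)"
 and ig_ext_eq: "x ~= 0 ==> inc_Gamma (- 3/2) x = ig_ext (of_real x)"
proof -
 have "\<exists>g. (\<forall>t\<in>ig_domain. (g has_field_derivative - ig_kernel t) (at t)) \<and>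
  (\<forall>x. x ~= 0 \<longrightarrow> inc_Gamma (- 3/2) x = g (of_real x))"
  using inc_Gamma_holomorphic_extension by metis
 from someI_ex[OF this]
 show "t : ig_domain ==> (ig_ext has_field_derivative - ig_kernel t) (at t)"
  "x ~= 0 ==> inc_Gamma (- 3/2) x = ig_ext (of_real x)" unfolding ig_ext_def by blast+
qed

lemma ig_kernel_deriv:
 assumes "t : ig_domain"
 shows "(ig_kernel has_field_derivative ig_kernel t*(- 1 - 5/(2 * t))) (at t)"
proof -
 have nz: "- \<i> * t \<notin> \<real>\<^sub>\<le>\<^sub>0" and t0: "t ~= 0" using assms by (auto simp: ig_domain_def)
 have "((%t. (- \<i> * t) powr of_real (- 5/2)) has_field_derivative
   (of_real (- 5/2)*(- \<i> * t) powr (of_real (- 5/2) - 1))*(- \<i>)) (at t)"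
  by (rule DERIV_chain2[where f = "%u. u powr of_real (- 5/2)" and g = "%t. - \<i> * t", OF has_field_derivative_powr[OF nz]])
   (auto intro!: derivative_eq_intros)
 moreover have "(- \<i> * t) powr (of_real (- 5/2) - 1) = (- \<i> * t) powr of_real (- 5/2)/(- \<i> * t)"
  unfolding powr_diff using t0 by simp
 moreover have "of_real (- 5/2)*(u/(- \<i> * t))*(- \<i>) = u*(- 5/(2 * t))" for u
  using t0 by (simp add: field_simps)
 ultimately have p: "((%t. (- \<i> * t) powr of_real (- 5/2)) has_field_derivative
   (- \<i> * t) powr of_real (- 5/2)*(- 5/(2 * t))) (at t)"
  by (simp only:)
 have e: "((%t. exp (- t)) has_field_derivative - exp (- t)) (at t)" by (auto intro!: derivative_eq_intros)
 from DERIV_mult[OF e DERIV_cmult_right[OF p, of "\<i> powr of_real (- 5/2)"]]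
 show ?thesis unfolding ig_kernel_def[abs_def] by (simp add: algebra_simps)
qed

lemma ig_kernel_norm:
 assumes "Re t > 0" shows "norm (ig_kernel t)<=exp (- Re t) * Re t powr (- 5/2)"
proof -
 have t0: "t ~= 0" using assms by auto
 have "\<bar>Arg t\<bar> < pi/2" using Re_Ln_pos_lt[of t] assms t0 by (simp add: Arg_eq_Im_Ln)
 then have "ig_kernel t = exp (- t) * t powr of_real (- 5/2)"
  using t0 by (intro ig_kernel_eq) auto
 then have "norm (ig_kernel t) = exp (- Re t)*norm t powr (- 5/2)"
  by (simp add: norm_mult norm_powr_real_powr')
 also have "...<=exp (- Re t) * Re t powr (- 5/2)"
  using assms complex_Re_le_cmod[of t] by (intro mult_left_mono powr_mono2') auto
 finally show ?thesis .
qed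

text \<open>Along the vertical line through t the derivative is bounded by a quantity depending on
  Re t alone. The distance |Im t| to the real axis, where the bound for the integral applies, gives
  the linear factor.\<close>

lemma ig_ext_norm:
 assumes "Re t > 0"
 shows "norm (ig_ext t)<=exp (- Re t) * Re t powr (- 5/2)*(1+\<bar>Im t\<bar>)"
proof -
 define S where "S = {s. Re s = Re t}"
 have S: "convex S" "of_real (Re t) : S" "t : S"
  using convex_hyperplane[of "1 :: complex" "Re t"] by (simp_all add: S_def inner_complex_def)
 have "norm (ig_ext t - ig_ext (of_real (Re t)))<=(exp (- Re t) * Re t powr (- 5/2))*norm (t - of_real (Re t))"
 proof (rule field_differentiable_bound[OF S(1)])
  fix s assume s: "s : S"
  then have r: "Re s = Re t" "Re s > 0" using assms by (auto simp: S_def)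
  then have "s : ig_domain" by (simp add: ig_domain_iff)
  then show "(ig_ext has_field_derivative - ig_kernel s) (at s within S)"
   by (rule has_field_derivative_at_within[OF ig_ext_deriv])
  show "norm (- ig_kernel s)<=exp (- Re t) * Re t powr (- 5/2)"
   using ig_kernel_norm[OF r(2)] by (simp add: r(1))
 qed (use S in auto)
 also have "norm (t - of_real (Re t)) = \<bar>Im t\<bar>"
 proof -
  have "t - of_real (Re t) = \<i> * of_real (Im t)" by (simp add: complex_eq_iff)
  then show ?thesis by (simp add: norm_mult)
 qed
 finally have 1: "norm (ig_ext t - ig_ext (of_real (Re t)))<=exp (- Re t) * Re t powr (- 5/2)*\<bar>Im t\<bar>" .
 have "ig_ext (of_real (Re t)) = of_real (ig_real (Re t))"
  using ig_ext_eq[of "Re t"] inc_Gamma_pos[OF assms] assms by simp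
 then have 2: "norm (ig_ext (of_real (Re t)))<=exp (- Re t) * Re t powr (- 5/2)"
  using ig_real_bounds[OF assms] by (simp add: mult.commute)
 have "norm (ig_ext t)<=norm (ig_ext t - ig_ext (of_real (Re t))) + norm (ig_ext (of_real (Re t)))"
  by (metis diff_add_cancel norm_triangle_ineq)
 with 1 2 show ?thesis by (simp add: algebra_simps)
qed

text \<open>Since ln t <= t, one has t^(-5/2) >= e^(-3t). A lower bound is what turns convergence of
  a given expansion into decay of its coefficients.\<close>

lemma ig_real_lower:
 assumes "x > 0" shows "exp (- 4*x)/4<=ig_real x"
proof -
 have i: "((%t. exp (- 4 * t)) has_integral exp (- 4*x)/4) {x..}"
  by (rule has_integral_exp_minus_to_infinity) simp
 have "integral {x..} (%t. exp (- 4 * t))<=ig_real x" unfolding ig_real_def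
 proof (rule integral_le[OF _ inc_gamma_integrable[OF assms]])
  show "(%t. exp (- 4 * t)) integrable_on {x..}" using i by blast
  fix t assume "t : {x..}"
  then have t: "t > 0" using assms by simp
  have "ln t<=t" using ln_le_minus_one[OF t] by linarith
  then have "exp (- 3 * t)<=t powr (- 5/2)" using t by (simp add: powr_def)
  then have "exp (- t)*exp (- 3 * t)<=exp (- t) * t powr (- 5/2)" by (intro mult_left_mono) auto
  then show "exp (- 4 * t)<=exp (- t) * t powr (- 5/2)" by (simp add: exp_add[symmetric])
 qed
 then show ?thesis using integral_unique[OF i] by simp
qed

lemma ffamily_laplacian:
 assumes F: "ffamily w \<rho> I \<nu> C f"
  and ode: "!!i. i : I ==> - of_real ((Im w)\<^sup>2)*((2 * of_real pi*\<i> * of_real (\<nu> i))\<^sup>2*C i (of_real (Im w)) + deriv (deriv (C i)) (of_real (Im w)))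
   +\<i> * of_real (k*Im w)*(2 * of_real pi*\<i> * of_real (\<nu> i)*C i (of_real (Im w))+\<i> * deriv (C i) (of_real (Im w))) = 0"
 shows "hyp_laplacian k f w = 0"
proof -
 have \<rho>: "\<rho> > 0" using F by (simp add: ffamily_def)
 have r: "0 < \<rho>/2" "\<rho>/2 < \<rho>" "0 < \<rho>/4" "\<rho>/4 < \<rho>/2" using \<rho> by auto
 note X = ffamily_wirt(2)[OF F r(1,2)] and Y = ffamily_wirt(3)[OF F r(1,2)]
 note XX = ffamily_wirt(2)[OF X r(3,4)] and YY = ffamily_wirt(3)[OF Y r(3,4)]
 define e where "e i = exp (2 * of_real pi*\<i> * of_real (\<nu> i * Re w))" for i
 have w: "w : ball w (\<rho>/2)" "w : ball w (\<rho>/4)" using r by auto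
 have x: "((%i. 2 * of_real pi*\<i> * of_real (\<nu> i)*C i (of_real (Im w))*e i) has_sum dx f w) I"
  using X w(1) by (simp add: ffamily_def e_def)
 have y: "((%i. deriv (C i) (of_real (Im w))*e i) has_sum dy f w) I"
  using Y w(1) by (simp add: ffamily_def e_def)
 have xx: "((%i. 2 * of_real pi*\<i> * of_real (\<nu> i)*(2 * of_real pi*\<i> * of_real (\<nu> i)*C i (of_real (Im w)))*e i) has_sum dx (dx f) w) I"
  using XX w(2) by (simp add: ffamily_def e_def)
 have yy: "((%i. deriv (deriv (C i)) (of_real (Im w))*e i) has_sum dy (dy f) w) I"
  using YY w(2) by (simp add: ffamily_def e_def)
 have "((%i. - of_real ((Im w)\<^sup>2)*(2 * of_real pi*\<i> * of_real (\<nu> i)*(2 * of_real pi*\<i> * of_real (\<nu> i)*C i (of_real (Im w)))*e i + deriv (deriv (C i)) (of_real (Im w))*e i)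
  +\<i> * of_real (k*Im w)*(2 * of_real pi*\<i> * of_real (\<nu> i)*C i (of_real (Im w))*e i+\<i>*(deriv (C i) (of_real (Im w))*e i)))
  has_sum (- of_real ((Im w)\<^sup>2)*(dx (dx f) w + dy (dy f) w)+\<i> * of_real (k*Im w)*(dx f w+\<i> * dy f w))) I"
  by (intro has_sum_add has_sum_cmult_right x y xx yy)
 moreover have "- of_real ((Im w)\<^sup>2)*(2 * of_real pi*\<i> * of_real (\<nu> i)*(2 * of_real pi*\<i> * of_real (\<nu> i)*C i (of_real (Im w)))*e i + deriv (deriv (C i)) (of_real (Im w))*e i)
  +\<i> * of_real (k*Im w)*(2 * of_real pi*\<i> * of_real (\<nu> i)*C i (of_real (Im w))*e i+\<i>*(deriv (C i) (of_real (Im w))*e i)) = 0" if "i : I" for i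
 proof -
  have "- of_real ((Im w)\<^sup>2)*(2 * of_real pi*\<i> * of_real (\<nu> i)*(2 * of_real pi*\<i> * of_real (\<nu> i)*C i (of_real (Im w)))*e i + deriv (deriv (C i)) (of_real (Im w))*e i)
  +\<i> * of_real (k*Im w)*(2 * of_real pi*\<i> * of_real (\<nu> i)*C i (of_real (Im w))*e i+\<i>*(deriv (C i) (of_real (Im w))*e i))
  = (- of_real ((Im w)\<^sup>2)*((2 * of_real pi*\<i> * of_real (\<nu> i))\<^sup>2*C i (of_real (Im w)) + deriv (deriv (C i)) (of_real (Im w)))
   +\<i> * of_real (k*Im w)*(2 * of_real pi*\<i> * of_real (\<nu> i)*C i (of_real (Im w))+\<i> * deriv (C i) (of_real (Im w))))*e i"
   by (simp only: power2_eq_square) (simp only: algebra_simps)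
  then show ?thesis using ode[OF that] by simp
 qed
 ultimately have "((%i. 0) has_sum hyp_laplacian k f w) I"
  unfolding hyp_laplacian_def by (rule has_sum_congD)
 moreover have "((%i. 0) has_sum (0::complex)) I" by (rule has_sum_0) simp
 ultimately show ?thesis using has_sum_unique by blast
qed

section \<open>The two halves of a Fourier expansion as families\<close>

definition pos_coeff :: "(int => complex) => int => complex => complex" where
 "pos_coeff ap n y = ap n*exp (- (2 * of_real pi * of_real (of_int n/24))*y)"

text \<open>\<open>ig_ext\<close> replaces \<open>inc_Gamma\<close>, which has a real argument, so
  that the coefficient is holomorphic in y near every positive y, for both signs of n.\<close>

definition neg_coeff :: "(int => complex) => int => complex => complex" where
 "neg_coeff am n y = am n * ig_ext (of_real (pi * of_int n/6)*y)*exp (of_real (pi * of_int n/12)*y)"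

lemma qpow_split: "qpow r z = exp (- (2 * of_real pi * of_real r) * of_real (Im z))*exp (2 * of_real pi*\<i> * of_real (r * Re z))"
proof -
 have "2 * of_real pi*\<i> * of_real r*z = - (2 * of_real pi * of_real r) * of_real (Im z)+2 * of_real pi*\<i> * of_real (r * Re z)"
  by (subst complex_eq[of z]) (simp add: algebra_simps)
 then show ?thesis by (simp only: qpow_def exp_add)
qed

text \<open>Convergence at height Im w/2 supplies the majorant: for n > 0 the radius Im w/4 is lost
  once in the coefficient and once in the weight, and 1 - 1/4 - 1/4 = 1/2. The finitely many other
  indices are harmless.\<close>

lemma pos_family:
 assumes I: "infinite I" and fin: "finite {n \<in> I. n<=0 & ap n ~= 0}"
  and sum: "!!z. z : uhp ==> ((%n. ap n*qpow (of_int n/24) z) has_sum f z) I" and w: "w : uhp"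
 shows "ffamily w (Im w/4) I (%n. of_int n/24) (pos_coeff ap) f"
proof -
 define Y where "Y = Im w"
 have Y: "Y > 0" using w by (simp add: Y_def uhp_iff)
 define S where "S n = norm (ap n)*exp (2*pi/24*(\<bar>of_int n\<bar> * Y/4 - of_int n * Y))" for n :: int
 have "norm (pos_coeff ap n y)<=S n" if "y : ball (of_real Y) (Y/4)" for n y
 proof -
  have "\<bar>Re y - Y\<bar><=Y/4" using that abs_Re_le_cmod[of "y - of_real Y"] by (simp add: dist_norm norm_minus_commute)
  then have "\<bar>of_int n\<bar>*\<bar>Re y - Y\<bar><=\<bar>of_int n\<bar>*(Y/4)" by (intro mult_left_mono) auto
  then have "\<bar>of_int n*(Re y - Y)\<bar><=\<bar>of_int n\<bar>*(Y/4)" by (simp only: abs_mult)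
  then have "- (of_int n*(Re y - Y))<=\<bar>of_int n\<bar>*(Y/4)" by linarith
  then have "- (of_int n * Re y)<=\<bar>of_int n\<bar> * Y/4 - of_int n * Y" by (simp add: algebra_simps)
  then have "2*pi/24 * - (of_int n * Re y)<=2*pi/24*(\<bar>of_int n\<bar> * Y/4 - of_int n * Y)" by (intro mult_left_mono) auto
  moreover have "Re (- (2 * of_real pi * of_real (of_int n/24))*y) = 2*pi/24 * - (of_int n * Re y)" by simp
  ultimately show ?thesis unfolding pos_coeff_def S_def norm_mult norm_exp_eq_Re
   by (intro mult_left_mono) (simp_all only: exp_le_cancel_iff norm_ge_zero)
 qed
 moreover have "(%n. S n*exp (2*pi*\<bar>of_int n/24\<bar>*(Y/4))) summable_on I"
 proof -
  have "Complex 0 (Y/2) : uhp" using Y by (simp add: uhp_iff)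
  from has_sum_imp_summable[OF sum[OF this]]
  have s: "(%n. norm (ap n*qpow (of_int n/24) (Complex 0 (Y/2)))) summable_on I"
   by (simp add: summable_on_iff_abs_summable_on_complex)
  have 1: "(%n. S n*exp (2*pi*\<bar>of_int n/24\<bar>*(Y/4))) summable_on (I \<inter> {n. n > 0})"
  proof (rule summable_on_comparison_test)
   show "(%n. norm (ap n*qpow (of_int n/24) (Complex 0 (Y/2)))) summable_on (I \<inter> {n. n > 0})"
    by (rule summable_on_subset_banach[OF s]) auto
   fix n assume "n : I \<inter> {n. n > 0}"
   then have n: "n > 0" by simp
   show "S n*exp (2*pi*\<bar>of_int n/24\<bar>*(Y/4))<=norm (ap n*qpow (of_int n/24) (Complex 0 (Y/2)))"
    using n by (simp add: S_def norm_mult norm_qpow mult.assoc exp_add[symmetric]) (simp add: algebra_simps)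
  qed (simp add: S_def)
  have "(%n. S n*exp (2*pi*\<bar>of_int n/24\<bar>*(Y/4))) summable_on {n \<in> I. n<=0 & ap n ~= 0}"
   using fin by (rule summable_on_finite)
  then have "(%n. S n*exp (2*pi*\<bar>of_int n/24\<bar>*(Y/4))) summable_on (I \<inter> {n. n<=0})"
   by (rule summable_on_cong_neutral[THEN iffD1, rotated -1]) (auto simp: S_def)
  from summable_on_Un_disjoint[OF 1 this]
  have "(%n. S n*exp (2*pi*\<bar>of_int n/24\<bar>*(Y/4))) summable_on ((I \<inter> {n. n > 0}) \<union> (I \<inter> {n. n<=0}))" by fastforce
  moreover have "(I \<inter> {n. n > 0}) \<union> (I \<inter> {n. n<=0}) = I" by auto
  ultimately show ?thesis by (simp only:)
 qed
 moreover have "((%n. pos_coeff ap n (of_real (Im z))*exp (2 * of_real pi*\<i> * of_real (of_int n/24 * Re z))) has_sum f z) I"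
  if "z : ball w (Y/4)" for z
 proof -
  have "\<bar>Im w - Im z\<bar> < Y/4" using that abs_Im_le_cmod[of "w - z"] by (simp add: dist_norm)
  then have "z : uhp" using Y unfolding uhp_iff Y_def by linarith
  from sum[OF this] show ?thesis by (simp only: pos_coeff_def qpow_split mult.assoc)
 qed
 ultimately show ?thesis unfolding ffamily_def Y_def[symmetric]
  using Y I by (auto simp: pos_coeff_def[abs_def] intro!: holomorphic_intros exI[of _ S])
qed

lemma neg_argument_in_domain:
 assumes "n ~= (0::int)" "Y > 0" "y : ball (complex_of_real Y) (Y/2)"
 shows "of_real (pi * of_int n/6)*y : ig_domain"
proof -
 have "\<bar>Re y - Y\<bar> < Y/2" using assms abs_Re_le_cmod[of "y - of_real Y"] by (simp add: dist_norm norm_minus_commute)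
 then have "Re y ~= 0" using assms(2) by linarith
 then show ?thesis using assms(1) by (simp add: ig_domain_iff)
qed

lemma neg_coeff_deriv:
 assumes "n ~= (0::int)" "Y > 0" "y : ball (complex_of_real Y) (Y/2)"
 defines "a \<equiv> complex_of_real (pi * of_int n/6)"
 shows "(neg_coeff am n has_field_derivative a/2*neg_coeff am n y - am n * a * ig_kernel (a*y)*exp (a/2*y)) (at y)"
proof -
 have d: "a*y : ig_domain" unfolding a_def by (rule neg_argument_in_domain[OF assms(1-3)])
 have h: "of_real (pi * of_int n/12) = a/2" by (simp add: a_def)
 have l: "((%y. a*y) has_field_derivative a) (at y)" by (auto intro!: derivative_eq_intros)
 have e: "((%y. exp (a/2*y)) has_field_derivative exp (a/2*y)*(a/2)) (at y)"
  by (auto intro!: derivative_eq_intros)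
 from DERIV_mult[OF DERIV_cmult[OF DERIV_chain2[OF ig_ext_deriv[OF d] l], of "am n"] e]
 show ?thesis unfolding neg_coeff_def[abs_def] h a_def[symmetric] by (simp add: algebra_simps)
qed

lemma neg_coeff_holomorphic:
 assumes "n ~= 0" "Y > 0" shows "neg_coeff am n holomorphic_on ball (of_real Y) (Y/2)"
 unfolding holomorphic_on_open[OF open_ball] using neg_coeff_deriv[OF assms] by blast

lemma neg_coeff_deriv2:
 fixes am :: "int => complex"
 assumes "n ~= (0::int)" "Y > 0"
 defines "a \<equiv> complex_of_real (pi * of_int n/6)"
 defines "D \<equiv> am n * a * ig_kernel (a * of_real Y)*exp (a/2 * of_real Y)"
 shows "deriv (neg_coeff am n) (of_real Y) = a/2*neg_coeff am n (of_real Y) - D"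
  "deriv (deriv (neg_coeff am n)) (of_real Y) = a\<^sup>2/4*neg_coeff am n (of_real Y)+5/(2 * of_real Y)*D"
proof -
 let ?B = "ball (complex_of_real Y) (Y/2)"
 have yB: "of_real Y : ?B" using assms by simp
 have d1: "deriv (neg_coeff am n) y = a/2*neg_coeff am n y - am n * a * ig_kernel (a*y)*exp (a/2*y)" if "y : ?B" for y
  using DERIV_imp_deriv[OF neg_coeff_deriv[OF assms(1,2) that]] by (simp add: a_def)
 show 1: "deriv (neg_coeff am n) (of_real Y) = a/2*neg_coeff am n (of_real Y) - D"
  using d1[OF yB] by (simp add: D_def)
 have dom: "a * of_real Y : ig_domain" unfolding a_def by (rule neg_argument_in_domain[OF assms(1,2) yB])
 have a0: "a ~= 0" using assms(1) by (simp add: a_def)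
 have l: "((%y. a*y) has_field_derivative a) (at (of_real Y))" by (auto intro!: derivative_eq_intros)
 have e: "((%y. exp (a/2*y)) has_field_derivative exp (a/2 * of_real Y)*(a/2)) (at (of_real Y))"
  by (auto intro!: derivative_eq_intros)
 note k = DERIV_mult[OF DERIV_cmult[OF DERIV_chain2[OF ig_kernel_deriv[OF dom] l], of "am n * a"] e]
 have nc: "(neg_coeff am n has_field_derivative (a/2*neg_coeff am n (of_real Y) - D)) (at (of_real Y))"
  using neg_coeff_deriv[OF assms(1,2) yB] by (simp add: D_def a_def)
 have "((%y. a/2*neg_coeff am n y - am n * a * ig_kernel (a*y)*exp (a/2*y)) has_field_derivative
   a/2*(a/2*neg_coeff am n (of_real Y) - D) -
   (am n * a*(ig_kernel (a * of_real Y)*(- 1 - 5/(2*(a * of_real Y))) * a)*exp (a/2 * of_real Y)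
    + exp (a/2 * of_real Y)*(a/2)*(am n * a * ig_kernel (a * of_real Y)))) (at (of_real Y))"
  by (rule DERIV_diff[OF DERIV_cmult[OF nc] k])
 then have "(deriv (neg_coeff am n) has_field_derivative
   a/2*(a/2*neg_coeff am n (of_real Y) - D) -
   (am n * a*(ig_kernel (a * of_real Y)*(- 1 - 5/(2*(a * of_real Y))) * a)*exp (a/2 * of_real Y)
    + exp (a/2 * of_real Y)*(a/2)*(am n * a * ig_kernel (a * of_real Y)))) (at (of_real Y))"
  by (rule has_field_derivative_transform_within_open[OF _ open_ball yB]) (simp add: d1)
 then have "deriv (deriv (neg_coeff am n)) (of_real Y) = a/2*(a/2*neg_coeff am n (of_real Y) - D) -
   (am n * a*(ig_kernel (a * of_real Y)*(- 1 - 5/(2*(a * of_real Y))) * a)*exp (a/2 * of_real Y)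
    + exp (a/2 * of_real Y)*(a/2)*(am n * a * ig_kernel (a * of_real Y)))" by (rule DERIV_imp_deriv)
 also have "am n * a*(ig_kernel (a * of_real Y)*(- 1 - 5/(2*(a * of_real Y))) * a)*exp (a/2 * of_real Y)
    + exp (a/2 * of_real Y)*(a/2)*(am n * a * ig_kernel (a * of_real Y))
   = D*((- 1 - 5/(2*(a * of_real Y))) * a + a/2)" by (simp add: D_def algebra_simps)
 also have "(- 1 - 5/(2*(a * of_real Y))) * a + a/2 = - a/2 - 5/(2 * of_real Y)"
  using a0 assms(2) by (simp add: field_simps)
 finally show "deriv (deriv (neg_coeff am n)) (of_real Y) = a\<^sup>2/4*neg_coeff am n (of_real Y)+5/(2 * of_real Y)*D"
  by (simp add: power2_eq_square algebra_simps)
qed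

text \<open>In units of aY with a = pi n/6, the exponents are -15/16 from the incomplete Gamma
  function, 1/4 from absorbing its linear factor, 17/32 from the exponential and 1/32 from the
  weight; their sum is -1/8.\<close>

lemma neg_coeff_bound:
 assumes "n > (0::int)" "Y > 0" "y : ball (complex_of_real Y) (Y/16)"
 shows "norm (neg_coeff am n y)*exp (2*pi*\<bar>of_int n/24\<bar>*(Y/16))
 <=(pi/6*(15 * Y/16)) powr (- 5/2)*norm (am n)*exp (- (pi * of_int n/6)*(Y/8))"
proof -
 define c where "c = pi/6*(15 * Y/16)"
 have c: "c > 0" using assms by (simp add: c_def)
 define a where "a = pi * of_int n/6"
 have "real_of_int n >= 1" using assms(1) by simp
 then have a: "a >= pi/6" by (simp add: a_def)
 then have a0: "a > 0" using pi_gt_zero by linarith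
 have re: "\<bar>Re y - Y\<bar><=Y/16" "\<bar>Im y\<bar><=Y/16"
  using assms(3) abs_Re_le_cmod[of "y - of_real Y"] abs_Im_le_cmod[of "y - of_real Y"] by (auto simp: dist_norm norm_minus_commute)
 then have re': "15 * Y/16<=Re y" "Re y<=17 * Y/16" by linarith+
 have R: "a*(15 * Y/16)<=a * Re y" "a * Re y<=a*(17 * Y/16)"
  using mult_left_mono[OF re'(1), of a] mult_left_mono[OF re'(2), of a] a0 by auto
 have R0: "a * Re y > 0" using a0 re'(1) assms(2) by (intro mult_pos_pos) linarith+
 have cR: "c<=a * Re y"
  using mult_right_mono[OF a, of "15 * Y/16"] assms(2) R(1) unfolding c_def by linarith
 have "norm (ig_ext (of_real a*y))<=exp (- (a * Re y))*(a * Re y) powr (- 5/2)*(1+\<bar>a*Im y\<bar>)"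
  using ig_ext_norm[of "of_real a*y"] R0 by simp
 also have "...<=exp (- (a*(15 * Y/16))) * c powr (- 5/2)*exp (a*(Y/4))"
 proof (intro mult_mono)
  show "(a * Re y) powr (- 5/2)<=c powr (- 5/2)" using cR c by (intro powr_mono2') auto
  have "\<bar>a*Im y\<bar><=a*(Y/4)"
   using re(2) a0 assms(2) unfolding abs_mult by (intro mult_mono) auto
  then show "1+\<bar>a*Im y\<bar><=exp (a*(Y/4))" using exp_ge_add_one_self[of "a*(Y/4)"] by linarith
 qed (use R in auto)
 finally have 1: "norm (ig_ext (of_real a*y))<=exp (- (a*(15 * Y/16))) * c powr (- 5/2)*exp (a*(Y/4))" .
 have h: "pi * of_int n/12 = a/2" "2*pi*\<bar>of_int n/24\<bar> = a/2" using assms(1) by (simp_all add: a_def)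
 have 2: "norm (exp (complex_of_real (a/2)*y))<=exp (a/2*(17 * Y/16))"
  using R(2) by simp
 have "norm (neg_coeff am n y) = norm (am n)*norm (ig_ext (of_real a*y))*norm (exp (complex_of_real (a/2)*y))"
  unfolding neg_coeff_def h a_def[symmetric] norm_mult ..
 also have "...<=norm (am n)*(exp (- (a*(15 * Y/16))) * c powr (- 5/2)*exp (a*(Y/4)))*exp (a/2*(17 * Y/16))"
  by (intro mult_mono 1 2) auto
 finally have "norm (neg_coeff am n y)*exp (a/2*(Y/16))
  <=norm (am n)*(exp (- (a*(15 * Y/16))) * c powr (- 5/2)*exp (a*(Y/4)))*exp (a/2*(17 * Y/16))*exp (a/2*(Y/16))"
  by (intro mult_right_mono) auto
 also have "... = c powr (- 5/2)*norm (am n)*(exp (- (a*(15 * Y/16)))*exp (a*(Y/4))*exp (a/2*(17 * Y/16))*exp (a/2*(Y/16)))"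
  by (simp only: mult_ac)
 also have "exp (- (a*(15 * Y/16)))*exp (a*(Y/4))*exp (a/2*(17 * Y/16))*exp (a/2*(Y/16)) = exp (- a*(Y/8))"
  unfolding exp_add[symmetric] by (rule arg_cong[of _ _ exp]) (simp add: field_simps)
 finally show ?thesis unfolding h(2) by (simp only: c_def a_def)
qed

lemma neg_family:
 assumes fin: "finite {n. n<=0 & [n = -1] (mod 24) & am n ~= 0}"
  and sum: "!!z. z : uhp ==> ((%n. nonhol am n z) has_sum f z) negset"
  and w: "w : uhp"
 shows "ffamily w (Im w/16) negset (%n. - of_int n/24) (neg_coeff am) f"
proof -
 define Y where "Y = Im w"
 have Y: "Y > 0" using w by (simp add: Y_def uhp_iff)
 define B where "B = ball (complex_of_real Y) (Y/16)"
 have fm: "am n * inc_Gamma (1 - 5/2) (pi * of_int n*y/6) = am n * ig_ext (of_real (pi * of_int n/6) * of_real y)"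
  if "n : negset" "y > 0" for n y
 proof -
  have "pi * of_int n*y/6 ~= 0" using negset_nonzero[OF that(1)] that(2) by simp
  from ig_ext_eq[OF this] show ?thesis by simp
 qed
 have "\<exists>s. \<forall>y\<in>B. norm (neg_coeff am n y)<=s" if n: "n : negset" for n
 proof -
  have n0: "n ~= 0" by (rule negset_nonzero[OF n])
  have "cball (complex_of_real Y) (Y/16) \<subseteq> ball (of_real Y) (Y/2)" using Y by (simp add: cball_subset_ball_iff)
  then have "continuous_on (cball (of_real Y) (Y/16)) (neg_coeff am n)"
   by (rule continuous_on_subset[OF holomorphic_on_imp_continuous_on[OF neg_coeff_holomorphic[OF n0 Y]]])
  then have "bounded (neg_coeff am n ` cball (of_real Y) (Y/16))"
   by (intro compact_imp_bounded compact_continuous_image) auto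
  then obtain s where "\<forall>x\<in>neg_coeff am n ` cball (of_real Y) (Y/16). norm x<=s" unfolding bounded_iff by blast
  then show ?thesis unfolding B_def by (intro exI[of _ s]) auto
 qed
 then have "\<forall>n\<in>negset. \<exists>s. \<forall>y\<in>B. norm (neg_coeff am n y)<=s" by (rule ballI)
 from bchoice[OF this] obtain s where s: "!!n y. n : negset ==> y : B ==> norm (neg_coeff am n y)<=s n"
  by (elim exE) (rule that, drule bspec, assumption, erule bspec, assumption)
 define K where "K = (pi/6*(15 * Y/16)) powr (- 5/2)"
 define E where "E n = exp (2*pi*\<bar>- of_int n/24\<bar>*(Y/16))" for n :: int
 \<comment> \<open>For n > 0 the explicit decay is needed; at the finitely many nonpositive indices
   with nonzero coefficient a bound by compactness is enough.\<close>
 define S where "S n = (if n > 0 then K*norm (am n)*exp (- (pi * of_int n/6)*(Y/8))/E n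
   else if am n = 0 then 0 else s n)" for n
 have Sb: "norm (neg_coeff am n y)<=S n" if "n : negset" "y : B" for n y
 proof (cases "n > 0")
  case True
  have "norm (neg_coeff am n y)*E n<=K*norm (am n)*exp (- (pi * of_int n/6)*(Y/8))"
   using neg_coeff_bound[OF True Y that(2)[unfolded B_def], of am] by (simp add: E_def K_def)
  then show ?thesis using True by (simp add: S_def E_def pos_le_divide_eq)
 next
  case False
  then show ?thesis using s[OF that] by (simp add: S_def neg_coeff_def)
 qed
 have Ss: "(%n. S n*E n) summable_on negset"
 proof -
  \<comment> \<open>The height is chosen so that the lower bound e^(-4x)/4 at x = pi n y/6
    reproduces the decay exp(-(pi n/6) Y/8) of \<open>neg_coeff_bound\<close>.\<close>
  define y where "y = Y/32"
  have y: "y > 0" using Y by (simp add: y_def)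
  have "Complex 0 y : uhp" using y by (simp add: uhp_iff)
  from has_sum_imp_summable[OF sum[OF this]]
  have s1: "(%n. norm (am n * inc_Gamma (1 - 5/2) (pi * of_int n*y/6)*qpow (- of_int n/24) (Complex 0 y))) summable_on negset"
   by (simp add: summable_on_iff_abs_summable_on_complex)
  have 1: "(%n. S n*E n) summable_on (negset \<inter> {n. n > 0})"
  proof (rule summable_on_comparison_test)
   show "(%n. 4*K*norm (am n * inc_Gamma (1 - 5/2) (pi * of_int n*y/6)*qpow (- of_int n/24) (Complex 0 y))) summable_on (negset \<inter> {n. n > 0})"
    by (intro summable_on_cmult_right) (rule summable_on_subset_banach[OF s1], auto)
   fix n assume n: "n : negset \<inter> {n. n > 0}"
   define x where "x = pi * of_int n*y/6"
   have x: "x > 0" using n y by (simp add: x_def)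
   have "norm (inc_Gamma (1 - 5/2) x) = ig_real x"
    using inc_Gamma_pos[OF x] ig_real_bounds(1)[OF x] by simp
   then have g: "exp (- 4*x)/4<=norm (inc_Gamma (1 - 5/2) x)" using ig_real_lower[OF x] by simp
   have q: "1<=norm (qpow (- of_int n/24) (Complex 0 y))" using n y by (simp add: norm_qpow)
   have "exp (- 4*x)/4*1<=norm (inc_Gamma (1 - 5/2) x)*norm (qpow (- of_int n/24) (Complex 0 y))"
    using g q by (intro mult_mono) auto
   then have "4*K*(norm (am n)*(exp (- 4*x)/4*1))<=4*K*(norm (am n)*(norm (inc_Gamma (1 - 5/2) x)*norm (qpow (- of_int n/24) (Complex 0 y))))"
    by (intro mult_left_mono) (auto simp: K_def)
   moreover have "S n*E n = K*norm (am n)*exp (- 4*x)"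
    using n by (simp add: S_def E_def x_def y_def)
   ultimately show "S n*E n<=4*K*norm (am n * inc_Gamma (1 - 5/2) (pi * of_int n*y/6)*qpow (- of_int n/24) (Complex 0 y))"
    unfolding norm_mult x_def[symmetric] by (simp only: mult.assoc)
   show "0<=S n*E n" using n by (simp add: S_def E_def K_def)
  qed
  have "(%n. S n*E n) summable_on {n. n<=0 & [n = -1] (mod 24) & am n ~= 0}"
   using fin by (rule summable_on_finite)
  then have "(%n. S n*E n) summable_on (negset \<inter> {n. n<=0})"
   by (rule summable_on_cong_neutral[THEN iffD1, rotated -1]) (auto simp: S_def)
  from summable_on_Un_disjoint[OF 1 this]
  have "(%n. S n*E n) summable_on ((negset \<inter> {n. n > 0}) \<union> (negset \<inter> {n. n<=0}))" by fastforce
  moreover have "(negset \<inter> {n. n > 0}) \<union> (negset \<inter> {n. n<=0}) = negset" by auto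
  ultimately show ?thesis by (simp only:)
 qed
 have "((%n. neg_coeff am n (of_real (Im z))*exp (2 * of_real pi*\<i> * of_real (- of_int n/24 * Re z))) has_sum f z) negset"
  if "z : ball w (Y/16)" for z
 proof -
  have "\<bar>Im w - Im z\<bar> < Y/16" using that abs_Im_le_cmod[of "w - z"] by (simp add: dist_norm)
  then have z: "z : uhp" using Y unfolding uhp_iff Y_def by linarith
  have "nonhol am n z
    = neg_coeff am n (of_real (Im z))*exp (2 * of_real pi*\<i> * of_real (- of_int n/24 * Re z))" if n: "n : negset" for n
  proof -
   have "exp (- (2 * complex_of_real pi * of_real (- of_int n/24)) * of_real (Im z)) = exp (of_real (pi * of_int n/12) * of_real (Im z))"
    by (rule arg_cong[of _ _ exp]) simp
   then show ?thesis using z unfolding qpow_split neg_coeff_def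
    by (subst fm[OF n]) (simp_all only: uhp_iff mult.assoc)
  qed
  then show ?thesis using sum[OF z] by (rule has_sum_cong[THEN iffD1])
 qed
 moreover have "neg_coeff am n holomorphic_on ball (of_real Y) (Y/16)" if "n : negset" for n
  by (rule holomorphic_on_subset[OF neg_coeff_holomorphic[OF negset_nonzero[OF that] Y]]) (use Y in auto)
 ultimately show ?thesis unfolding ffamily_def Y_def[symmetric]
  using Y infinite_negset Sb[unfolded B_def] Ss[unfolded E_def] by (intro conjI exI[of _ S]) auto
qed

section \<open>Exponential sums: holomorphy, growth at the cusp, uniqueness\<close>

lemma exp_sum_holomorphic:
 assumes "infinite I" "finite {n \<in> I. n<=0 & b n ~= 0}"
  and sum: "!!z. z : uhp ==> ((%n. b n*qpow (of_int n/24) z) has_sum f z) I"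
 shows "f holomorphic_on uhp"
  and "!!w. w : uhp ==> has_wirt f (dx f w) 0 w"
proof -
 have w: "has_wirt f (dx f w) 0 w" if w: "w : uhp" for w
 proof -
  note F = pos_family[OF assms w]
  have r: "0 < Im w/8" "Im w/8 < Im w/4" using w by (auto simp: uhp_iff)
  define e where "e n = exp (2 * of_real pi*\<i> * of_real (of_int n/24 * Re w))" for n :: int
  have wb: "w : ball w (Im w/8)" using r by simp
  have x: "((%n. 2 * of_real pi*\<i> * of_real (of_int n/24)*pos_coeff b n (of_real (Im w))*e n) has_sum dx f w) I"
   using ffamily_wirt(2)[OF F r] wb by (simp add: ffamily_def e_def)
  have y: "((%n. deriv (pos_coeff b n) (of_real (Im w))*e n) has_sum dy f w) I"
   using ffamily_wirt(3)[OF F r] wb by (simp add: ffamily_def e_def)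
  have d: "deriv (pos_coeff b n) u = - (2 * of_real pi * of_real (of_int n/24))*pos_coeff b n u" for n u
   unfolding pos_coeff_def[abs_def] by (rule DERIV_imp_deriv) (auto intro!: derivative_eq_intros)
  have "((%n. \<i>*(deriv (pos_coeff b n) (of_real (Im w))*e n)) has_sum (\<i> * dy f w)) I" by (rule has_sum_cmult_right[OF y])
  then have "((%n. 2 * of_real pi*\<i> * of_real (of_int n/24)*pos_coeff b n (of_real (Im w))*e n+\<i>*(deriv (pos_coeff b n) (of_real (Im w))*e n)) has_sum (dx f w+\<i> * dy f w)) I"
   by (rule has_sum_add[OF x])
  then have "((%n. 0) has_sum (dx f w+\<i> * dy f w)) I" unfolding d by (simp add: mult_ac)
  moreover have "((%n. 0) has_sum (0::complex)) I" by (rule has_sum_0) simp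
  ultimately have z: "dx f w+\<i> * dy f w = 0" using has_sum_unique by blast
  then have h: "(dx f w - \<i> * dy f w)/2 = dx f w" by (simp add: add_eq_0_iff2)
  show ?thesis using ffamily_wirt(1)[OF F r wb] unfolding h z by simp
 qed
 show "!!w. w : uhp ==> has_wirt f (dx f w) 0 w" by (rule w)
 show "f holomorphic_on uhp" unfolding holomorphic_on_open[OF open_uhp]
  using has_wirt_zero_imp_field_derivative[OF w] by blast
qed

text \<open>Compare with the absolutely convergent sum at i: on raising the height from 1 to Im z
  every term shrinks at least as much as the term of lowest index n0.\<close>

lemma exp_sum_cusp_bound:
 assumes sum: "!!z. z : uhp ==> ((%n. b n*qpow (of_int n/24) z) has_sum f z) I"
  and supp: "!!n. n : I ==> n < n0 ==> b n = 0"
 obtains C where "C >= 0" "!!z. Im z >= 1 ==> norm (f z)<=C*exp (- (2*pi * of_int n0/24)*(Im z - 1))"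
proof -
 have iu: "\<i> : uhp" by (simp add: uhp_iff)
 have s: "(%n. norm (b n*qpow (of_int n/24) \<i>)) summable_on I"
  using has_sum_imp_summable[OF sum[OF iu]] by (simp add: summable_on_iff_abs_summable_on_complex)
 define C where "C = (\<Sum>\<^sub>\<infinity>n\<in>I. norm (b n*qpow (of_int n/24) \<i>))"
 have Cs: "((%n. norm (b n*qpow (of_int n/24) \<i>)) has_sum C) I" unfolding C_def by (rule has_sum_infsum[OF s])
 have "norm (f z)<=C*exp (- (2*pi * of_int n0/24)*(Im z - 1))" if z: "Im z >= 1" for z
 proof -
  have zu: "z : uhp" using z by (simp add: uhp_iff)
  have 1: "((%n. norm (b n*qpow (of_int n/24) \<i>)*exp (- (2*pi * of_int n0/24)*(Im z - 1))) has_sum C*exp (- (2*pi * of_int n0/24)*(Im z - 1))) I"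
   by (rule has_sum_cmult_left[OF Cs])
  have le: "norm (b n*qpow (of_int n/24) z)<=norm (b n*qpow (of_int n/24) \<i>)*exp (- (2*pi * of_int n0/24)*(Im z - 1))" if "n : I" for n
  proof (cases "n < n0")
   case True
   then show ?thesis using supp[OF that] by simp
  next
   case False
   then have "real_of_int n0*(Im z - 1)<=of_int n*(Im z - 1)" using z by (intro mult_right_mono) auto
   then have "pi*(real_of_int n0*(Im z - 1))<=pi*(of_int n*(Im z - 1))" by (intro mult_left_mono) auto
   then have "exp (- 2*pi*(of_int n/24)*Im z)<=exp (- 2*pi*(of_int n/24))*exp (- (2*pi * of_int n0/24)*(Im z - 1))"
    unfolding exp_add[symmetric] exp_le_cancel_iff by (simp add: field_simps)
   then have "norm (b n)*exp (- 2*pi*(of_int n/24)*Im z)<=norm (b n)*(exp (- 2*pi*(of_int n/24))*exp (- (2*pi * of_int n0/24)*(Im z - 1)))"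
    by (intro mult_left_mono) auto
   then show ?thesis by (simp add: norm_mult norm_qpow mult.assoc)
  qed
  have ab: "(%n. norm (b n*qpow (of_int n/24) z)) summable_on I"
   using has_sum_imp_summable[OF sum[OF zu]] by (simp add: summable_on_iff_abs_summable_on_complex)
  have "norm (f z) = norm (\<Sum>\<^sub>\<infinity>n\<in>I. b n*qpow (of_int n/24) z)" using infsumI[OF sum[OF zu]] by simp
  also have "...<=(\<Sum>\<^sub>\<infinity>n\<in>I. norm (b n*qpow (of_int n/24) z))" by (rule norm_infsum_bound[OF ab])
  also have "...<=C*exp (- (2*pi * of_int n0/24)*(Im z - 1))"
   by (rule has_sum_mono[OF has_sum_infsum[OF ab] 1 le])
  finally show ?thesis .
 qed
 moreover have "C >= 0" using Cs by (rule has_sum_nonneg) simp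
 ultimately show ?thesis using that by blast
qed

text \<open>Finiteness of the nonpositive support provides a lowest nonzero term. The remaining
  terms are smaller by a factor exp(-2 pi y/24) and cannot cancel it as y grows.\<close>

lemma exp_sum_unique:
 assumes fin: "finite {n \<in> I. n<=0 & b n ~= 0}"
  and sum: "!!z. z : uhp ==> ((%n. b n*qpow (of_int n/24) z) has_sum 0) I" and n: "n : I"
 shows "b n = 0"
proof (rule ccontr)
 assume bn: "b n ~= 0"
 define A where "A = {k \<in> I. k<=n & b k ~= 0}"
 have "A \<subseteq> {n \<in> I. n<=0 & b n ~= 0} \<union> {0..n}" by (auto simp: A_def)
 then have finA: "finite A" using fin finite_subset by blast
 have nA: "n : A" using n bn by (simp add: A_def)
 define m where "m = Min A"
 have mA: "m : A" unfolding m_def using finA nA by (intro Min_in) auto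
 have low: "b k = 0" if "k : I" "k < m" for k
 proof (rule ccontr)
  assume "b k ~= 0"
  then have "k : A" using that mA by (simp add: A_def)
  then have "m<=k" unfolding m_def using finA by (intro Min_le)
  then show False using that by simp
 qed
 define b' where "b' k = (if k = m then 0 else b k)" for k
 have m: "m : I" "b m ~= 0" using mA by (auto simp: A_def)
 have sum': "((%k. b' k*qpow (of_int k/24) z) has_sum (- (b m*qpow (of_int m/24) z))) I" if "z : uhp" for z
 proof -
  have "((%k. if k = m then b m*qpow (of_int m/24) z else 0) has_sum (b m*qpow (of_int m/24) z)) I"
   using has_sum_finite_neutralI[of "{m}" I "%k. if k = m then b m*qpow (of_int m/24) z else 0" "b m*qpow (of_int m/24) z"] m by auto
  from has_sum_add[OF sum[OF that] has_sum_neg[OF this]]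
  have "((%k. b k*qpow (of_int k/24) z + - (if k = m then b m*qpow (of_int m/24) z else 0)) has_sum (- (b m*qpow (of_int m/24) z))) I" by (simp only: add_0)
  then show ?thesis by (rule has_sum_congD) (auto simp: b'_def)
 qed
 obtain C where C: "C >= 0" "!!z. Im z >= 1 ==> norm (- (b m*qpow (of_int m/24) z))<=C*exp (- (2*pi * of_int (m+1)/24)*(Im z - 1))"
  by (rule exp_sum_cusp_bound[OF sum', of "m+1"]) (use low in \<open>force simp: b'_def\<close>)+
 define K where "K = C*exp (2*pi * of_int (m+1)/24)"
 have bd: "norm (b m)<=K*exp (- (2*pi/24)*y)" if y: "y >= 1" for y
 proof -
  have "norm (b m)*exp (- (2*pi * of_int m/24)*y)<=C*exp (- (2*pi * of_int (m+1)/24)*(y - 1))"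
   using C(2)[of "Complex 0 y"] y by (simp add: norm_mult norm_qpow)
  from mult_right_mono[OF this, of "exp ((2*pi * of_int m/24)*y)"]
  have "norm (b m)<=C*(exp (- (2*pi * of_int (m+1)/24)*(y - 1))*exp ((2*pi * of_int m/24)*y))"
   by (simp add: mult.assoc exp_add[symmetric])
  also have "exp (- (2*pi * of_int (m+1)/24)*(y - 1))*exp ((2*pi * of_int m/24)*y) = exp (2*pi * of_int (m+1)/24)*exp (- (2*pi/24)*y)"
   unfolding exp_add[symmetric] by (rule arg_cong[of _ _ exp]) (simp add: field_simps)
  finally show ?thesis by (simp add: K_def mult.assoc)
 qed
 have "((%y. K*exp (- (2*pi/24)*y)) \<longlongrightarrow> 0) at_top" using pi_gt_zero by real_asymp
 then have "eventually (%y. K*exp (- (2*pi/24)*y) < norm (b m)) at_top"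
  by (rule order_tendstoD) (use m in simp)
 then obtain y0 where y0: "!!y. y >= y0 ==> K*exp (- (2*pi/24)*y) < norm (b m)"
  by (auto simp: eventually_at_top_linorder)
 show False using bd[of "max 1 y0"] y0[of "max 1 y0"] by simp
qed

definition hexp :: "(complex => complex) => (int => complex) => (int => complex) => bool" where
 "hexp f ap am \<longleftrightarrow> finite {n. n<=0 & [n = 1] (mod 24) & ap n ~= 0} \<and>
    finite {n. n<=0 & [n = -1] (mod 24) & am n ~= 0} \<and>
    (\<forall>z\<in>uhp. \<exists>s t.
     ((%n. ap n*qpow (of_int n/24) z) has_sum s) posset \<and>
     ((%n. nonhol am n z)
       has_sum t) negset & f z = s + t)"

lemma hexp_parts:
 assumes "hexp f ap am"
 obtains P N where "!!z. z : uhp ==> ((%n. ap n*qpow (of_int n/24) z) has_sum P z) posset"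
  "!!z. z : uhp ==> ((%n. nonhol am n z) has_sum N z) negset"
  "!!z. z : uhp ==> f z = P z + N z"
  "finite {n \<in> posset. n<=0 & ap n ~= 0}" "finite {n. n<=0 & [n = -1] (mod 24) & am n ~= 0}"
proof -
 have "\<forall>z. \<exists>p. z : uhp \<longrightarrow> ((%n. ap n*qpow (of_int n/24) z) has_sum fst p) posset \<and>
  ((%n. nonhol am n z) has_sum snd p) negset & f z = fst p + snd p"
 proof
  fix z
  show "\<exists>p. z : uhp \<longrightarrow> ((%n. ap n*qpow (of_int n/24) z) has_sum fst p) posset \<and>
  ((%n. nonhol am n z) has_sum snd p) negset & f z = fst p + snd p"
  proof (cases "z : uhp")
   case True
   then obtain s t where "((%n. ap n*qpow (of_int n/24) z) has_sum s) posset \<and>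
    ((%n. nonhol am n z) has_sum t) negset & f z = s + t"
    using assms unfolding hexp_def by blast
   then show ?thesis by (intro exI[of _ "(s, t)"] impI) (simp only: fst_conv snd_conv)
  qed simp
 qed
 from choice[OF this] obtain p where p: "!!z. z : uhp ==> ((%n. ap n*qpow (of_int n/24) z) has_sum fst (p z)) posset"
  "!!z. z : uhp ==> ((%n. nonhol am n z) has_sum snd (p z)) negset"
  "!!z. z : uhp ==> f z = fst (p z) + snd (p z)" by blast
 show ?thesis
 proof (rule that[of "%z. fst (p z)" "%z. snd (p z)"])
  have "{n \<in> posset. n<=0 & ap n ~= 0} = {n. n<=0 & [n = 1] (mod 24) & ap n ~= 0}" by auto
  then show "finite {n \<in> posset. n<=0 & ap n ~= 0}" using assms by (simp only: hexp_def)
 qed (use p assms in \<open>auto simp: hexp_def\<close>)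
qed

text \<open>The ratio of a shadow coefficient to the coefficient of the expansion, up to
  conjugation. The power arises from a (ay)^(-5/2) with a = pi n/6, and i for negative n from the
  value of the kernel on the negative axis.\<close>

definition shadow_fac :: "int => complex" where
 "shadow_fac n = of_real (\<bar>pi * of_int n/6\<bar> powr (- 3/2))*(if n > 0 then 1 else \<i>)"

lemma shadow_kernel:
 assumes "n ~= (0::int)" "z : uhp"
 defines "a \<equiv> complex_of_real (pi * of_int n/6)"
 shows "a * ig_kernel (a * of_real (Im z))*exp (a/2 * of_real (Im z))*exp (2 * of_real pi*\<i> * of_real (- of_int n/24 * Re z))
  = of_real (Im z powr (- 5/2)) * shadow_fac n * cnj (qpow (of_int n/24) z)"
proof -
 define r where "r = pi * of_int n/6"
 define y where "y = Im z"
 have y: "y > 0" using assms by (simp add: y_def uhp_iff)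
 have r0: "r ~= 0" using assms by (simp add: r_def)
 have k: "a * ig_kernel (a * of_real y) = of_real (y powr (- 5/2)) * shadow_fac n * of_real (exp (- (r*y)))"
 proof -
  have ay: "a * of_real y = of_real (r*y)" by (simp add: a_def r_def)
  have pw: "\<bar>r\<bar>*\<bar>r*y\<bar> powr (- 5/2) = y powr (- 5/2)*\<bar>r\<bar> powr (- 3/2)"
  proof -
   have 1: "\<bar>r*y\<bar> powr (- 5/2) = \<bar>r\<bar> powr (- 5/2)*y powr (- 5/2)" using y by (simp add: abs_mult powr_mult)
   have 2: "\<bar>r\<bar>*\<bar>r\<bar> powr (- 5/2) = \<bar>r\<bar> powr (- 3/2)"
    using r0 powr_add[of "\<bar>r\<bar>" 1 "- 5/2"] by simp
   show ?thesis unfolding 1 mult.assoc[symmetric] 2 by (rule mult.commute)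
  qed
  show ?thesis
  proof (cases "n > 0")
   case True
   then have r: "r > 0" by (simp add: r_def)
   have "a * ig_kernel (a * of_real y) = of_real (\<bar>r\<bar>*\<bar>r*y\<bar> powr (- 5/2)*exp (- (r*y)))"
    unfolding ay using r y by (subst ig_kernel_pos) (simp_all add: a_def r_def)
   then show ?thesis unfolding pw using True by (simp add: shadow_fac_def r_def)
  next
   case False
   then have r: "r < 0" using assms(1) by (simp add: r_def mult_less_0_iff)
   then have ry: "r*y < 0" using y by (simp add: mult_less_0_iff)
   have "a = - of_real \<bar>r\<bar>" using r by (simp add: a_def r_def)
   then have "a * ig_kernel (a * of_real y) = \<i> * of_real (\<bar>r\<bar>*\<bar>r*y\<bar> powr (- 5/2)*exp (- (r*y)))"
    unfolding ay ig_kernel_neg[OF ry] by (simp add: mult_ac)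
   then show ?thesis unfolding pw using False by (simp add: shadow_fac_def r_def mult_ac)
  qed
 qed
 have c: "cnj (qpow (of_int n/24) z) = of_real (exp (- (r/2*y)))*exp (2 * of_real pi*\<i> * of_real (- of_int n/24 * Re z))"
 proof -
  have "cnj (qpow (of_int n/24) z) = exp (cnj (- (2 * of_real pi * of_real (of_int n/24)) * of_real (Im z)))*exp (cnj (2 * of_real pi*\<i> * of_real (of_int n/24 * Re z)))"
   by (simp only: qpow_split exp_cnj complex_cnj_mult)
  also have "cnj (- (2 * of_real pi * of_real (of_int n/24)) * of_real (Im z)) = of_real (- (r/2*y))" by (simp add: r_def y_def)
  also have "cnj (2 * of_real pi*\<i> * of_real (of_int n/24 * Re z)) = 2 * of_real pi*\<i> * of_real (- of_int n/24 * Re z)" by simp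
  finally show ?thesis by (simp only: exp_of_real)
 qed
 have "exp (a/2 * of_real y) = of_real (exp (r/2*y))" by (simp add: a_def r_def exp_of_real[symmetric])
 moreover have "of_real (exp (- (r*y))) * of_real (exp (r/2*y)) = (of_real (exp (- (r/2*y))) :: complex)"
  unfolding of_real_mult[symmetric] exp_add[symmetric] by (simp add: field_simps)
 ultimately show ?thesis unfolding y_def[symmetric] k c by (simp only: mult.assoc)
qed

text \<open>As q^(-n/24) is holomorphic, only the incomplete Gamma function is differentiated, and
  its derivative turns q^(-n/24) into y^(-5/2) times the conjugate of q^(n/24). Hence the derivative
  is y^(-5/2) times a conjugated q-series.\<close>

lemma neg_part_wirt:
 assumes fin: "finite {n. n<=0 & [n = -1] (mod 24) & am n ~= 0}"
  and sum: "!!z. z : uhp ==> ((%n. nonhol am n z) has_sum N z) negset"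
 obtains G p where "!!z. z : uhp ==> ((%n. cnj (am n * shadow_fac n)*qpow (of_int n/24) z) has_sum G z) negset"
  "!!z. z : uhp ==> has_wirt N (p z) (- \<i>/2 * of_real (Im z powr (- 5/2)) * cnj (G z)) z"
proof -
 define G where "G w = cnj ((dx N w+\<i> * dy N w)/(- \<i> * of_real (Im w powr (- 5/2))))" for w
 have G: "((%n. cnj (am n * shadow_fac n)*qpow (of_int n/24) w) has_sum G w) negset \<and>
  has_wirt N ((dx N w - \<i> * dy N w)/2) (- \<i>/2 * of_real (Im w powr (- 5/2)) * cnj (G w)) w" if w: "w : uhp" for w
 proof -
  define Y where "Y = Im w"
  have Y: "Y > 0" using w by (simp add: uhp_iff Y_def)
  note F = neg_family[OF fin sum w, folded Y_def]
  have r: "0 < Y/32" "Y/32 < Y/16" using Y by auto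
  have wb: "w : ball w (Y/32)" using Y by simp
  define e where "e n = exp (2 * of_real pi*\<i> * of_real (- of_int n/24 * Re w))" for n :: int
  have x: "((%n. 2 * of_real pi*\<i> * of_real (- of_int n/24)*neg_coeff am n (of_real Y)*e n) has_sum dx N w) negset"
   using ffamily_wirt(2)[OF F r] wb by (simp add: ffamily_def e_def Y_def)
  have y: "((%n. deriv (neg_coeff am n) (of_real Y)*e n) has_sum dy N w) negset"
   using ffamily_wirt(3)[OF F r] wb by (simp add: ffamily_def e_def Y_def)
  have "((%n. 2 * of_real pi*\<i> * of_real (- of_int n/24)*neg_coeff am n (of_real Y)*e n+\<i>*(deriv (neg_coeff am n) (of_real Y)*e n)) has_sum (dx N w+\<i> * dy N w)) negset"
   by (intro has_sum_add has_sum_cmult_right x y)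
  moreover have "2 * of_real pi*\<i> * of_real (- of_int n/24)*neg_coeff am n (of_real Y)*e n+\<i>*(deriv (neg_coeff am n) (of_real Y)*e n)
   = - \<i> * of_real (Y powr (- 5/2)) * cnj (cnj (am n * shadow_fac n)*qpow (of_int n/24) w)" if n: "n : negset" for n
  proof -
   have n0: "n ~= 0" by (rule negset_nonzero[OF n])
   define a where "a = complex_of_real (pi * of_int n/6)"
   have "2 * of_real pi*\<i> * of_real (- of_int n/24) = - \<i>*(a/2)" by (simp add: a_def)
   then have "2 * of_real pi*\<i> * of_real (- of_int n/24)*neg_coeff am n (of_real Y)*e n+\<i>*(deriv (neg_coeff am n) (of_real Y)*e n)
    = - \<i> * am n*(a * ig_kernel (a * of_real Y)*exp (a/2 * of_real Y)*e n)"
    unfolding neg_coeff_deriv2(1)[OF n0 Y, of am, folded a_def] by (simp only:) (simp add: algebra_simps)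
   also have "... = - \<i> * am n*(of_real (Y powr (- 5/2)) * shadow_fac n * cnj (qpow (of_int n/24) w))"
    using shadow_kernel[OF n0 w, folded a_def Y_def] by (simp only: e_def)
   finally show ?thesis by (simp add: mult_ac)
  qed
  ultimately have h: "((%n. - \<i> * of_real (Y powr (- 5/2)) * cnj (cnj (am n * shadow_fac n)*qpow (of_int n/24) w)) has_sum (dx N w+\<i> * dy N w)) negset"
   by (rule has_sum_congD)
  have nz: "- \<i> * complex_of_real (Y powr (- 5/2)) ~= 0" using Y by simp
  have "((%n. 1/(- \<i> * of_real (Y powr (- 5/2)))*(- \<i> * of_real (Y powr (- 5/2)) * cnj (cnj (am n * shadow_fac n)*qpow (of_int n/24) w))) has_sum
   (1/(- \<i> * of_real (Y powr (- 5/2)))*(dx N w+\<i> * dy N w))) negset" by (rule has_sum_cmult_right[OF h])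
  then have "((%n. cnj (cnj (am n * shadow_fac n)*qpow (of_int n/24) w)) has_sum cnj (G w)) negset"
   using nz by (simp add: G_def Y_def del: complex_cnj_mult)
  then have 1: "((%n. cnj (am n * shadow_fac n)*qpow (of_int n/24) w) has_sum G w) negset"
   unfolding has_sum_cnj_iff .
  have "(dx N w+\<i> * dy N w)/2 = - \<i>/2 * of_real (Y powr (- 5/2)) * cnj (G w)"
   using nz by (simp add: G_def Y_def)
  then show ?thesis using 1 ffamily_wirt(1)[OF F r wb] by (simp add: Y_def)
 qed
 show ?thesis by (rule that[OF G[THEN conjunct1] G[THEN conjunct2]])
qed

lemma hexp_wirt:
 assumes "hexp f ap am"
 obtains G p where "!!z. z : uhp ==> ((%n. cnj (am n * shadow_fac n)*qpow (of_int n/24) z) has_sum G z) negset"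
  "!!z. z : uhp ==> has_wirt f (p z) (- \<i>/2 * of_real (Im z powr (- 5/2)) * cnj (G z)) z"
proof -
 obtain P N where PN: "!!z. z : uhp ==> ((%n. ap n*qpow (of_int n/24) z) has_sum P z) posset"
  "!!z. z : uhp ==> ((%n. nonhol am n z) has_sum N z) negset"
  "!!z. z : uhp ==> f z = P z + N z"
  "finite {n \<in> posset. n<=0 & ap n ~= 0}" "finite {n. n<=0 & [n = -1] (mod 24) & am n ~= 0}"
 proof (rule hexp_parts[OF assms], goal_cases)
  case (1 P N)
  show ?case by (rule 1(1)[OF 1(2-6)])
 qed
 obtain G p where Gp: "!!z. z : uhp ==> ((%n. cnj (am n * shadow_fac n)*qpow (of_int n/24) z) has_sum G z) negset"
  "!!z. z : uhp ==> has_wirt N (p z) (- \<i>/2 * of_real (Im z powr (- 5/2)) * cnj (G z)) z"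
 proof (rule neg_part_wirt[OF PN(5,2)], goal_cases)
  case (2 G p)
  show ?case by (rule 2(1)[OF 2(2-3)])
 qed
 have "has_wirt f (dx P z + p z) (- \<i>/2 * of_real (Im z powr (- 5/2)) * cnj (G z)) z" if z: "z : uhp" for z
 proof (rule has_wirt_transform[OF _ open_uhp z])
  show "has_wirt (%z. P z + N z) (dx P z + p z) (- \<i>/2 * of_real (Im z powr (- 5/2)) * cnj (G z)) z"
   using has_wirt_add[OF exp_sum_holomorphic(2)[OF infinite_posset PN(4,1) z] Gp(2)[OF z]] by simp
 qed (use PN(3) in simp)
 with Gp(1) show ?thesis by (rule that)
qed

lemma hyp_laplacian_add:
 assumes "w : S" "open S" "!!z. z : S ==> \<exists>p q. has_wirt f p q z" "!!z. z : S ==> \<exists>p q. has_wirt g p q z"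
  "\<exists>p q. has_wirt (dx f) p q w" "\<exists>p q. has_wirt (dy f) p q w" "\<exists>p q. has_wirt (dx g) p q w" "\<exists>p q. has_wirt (dy g) p q w"
  "!!z. z : S ==> h z = f z + g z"
 shows "hyp_laplacian k h w = hyp_laplacian k f w + hyp_laplacian k g w"
proof -
 have xy: "dx h z = dx f z + dx g z & dy h z = dy f z + dy g z" if z: "z : S" for z
 proof -
  obtain p q p' q' where 1: "has_wirt f p q z" "has_wirt g p' q' z" using assms(3,4) z by blast
  have "has_wirt h (p + p') (q + q') z"
   by (rule has_wirt_transform[OF has_wirt_add[OF 1] assms(2) z]) (simp add: assms(9))
  then show ?thesis using 1 by (simp add: has_wirt_dx has_wirt_dy algebra_simps)
 qed
 obtain p q p' q' where x: "has_wirt (dx f) p q w" "has_wirt (dx g) p' q' w" using assms by blast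
 have hx: "has_wirt (dx h) (p + p') (q + q') w"
  by (rule has_wirt_transform[OF has_wirt_add[OF x] assms(2,1)]) (simp add: xy)
 obtain r s r' s' where y: "has_wirt (dy f) r s w" "has_wirt (dy g) r' s' w" using assms by blast
 have hy: "has_wirt (dy h) (r + r') (s + s') w"
  by (rule has_wirt_transform[OF has_wirt_add[OF y] assms(2,1)]) (simp add: xy)
 have "dx (dx h) w = dx (dx f) w + dx (dx g) w" using has_wirt_dx[OF hx] has_wirt_dx[OF x(1)] has_wirt_dx[OF x(2)] by simp
 moreover have "dy (dy h) w = dy (dy f) w + dy (dy g) w"
  unfolding has_wirt_dy[OF hy] has_wirt_dy[OF y(1)] has_wirt_dy[OF y(2)] by (simp add: algebra_simps)
 ultimately show ?thesis unfolding hyp_laplacian_def using xy[OF assms(1)] by (simp add: algebra_simps)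
qed

text \<open>Both halves are locally families, so they are analytic and may be differentiated
  termwise, and each frequency solves the ordinary differential equation in y. For the constructed
  functions this leaves the expansion and the transformation law to be proved.\<close>

lemma hexp_analytic_harmonic:
 assumes "hexp f ap am"
 shows "real_analytic_on_uhp f" "w : uhp ==> hyp_laplacian (5/2) f w = 0"
proof -
 obtain P N where PN: "!!z. z : uhp ==> ((%n. ap n*qpow (of_int n/24) z) has_sum P z) posset"
  "!!z. z : uhp ==> ((%n. nonhol am n z) has_sum N z) negset"
  "!!z. z : uhp ==> f z = P z + N z"
  "finite {n \<in> posset. n<=0 & ap n ~= 0}" "finite {n. n<=0 & [n = -1] (mod 24) & am n ~= 0}"
 proof (rule hexp_parts[OF assms], goal_cases)
  case (1 P N)
  show ?case by (rule 1(1)[OF 1(2-6)])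
 qed
 have FP: "!!w. w : uhp ==> ffamily w (Im w/4) posset (%n. of_int n/24) (pos_coeff ap) P"
  by (rule pos_family[OF infinite_posset PN(4,1)])
 have FN: "!!w. w : uhp ==> ffamily w (Im w/16) negset (%n. - of_int n/24) (neg_coeff am) N"
  by (rule neg_family[OF PN(5,2)])
 have ball_uhp: "ball w (Im w) \<subseteq> uhp" if "w : uhp" for w
 proof
  fix z assume "z : ball w (Im w)"
  then have "\<bar>Im w - Im z\<bar> < Im w" using abs_Im_le_cmod[of "w - z"] by (simp add: dist_norm)
  then show "z : uhp" by (simp add: uhp_iff)
 qed
 show "real_analytic_on_uhp f" unfolding real_analytic_on_uhp_def
 proof
  fix w assume w: "w : uhp"
  have "real_analytic_at (%z. P z + N z) w"
   by (rule real_analytic_at_add[OF ffamily_real_analytic[OF FP[OF w]] ffamily_real_analytic[OF FN[OF w]]])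
  then obtain r a where r: "r > 0" "\<forall>z\<in>ball w r. ((%(m, n). a m n * of_real ((Re z - Re w)^m*(Im z - Im w)^n)) has_sum (P z + N z)) UNIV"
   unfolding real_analytic_at_def by blast
  have "\<forall>z\<in>ball w (min r (Im w)). ((%(m, n). a m n * of_real ((Re z - Re w)^m*(Im z - Im w)^n)) has_sum f z) UNIV"
   using r(2) ball_uhp[OF w] PN(3) by (auto simp: subset_iff)
  moreover have "min r (Im w) > 0" using r w by (simp add: uhp_iff)
  ultimately show "\<exists>r>0. \<exists>a. \<forall>z\<in>ball w r. ((%(m, n). a m n * of_real ((Re z - Re w)^m*(Im z - Im w)^n)) has_sum f z) UNIV" by blast
 qed
 assume w: "w : uhp"
 define Y where "Y = Im w"
 have Y: "Y > 0" using w by (simp add: uhp_iff Y_def)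
 have r: "0 < Y/8" "Y/8 < Y/4" "0 < Y/32" "Y/32 < Y/16" "0 < Y/64" "Y/64 < Y/8" "Y/64 < Y/32" using Y by auto
 note FPw = FP[OF w, folded Y_def] and FNw = FN[OF w, folded Y_def]
 have ww: "w : ball w (Y/64)" using r by simp
 have "hyp_laplacian (5/2) f w = hyp_laplacian (5/2) P w + hyp_laplacian (5/2) N w"
 proof (rule hyp_laplacian_add[of w "ball w (Y/32)"])
  show "\<exists>p q. has_wirt P p q z" if "z : ball w (Y/32)" for z
  proof -
   have "z : ball w (Y/8)" using that Y by simp
   from ffamily_wirt(1)[OF FPw r(1,2) this] show ?thesis by blast
  qed
  show "\<exists>p q. has_wirt N p q z" if "z : ball w (Y/32)" for z
   using ffamily_wirt(1)[OF FNw r(3,4) that] by blast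
  show "\<exists>p q. has_wirt (dx P) p q w" using ffamily_wirt(1)[OF ffamily_wirt(2)[OF FPw r(1,2)] r(5,6) ww] by blast
  show "\<exists>p q. has_wirt (dy P) p q w" using ffamily_wirt(1)[OF ffamily_wirt(3)[OF FPw r(1,2)] r(5,6) ww] by blast
  show "\<exists>p q. has_wirt (dx N) p q w" using ffamily_wirt(1)[OF ffamily_wirt(2)[OF FNw r(3,4)] r(5,7) ww] by blast
  show "\<exists>p q. has_wirt (dy N) p q w" using ffamily_wirt(1)[OF ffamily_wirt(3)[OF FNw r(3,4)] r(5,7) ww] by blast
  show "f z = P z + N z" if "z : ball w (Y/32)" for z
   using that ball_uhp[OF w] Y PN(3) by (auto simp: subset_iff Y_def)
 qed (use r in auto)
 also have "hyp_laplacian (5/2) P w = 0"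
 proof (rule ffamily_laplacian[OF FPw])
  fix n :: int
  define c where "c = - (2 * complex_of_real pi * of_real (of_int n/24))"
  have d: "deriv (pos_coeff ap n) u = c*pos_coeff ap n u" for u
   unfolding pos_coeff_def[abs_def] c_def by (rule DERIV_imp_deriv) (auto intro!: derivative_eq_intros)
  have "(pos_coeff ap n has_field_derivative c*pos_coeff ap n u) (at u)" for u
   unfolding pos_coeff_def[abs_def] c_def by (auto intro!: derivative_eq_intros)
  then have dd: "deriv (deriv (pos_coeff ap n)) u = c*(c*pos_coeff ap n u)" for u
   unfolding d[abs_def] by (intro DERIV_imp_deriv DERIV_cmult)
  have i: "2 * of_real pi*\<i> * of_real (of_int n/24) = - \<i> * c" by (simp add: c_def)
  show "- of_real ((Im w)\<^sup>2)*((2 * of_real pi*\<i> * of_real (of_int n/24))\<^sup>2*pos_coeff ap n (of_real (Im w)) + deriv (deriv (pos_coeff ap n)) (of_real (Im w)))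
   +\<i> * of_real (5/2*Im w)*(2 * of_real pi*\<i> * of_real (of_int n/24)*pos_coeff ap n (of_real (Im w))+\<i> * deriv (pos_coeff ap n) (of_real (Im w))) = 0"
   unfolding i dd d by (simp add: power2_eq_square algebra_simps)
 qed
 also have "hyp_laplacian (5/2) N w = 0"
 proof (rule ffamily_laplacian[OF FNw])
  fix n assume n: "n : negset"
  have n0: "n ~= 0" by (rule negset_nonzero[OF n])
  define a where "a = complex_of_real (pi * of_int n/6)"
  have i: "2 * of_real pi*\<i> * of_real (- of_int n/24) = - \<i>*(a/2)" by (simp add: a_def)
  have Y0: "complex_of_real Y ~= 0" using Y by simp
  have alg: "- of_real (y\<^sup>2)*((- \<i>*(a/2))\<^sup>2*C+(a\<^sup>2/4*C+5/(2 * of_real y)*D))+\<i> * of_real (5/2*y)*(- \<i>*(a/2)*C+\<i>*(a/2*C - D)) = 0"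
   if "complex_of_real y ~= 0" for C D a :: complex and y
   using that by (simp add: power2_eq_square field_simps)
  show "- of_real ((Im w)\<^sup>2)*((2 * of_real pi*\<i> * of_real (- of_int n/24))\<^sup>2*neg_coeff am n (of_real (Im w)) + deriv (deriv (neg_coeff am n)) (of_real (Im w)))
   +\<i> * of_real (5/2*Im w)*(2 * of_real pi*\<i> * of_real (- of_int n/24)*neg_coeff am n (of_real (Im w))+\<i> * deriv (neg_coeff am n) (of_real (Im w))) = 0"
   unfolding i Y_def[symmetric] neg_coeff_deriv2[OF n0 Y, of am, folded a_def] by (rule alg[OF Y0])
 qed
 finally show "hyp_laplacian (5/2) f w = 0" by simp
qed

section \<open>Uniqueness and holomorphic forms\<close>

lemma weak_harmonic_iff:
 "f : weak_harmonic_Maass_forms (5/2) \<longleftrightarrow> (\<forall>z. z \<notin> uhp \<longrightarrow> f z = 0) \<and>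
  transforms_like (5/2) eta_mult f & (\<exists>ap am. hexp f ap am)"
proof -
 have "f : weak_harmonic_Maass_forms (5/2) \<longleftrightarrow> (\<forall>z. z \<notin> uhp \<longrightarrow> f z = 0) \<and>
  real_analytic_on_uhp f & transforms_like (5/2) eta_mult f \<and>
  (\<forall>z\<in>uhp. hyp_laplacian (5/2) f z = 0) & (\<exists>ap am. hexp f ap am)"
  unfolding weak_harmonic_Maass_forms_def hexp_def mem_Collect_eq by (rule refl)
 then show ?thesis using hexp_analytic_harmonic by blast
qed

lemma hexp_add_scaled:
 assumes "hexp f ap am" "hexp g bp bm"
 shows "hexp (%z. f z + c*g z) (%n. ap n + c * bp n) (%n. am n + c * bm n)"
proof -
 have fin: "finite {n. n<=0 & [n = k] (mod 24) & u n + c * v n ~= 0}"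
  if "finite {n. n<=0 & [n = k] (mod 24) & u n ~= 0}" "finite {n. n<=0 & [n = k] (mod 24) & v n ~= 0}"
  for k :: int and u v :: "int => complex"
  by (rule finite_subset[OF _ finite_UnI[OF that]]) auto
 show ?thesis unfolding hexp_def
 proof (intro conjI ballI)
  show "finite {n. n<=0 & [n = 1] (mod 24) & ap n + c * bp n ~= 0}"
   using assms by (intro fin) (simp_all add: hexp_def)
  show "finite {n. n<=0 & [n = -1] (mod 24) & am n + c * bm n ~= 0}"
   using assms by (intro fin) (simp_all add: hexp_def)
  fix z assume z: "z : uhp"
  obtain s t where st: "((%n. ap n*qpow (of_int n/24) z) has_sum s) posset"
   "((%n. nonhol am n z) has_sum t) negset" "f z = s + t"
   using assms(1) z unfolding hexp_def by blast
  obtain s' t' where st': "((%n. bp n*qpow (of_int n/24) z) has_sum s') posset"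
   "((%n. bm n*gam n z*qpow (- of_int n/24) z) has_sum t') negset" "g z = s' + t'"
   using assms(2) z unfolding hexp_def by blast
  have "((%n. (ap n + c * bp n)*qpow (of_int n/24) z) has_sum (s + c * s')) posset"
   using has_sum_add[OF st(1) has_sum_cmult_right[OF st'(1), of c]]
   by (rule has_sum_congD) (simp only: algebra_simps)
  moreover have "((%n. (am n + c * bm n)*gam n z*qpow (- of_int n/24) z) has_sum (t + c * t')) negset"
   using has_sum_add[OF st(2) has_sum_cmult_right[OF st'(2), of c]]
   by (rule has_sum_congD) (simp only: distrib_right mult.assoc)
  moreover have "f z + c*g z = (s + c * s')+(t + c * t')" using st(3) st'(3) by (simp add: algebra_simps)
  ultimately show "\<exists>s t. ((%n. (ap n + c * bp n)*qpow (of_int n/24) z) has_sum s) posset \<and>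
   ((%n. (am n + c * bm n)*gam n z*qpow (- of_int n/24) z) has_sum t) negset \<and>
   f z + c*g z = s + t" by blast
 qed
qed

lemma shadow_fac_nonzero: "n ~= 0 ==> shadow_fac n ~= 0"
 by (simp add: shadow_fac_def)

text \<open>The shadow of 0 is 0, which kills the nonholomorphic coefficients by uniqueness of
  q-series; what is left is a q-series again. This makes the coefficients of a form well
  defined.\<close>

lemma hexp_coeffs_zero:
 assumes h: "hexp f ap am" and z: "!!z. z : uhp ==> f z = 0"
 shows "n : negset ==> am n = 0" and "n : posset ==> ap n = 0"
proof -
 obtain P N where PN: "!!z. z : uhp ==> ((%n. ap n*qpow (of_int n/24) z) has_sum P z) posset"
  "!!z. z : uhp ==> ((%n. nonhol am n z) has_sum N z) negset"
  "!!z. z : uhp ==> f z = P z + N z"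
  "finite {n \<in> posset. n<=0 & ap n ~= 0}" "finite {n. n<=0 & [n = -1] (mod 24) & am n ~= 0}"
 proof (rule hexp_parts[OF h], goal_cases)
  case (1 P N)
  show ?case by (rule 1(1)[OF 1(2-6)])
 qed
 obtain G p where Gp: "!!z. z : uhp ==> ((%n. cnj (am n * shadow_fac n)*qpow (of_int n/24) z) has_sum G z) negset"
  "!!z. z : uhp ==> has_wirt f (p z) (- \<i>/2 * of_real (Im z powr (- 5/2)) * cnj (G z)) z"
 proof (rule hexp_wirt[OF h], goal_cases)
  case (1 G p)
  show ?case by (rule 1(1)[OF 1(2-3)])
 qed
 have G0: "G z = 0" if "z : uhp" for z
 proof -
  have "has_wirt (%z. 0) 0 0 z" by (rule has_wirt_holomorphic) simp
  then have "has_wirt f 0 0 z" by (rule has_wirt_transform[OF _ open_uhp that]) (simp add: z)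
  from has_wirt_unique[OF Gp(2)[OF that] this] show ?thesis using that by (simp add: uhp_iff)
 qed
 have fin: "finite {n \<in> negset. n<=0 & cnj (am n * shadow_fac n) ~= 0}"
  by (rule finite_subset[OF _ PN(5)]) auto
 have G1: "((%n. cnj (am n * shadow_fac n)*qpow (of_int n/24) z) has_sum 0) negset" if "z : uhp" for z
  using Gp(1)[OF that] unfolding G0[OF that] .
 have am: "am n = 0" if "n : negset" for n
  using exp_sum_unique[OF fin G1 that] shadow_fac_nonzero[OF negset_nonzero[OF that]] by simp
 have "((%n. ap n*qpow (of_int n/24) z) has_sum 0) posset" if "z : uhp" for z
 proof -
  have "((%n. nonhol am n z) has_sum 0) negset"
   by (rule has_sum_0) (simp add: am)
  then have "N z = 0" using PN(2)[OF that] has_sum_unique by blast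
  then have "P z = 0" using PN(3)[OF that] z[OF that] by simp
  then show ?thesis using PN(1)[OF that] by (simp only:)
 qed
 then show "n : posset ==> ap n = 0" by (rule exp_sum_unique[OF PN(4)])
 show "n : negset ==> am n = 0" by (rule am)
qed

text \<open>Differentiate phi(gamma z) = j^2 phi(z) in the conjugate variable, with j = cz + d: the
  factor j^2 is holomorphic and passes through, and the chain rule puts the conjugate of j^(-2) on
  the left.\<close>

lemma wirt_weight2:
 assumes mod: "mweight 2 \<phi>" and w: "!!z. z : uhp ==> has_wirt \<phi> (p z) (q z) z"
  and det: "a * d - b * c = 1" and z: "z : uhp"
 shows "q (moeb a b c d z) = of_real (norm (jf c d z)^4)*q z"
proof -
 let ?J = "jf c d z"
 have J0: "?J ~= 0" by (rule det_jf_nonzero[OF z det])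
 have 1: "has_wirt (%z. \<phi> (moeb a b c d z)) (p (moeb a b c d z)*(1/?J\<^sup>2)) (q (moeb a b c d z) * cnj (1/?J\<^sup>2)) z"
  by (rule has_wirt_compose[OF w[OF moebius_in_uhp[OF det z]] moebius_has_field_derivative[OF det z]])
 have d: "((%z. jf c d z^2) has_field_derivative 2 * ?J * of_int c) (at z)"
  unfolding jf_def by (auto intro!: derivative_eq_intros)
 have 2: "has_wirt (%z. jf c d z^2*\<phi> z) (?J^2*p z+2 * ?J * of_int c*\<phi> z) (?J^2*q z+0*\<phi> z) z"
  by (rule has_wirt_mult[OF has_wirt_holomorphic[OF d] w[OF z]])
 have 3: "has_wirt (%z. \<phi> (moeb a b c d z)) (?J^2*p z+2 * ?J * of_int c*\<phi> z) (?J^2*q z+0*\<phi> z) z"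
  by (rule has_wirt_transform[OF 2 open_uhp z]) (simp add: modular_weightD[OF mod det])
 from has_wirt_unique[OF 1 3, THEN conjunct2]
 have "q (moeb a b c d z) * cnj (1/?J\<^sup>2) = ?J^2*q z" by (simp only: mult_zero_left add_0_right)
 then have "q (moeb a b c d z) = (?J * cnj ?J)\<^sup>2*q z" using J0 by (simp add: field_simps)
 also have "?J * cnj ?J = of_real ((norm ?J)\<^sup>2)" by (simp only: complex_norm_square)
 finally show ?thesis by (simp flip: of_real_power power_mult)
qed

lemma powr_52_scale:
 assumes "J > 0" "y > (0::real)"
 shows "(y/J\<^sup>2) powr (- 5/2) = J^5*y powr (- 5/2)"
proof -
 have "(J\<^sup>2) powr (- 5/2) = J powr (- 5)"
  using assms powr_powr[of J 2 "- 5/2"] by (simp add: powr_numeral)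
 also have "... = 1/J^5" using assms powr_minus[of J 5] by (simp add: powr_numeral inverse_eq_divide)
 finally have "(J\<^sup>2) powr (- 5/2) = 1/J^5" .
 then show ?thesis using assms powr_divide[of y "J\<^sup>2" "- 5/2"] by simp
qed

text \<open>The conjugate derivative of f/eta acquires |j|^4 by \<open>wirt_weight2\<close>.
  Im^(-5/2) acquires |j|^5 and |eta|^(-2) acquires |j|^(-1), which is the same factor, so the
  conjugate of G eta is invariant.\<close>

lemma shadow_modular:
 assumes tr: "transforms_like (5/2) eta_mult f"
  and w: "!!z. z : uhp ==> has_wirt f (p z) (- \<i>/2 * of_real (Im z powr (- 5/2)) * cnj (G z)) z"
 shows "mweight 0 (%z. G z*eta z)"
 unfolding mweight_def
proof (intro allI impI)
 fix a b c d :: int and z assume det: "a * d - b * c = 1" and z: "z : uhp"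
 define g where "g = moeb a b c d z"
 have g: "g : uhp" unfolding g_def by (rule moebius_in_uhp[OF det z])
 have mod: "mweight 2 (%z. f z*(1/eta z))" using tr unfolding transforms_like_52 by simp
 define Q where "Q z = f z*0 + - \<i>/2 * of_real (Im z powr (- 5/2)) * cnj (G z)*(1/eta z)" for z
 have wQ: "has_wirt (%z. f z*(1/eta z)) (f z * deriv (%z. 1/eta z) z + p z*(1/eta z)) (Q z) z" if z: "z : uhp" for z
 proof -
  have "(%z. 1/eta z) holomorphic_on uhp" using eta_nonzero eta_holomorphic by (intro holomorphic_intros) auto
  then have "((%z. 1/eta z) has_field_derivative deriv (%z. 1/eta z) z) (at z)" using z by (intro holomorphic_derivI[OF _ open_uhp]) auto
  then show ?thesis unfolding Q_def by (rule has_wirt_mult[OF w[OF z] has_wirt_holomorphic])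
 qed
 have Qe: "Q z = - \<i>/2 * of_real (Im z powr (- 5/2)/(norm (eta z))\<^sup>2) * cnj (G z*eta z)" if "z : uhp" for z
 proof -
  have "complex_of_real ((norm (eta z))\<^sup>2) = eta z * cnj (eta z)" by (simp only: complex_norm_square)
  then show ?thesis using eta_nonzero[OF that] by (simp add: Q_def)
 qed
 define J where "J = norm (jf c d z)"
 have J: "J > 0" using det_jf_nonzero[OF z det] by (simp add: J_def)
 have y: "Im z > 0" "norm (eta z) > 0" using z eta_nonzero[OF z] by (auto simp: uhp_iff)
 have "Im g powr (- 5/2)/(norm (eta g))\<^sup>2 = J^4*(Im z powr (- 5/2)/(norm (eta z))\<^sup>2)"
  unfolding g_def Im_moebius[OF det] norm_eta_moebius[OF det z] J_def[symmetric] powr_52_scale[OF J y(1)]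
  using J y by (simp add: field_simps power_numeral_reduce)
 moreover have "Q g = of_real (J^4) * Q z" unfolding g_def J_def by (rule wirt_weight2[OF mod wQ det z])
 ultimately have "- \<i>/2 * of_real (J^4*(Im z powr (- 5/2)/(norm (eta z))\<^sup>2)) * cnj (G g*eta g)
  = of_real (J^4)*(- \<i>/2 * of_real (Im z powr (- 5/2)/(norm (eta z))\<^sup>2) * cnj (G z*eta z))"
  unfolding Qe[OF z] Qe[OF g] by (simp only:)
 also have "... = - \<i>/2 * of_real (J^4*(Im z powr (- 5/2)/(norm (eta z))\<^sup>2)) * cnj (G z*eta z)" by simp
 finally have "cnj (G g*eta g) = cnj (G z*eta z)" using J y by (simp del: complex_cnj_mult)
 then have "G g*eta g = G z*eta z" by (simp only: complex_cnj_cancel_iff)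
 then show "G (moeb a b c d z)*eta (moeb a b c d z) = jf c d z^0*(G z*eta z)" by (simp add: g_def)
qed

lemma eta_cusp_bound:
 obtains C where "C > 0" "!!z. Im z >= 1 ==> norm (eta z)<=C*exp (- (2*pi/24)*Im z)"
proof -
 obtain C where C: "C > 0" "!!z. Im z >= 1 ==> norm (ephi (qpow 1 z))<=C" using q_function_bounded[OF ephi_holomorphic] by metis
 have "norm (eta z)<=C*exp (- (2*pi/24)*Im z)" if "Im z >= 1" for z
  using mult_right_mono[OF C(2)[OF that], of "exp (- (2*pi/24)*Im z)"] by (simp add: eta_ephi norm_mult norm_qpow mult.commute)
 then show ?thesis using C(1) that by blast
qed

lemma inverse_eta_cusp_bound:
 obtains C where "C > 0" "!!z. Im z >= 1 ==> norm (1/eta z)<=C*exp ((2*pi/24)*Im z)"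
proof -
 have "(%q. 1/ephi q) holomorphic_on ball 0 1" using ephi_nonzero ephi_holomorphic by (intro holomorphic_intros) auto
 from q_function_bounded[OF this]
 obtain C where C: "C > 0" "!!z. Im z >= 1 ==> norm (1/ephi (qpow 1 z))<=C" by metis
 have "norm (1/eta z)<=C*exp ((2*pi/24)*Im z)" if "Im z >= 1" for z
 proof -
  have "norm (1/eta z) = norm (1/ephi (qpow 1 z))*exp ((2*pi/24)*Im z)"
   by (simp add: eta_ephi norm_mult norm_divide norm_qpow exp_minus field_simps)
  then show ?thesis using mult_right_mono[OF C(2)[OF that], of "exp ((2*pi/24)*Im z)"] by simp
 qed
 then show ?thesis using C(1) that by blast
qed

lemma hexp_vanishing:
 assumes h: "hexp f ap am" and tr: "transforms_like (5/2) eta_mult f"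
  and ap: "!!n. n : posset ==> n<=0 ==> ap n = 0" and am: "!!n. n : negset ==> n<=0 ==> am n = 0"
  and z0: "z0 : uhp"
 shows "f z0 = 0"
proof -
 obtain P N where PN: "!!z. z : uhp ==> ((%n. ap n*qpow (of_int n/24) z) has_sum P z) posset"
  "!!z. z : uhp ==> ((%n. nonhol am n z) has_sum N z) negset"
  "!!z. z : uhp ==> f z = P z + N z"
  "finite {n \<in> posset. n<=0 & ap n ~= 0}" "finite {n. n<=0 & [n = -1] (mod 24) & am n ~= 0}"
 proof (rule hexp_parts[OF h], goal_cases)
  case (1 P N)
  show ?case by (rule 1(1)[OF 1(2-6)])
 qed
 obtain G p where Gp: "!!z. z : uhp ==> ((%n. cnj (am n * shadow_fac n)*qpow (of_int n/24) z) has_sum G z) negset"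
  "!!z. z : uhp ==> has_wirt f (p z) (- \<i>/2 * of_real (Im z powr (- 5/2)) * cnj (G z)) z"
 proof (rule hexp_wirt[OF h], goal_cases)
  case (1 G p)
  show ?case by (rule 1(1)[OF 1(2-3)])
 qed
 have fin: "finite {n \<in> negset. n<=0 & cnj (am n * shadow_fac n) ~= 0}"
  by (rule finite_subset[OF _ PN(5)]) auto
 have Gh: "G holomorphic_on uhp" by (rule exp_sum_holomorphic(1)[OF infinite_negset fin Gp(1)])
 obtain C where C: "C >= 0" "!!z. Im z >= 1 ==> norm (G z)<=C*exp (- (2*pi * of_int 1/24)*(Im z - 1))"
  by (rule exp_sum_cusp_bound[OF Gp(1), of 1]) (auto simp: am)
 obtain E where E: "E > 0" "!!z. Im z >= 1 ==> norm (eta z)<=E*exp (- (2*pi/24)*Im z)" using eta_cusp_bound by blast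
 have cG: "tendsto_cusp (%z. G z*eta z)"
 proof (rule tendsto_cusp_exp)
  fix z assume z: "Im z >= 1"
  have "norm (G z)<=C*exp 0" using C(2)[OF z] by (rule order_trans) (intro mult_left_mono, use z C(1) in auto)
  then have "norm (G z)*norm (eta z)<=C*(E*exp (- (2*pi/24)*Im z))"
   using E(2)[OF z] by (intro mult_mono) (use C(1) in auto)
  then show "norm (G z*eta z)<=(C*E)*exp (- (2*pi/24)*Im z)" by (simp add: norm_mult mult.assoc)
 qed simp
 have "G z*eta z = 0" if "z : uhp" for z
  by (rule weight0_tendsto_cusp_zero[of "%z. G z*eta z", OF _ shadow_modular[OF tr Gp(2)] cG that])
   (intro holomorphic_intros Gh eta_holomorphic)
 then have G0: "G z = 0" if "z : uhp" for z using eta_nonzero that by auto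
 have G1: "((%n. cnj (am n * shadow_fac n)*qpow (of_int n/24) z) has_sum 0) negset" if "z : uhp" for z
  using Gp(1)[OF that] unfolding G0[OF that] .
 have am0: "am n = 0" if "n : negset" for n
  using exp_sum_unique[OF fin G1 that] shadow_fac_nonzero[OF negset_nonzero[OF that]] by simp
 have fP: "f z = P z" if "z : uhp" for z
 proof -
  have "((%n. nonhol am n z) has_sum 0) negset"
   by (rule has_sum_0) (simp add: am0)
  then have "N z = 0" using PN(2)[OF that] has_sum_unique by blast
  then show ?thesis using PN(3)[OF that] by simp
 qed
 have Ph: "P holomorphic_on uhp" by (rule exp_sum_holomorphic(1)[OF infinite_posset PN(4,1)])
 then have fh: "f holomorphic_on uhp" by (rule holomorphic_transform) (simp add: fP)
 obtain D where D: "D >= 0" "!!z. Im z >= 1 ==> norm (P z)<=D*exp (- (2*pi * of_int 1/24)*(Im z - 1))"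
  by (rule exp_sum_cusp_bound[OF PN(1), of 1]) (auto simp: ap)
 obtain F where F: "F > 0" "!!z. Im z >= 1 ==> norm (1/eta z)<=F*exp ((2*pi/24)*Im z)" using inverse_eta_cusp_bound by blast
 \<comment> \<open>The exponents of f start at 1/24 or later, which balances the growth of 1/eta; so
   f/eta is bounded and the factor q makes the product tend to 0.\<close>
 have "tendsto_cusp (%z. qpow 1 z*(f z/eta z))"
 proof (rule tendsto_cusp_exp)
  fix z assume z: "Im z >= 1"
  then have zu: "z : uhp" by (simp add: uhp_iff)
  have "norm (P z)*norm (1/eta z)<=(D*exp (- (2*pi * of_int 1/24)*(Im z - 1)))*(F*exp ((2*pi/24)*Im z))"
   using D(2)[OF z] F(2)[OF z] by (intro mult_mono) (use D(1) in auto)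
  also have "... = D*F*(exp (- (2*pi * of_int 1/24)*(Im z - 1))*exp ((2*pi/24)*Im z))" by (simp only: mult_ac)
  also have "exp (- (2*pi * of_int 1/24)*(Im z - 1))*exp ((2*pi/24)*Im z) = exp (2*pi/24)"
   unfolding exp_add[symmetric] by (rule arg_cong[of _ _ exp]) (simp add: field_simps)
  finally have X: "norm (P z)*norm (1/eta z)<=D*F*exp (2*pi/24)" .
  have "norm (qpow 1 z)*(norm (P z)*norm (1/eta z))<=exp (- (2*pi)*Im z)*(D*F*exp (2*pi/24))"
   using mult_left_mono[OF X, of "exp (- (2*pi)*Im z)"] by (simp add: norm_qpow)
  then show "norm (qpow 1 z*(f z/eta z))<=(D*F*exp (2*pi/24))*exp (- (2*pi)*Im z)"
   by (simp add: norm_mult norm_divide fP[OF zu] mult_ac)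
 qed simp
 moreover have "mweight 2 (%z. f z/eta z)" using tr unfolding transforms_like_52 .
 moreover have "(%z. f z/eta z) holomorphic_on uhp" using eta_nonzero by (intro holomorphic_intros fh eta_holomorphic) auto
 ultimately have "f z0/eta z0 = 0" using z0 by (intro weight2_vanishing[of "%z. f z/eta z"])
 then show ?thesis using eta_nonzero[OF z0] by simp
qed

lemma q_series_sum:
 assumes R: "R holomorphic_on ball 0 1" and \<kappa>: "0 < \<kappa>" "\<kappa> < (24::int)"
 obtains b where "!!n. n<=0 ==> b n = 0"
  "!!z. z : uhp ==> ((%n. b n*qpow (of_int n/24) z) has_sum (qpow (of_int \<kappa>/24) z * R (qpow 1 z))) {n. [n = \<kappa>] (mod 24)}"
proof -
 \<comment> \<open>The guard matters: \<open>nat\<close> sends negative quotients to 0, so without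
   it negative indices would receive the constant coefficient.\<close>
 define b where "b n = (if n > 0 then (deriv ^^ nat (n div 24)) R 0/fact (nat (n div 24)) else 0)" for n :: int
 have "((%n. b n*qpow (of_int n/24) z) has_sum (qpow (of_int \<kappa>/24) z * R (qpow 1 z))) {n. [n = \<kappa>] (mod 24)}" if z: "z : uhp" for z
 proof -
  let ?i = "%k::nat. 24 * int k+\<kappa>"
  have 1: "((%k. qpow (of_int \<kappa>/24) z*((deriv ^^ k) R 0/fact k*qpow 1 z^k)) has_sum (qpow (of_int \<kappa>/24) z * R (qpow 1 z))) UNIV"
   by (rule has_sum_cmult_right[OF ball_power_series[OF R]]) (rule qpow_less_1[OF z])
  have t: "qpow (of_int \<kappa>/24) z*((deriv ^^ k) R 0/fact k*qpow 1 z^k) = b (?i k)*qpow (of_int (?i k)/24) z" for k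
  proof -
   have d: "?i k div 24 = int k" using \<kappa> by simp
   have e: "real_of_int (?i k)/24 = of_int \<kappa>/24 + of_nat k" by (simp add: field_simps)
   have "?i k > 0" using \<kappa> by simp
   then have "b (?i k) = (deriv ^^ k) R 0/fact k" by (simp add: b_def d)
   then show ?thesis unfolding e qpow_add qpow_nat by (simp only: mult_ac)
  qed
  from 1 have "((%k. b (?i k)*qpow (of_int (?i k)/24) z) has_sum (qpow (of_int \<kappa>/24) z * R (qpow 1 z))) UNIV" unfolding t .
  moreover have "inj ?i" by (auto simp: inj_def)
  ultimately have "((%n. b n*qpow (of_int n/24) z) has_sum (qpow (of_int \<kappa>/24) z * R (qpow 1 z))) (range ?i)"
   by (subst has_sum_reindex) (simp_all add: o_def)
  then show ?thesis
  proof (rule has_sum_cong_neutral[THEN iffD1, rotated -1])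
   fix n assume n: "n : {n. [n = \<kappa>] (mod 24)} - range ?i"
   show "b n*qpow (of_int n/24) z = 0"
   proof (cases "n > 0")
    case True
    have "n mod 24 = \<kappa>" using n \<kappa> by (simp add: cong_def)
    then have "n = 24*(n div 24)+\<kappa>" by (metis mult_div_mod_eq)
    moreover have "n div 24 = int (nat (n div 24))" using True by simp
    ultimately have "n = ?i (nat (n div 24))" by simp
    then have "n : range ?i" by (rule range_eqI)
    then show ?thesis using n by blast
   qed (simp add: b_def)
  qed (auto simp: cong_def)
 qed
 then show ?thesis using that[of b] by (simp add: b_def)
qed

lemma negset_eq: "negset = {n. [n = 23] (mod 24)}"
 by (simp add: cong_def)

lemma tendsto_cusp_cong:
 assumes "tendsto_cusp f" "!!z. Im z >= 1 ==> f z = g z" shows "tendsto_cusp g"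
 unfolding tendsto_cusp_def
proof (intro allI impI)
 fix e :: real assume "e > 0"
 then obtain Y where "!!z. Im z > Y ==> norm (f z) < e" using assms(1) unfolding tendsto_cusp_def by blast
 then have "norm (g z) < e" if "Im z > max Y 1" for z using that assms(2)[of z, symmetric] by simp
 then show "\<exists>Y. \<forall>z. Im z > Y \<longrightarrow> norm (g z) < e" by blast
qed

lemma tendsto_cusp_diff:
 assumes "tendsto_cusp f" "tendsto_cusp g" shows "tendsto_cusp (%z. f z - g z)"
 unfolding tendsto_cusp_def
proof (intro allI impI)
 fix e :: real assume "e > 0"
 then have "e/2 > 0" by simp
 then obtain Y Y' where "!!z. Im z > Y ==> norm (f z) < e/2" "!!z. Im z > Y' ==> norm (g z) < e/2"
  using assms unfolding tendsto_cusp_def by meson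
 then show "\<exists>Y. \<forall>z. Im z > Y \<longrightarrow> norm (f z - g z) < e"
  by (intro exI[of _ "max Y Y'"] allI impI norm_diff_triangle_less[of _ 0 "e/2" _ "e/2", simplified]) auto
qed

lemma tendsto_cusp_bigo:
 assumes f: "f : O[filtercomap Im at_top](qpow r)" and r: "r > 0" and C: "!!z. Im z >= 1 ==> norm (g z)<=C"
 shows "tendsto_cusp (%z. f z*g z)"
 unfolding tendsto_cusp_def
proof (intro allI impI)
 fix e :: real assume e: "e > 0"
 obtain c where c: "c > 0" "\<forall>\<^sub>F z in filtercomap Im at_top. norm (f z)<=c*norm (qpow r z)" using landau_o.bigE[OF f] by blast
 then obtain Y where Y: "!!z. Im z >= Y ==> norm (f z)<=c*norm (qpow r z)" unfolding eventually_filtercomap_at_top_linorder by blast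
 have "((%y. (c*exp (- (2*pi * r)*y))*C) \<longlongrightarrow> 0) at_top" using pi_gt_zero r by real_asymp
 then have "eventually (%y. (c*exp (- (2*pi * r)*y))*C < e) at_top" by (rule order_tendstoD) (rule e)
 then obtain y0 where y0: "!!y. y >= y0 ==> (c*exp (- (2*pi * r)*y))*C < e" by (auto simp: eventually_at_top_linorder)
 have "norm (f z*g z) < e" if "Im z > max (max Y y0) 1" for z
 proof -
  have "norm (f z)*norm (g z)<=(c*norm (qpow r z))*C" using Y[of z] C[of z] that c(1) by (intro mult_mono) auto
  then show ?thesis using y0[of "Im z"] that by (simp add: norm_mult norm_qpow)
 qed
 then show "\<exists>Y. \<forall>z. Im z > Y \<longrightarrow> norm (f z*g z) < e" by blast
qed

section \<open>The forms of weight -1/2 and the holomorphic forms of weight 5/2\<close>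

lemma mweight_poly_j: "mweight 0 (%z. poly P (j_fun z))"
 using mweight_j unfolding mweight_def by simp

lemma poly_j_holomorphic: "(%z. poly P (j_fun z)) holomorphic_on uhp"
 by (intro holomorphic_intros j_fun_holomorphic)

text \<open>Uniqueness behind the definite description: the difference of two candidates times
  \<open>eta\<close> is a polynomial in j which tends to 0 at the cusp, being a bounded function
  times O(q^(23/24)); so it vanishes in weight 0.\<close>

lemma g_form_expansion:
 assumes m: "[m = 1] (mod 24)" "m > 0"
 obtains P R where "g_form m = on_uhp (%z. poly P (j_fun z)/eta z)" "R holomorphic_on ball 0 1"
  "!!z. z : uhp ==> g_form m z = qpow (- of_int m/24) z + qpow (23/24) z * R (qpow 1 z)"
proof -
 define N where "N = nat (m div 24)"
 have "m mod 24 = 1" using m by (simp add: cong_def)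
 then have mN: "of_int m/24 = of_nat N+(1::real)/24"
  using m(2) mult_div_mod_eq[of 24 m] unfolding N_def by linarith
 have mN': "- of_int m/24 = - of_nat N - (1::real)/24" using mN by simp
 obtain P R where PR: "lead_coeff P = 1" "R holomorphic_on ball 0 1"
  "!!z. z : uhp ==> poly P (j_fun z)/eta z = qpow (- (of_nat N) - 1/24) z + qpow (23/24) z * R (qpow 1 z)"
  using shadow_form_exists[of N] by metis
 define g where "g = on_uhp (%z. poly P (j_fun z)/eta z)"
 have ge: "g z = qpow (- of_int m/24) z + qpow (23/24) z * R (qpow 1 z)" if "z : uhp" for z
  using PR(3)[OF that] that unfolding mN' by (simp add: g_def on_uhp_def)
 obtain C where C: "C > 0" "!!z. Im z >= 1 ==> norm (R (qpow 1 z))<=C" using q_function_bounded[OF PR(2)] by metis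
 have big: "(%z. g z - qpow (- of_int m/24) z) : O[filtercomap Im at_top](qpow (23/24))"
 proof (rule landau_o.bigI[OF C(1)])
  show "\<forall>\<^sub>F z in filtercomap Im at_top. norm (g z - qpow (- of_int m/24) z)<=C*norm (qpow (23/24) z)"
   unfolding eventually_filtercomap_at_top_linorder
  proof (intro exI[of _ 1] allI impI)
   fix z assume z: "Im z >= 1"
   then have "z : uhp" by (simp add: uhp_iff)
   from ge[OF this] have "g z - qpow (- of_int m/24) z = R (qpow 1 z)*qpow (23/24) z" by (simp only: add_diff_cancel_left' mult.commute)
   then show "norm (g z - qpow (- of_int m/24) z)<=C*norm (qpow (23/24) z)"
    using mult_right_mono[OF C(2)[OF z], of "norm (qpow (23/24) z)"] by (simp only: norm_mult norm_ge_zero)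
  qed
 qed
 obtain E where E: "E > 0" "!!z. Im z >= 1 ==> norm (eta z)<=E*exp (- (2*pi/24)*Im z)" using eta_cusp_bound by blast
 have Eb: "norm (eta z)<=E" if "Im z >= 1" for z
 proof -
  have "E*exp (- (2*pi/24)*Im z)<=E*1" using E(1) that by (intro mult_left_mono) auto
  then show ?thesis using E(2)[OF that] by simp
 qed
 have "g_form m = g" unfolding g_form_def
 proof (rule the_equality)
  show "\<exists>P. lead_coeff P = 1 & g = on_uhp (%z. poly P (j_fun z)/eta z) \<and>
   (%z. g z - qpow (- of_int m/24) z) : O[filtercomap Im at_top](qpow (23/24))"
   using PR(1) g_def big by blast
  fix g' assume "\<exists>P. lead_coeff P = 1 & g' = on_uhp (%z. poly P (j_fun z)/eta z) \<and>
   (%z. g' z - qpow (- of_int m/24) z) : O[filtercomap Im at_top](qpow (23/24))"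
  then obtain P' where P': "g' = on_uhp (%z. poly P' (j_fun z)/eta z)"
   "(%z. g' z - qpow (- of_int m/24) z) : O[filtercomap Im at_top](qpow (23/24))" by blast
  have "(%z. (g' z - qpow (- of_int m/24) z) - (g z - qpow (- of_int m/24) z)) : O[filtercomap Im at_top](qpow (23/24))"
   by (rule sum_in_bigo(2)[OF P'(2) big])
  then have "tendsto_cusp (%z. ((g' z - qpow (- of_int m/24) z) - (g z - qpow (- of_int m/24) z))*eta z)"
   by (rule tendsto_cusp_bigo) (use Eb in auto)
  then have t: "tendsto_cusp (%z. poly (P' - P) (j_fun z))"
  proof (rule tendsto_cusp_cong)
   fix z assume "Im z >= 1"
   then have z: "z : uhp" by (simp add: uhp_iff)
   then show "(g' z - qpow (- of_int m/24) z - (g z - qpow (- of_int m/24) z))*eta z = poly (P' - P) (j_fun z)"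
    using eta_nonzero[OF z] by (simp add: g_def P'(1) on_uhp_def field_simps)
  qed
  show "g' = g"
  proof
   fix z
   have "poly (P' - P) (j_fun z) = 0" if "z : uhp"
    by (rule weight0_tendsto_cusp_zero[OF poly_j_holomorphic mweight_poly_j t that])
   then show "g' z = g z" by (cases "z : uhp") (simp_all add: g_def P'(1) on_uhp_def)
  qed
 qed
 then show ?thesis using that[of P R] PR(2) ge g_def by simp
qed

lemma g_form_basic:
 assumes m: "[m = 1] (mod 24)" "m > 0"
 shows "z \<notin> uhp ==> g_form m z = 0" "g_form m holomorphic_on uhp"
  "mweight 0 (%z. g_form m z*eta z)"
proof -
 obtain P R where PR: "g_form m = on_uhp (%z. poly P (j_fun z)/eta z)" "R holomorphic_on ball 0 1"
  "!!z. z : uhp ==> g_form m z = qpow (- of_int m/24) z + qpow (23/24) z * R (qpow 1 z)"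
  using g_form_expansion[OF m] by metis
 show "z \<notin> uhp ==> g_form m z = 0" by (simp add: PR(1) on_uhp_def)
 have "(%z. poly P (j_fun z)/eta z) holomorphic_on uhp"
  using eta_nonzero by (intro holomorphic_on_divide poly_j_holomorphic eta_holomorphic) auto
 then show "g_form m holomorphic_on uhp" by (rule holomorphic_transform) (simp add: PR(1) on_uhp_def)
 have e: "g_form m z*eta z = poly P (j_fun z)" if "z : uhp" for z using that eta_nonzero[OF that] by (simp add: PR(1) on_uhp_def)
 show "mweight 0 (%z. g_form m z*eta z)"
  using mweight_poly_j[of P] e moebius_in_uhp unfolding mweight_def by simp
qed

text \<open>Made for recognising the shadow of a series, which is known only through its asymptotic
  behaviour: the error is merely required to be small compared with 1/eta, not O(q^(23/24)).\<close>

lemma g_form_char: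
 assumes m: "[m = 1] (mod 24)" "m > 0" and hol: "g holomorphic_on uhp"
  and mod: "mweight 0 (%z. g z*eta z)"
  and cusp: "tendsto_cusp (%z. (g z - qpow (- of_int m/24) z)*eta z)" and z: "z : uhp"
 shows "g z = g_form m z"
proof -
 obtain P R where PR: "g_form m = on_uhp (%z. poly P (j_fun z)/eta z)" "R holomorphic_on ball 0 1"
  "!!z. z : uhp ==> g_form m z = qpow (- of_int m/24) z + qpow (23/24) z * R (qpow 1 z)"
  using g_form_expansion[OF m] by metis
 have "(%q. R q*ephi q) holomorphic_on ball 0 1" by (intro holomorphic_intros PR(2) ephi_holomorphic)
 then have "tendsto_cusp (%z. qpow 1 z*(R (qpow 1 z)*ephi (qpow 1 z)))"
  by (rule tendsto_cusp_q_multiple[where r = 1]) auto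
 from tendsto_cusp_diff[OF cusp this] have c: "tendsto_cusp (%z. g z*eta z - g_form m z*eta z)"
 proof (rule tendsto_cusp_cong)
  fix z assume "Im z >= 1"
  then have z: "z : uhp" by (simp add: uhp_iff)
  have "qpow 1 z = qpow (23/24) z*qpow (1/24) z" using qpow_add[of "23/24" "1/24" z] by simp
  then have "qpow 1 z*(R (qpow 1 z)*ephi (qpow 1 z)) = qpow (23/24) z * R (qpow 1 z)*eta z" by (simp add: eta_ephi)
  then show "(g z - qpow (- of_int m/24) z)*eta z - qpow 1 z*(R (qpow 1 z)*ephi (qpow 1 z)) = g z*eta z - g_form m z*eta z"
   unfolding PR(3)[OF z] by (simp only: left_diff_distrib distrib_right diff_diff_eq)
 qed
 have "g z*eta z - g_form m z*eta z = 0"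
 proof (rule weight0_tendsto_cusp_zero[of "%z. g z*eta z - g_form m z*eta z", OF _ _ c z])
  show "(%z. g z*eta z - g_form m z*eta z) holomorphic_on uhp"
   by (intro holomorphic_intros hol eta_holomorphic g_form_basic(2)[OF m])
  show "mweight 0 (%z. g z*eta z - g_form m z*eta z)"
   using mod g_form_basic(3)[OF m] unfolding mweight_def by simp
 qed
 then show ?thesis using eta_nonzero[OF z] by (simp add: left_diff_distrib[symmetric])
qed

lemma q_power_meromorphic:
 assumes "R holomorphic_on ball 0 1"
 shows "(%q. C*(1/q^N + q^k * R q)) meromorphic_on {0}"
 using holomorphic_imp_meromorphic_at_0[OF assms] by (intro meromorphic_intros)

lemma g_form_weakly_holomorphic:
 assumes m: "[m = 1] (mod 24)" "m > 0"
 shows "cscale C (g_form m) : weakly_holomorphic_forms (- 1/2) eta_mult_cnj"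
proof -
 obtain P R where PR: "g_form m = on_uhp (%z. poly P (j_fun z)/eta z)" "R holomorphic_on ball 0 1"
  "!!z. z : uhp ==> g_form m z = qpow (- of_int m/24) z + qpow (23/24) z * R (qpow 1 z)"
  using g_form_expansion[OF m] by metis
 define N where "N = nat (m div 24)"
 have "m mod 24 = 1" using m by (simp add: cong_def)
 then have mN: "- of_int m/24 = (- 1/24 :: real) + - of_nat N"
  using m(2) mult_div_mod_eq[of 24 m] unfolding N_def by linarith
 have 1: "eta_mult_cnj 1 1 0 1 = cis (2*pi*(- 1/24))" by (simp add: eta_mult_cnj_def eta_mult_T cis_cnj)
 have "cscale C (g_form m) z = qpow (- 1/24) z*(C*(1/qpow 1 z^N + qpow 1 z^1 * R (qpow 1 z)))" if "z : uhp" for z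
 proof -
  have "qpow (23/24) z = qpow (- 1/24) z*qpow 1 z" using qpow_add[of "- 1/24" 1 z] by simp
  then show ?thesis unfolding cscale_def PR(3)[OF that] mN qpow_add qpow_minus_nat by (simp add: algebra_simps)
 qed
 with 1 q_power_meromorphic[OF PR(2), of C N 1] have "meromorphic_at_cusp eta_mult_cnj (cscale C (g_form m))"
  unfolding meromorphic_at_cusp_def by blast
 moreover have "mweight 0 (%z. cscale C (g_form m) z*eta z)"
  using g_form_basic(3)[OF m] unfolding mweight_def cscale_def by simp
 then have "transforms_like (- 1/2) eta_mult_cnj (cscale C (g_form m))" unfolding transforms_like_m12 .
 moreover have "cscale C (g_form m) holomorphic_on uhp"
  unfolding cscale_def by (intro holomorphic_intros g_form_basic(2)[OF m])
 moreover have "\<forall>z. z \<notin> uhp \<longrightarrow> cscale C (g_form m) z = 0" using g_form_basic(1)[OF m] by (simp add: cscale_def)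
 ultimately show ?thesis unfolding weakly_holomorphic_forms_def by blast
qed

lemma djq_0: "djq 0 = 1" by (simp add: djq_def jq_0)

text \<open>In powers of j times eta j' the constant multiple -1/(2 pi i) normalises the leading
  coefficient. After elimination and division by q the remainder begins at q^(1/24), that is at n =
  1.\<close>

lemma negative_form_exists:
 assumes m: "[m = 1] (mod 24)" "m < 0"
 obtains h R where "h : weakly_holomorphic_forms (5/2) eta_mult" "R holomorphic_on ball 0 1"
  "!!z. z : uhp ==> h z = qpow (of_int m/24) z + qpow (1/24) z * R (qpow 1 z)"
proof -
 \<comment> \<open>eta j' begins with q^(1/24 - 1), so N further powers of j reach q^(m/24) when N +
   1 = -(m div 24).\<close>
 define N where "N = nat (- (m div 24) - 1)"
 have mm: "m mod 24 = 1" using m by (simp add: cong_def)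
 have mN: "of_int m/24 = (1/24 :: real) + - of_nat (Suc N)"
  using mm m(2) mult_div_mod_eq[of 24 m] unfolding N_def by linarith
 define f where "f i z = j_fun z ^ i*(djq (qpow 1 z)*ephi (qpow 1 z))" for i z
 have "\<exists>U. U holomorphic_on ball 0 1 & U 0 = 1 & (\<forall>z\<in>uhp. f i z = U (qpow 1 z)/qpow 1 z ^ i)" for i
 proof (intro exI[of _ "%q. jq q ^ i*(djq q*ephi q)"] conjI ballI)
  show "(%q. jq q ^ i*(djq q*ephi q)) holomorphic_on ball 0 1"
   by (intro holomorphic_intros jq_holomorphic djq_holomorphic ephi_holomorphic)
 qed (simp_all add: jq_0 djq_0 f_def j_fun_jq power_divide)
 from laurent_elimination[of f, OF this, of N]
 obtain c R where cR: "R holomorphic_on ball 0 1" "!!z. z : uhp ==> (\<Sum>i\<le>N. c i*f i z) = 1/qpow 1 z^N + qpow 1 z * R (qpow 1 z)"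
  by blast
 define h where "h = on_uhp (%z. (\<Sum>i\<le>N. c i*j_fun z ^ i)*(deriv j_fun z/(- 2 * of_real pi*\<i>))*eta z)"
 have dj: "deriv j_fun z/(- 2 * of_real pi*\<i>) = djq (qpow 1 z)/qpow 1 z" if "z : uhp" for z
  unfolding deriv_j_fun[OF that] by simp
 have e: "h z = qpow (1/24) z*(1*(1/qpow 1 z^Suc N + qpow 1 z^0 * R (qpow 1 z)))" if z: "z : uhp" for z
 proof -
  have "h z = qpow (1/24) z*((\<Sum>i\<le>N. c i*f i z)/qpow 1 z)"
  proof -
   have "h z = (\<Sum>i\<le>N. c i*j_fun z ^ i)*(djq (qpow 1 z)/qpow 1 z)*eta z"
    unfolding h_def on_uhp_def dj[OF z, symmetric] using z by (rule if_P)
   then show ?thesis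
    by (simp add: eta_ephi f_def sum_distrib_left sum_distrib_right sum_divide_distrib mult_ac)
  qed
  then show ?thesis unfolding cR(2)[OF z] by (simp add: add_divide_distrib mult.commute)
 qed
 have "h z = qpow (of_int m/24) z + qpow (1/24) z * R (qpow 1 z)" if "z : uhp" for z
  unfolding e[OF that] mN qpow_add qpow_minus_nat by (simp only: distrib_left power_0 mult_1)
 moreover have "h : weakly_holomorphic_forms (5/2) eta_mult"
 proof -
  have "(%z. (\<Sum>i\<le>N. c i*j_fun z ^ i)*(deriv j_fun z/(- 2 * of_real pi*\<i>))*eta z) holomorphic_on uhp"
   by (intro holomorphic_intros j_fun_holomorphic eta_holomorphic holomorphic_deriv open_uhp) auto
  then have "h holomorphic_on uhp" by (rule holomorphic_transform) (simp add: h_def on_uhp_def)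
  moreover have "mweight 2 (%z. h z/eta z)"
   using mweight_j mweight_deriv_j moebius_in_uhp eta_nonzero
   unfolding mweight_def h_def on_uhp_def by simp
  then have "transforms_like (5/2) eta_mult h" unfolding transforms_like_52 .
  moreover have "eta_mult 1 1 0 1 = cis (2*pi*(1/24))" by (simp add: eta_mult_T)
  with e q_power_meromorphic[OF cR(1), of 1 "Suc N" 0] have "meromorphic_at_cusp eta_mult h"
   unfolding meromorphic_at_cusp_def by blast
  ultimately show ?thesis unfolding weakly_holomorphic_forms_def by (simp add: h_def on_uhp_def)
 qed
 ultimately show ?thesis using that cR(1) by blast
qed

section \<open>Poincare series\<close>

text \<open>Both signs of a row are kept, so every coset of the translations occurs twice; this is
  the origin of the factor 2 in the main terms at the cusp.\<close>

definition crows :: "(int \<times> int) set" where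
 "crows = {p. coprime (fst p) (snd p)}"

text \<open>An arbitrary completion to a matrix. By \<open>moebius_same_bottom\<close> another
  choice changes \<open>row_map\<close> by an integer translation only, which periodic kernels
  ignore.\<close>

definition top_row :: "int \<times> int => int \<times> int" where
 "top_row p = (SOME t. fst t * snd p - snd t*fst p = 1)"

definition row_map :: "int \<times> int => complex => complex" where
 "row_map p = moeb (fst (top_row p)) (snd (top_row p)) (fst p) (snd p)"

definition rjf :: "int \<times> int => complex => complex" where "rjf p = jf (fst p) (snd p)"

lemma top_row: "p : crows ==> fst (top_row p) * snd p - snd (top_row p)*fst p = 1"
proof -
 assume "p : crows"
 then obtain a b where "a * snd p - b*fst p = 1" using coprime_row unfolding crows_def by blast
 then have "\<exists>t. fst t * snd p - snd t*fst p = 1" by (intro exI[of _ "(a, b)"]) simp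
 then show ?thesis unfolding top_row_def by (rule someI_ex)
qed

lemma row_map_uhp: "p : crows ==> z : uhp ==> row_map p z : uhp"
 unfolding row_map_def by (rule moebius_in_uhp[OF top_row])

lemma Im_row_map: "p : crows ==> Im (row_map p z) = Im z/(norm (rjf p z))\<^sup>2"
 unfolding row_map_def rjf_def by (rule Im_moebius[OF top_row])

lemma row_map_deriv: "p : crows ==> z : uhp ==> (row_map p has_field_derivative 1/(rjf p z)\<^sup>2) (at z)"
 unfolding row_map_def rjf_def by (rule moebius_has_field_derivative[OF top_row])

lemma rjf_nonzero: "p : crows ==> z : uhp ==> rjf p z ~= 0"
 unfolding rjf_def using det_jf_nonzero[OF _ top_row] by blast

lemma norm_eta_row_map:
 assumes "p : crows" "z : uhp"
 shows "(norm (eta (row_map p z)))\<^sup>2 = norm (rjf p z)*(norm (eta z))\<^sup>2"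
  "norm (eta (row_map p z)) = norm (rjf p z) powr (1/2)*norm (eta z)"
proof -
 show 1: "(norm (eta (row_map p z)))\<^sup>2 = norm (rjf p z)*(norm (eta z))\<^sup>2"
  unfolding row_map_def rjf_def by (rule norm_eta_moebius[OF top_row[OF assms(1)] assms(2)])
 have "(norm (rjf p z) powr (1/2)*norm (eta z))\<^sup>2 = norm (rjf p z)*(norm (eta z))\<^sup>2"
  by (simp add: power_mult_distrib powr_half_sqrt)
 with 1 have "(norm (eta (row_map p z)))\<^sup>2 = (norm (rjf p z) powr (1/2)*norm (eta z))\<^sup>2" by (simp only:)
 then show "norm (eta (row_map p z)) = norm (rjf p z) powr (1/2)*norm (eta z)"
  by (rule power2_eq_imp_eq) (simp_all only: norm_ge_zero powr_ge_zero mult_nonneg_nonneg)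
qed

lemma crows_nonzero: "p : crows ==> p ~= (0, 0)"
 by (auto simp: crows_def)

lemma crows_mult:
 assumes "a * d - b * c = 1" "p : crows"
 shows "(fst p * a + snd p * c, fst p * b + snd p * d) : crows"
 using det_coprime(1)[OF det_compose[OF assms(1) top_row[OF assms(2)]]] by (simp add: crows_def)

lemma bij_coprime_rows:
 assumes det: "a * d - b * c = (1::int)"
 shows "bij_betw (%p. (fst p * a + snd p * c, fst p * b + snd p * d)) crows crows"
proof (rule bij_betw_byWitness[where f' = "%p. (fst p * d + snd p*(- c), fst p*(- b) + snd p * a)"])
 have "(x * a + y * c) * d+(x * b + y * d)*(- c) = x*(a * d - b * c)"
  "(x * a + y * c)*(- b)+(x * b + y * d) * a = y*(a * d - b * c)"
  "(x * d + y*(- c)) * a+(x*(- b) + y * a) * c = x*(a * d - b * c)"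
  "(x * d + y*(- c)) * b+(x*(- b) + y * a) * d = y*(a * d - b * c)" for x y
  by (simp_all add: algebra_simps)
 then show "\<forall>p\<in>crows. (fst (fst p * a + snd p * c, fst p * b + snd p * d) * d + snd (fst p * a + snd p * c, fst p * b + snd p * d)*(- c),
  fst (fst p * a + snd p * c, fst p * b + snd p * d)*(- b) + snd (fst p * a + snd p * c, fst p * b + snd p * d) * a) = p"
  "\<forall>p\<in>crows. (fst (fst p * d + snd p*(- c), fst p*(- b) + snd p * a) * a + snd (fst p * d + snd p*(- c), fst p*(- b) + snd p * a) * c,
  fst (fst p * d + snd p*(- c), fst p*(- b) + snd p * a) * b + snd (fst p * d + snd p*(- c), fst p*(- b) + snd p * a) * d) = p"
  using det by (simp_all only: fst_conv snd_conv mult_1_right prod.collapse simp_thms ball_triv)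
 show "(%p. (fst p * a + snd p * c, fst p * b + snd p * d)) ` crows \<subseteq> crows"
  using crows_mult[OF det] by blast
 have "d * a - (- b)*(- c) = 1" using det by (simp add: mult.commute)
 from crows_mult[OF this]
 show "(%p. (fst p * d + snd p*(- c), fst p*(- b) + snd p * a)) ` crows \<subseteq> crows" by blast
qed

lemma row_map_compose:
 assumes det: "a * d - b * c = 1" and z: "z : uhp" and p: "p : crows"
 shows "\<exists>n. row_map p (moeb a b c d z) = row_map (fst p * a + snd p * c, fst p * b + snd p * d) z + of_int n"
proof -
 have 1: "row_map p (moeb a b c d z) = moeb (fst (top_row p) * a + snd (top_row p) * c) (fst (top_row p) * b + snd (top_row p) * d)
   (fst p * a + snd p * c) (fst p * b + snd p * d) z"
  unfolding row_map_def by (rule moebius_compose[OF det top_row[OF p] z])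
 show ?thesis unfolding 1 unfolding row_map_def fst_conv snd_conv
  by (rule moebius_same_bottom[OF top_row[OF crows_mult[OF det p], unfolded fst_conv snd_conv] det_compose[OF det top_row[OF p]] z])
qed

lemma infinite_coprime_rows: "infinite crows"
proof -
 have "inj (%n::nat. (1 :: int, int n))" "range (%n::nat. (1 :: int, int n)) \<subseteq> crows"
  by (auto simp: inj_def crows_def)
 then show ?thesis using finite_subset range_inj_infinite by blast
qed

lemma rowsize_rjf:
 assumes "y0<=Im z" "0 < y0" "norm z<=R"
 shows "rowsize p<=(1/y0+1 + R/y0)*norm (rjf p z)" "norm (rjf p z)<=(1 + R) * rowsize p"
proof -
 show "rowsize p<=(1/y0+1 + R/y0)*norm (rjf p z)"
  using rowsize_le_jf[OF assms, of "fst p" "snd p"] by (simp add: rjf_def)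
 have "norm (rjf p z)<=(1 + norm z) * rowsize p"
  using jf_le_rowsize[of "fst p" "snd p" z] by (simp add: rjf_def)
 also have "...<=(1 + R) * rowsize p" using assms by (intro mult_right_mono) (auto simp: rowsize_def)
 finally show "norm (rjf p z)<=(1 + R) * rowsize p" .
qed

lemma rjf_powr_le:
 assumes "0 < y0" "0<=R"
 obtains K where "K > 0" "!!p z. p : crows ==> y0<=Im z ==> norm z<=R ==> norm (rjf p z) powr s<=K * rowsize p powr s"
proof (cases "s >= 0")
 case True
 have "norm (rjf p z) powr s<=(1 + R) powr s * rowsize p powr s" if "p : crows" "y0<=Im z" "norm z<=R" for p z
 proof -
  have "norm (rjf p z) powr s<=((1 + R) * rowsize p) powr s"
   using True rowsize_rjf(2)[OF that(2) assms(1) that(3)] by (intro powr_mono2) auto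
  then show ?thesis using assms by (simp add: powr_mult rowsize_def)
 qed
 then show ?thesis using that[of "(1 + R) powr s"] assms by simp
next
 case False
 define L where "L = 1/y0+1 + R/y0"
 have "0<=R/y0" "0 < 1/y0" using assms by auto
 then have L: "L > 0" unfolding L_def by linarith
 have "norm (rjf p z) powr s<=L powr (- s) * rowsize p powr s" if "p : crows" "y0<=Im z" "norm z<=R" for p z
 proof -
  have r: "rowsize p > 0" using rowsize_ge_1[OF crows_nonzero[OF that(1)]] by simp
  have "rowsize p<=norm (rjf p z)*L" using rowsize_rjf(1)[OF that(2) assms(1) that(3)] by (simp add: L_def mult.commute)
  then have "rowsize p/L<=norm (rjf p z)" using L by (simp add: pos_divide_le_eq)
  then have "norm (rjf p z) powr s<=(rowsize p/L) powr s" using False r L by (intro powr_mono2') auto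
  also have "... = L powr (- s) * rowsize p powr s" using r L by (simp add: powr_divide powr_minus field_simps)
  finally show ?thesis .
 qed
 then show ?thesis using that[of "L powr (- s)"] L by simp
qed

text \<open>In contrast to \<open>rowsize_rjf\<close> the constant does not depend on the height, as
  is required for estimates at the cusp.\<close>

lemma rowsize_le_strip:
 assumes "Im z >= 1" "\<bar>Re z\<bar><=1/2" shows "rowsize p<=2*norm (rjf p z)"
proof -
 have i: "Im (rjf p z) = of_int (fst p)*Im z" "Re (rjf p z) = of_int (fst p) * Re z + of_int (snd p)" by (simp_all add: rjf_def jf_def)
 have "\<bar>of_int (fst p)\<bar>*1<=\<bar>of_int (fst p)\<bar>*\<bar>Im z\<bar>" using assms(1) by (intro mult_left_mono) auto
 then have 1: "\<bar>of_int (fst p)\<bar><=norm (rjf p z)" using abs_Im_le_cmod[of "rjf p z"] unfolding i abs_mult by linarith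
 have "\<bar>of_int (fst p)\<bar>*\<bar>Re z\<bar><=\<bar>of_int (fst p)\<bar>*(1/2)" using assms(2) by (intro mult_left_mono) auto
 then have "\<bar>of_int (fst p) * Re z\<bar><=\<bar>of_int (fst p)\<bar>/2" by (simp add: abs_mult)
 then have "\<bar>of_int (snd p)\<bar><=norm (rjf p z)+\<bar>of_int (fst p)\<bar>/2"
  using abs_Re_le_cmod[of "rjf p z"] unfolding i by linarith
 then have "\<bar>of_int (snd p)\<bar><=2*norm (rjf p z)" using 1 norm_ge_zero[of "rjf p z"] by linarith
 moreover have "\<bar>of_int (fst p)\<bar><=2*norm (rjf p z)" using 1 norm_ge_zero[of "rjf p z"] by linarith
 ultimately show ?thesis unfolding rowsize_def by (simp add: max_def)
qed

lemma row_map_translation: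
 shows "\<exists>n. row_map (0, 1) z = z + of_int n" "\<exists>n. row_map (0, - 1) z = z + of_int n"
proof -
 have "(0, 1) : crows" "(0, - 1) : crows" by (simp_all add: crows_def)
 note t = this[THEN top_row]
 have "row_map (0, 1) z = z + of_int (snd (top_row (0, 1)))" using t(1) by (simp add: row_map_def moebius_int_def)
 then show "\<exists>n. row_map (0, 1) z = z + of_int n" by blast
 have "fst (top_row (0, - 1)) = - 1" using t(2) by simp
 then have "row_map (0, - 1) z = z + of_int (- snd (top_row (0, - 1)))" by (simp add: row_map_def moebius_int_def)
 then show "\<exists>n. row_map (0, - 1) z = z + of_int n" by blast
qed

text \<open>A series of weight k with kernel V(Im) H. The exponents \<open>\<alpha>\<close> and
  \<open>\<beta>\<close> measure the factors H and V in powers of |cz + d|, and their sum below -2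
  gives convergence over rows. The bound on V' has the factor that the chain rule produces, so it
  serves termwise differentiation. With k even both signs of a row contribute equally.\<close>

locale poincare =
 fixes k :: nat and V V' :: "real => real" and H :: "complex => complex" and \<alpha> \<beta> :: real
 assumes even_k: "even k"
  and H_hol: "H holomorphic_on uhp"
  and H_T: "!!z. z : uhp ==> H (z+1) = H z"
  and V_deriv: "!!y. y > 0 ==> (V has_real_derivative V' y) (at y)"
  and exps: "\<alpha>+\<beta> < - 2"
  and bnd: "!!y0 R. 0 < y0 ==> 0<=R ==> \<exists>C. \<forall>p\<in>crows. \<forall>z. y0<=Im z \<longrightarrow> norm z<=R \<longrightarrow>
   norm (H (row_map p z))/norm (rjf p z)^k<=C*norm (rjf p z) powr \<alpha> \<and>
   \<bar>V (Im (row_map p z))\<bar><=C*norm (rjf p z) powr \<beta> \<and>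
   \<bar>V' (Im (row_map p z))\<bar>/(norm (rjf p z))\<^sup>2<=C*norm (rjf p z) powr \<beta>"
begin

definition u :: "int \<times> int => complex => complex" where "u p z = H (row_map p z)/rjf p z^k"
definition t :: "int \<times> int => complex => complex" where "t p z = of_real (V (Im (row_map p z)))*u p z"
definition F :: "complex => complex" where "F z = (\<Sum>\<^sub>\<infinity>p\<in>crows. t p z)"

lemma bounds:
 assumes "0 < y0" "0<=R"
 obtains C where "C > 0" "!!p z. p : crows ==> y0<=Im z ==> norm z<=R \<Longrightarrow>
  norm (u p z)<=C * rowsize p powr \<alpha> & \<bar>V (Im (row_map p z))\<bar><=C * rowsize p powr \<beta> \<and>
  \<bar>V' (Im (row_map p z))\<bar>/(norm (rjf p z))\<^sup>2<=C * rowsize p powr \<beta>"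
proof -
 obtain C where C: "!!p z. p : crows ==> y0<=Im z ==> norm z<=R \<Longrightarrow>
   norm (H (row_map p z))/norm (rjf p z)^k<=C*norm (rjf p z) powr \<alpha> \<and>
   \<bar>V (Im (row_map p z))\<bar><=C*norm (rjf p z) powr \<beta> \<and>
   \<bar>V' (Im (row_map p z))\<bar>/(norm (rjf p z))\<^sup>2<=C*norm (rjf p z) powr \<beta>"
  using bnd[OF assms] by blast
 obtain A where A: "A > 0" "!!p z. p : crows ==> y0<=Im z ==> norm z<=R ==> norm (rjf p z) powr \<alpha><=A * rowsize p powr \<alpha>"
  using rjf_powr_le[OF assms] by blast
 obtain B where B: "B > 0" "!!p z. p : crows ==> y0<=Im z ==> norm z<=R ==> norm (rjf p z) powr \<beta><=B * rowsize p powr \<beta>"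
  using rjf_powr_le[OF assms] by blast
 define D where "D = \<bar>C\<bar>*A+\<bar>C\<bar>*B+1"
 have a: "C*norm (rjf p z) powr \<alpha><=D * rowsize p powr \<alpha>" and b: "C*norm (rjf p z) powr \<beta><=D * rowsize p powr \<beta>"
  if z: "p : crows" "y0<=Im z" "norm z<=R" for p z
 proof -
  have "C*norm (rjf p z) powr \<alpha><=\<bar>C\<bar>*(A * rowsize p powr \<alpha>)" by (intro mult_mono A(2)[OF z]) auto
  also have "...<=D * rowsize p powr \<alpha>" unfolding D_def mult.assoc[symmetric] using A(1) B(1) by (intro mult_right_mono) auto
  finally show "C*norm (rjf p z) powr \<alpha><=D * rowsize p powr \<alpha>" .
  have "C*norm (rjf p z) powr \<beta><=\<bar>C\<bar>*(B * rowsize p powr \<beta>)" by (intro mult_mono B(2)[OF z]) auto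
  also have "...<=D * rowsize p powr \<beta>" unfolding D_def mult.assoc[symmetric] using A(1) B(1) by (intro mult_right_mono) auto
  finally show "C*norm (rjf p z) powr \<beta><=D * rowsize p powr \<beta>" .
 qed
 have "D > 0" using A(1) B(1) by (simp add: D_def add_nonneg_pos)
 then show ?thesis
 proof (rule that)
  fix p z assume z: "p : crows" "y0<=Im z" "norm z<=R"
  have "norm (u p z) = norm (H (row_map p z))/norm (rjf p z)^k" by (simp add: u_def norm_divide norm_power)
  then show "norm (u p z)<=D * rowsize p powr \<alpha> & \<bar>V (Im (row_map p z))\<bar><=D * rowsize p powr \<beta> \<and>
   \<bar>V' (Im (row_map p z))\<bar>/(norm (rjf p z))\<^sup>2<=D * rowsize p powr \<beta>"
   using C[OF z] a[OF z] b[OF z] by linarith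
 qed
qed

lemma u_hol: assumes p: "p : crows" shows "u p holomorphic_on uhp"
proof -
 have "row_map p holomorphic_on uhp" unfolding holomorphic_on_open[OF open_uhp] using row_map_deriv[OF p] by blast
 then have "(H \<circ> row_map p) holomorphic_on uhp"
  by (rule holomorphic_on_compose_gen[OF _ H_hol]) (use row_map_uhp[OF p] in auto)
 then have h: "(%z. H (row_map p z)) holomorphic_on uhp" by (simp add: o_def)
 have j: "rjf p holomorphic_on uhp" unfolding rjf_def jf_def by (intro holomorphic_intros)
 show ?thesis unfolding u_def[abs_def] by (intro holomorphic_on_divide holomorphic_on_power h j) (simp add: rjf_nonzero[OF p])
qed

lemma summable_rows: "s > 2 ==> (%p. K * rowsize p powr (- s)) summable_on A"
 by (intro summable_on_cmult_right summable_on_subset_banach[OF summable_rowsize]) auto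

lemma summable_ab: "(%p. K * rowsize p powr (\<alpha>+\<beta>)) summable_on A"
 using exps by (intro summable_rows[of "- (\<alpha>+\<beta>)" K A, unfolded minus_minus]) linarith

lemma t_has_sum:
 assumes z: "z : uhp"
 shows "((%p. t p z) has_sum F z) crows"
proof -
 have "0 < Im z" using z by (simp add: uhp_iff)
 from bounds[OF this norm_ge_zero[of z]]
 obtain C where C: "C > 0" "!!p w. p : crows ==> Im z<=Im w ==> norm w<=norm z \<Longrightarrow>
  norm (u p w)<=C * rowsize p powr \<alpha> & \<bar>V (Im (row_map p w))\<bar><=C * rowsize p powr \<beta> \<and>
  \<bar>V' (Im (row_map p w))\<bar>/(norm (rjf p w))\<^sup>2<=C * rowsize p powr \<beta>" by blast
 have "(%p. norm (t p z)) summable_on crows"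
 proof (rule summable_on_comparison_test[OF summable_ab[of "C*C"]])
  fix p assume p: "p : crows"
  have "norm (t p z)<=(C * rowsize p powr \<beta>)*(C * rowsize p powr \<alpha>)"
   unfolding t_def norm_mult norm_of_real using C(2)[OF p order_refl order_refl] C(1) by (intro mult_mono) auto
  then show "norm (t p z)<=C*C * rowsize p powr (\<alpha>+\<beta>)" by (simp add: powr_add mult_ac)
 qed simp
 then show ?thesis unfolding F_def by (intro has_sum_infsum) (simp add: summable_on_iff_abs_summable_on_complex)
qed

text \<open>As H is holomorphic, the conjugate derivative of a term only involves V', with the
  conjugate of (cz + d)^(-2) from the chain rule. The z-derivative is left unspecified; it only
  needs the majorant, by Cauchy's estimate.\<close>

lemma F_wirt:
 assumes z0: "z0 : uhp"
 obtains P where "has_wirt F P (\<Sum>\<^sub>\<infinity>p\<in>crows. \<i>/2 * of_real (V' (Im (row_map p z0))) * cnj (1/(rjf p z0)\<^sup>2)*u p z0) z0"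
proof -
 define y where "y = Im z0/4"
 have y: "y > 0" "Im z0 = 4*y" using z0 by (auto simp: y_def uhp_iff)
 define R where "R = norm z0+2*y"
 have R: "2*y > 0" "R >= 0" using y by (auto simp: R_def)
 obtain C where C: "C > 0" "!!p w. p : crows ==> 2*y<=Im w ==> norm w<=R \<Longrightarrow>
  norm (u p w)<=C * rowsize p powr \<alpha> & \<bar>V (Im (row_map p w))\<bar><=C * rowsize p powr \<beta> \<and>
  \<bar>V' (Im (row_map p w))\<bar>/(norm (rjf p w))\<^sup>2<=C * rowsize p powr \<beta>" using bounds[OF R] by blast
 have region: "2*y<=Im z & norm z<=R & z : uhp" if "z : ball z0 (2*y)" for z
 proof -
  have "\<bar>Im z0 - Im z\<bar> < 2*y" using that abs_Im_le_cmod[of "z0 - z"] by (simp add: dist_norm)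
  then have "Im z >= 2*y" using y by linarith
  moreover have "norm z<=norm z0 + norm (z0 - z)" by (metis norm_minus_commute norm_triangle_sub add.commute)
  ultimately show ?thesis using that y by (auto simp: uhp_iff R_def dist_norm)
 qed
 let ?S = "ball z0 y"
 have S2: "z : ball z0 (2*y)" if "z : ?S" for z using that y by simp
 define P where "P p z = of_real (V (Im (row_map p z))) * deriv (u p) z + of_real (V' (Im (row_map p z)))/(2*\<i>)*(1/(rjf p z)\<^sup>2)*u p z" for p z
 define Q where "Q p z = \<i>/2 * of_real (V' (Im (row_map p z))) * cnj (1/(rjf p z)\<^sup>2)*u p z" for p z
 have "has_wirt F (\<Sum>\<^sub>\<infinity>p\<in>crows. P p z0) (\<Sum>\<^sub>\<infinity>p\<in>crows. Q p z0) z0"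
 proof (rule has_wirt_series[of crows ?S t P Q "%p. (C*C*(2/y) + C*C) * rowsize p powr (\<alpha>+\<beta>)"])
  fix p z assume p: "p : crows" and z: "z : ?S"
  have zu: "z : uhp" using region[OF S2[OF z]] by simp
  have "Im (row_map p z) > 0" using row_map_uhp[OF p zu] by (simp add: uhp_iff)
  then have "((%y. complex_of_real (V y)) has_vector_derivative of_real (V' (Im (row_map p z)))) (at (Im (row_map p z)))"
   by (intro has_vector_derivative_of_real V_deriv)
  from has_wirt_compose[OF has_wirt_Im_compose[OF this] row_map_deriv[OF p zu]]
  have v: "has_wirt (%z. of_real (V (Im (row_map p z)))) (of_real (V' (Im (row_map p z)))/(2*\<i>)*(1/(rjf p z)\<^sup>2))
   (- of_real (V' (Im (row_map p z)))/(2*\<i>) * cnj (1/(rjf p z)\<^sup>2)) z" .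
  have "(u p has_field_derivative deriv (u p) z) (at z)" by (rule holomorphic_derivI[OF u_hol[OF p] open_uhp zu])
  from has_wirt_mult[OF v has_wirt_holomorphic[OF this]]
  show "has_wirt (t p) (P p z) (Q p z) z" unfolding t_def[abs_def] P_def Q_def by simp
  note c = C(2)[OF p] region[OF S2[OF z]]
  have du: "norm (deriv (u p) z)<=C * rowsize p powr \<alpha>*(2/(2*y - y))"
  proof (rule deriv_bound_ball)
   show "u p holomorphic_on ball z0 (2*y)" by (rule holomorphic_on_subset[OF u_hol[OF p]]) (use region in blast)
   show "norm (u p w)<=C * rowsize p powr \<alpha>" if "w : ball z0 (2*y)" for w using region[OF that] C(2)[OF p] by blast
  qed (use y z in auto)
  have cz: "norm (u p z)<=C * rowsize p powr \<alpha>" "\<bar>V (Im (row_map p z))\<bar><=C * rowsize p powr \<beta>"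
   "\<bar>V' (Im (row_map p z))\<bar>/(norm (rjf p z))\<^sup>2<=C * rowsize p powr \<beta>" using c by auto
  have 1: "\<bar>V (Im (row_map p z))\<bar>*norm (deriv (u p) z)<=(C * rowsize p powr \<beta>)*(C * rowsize p powr \<alpha>*(2/y))"
   using du cz(2) C(1) by (intro mult_mono) auto
  have 2: "\<bar>V' (Im (row_map p z))\<bar>/(norm (rjf p z))\<^sup>2*norm (u p z)<=(C * rowsize p powr \<beta>)*(C * rowsize p powr \<alpha>)"
   using cz(1,3) C(1) by (intro mult_mono) auto
  define X where "X = \<bar>V' (Im (row_map p z))\<bar>/(norm (rjf p z))\<^sup>2*norm (u p z)"
  have "norm (P p z)<=\<bar>V (Im (row_map p z))\<bar>*norm (deriv (u p) z) + X/2"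
   unfolding P_def X_def by (rule order_trans[OF norm_triangle_ineq]) (simp add: norm_mult norm_divide norm_power)
  moreover have "norm (Q p z) = X/2"
   unfolding Q_def X_def by (simp add: norm_mult norm_divide norm_power)
  ultimately have "norm (P p z) + norm (Q p z)<=(C * rowsize p powr \<beta>)*(C * rowsize p powr \<alpha>*(2/y))+(C * rowsize p powr \<beta>)*(C * rowsize p powr \<alpha>)"
   using 1 2[folded X_def] by linarith
  then show "norm (P p z) + norm (Q p z)<=(C*C*(2/y) + C*C) * rowsize p powr (\<alpha>+\<beta>)" by (simp add: powr_add algebra_simps)
 next
  fix z assume "z : ?S"
  then show "((%p. t p z) has_sum F z) crows" using region[OF S2] by (intro t_has_sum) auto
 qed (use y infinite_coprime_rows summable_ab in auto)
 then show ?thesis unfolding Q_def by (rule that)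
qed

lemma g_translate:
 assumes "z : uhp" shows "of_real (V (Im (z + of_int n)))*H (z + of_int n) = of_real (V (Im z))*H z"
 using periodic_int[of H, OF H_T assms] by simp

lemma F_modular: "mweight k F"
 unfolding mweight_def
proof (intro allI impI)
 fix a b c d z assume det: "a * d - b * c = (1::int)" and z: "z : uhp"
 define g where "g = moeb a b c d z"
 have g: "g : uhp" unfolding g_def by (rule moebius_in_uhp[OF det z])
 let ?s = "%p. (fst p * a + snd p * c, fst p * b + snd p * d)"
 have tt: "t p g = jf c d z^k * t (?s p) z" if p: "p : crows" for p
 proof -
  obtain n where n: "row_map p g = row_map (?s p) z + of_int n" using row_map_compose[OF det z p] by (auto simp: g_def)
  have j: "rjf p g*jf c d z = rjf (?s p) z" unfolding rjf_def g_def fst_conv snd_conv by (rule jf_compose[OF det z])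
  have J: "rjf p g ~= 0" "jf c d z ~= 0" by (rule rjf_nonzero[OF p g]) (rule det_jf_nonzero[OF z det])
  have "t p g = (of_real (V (Im (row_map (?s p) z)))*H (row_map (?s p) z))/rjf p g^k"
   unfolding t_def u_def n g_translate[OF row_map_uhp[OF crows_mult[OF det p] z], of n, symmetric] by simp
  also have "... = jf c d z^k*((of_real (V (Im (row_map (?s p) z)))*H (row_map (?s p) z))/rjf (?s p) z^k)"
   unfolding j[symmetric] using J by (simp add: power_mult_distrib)
  finally show ?thesis by (simp add: t_def u_def)
 qed
 have "((%p. t (?s p) z) has_sum F z) crows"
  using has_sum_reindex_bij_betw[OF bij_coprime_rows[OF det], of "%p. t p z" "F z"] t_has_sum[OF z] by simp
 then have "((%p. jf c d z^k * t (?s p) z) has_sum (jf c d z^k*F z)) crows" by (rule has_sum_cmult_right)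
 then have "((%p. t p g) has_sum (jf c d z^k*F z)) crows"
  by (rule has_sum_congD) (simp only: tt)
 then show "F (moeb a b c d z) = jf c d z^k*F z"
  using t_has_sum[OF g] has_sum_unique unfolding g_def by blast
qed

text \<open>The rows with c = 0 give the main term. The others are estimated for |Re z| <= 1/2,
  where \<open>rowsize\<close> is at most 2 |cz + d|, and the estimate is spread to all z by
  periodicity.\<close>

lemma F_cusp:
 assumes s: "s > 2" and B: "!!y. y >= 1 ==> B y >= 0"
  and tb: "!!p z. p : crows ==> fst p ~= 0 ==> Im z >= 1 ==> rowsize p<=2*norm (rjf p z) \<Longrightarrow>
   \<bar>of_int (fst p)\<bar>*Im z<=norm (rjf p z) ==> norm (t p z)<=B (Im z) * rowsize p powr (- s)"
 obtains K where "K > 0" "!!z. Im z >= 1 ==> norm (F z - 2 * of_real (V (Im z))*H z)<=K*B (Im z)"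
proof -
 define K where "K = (\<Sum>\<^sub>\<infinity>p\<in>UNIV. rowsize p powr (- s))"
 have Ks: "((%p. rowsize p powr (- s)) has_sum K) UNIV" unfolding K_def by (rule has_sum_infsum[OF summable_rowsize[OF s]])
 have K0: "K >= 0" using Ks by (rule has_sum_nonneg) simp
 have main: "norm (F z - 2 * of_real (V (Im z))*H z)<=K*B (Im z)" if z: "Im z >= 1" "\<bar>Re z\<bar><=1/2" for z
 proof -
  have zu: "z : uhp" using z by (simp add: uhp_iff)
  \<comment> \<open>Each of these two rows contributes V H: the row map is a translation and the
    factor (cz + d)^k is 1 because k is even.\<close>
  let ?E = "{(0, 1), (0, - 1)} :: (int \<times> int) set"
  have E: "?E \<subseteq> crows" by (auto simp: crows_def)
  have e: "t p z = of_real (V (Im z))*H z" if p: "p : ?E" for p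
  proof -
   obtain n where "row_map p z = z + of_int n" using row_map_translation[of z] p by auto
   moreover have "rjf p z^k = 1" using p even_k by (auto simp: rjf_def jf_def)
   ultimately show ?thesis using g_translate[OF zu, of n] by (simp add: t_def u_def)
  qed
  have "((%p. t p z) has_sum (2 * of_real (V (Im z))*H z)) ?E"
   by (rule has_sum_finiteI) (simp_all add: e)
  from has_sum_Diff[OF t_has_sum[OF zu] this E]
  have d: "((%p. t p z) has_sum (F z - 2 * of_real (V (Im z))*H z)) (crows - ?E)" .
  have tp: "norm (t p z)<=B (Im z) * rowsize p powr (- s)" if p: "p : crows - ?E" for p
  proof -
   have "fst p ~= 0"
   proof
    assume "fst p = 0"
    then have "\<bar>snd p\<bar> = 1" using p by (simp add: crows_def)
    then show False using p \<open>fst p = 0\<close> by (cases p) auto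
   qed
   moreover have "\<bar>of_int (fst p)\<bar>*Im z<=norm (rjf p z)"
    using abs_Im_le_cmod[of "rjf p z"] z by (simp add: rjf_def jf_def abs_mult)
   ultimately show ?thesis using tb[of p z] rowsize_le_strip[OF z, of p] p z by simp
  qed
  have sm: "(%p. norm (t p z)) summable_on (crows - ?E)"
   using has_sum_imp_summable[OF d] by (simp add: summable_on_iff_abs_summable_on_complex)
  have "((%p. B (Im z) * rowsize p powr (- s)) has_sum (B (Im z)*K)) UNIV" by (rule has_sum_cmult_right[OF Ks])
  then have "(\<Sum>\<^sub>\<infinity>p\<in>crows - ?E. norm (t p z))<=B (Im z)*K"
   by (rule has_sum_mono_neutral[OF has_sum_infsum[OF sm]]) (use tp B z in auto)
  moreover have "norm (F z - 2 * of_real (V (Im z))*H z)<=(\<Sum>\<^sub>\<infinity>p\<in>crows - ?E. norm (t p z))"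
   by (rule norm_has_sum_bound[OF has_sum_infsum[OF sm] d])
  ultimately show ?thesis by (simp add: mult.commute)
 qed
 have "norm (F z - 2 * of_real (V (Im z))*H z)<=(K+1)*B (Im z)" if z: "Im z >= 1" for z
 proof -
  define n where "n = - round (Re z)"
  define w where "w = z + of_int n"
  have zu: "z : uhp" using z by (simp add: uhp_iff)
  have w: "Im w = Im z" "\<bar>Re w\<bar><=1/2" using of_int_round_abs_le[of "Re z"] by (auto simp: w_def n_def abs_minus_commute)
  have "F w = F z" unfolding w_def by (rule periodic_int[of F, OF mweight_T[OF F_modular] zu])
  moreover have "H w = H z" unfolding w_def by (rule periodic_int[of H, OF H_T zu])
  ultimately have "norm (F z - 2 * of_real (V (Im z))*H z)<=K*B (Im z)" using main[of w] w z by simp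
  also have "...<=(K+1)*B (Im z)" using B[OF z] by (intro mult_right_mono) auto
  finally show ?thesis .
 qed
 then show ?thesis using that[of "K+1"] K0 by simp
qed

end

section \<open>The functions w and v\<close>

definition wfun :: "real => real => real" where
 "wfun a y = integral {0..y} (%s. sqrt s*exp (- a * s))"

lemma wfun_deriv:
 assumes "y > 0" shows "(wfun a has_real_derivative sqrt y*exp (- a*y)) (at y)"
proof -
 have "continuous_on {0..y+1} (%s. sqrt s*exp (- a * s))" by (intro continuous_intros)
 then have "((%x. integral {0..x} (%s. sqrt s*exp (- a * s))) has_real_derivative sqrt y*exp (- a*y)) (at y within {0..y+1})"
  by (rule integral_has_real_derivative) (use assms in auto)
 then show ?thesis unfolding wfun_def[abs_def] using assms by (simp add: at_within_Icc_at)
qed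

lemma wfun_bounds:
 assumes "a > 0" "y > 0" shows "0<=wfun a y" "wfun a y<=y powr (3/2)"
proof -
 have i: "(%s. sqrt s*exp (- a * s)) integrable_on {0..y}" by (intro integrable_continuous_interval continuous_intros)
 show "0<=wfun a y" unfolding wfun_def by (rule integral_nonneg[OF i]) auto
 have "wfun a y<=integral {0..y} (%s. sqrt y)" unfolding wfun_def
 proof (rule integral_le[OF i])
  fix s assume "s : {0..y}"
  then have "sqrt s*exp (- a * s)<=sqrt y*1" using assms by (intro mult_mono) auto
  then show "sqrt s*exp (- a * s)<=sqrt y" by simp
 qed (intro integrable_continuous_interval continuous_intros)
 also have "... = y * sqrt y" using assms by simp
 also have "... = y powr (3/2)" using assms powr_add[of y 1 "1/2"] by (simp add: powr_half_sqrt)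
 finally show "wfun a y<=y powr (3/2)" .
qed

text \<open>w increases, and a suitable multiple of e^(-3ay/4) added to it makes it decrease, so the
  supremum W is approached at that rate. The rate is below a because e^(as/4) is spent on the factor
  s^(1/2).\<close>

lemma wfun_limit:
 assumes a: "a > 0"
 obtains W K where "W > 0" "K >= 0" "!!y. y > 0 ==> wfun a y<=W" "!!y. y > 0 ==> W<=wfun a y + K*exp (- (3/4 * a)*y)"
proof -
 \<comment> \<open>Chosen so that K (3/4) a = 1 + 4/a, the constant in sqrt s <= (1 + 4/a)
   e^(as/4).\<close>
 define K where "K = 4/(3 * a)*(1+4/a)"
 have K: "K >= 0" using a by (simp add: K_def)
 have mono: "wfun a x<=wfun a y" if "0 < x" "x<=y" for x y
 proof (rule DERIV_nonneg_imp_nondecreasing[OF that(2)])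
  fix s assume "x<=s" "s<=y"
  then have "s > 0" using that by simp
  then show "\<exists>d. (wfun a has_real_derivative d) (at s) & 0<=d"
   using wfun_deriv[of s a] by (intro exI[of _ "sqrt s*exp (- a * s)"] conjI) auto
 qed
 have anti: "wfun a y + K*exp (- (3/4 * a)*y)<=wfun a x + K*exp (- (3/4 * a)*x)" if "0 < x" "x<=y" for x y
 proof (rule DERIV_nonpos_imp_nonincreasing[OF that(2)])
  fix s assume s: "x<=s" "s<=y"
  then have s0: "s > 0" using that by simp
  have "((%y. wfun a y + K*exp (- (3/4 * a)*y)) has_real_derivative sqrt s*exp (- a * s) + K*(exp (- (3/4 * a) * s)*(- (3/4 * a)))) (at s)"
   by (intro DERIV_add DERIV_cmult wfun_deriv[OF s0]) (auto intro!: derivative_eq_intros)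
  moreover have "sqrt s*exp (- a * s) + K*(exp (- (3/4 * a) * s)*(- (3/4 * a)))<=0"
  proof -
   have "sqrt s<=1 + s" using s0 by (intro real_le_lsqrt) (auto simp: power2_eq_square algebra_simps)
   also have "...<=(1+4/a)*exp (a/4 * s)"
   proof -
    have "a/4 * s<=exp (a/4 * s)" using exp_ge_add_one_self[of "a/4 * s"] by linarith
    then have "s<=4/a*exp (a/4 * s)" using a by (simp add: field_simps)
    moreover have "1<=exp (a/4 * s)" using a s0 by simp
    ultimately show ?thesis unfolding distrib_right mult_1 by linarith
   qed
   finally have "sqrt s*exp (- a * s)<=(1+4/a)*exp (a/4 * s)*exp (- a * s)" by (intro mult_right_mono) auto
   also have "... = (1+4/a)*exp (- (3/4 * a) * s)" by (simp add: exp_add[symmetric] mult.assoc)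
   also have "(1+4/a) = K*(3/4 * a)" using a by (simp add: K_def)
   finally show ?thesis by (simp add: algebra_simps)
  qed
  ultimately show "\<exists>d. ((%y. wfun a y + K*exp (- (3/4 * a)*y)) has_real_derivative d) (at s) & d<=0" by blast
 qed
 have cross: "wfun a x<=wfun a y + K*exp (- (3/4 * a)*y)" if "0 < x" "0 < y" for x y
 proof (cases "x<=y")
  case True
  then show ?thesis using mono[OF that(1) True] K by (smt (verit) exp_ge_zero mult_nonneg_nonneg)
 next
  case False
  then show ?thesis using anti[of y x] that K by (smt (verit) exp_ge_zero mult_nonneg_nonneg)
 qed
 define W where "W = Sup (wfun a ` {0<..})"
 have bdd: "bdd_above (wfun a ` {0<..})" using cross[of _ 1] by (intro bdd_aboveI2) auto
 have le: "wfun a y<=W" if "y > 0" for y unfolding W_def using that bdd by (intro cSUP_upper) auto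
 have ge: "W<=wfun a y + K*exp (- (3/4 * a)*y)" if "y > 0" for y
  unfolding W_def using cross that by (intro cSUP_least) auto
 have "wfun a 1 < wfun a 2"
 proof (rule DERIV_pos_imp_increasing[of 1 2 "wfun a"])
  fix s :: real assume "1<=s" "s<=2"
  then show "\<exists>d. (wfun a has_real_derivative d) (at s) & 0 < d"
   using wfun_deriv[of s a] by (intro exI[of _ "sqrt s*exp (- a * s)"] conjI) auto
 qed simp
 then have "W > 0" using le[of 2] wfun_bounds(1)[OF a, of 1] by simp
 then show ?thesis using that[of W K] K le ge by blast
qed

definition vfun_deriv :: "real => real => real" where
 "vfun_deriv a y = y powr (- 5/2)*exp (a*y)*wfun a y"

lemma vfun_exists:
 obtains v where "!!y. y > 0 ==> (v has_real_derivative vfun_deriv a y) (at y)"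
proof -
 have "isCont (vfun_deriv a) y" if "y > 0" for y
  unfolding vfun_deriv_def[abs_def] using DERIV_isCont[OF wfun_deriv[OF that]] that by (intro continuous_intros) auto
 then have "\<exists>F. \<forall>x::real. (0::ereal) < x \<longrightarrow> x < \<infinity> \<longrightarrow> (F has_vector_derivative vfun_deriv a x) (at x)"
  by (intro einterval_antiderivative) auto
 then show ?thesis using that by (auto simp: has_real_derivative_iff_has_vector_derivative)
qed

lemma vfun_deriv_bounds:
 assumes a: "a > 0" and y: "y > 0"
 shows "0<=vfun_deriv a y" "vfun_deriv a y<=exp (a*y)/y"
proof -
 show "0<=vfun_deriv a y" using wfun_bounds[OF assms] by (simp add: vfun_deriv_def)
 have "vfun_deriv a y<=y powr (- 5/2)*exp (a*y)*y powr (3/2)"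
  unfolding vfun_deriv_def using wfun_bounds[OF assms] by (intro mult_left_mono) auto
 also have "... = exp (a*y)*(y powr (- 5/2)*y powr (3/2))" by (simp only: mult_ac)
 also have "y powr (- 5/2)*y powr (3/2) = y powr (- 1)" unfolding powr_add[symmetric] by simp
 also have "... = 1/y" using y by (simp add: powr_minus field_simps)
 finally show "vfun_deriv a y<=exp (a*y)/y" by simp
qed

text \<open>v is logarithmic at 0, because its derivative is O(1/y). The power -1/8 is a convenient
  majorant: at Im z/J^2 it becomes J^(1/4), and -5/2 + 1/4 = -9/4 is still below -2.\<close>

lemma vfun_bound:
 assumes a: "a > 0" and v: "!!y. y > 0 ==> (v has_real_derivative vfun_deriv a y) (at y)" and L: "L > 0"
 obtains K where "K >= 0" "!!y. 0 < y ==> y<=L ==> \<bar>v y\<bar><=K*y powr (- 1/8)"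
proof -
 \<comment> \<open>The factor 8 undoes the exponent 1/8 after differentiation, and L^(1/8) accounts
   for 1/y <= L^(1/8) y^(-9/8) on the interval up to L.\<close>
 define D where "D = 8*(exp (a*L)*L powr (1/8))"
 have D: "D >= 0" by (simp add: D_def)
 have "\<bar>v y\<bar><=(\<bar>v L\<bar>*L powr (1/8) + D)*y powr (- 1/8)" if y: "0 < y" "y<=L" for y
 proof -
  have 1: "v y<=v L"
  proof (rule DERIV_nonneg_imp_nondecreasing[OF y(2)])
   fix s assume "y<=s" "s<=L"
   then have "s > 0" using y by simp
   then show "\<exists>d. (v has_real_derivative d) (at s) & 0<=d"
    using v[of s] vfun_deriv_bounds(1)[OF a, of s] by (intro exI[of _ "vfun_deriv a s"] conjI)
  qed
  have 2: "v L + D*L powr (- 1/8)<=v y + D*y powr (- 1/8)"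
  proof (rule DERIV_nonpos_imp_nonincreasing[OF y(2)])
   fix s assume s: "y<=s" "s<=L"
   then have s0: "s > 0" using y by simp
   have "((%y. v y + D*y powr (- 1/8)) has_real_derivative vfun_deriv a s + D*(- 1/8 * s powr (- 1/8 - 1))) (at s)"
    by (intro DERIV_add DERIV_cmult v[OF s0] has_real_derivative_powr s0)
   moreover have "vfun_deriv a s + D*(- 1/8 * s powr (- 1/8 - 1))<=0"
   proof -
    have "vfun_deriv a s<=exp (a * s)/s" by (rule vfun_deriv_bounds(2)[OF a s0])
    also have "...<=exp (a*L)*(1/s)" using s s0 a by (simp add: field_simps)
    also have "1/s = s powr (1/8) * s powr (- 1/8 - 1)" unfolding powr_add[symmetric] using s0 by (simp add: powr_minus field_simps)
    also have "exp (a*L)*(s powr (1/8) * s powr (- 1/8 - 1))<=exp (a*L)*(L powr (1/8) * s powr (- 1/8 - 1))"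
     using s s0 by (intro mult_left_mono mult_right_mono powr_mono2) auto
    finally show ?thesis by (simp add: D_def algebra_simps)
   qed
   ultimately show "\<exists>d. ((%y. v y + D*y powr (- 1/8)) has_real_derivative d) (at s) & d<=0" by blast
  qed
  have "L powr (- 1/8)<=y powr (- 1/8)" using y by (intro powr_mono2') auto
  moreover have "L powr (1/8)*L powr (- 1/8) = 1" unfolding powr_add[symmetric] using L by simp
  ultimately have "1<=L powr (1/8)*y powr (- 1/8)" by (metis mult_left_mono powr_ge_zero)
  then have "\<bar>v L\<bar>*1<=\<bar>v L\<bar>*(L powr (1/8)*y powr (- 1/8))" by (intro mult_left_mono) auto
  moreover have "0<=D*L powr (- 1/8)" "0<=D*y powr (- 1/8)" using D by simp_all
  ultimately have "v y<=\<bar>v L\<bar>*(L powr (1/8)*y powr (- 1/8)) + D*y powr (- 1/8)"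
   "- v y<=\<bar>v L\<bar>*(L powr (1/8)*y powr (- 1/8)) + D*y powr (- 1/8)" using 1 2 by linarith+
  then have "\<bar>v y\<bar><=\<bar>v L\<bar>*(L powr (1/8)*y powr (- 1/8)) + D*y powr (- 1/8)" by (rule abs_leI)
  then show ?thesis by (simp only: distrib_right mult.assoc)
 qed
 moreover have "\<bar>v L\<bar>*L powr (1/8) + D >= 0" using D by simp
 ultimately show ?thesis using that by blast
qed

lemma qpow_shift: "qpow r (z+1) = qpow r z * cis (2*pi * r)"
 by (simp add: qpow_def distrib_left exp_add cis_conv_exp mult_ac)

lemma cis_cong_24:
 assumes "[n = k] (mod 24)" shows "cis (2*pi*(of_int n/24)) = cis (2*pi*(of_int k/24))"
proof -
 obtain j where "n - k = 24*j" using assms unfolding cong_iff_dvd_diff by (auto simp: dvd_def)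
 then have "n = k+24*j" by simp
 then have "2*pi*(of_int n/24) = 2*pi*(of_int k/24)+2*pi * of_int j" by (simp add: field_simps)
 then have "cis (2*pi*(of_int n/24)) = cis (2*pi*(of_int k/24)) * cis (2*pi * of_int j)" by (simp only: cis_mult)
 then show ?thesis by simp
qed

lemma eta_region:
 assumes "0 < y0"
 obtains E where "E > 0" "!!z. y0<=Im z ==> norm z<=R ==> norm (eta z)<=E & norm (1/eta z)<=E"
proof -
 let ?S = "{z. Im z >= y0} \<inter> cball 0 R"
 have S: "compact ?S" by (rule closed_Int_compact[OF closed_halfspace_Im_ge compact_cball])
 have sub: "?S \<subseteq> uhp" using assms by (auto simp: uhp_iff)
 have c: "continuous_on ?S eta" by (rule continuous_on_subset[OF holomorphic_on_imp_continuous_on[OF eta_holomorphic] sub])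
 have "continuous_on ?S (%z. 1/eta z)" using sub eta_nonzero by (intro continuous_intros c) blast
 from compact_imp_bounded[OF compact_continuous_image[OF this S]]
 obtain B where B: "!!x. x : ?S ==> norm (1/eta x)<=B" unfolding bounded_iff by blast
 from compact_imp_bounded[OF compact_continuous_image[OF c S]]
 obtain A where A: "!!x. x : ?S ==> norm (eta x)<=A" unfolding bounded_iff by blast
 have "norm (eta z)<=\<bar>A\<bar>+\<bar>B\<bar>+1 & norm (1/eta z)<=\<bar>A\<bar>+\<bar>B\<bar>+1" if "y0<=Im z" "norm z<=R" for z
  using A[of z] B[of z] that by (auto simp: dist_norm)
 then show ?thesis using that[of "\<bar>A\<bar>+\<bar>B\<bar>+1"] by simp
qed

lemma scale_powr:
 assumes "J > 0" "y > (0::real)" shows "(y/J\<^sup>2) powr s = y powr s*J powr (- (2 * s))"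
proof -
 have "(J\<^sup>2) powr s = J powr (2 * s)" using assms powr_powr[of J 2 s] by (simp add: powr_numeral)
 then show ?thesis using assms powr_divide[of y "J\<^sup>2" s] by (simp add: powr_minus_divide)
qed

lemma rowsize_half_powr:
 assumes "rowsize p<=2*J" "p : crows" "s >= 0"
 shows "J powr (- s)<=2 powr s * rowsize p powr (- s)"
proof -
 have r: "rowsize p >= 1" by (rule rowsize_ge_1[OF crows_nonzero[OF assms(2)]])
 have "J powr (- s)<=(rowsize p/2) powr (- s)" using assms r by (intro powr_mono2') auto
 also have "... = 2 powr s * rowsize p powr (- s)" using r by (simp add: powr_divide powr_minus field_simps)
 finally show ?thesis .
qed

lemma quadratic_le_exp:
 assumes "y >= 1" "\<delta> > (0::real)" shows "y powr (3/2)<=2/\<delta>\<^sup>2*exp (\<delta>*y)"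
proof -
 have "y powr (3/2)<=y powr 2" using assms by (intro powr_mono) auto
 also have "... = y\<^sup>2" using assms by (simp add: powr_numeral)
 also have "...<=2/\<delta>\<^sup>2*exp (\<delta>*y)"
 proof -
  have "0<=\<delta>*y" using assms by simp
  then have "(\<delta>*y)\<^sup>2/2<=exp (\<delta>*y)" using exp_lower_Taylor_quadratic[of "\<delta>*y"] by linarith
  then show ?thesis using assms by (simp add: field_simps power_mult_distrib)
 qed
 finally show ?thesis .
qed

text \<open>The factor i cancels the -i of the kernel on the negative axis, so the derivative is
  real. It is v' with w replaced by its limit W, up to the constant a^(-3/2)/W; this links v to the
  required beta term.\<close>

lemma ibeta_deriv:
 assumes "a > 0" "y > 0"
 shows "((%y. \<i> * inc_Gamma (- 3/2) (- a*y)) has_vector_derivative of_real (a powr (- 3/2)*y powr (- 5/2)*exp (a*y))) (at y)"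
proof -
 have neg: "- a*y < 0" using assms by simp
 have dom: "complex_of_real (- a*y) : ig_domain" using assms by (simp add: ig_domain_iff)
 have l: "((%y. complex_of_real (- a*y)) has_vector_derivative of_real (- a)) (at y)"
  by (intro has_vector_derivative_of_real) (auto intro!: derivative_eq_intros)
 have "(ig_ext \<circ> (%y. complex_of_real (- a*y)) has_vector_derivative of_real (- a) * - ig_kernel (of_real (- a*y))) (at y)"
  by (rule field_vector_diff_chain_at[OF l ig_ext_deriv[OF dom]])
 then have "((%y. \<i> * ig_ext (of_real (- a*y))) has_vector_derivative \<i>*(of_real (- a) * - ig_kernel (of_real (- a*y)))) (at y)"
  unfolding o_def by (rule has_vector_derivative_mult_right)
 then have d: "((%y. \<i> * inc_Gamma (- 3/2) (- a*y)) has_vector_derivative \<i>*(of_real (- a) * - ig_kernel (of_real (- a*y)))) (at y)"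
 proof (rule has_vector_derivative_transform_within_open[of _ _ _ "{0<..}"])
  fix x :: real assume "x : {0<..}"
  then have "- a*x ~= 0" using assms by simp
  from ig_ext_eq[OF this] show "\<i> * ig_ext (of_real (- a*x)) = \<i> * inc_Gamma (- 3/2) (- a*x)" by (simp only:)
 qed (use assms in auto)
 have "a*\<bar>- a*y\<bar> powr (- 5/2) = a powr (- 3/2)*y powr (- 5/2)"
 proof -
  have "\<bar>- a*y\<bar> powr (- 5/2) = a powr (- 5/2)*y powr (- 5/2)" using assms by (simp add: abs_mult powr_mult)
  moreover have "a * a powr (- 5/2) = a powr (- 3/2)" using assms powr_add[of a 1 "- 5/2"] by simp
  ultimately show ?thesis by (simp only: mult.assoc[symmetric])
 qed
 then have "a powr (- 3/2)*y powr (- 5/2)*exp (a*y) = a*\<bar>- a*y\<bar> powr (- 5/2)*exp (a*y)" by (simp only:)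
 also have "... = a*(exp (- (- a*y))*\<bar>- a*y\<bar> powr (- 5/2))" by (simp add: mult_ac)
 finally have "a powr (- 3/2)*y powr (- 5/2)*exp (a*y) = a*(exp (- (- a*y))*\<bar>- a*y\<bar> powr (- 5/2))" .
 moreover have alg: "\<i>*(of_real (- a) * - (- \<i> * of_real X)) = of_real (a * X)" for X by (simp add: complex_eq_iff)
 have "\<i>*(of_real (- a) * - ig_kernel (of_real (- a*y))) = of_real (a*(exp (- (- a*y))*\<bar>- a*y\<bar> powr (- 5/2)))"
  unfolding ig_kernel_neg[OF neg] by (rule alg)
 ultimately show ?thesis using d by (simp only:)
qed

text \<open>The derivative is real, so the imaginary part cannot vary. It contributes a constant
  multiple of q^(m/24), which is why the coefficient at n = m is exempt from the reality
  assertion.\<close>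

lemma ibeta_Im_const:
 assumes "a > 0" "y > 0" "y' > 0"
 shows "Im (\<i> * inc_Gamma (- 3/2) (- a*y)) = Im (\<i> * inc_Gamma (- 3/2) (- a*y'))"
proof -
 have "((%y. Im (\<i> * inc_Gamma (- 3/2) (- a*y))) has_vector_derivative 0) (at y within {0<..})" if "y : {0<..}" for y
 proof (rule has_vector_derivative_at_within)
  show "((%y. Im (\<i> * inc_Gamma (- 3/2) (- a*y))) has_vector_derivative 0) (at y)"
   using bounded_linear.has_vector_derivative[OF bounded_linear_Im ibeta_deriv[OF assms(1), of y]] that
   unfolding Im_complex_of_real greaterThan_iff by blast
 qed
 then show ?thesis
 proof (rule has_vector_derivative_zero_constant[of "{0<..}" "%y. Im (\<i> * inc_Gamma (- 3/2) (- a*y))", rotated])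
  fix c assume c: "!!x. x : {0<..} ==> Im (\<i> * inc_Gamma (- 3/2) (- a*x)) = c"
  show ?thesis using c[of y] c[of y'] assms by simp
 qed (simp_all add: convex_real_interval)
qed

text \<open>Termwise inversion of the shadow map: dividing by \<open>shadow_fac\<close> gives a
  nonholomorphic part with the prescribed shadow. The decay e^(-x) of the incomplete Gamma function
  outweighs the growth e^(x/2) of q^(-n/24), so each term is bounded by the corresponding term of
  the shadow.\<close>

lemma neg_tail:
 assumes sum: "!!z. z : uhp ==> ((%n. b n*qpow (of_int n/24) z) has_sum G z) negset" and b0: "!!n. n<=0 ==> b n = 0"
 obtains N C where "!!z. z : uhp ==> ((%n. (cnj (b n)/shadow_fac n)*gam n z*qpow (- of_int n/24) z) has_sum N z) negset"
  "C >= 0" "!!z. Im z >= 1 ==> norm (N z)<=C"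
proof -
 let ?t = "%z n. (cnj (b n)/shadow_fac n)*gam n z*qpow (- of_int n/24) z"
 have t: "norm (?t z n)<=2*Im z powr (- 5/2)*norm (b n*qpow (of_int n/24) z)" if z: "z : uhp" for z n
 proof (cases "n > 0")
  case True
  define \<rho> where "\<rho> = pi * of_int n/6"
  define y where "y = Im z"
  have y: "y > 0" using z by (simp add: y_def uhp_iff)
  have "real_of_int n >= 1" using True by simp
  then have "pi*1<=pi * of_int n" by (intro mult_left_mono) auto
  then have \<rho>: "\<rho> >= 1/2" using pi_gt3 unfolding \<rho>_def by linarith
  have x: "\<rho>*y > 0" using \<rho> y by simp
  have sf: "norm (shadow_fac n) = \<rho> powr (- 3/2)" using True \<rho> by (simp add: shadow_fac_def \<rho>_def norm_mult abs_mult)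
  have "norm (inc_Gamma (1 - 5/2) (\<rho>*y)) = ig_real (\<rho>*y)" using inc_Gamma_pos[OF x] ig_real_bounds(1)[OF x] by simp
  then have g: "norm (inc_Gamma (1 - 5/2) (\<rho>*y))<=(\<rho>*y) powr (- 5/2)*exp (- (\<rho>*y))" using ig_real_bounds(2)[OF x] by simp
  have q: "norm (qpow (- of_int n/24) z) = exp (\<rho>*y/2)" "norm (qpow (of_int n/24) z) = exp (- (\<rho>*y/2))"
   by (simp_all add: norm_qpow \<rho>_def y_def field_simps)
  have a: "pi * of_int n*Im z/6 = \<rho>*y" by (simp add: \<rho>_def y_def)
  have "norm (?t z n)<=norm (b n)/\<rho> powr (- 3/2)*((\<rho>*y) powr (- 5/2)*exp (- (\<rho>*y)))*exp (\<rho>*y/2)"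
   unfolding a norm_mult norm_divide complex_mod_cnj sf q by (intro mult_right_mono mult_left_mono g) auto
  also have "... = norm (b n)*(\<rho> powr (- 5/2)/\<rho> powr (- 3/2))*y powr (- 5/2)*(exp (- (\<rho>*y))*exp (\<rho>*y/2))"
   using \<rho> y by (simp add: powr_mult)
  also have "exp (- (\<rho>*y))*exp (\<rho>*y/2) = exp (- (\<rho>*y/2))" unfolding exp_add[symmetric] by simp
  also have "\<rho> powr (- 5/2)/\<rho> powr (- 3/2) = 1/\<rho>" using \<rho> unfolding powr_diff[symmetric] by (simp add: powr_minus field_simps)
  also have "norm (b n)*(1/\<rho>)*y powr (- 5/2)*exp (- (\<rho>*y/2))<=norm (b n)*2*y powr (- 5/2)*exp (- (\<rho>*y/2))"
   using \<rho> by (intro mult_right_mono mult_left_mono) (auto simp: field_simps)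
  finally show ?thesis by (simp add: norm_mult q y_def mult_ac)
 qed (simp add: b0)
 have sb: "(%n. norm (b n*qpow (of_int n/24) z)) summable_on negset" if "z : uhp" for z
  using has_sum_imp_summable[OF sum[OF that]] by (simp add: summable_on_iff_abs_summable_on_complex)
 have st: "(%n. norm (?t z n)) summable_on negset" if "z : uhp" for z
  by (rule summable_on_comparison_test[OF summable_on_cmult_right[OF sb[OF that], of "2*Im z powr (- 5/2)"]]) (use t[OF that] in auto)
 define N where "N z = (\<Sum>\<^sub>\<infinity>n\<in>negset. ?t z n)" for z
 have N: "((%n. ?t z n) has_sum N z) negset" if "z : uhp" for z
  unfolding N_def using st[OF that] by (intro has_sum_infsum) (simp add: summable_on_iff_abs_summable_on_complex)
 have iu: "\<i> : uhp" by (simp add: uhp_iff)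
 define C where "C = (\<Sum>\<^sub>\<infinity>n\<in>negset. norm (b n*qpow (of_int n/24) \<i>))"
 have Cs: "((%n. norm (b n*qpow (of_int n/24) \<i>)) has_sum C) negset" unfolding C_def by (rule has_sum_infsum[OF sb[OF iu]])
 have "norm (N z)<=2*C" if z: "Im z >= 1" for z
 proof -
  have zu: "z : uhp" using z by (simp add: uhp_iff)
  have le: "norm (?t z n)<=2*norm (b n*qpow (of_int n/24) \<i>)" for n
  proof (cases "n > 0")
   case True
   have "Im z powr (- 5/2)<=1 powr (- 5/2)" using z by (intro powr_mono2') auto
   then have "2*Im z powr (- 5/2)*norm (b n*qpow (of_int n/24) z)<=2*1*norm (b n*qpow (of_int n/24) z)"
    by (intro mult_right_mono mult_left_mono) auto
   also have "...<=2*1*norm (b n*qpow (of_int n/24) \<i>)"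
    using True z unfolding norm_mult by (intro mult_left_mono) (auto simp: norm_qpow)
   finally show ?thesis using t[OF zu, of n] by simp
  qed (simp add: b0)
  have "norm (N z)<=(\<Sum>\<^sub>\<infinity>n\<in>negset. norm (?t z n))" by (rule norm_has_sum_bound[OF has_sum_infsum[OF st[OF zu]] N[OF zu]])
  also have "...<=2*C" by (rule has_sum_mono[OF has_sum_infsum[OF st[OF zu]] has_sum_cmult_right[OF Cs] le])
  finally show ?thesis .
 qed
 moreover have "C >= 0" using Cs by (rule has_sum_nonneg) simp
 ultimately show ?thesis using that[of N "2*C"] N by simp
qed

section \<open>The three series attached to a positive index\<close>

locale positive_index =
 fixes m :: int
 assumes m: "[m = 1] (mod 24)" "m > 0"
begin

definition r :: real where "r = of_int m/24"
definition a :: real where "a = 4*pi * r"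
definition v :: "real => real" where "v = (SOME v. \<forall>y>0. (v has_real_derivative vfun_deriv a y) (at y))"

lemma r_pos: "r > 0" and a_pos: "a > 0" and a_eq: "a = pi * of_int m/6"
 using m by (simp_all add: r_def a_def)

lemma v_deriv: "y > 0 ==> (v has_real_derivative vfun_deriv a y) (at y)"
proof -
 have "\<exists>v. \<forall>y>0. (v has_real_derivative vfun_deriv a y) (at y)" using vfun_exists by metis
 from someI_ex[OF this] show "y > 0 ==> (v has_real_derivative vfun_deriv a y) (at y)" unfolding v_def by blast
qed

lemma cis_r: "cis (2*pi * r) = cis (pi/12)"
 using cis_cong_24[OF m(1)] by (simp add: r_def)

lemma kernel_T: "z : uhp ==> qpow r (z+1)/eta (z+1) = qpow r z/eta z"
 "z : uhp ==> qpow (- r) (z+1)*eta (z+1) = qpow (- r) z*eta z"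
proof -
 have c: "cis (pi/12) ~= 0" by simp
 show 1: "z : uhp ==> qpow r (z+1)/eta (z+1) = qpow r z/eta z"
  unfolding qpow_shift eta_translate cis_r using c by simp
 have "qpow (- r) (z+1) = qpow (- r) z/cis (pi/12)" by (subst (1 2) qpow_minus) (simp add: qpow_shift cis_r)
 then show "z : uhp ==> qpow (- r) (z+1)*eta (z+1) = qpow (- r) z*eta z"
  unfolding eta_translate using c by simp
qed

lemma kernel_hol: "(%z. qpow r z/eta z) holomorphic_on uhp" "(%z. qpow (- r) z*eta z) holomorphic_on uhp"
 using eta_nonzero by (auto intro!: holomorphic_intros qpow_holomorphic eta_holomorphic)

text \<open>|q^r| <= 1 for r > 0, and 1/|eta| acquires J^(-1/2) with J = |cz + d|; together with the
  weight this makes J^(-5/2).\<close>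

lemma kernel_bound:
 assumes p: "p : crows" and z: "z : uhp"
 shows "norm (qpow r (row_map p z)/eta (row_map p z))/norm (rjf p z)^2<=norm (1/eta z)*norm (rjf p z) powr (- 5/2)"
proof -
 define J where "J = norm (rjf p z)"
 have J: "J > 0" using rjf_nonzero[OF p z] by (simp add: J_def)
 have "J powr (5/2) = J powr (1/2)*J\<^sup>2" using J powr_add[of J "1/2" 2] by (simp add: powr_numeral)
 then have pw: "J powr (- 5/2) = 1/(J powr (1/2)*J\<^sup>2)" using powr_minus[of J "5/2"] by (simp add: inverse_eq_divide)
 have "norm (qpow r (row_map p z))<=1" using r_pos row_map_uhp[OF p z] by (simp add: norm_qpow uhp_iff)
 then have "norm (qpow r (row_map p z))*norm (1/eta z)/(J powr (1/2)*J\<^sup>2)<=1*norm (1/eta z)/(J powr (1/2)*J\<^sup>2)"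
  by (intro divide_right_mono mult_right_mono) auto
 then show ?thesis unfolding J_def[symmetric] pw norm_divide norm_eta_row_map(2)[OF p z] by (simp add: field_simps)
qed

text \<open>q^(-r) grows with the height, so the bound uses an upper limit for the imaginary part of
  the transformed point.\<close>

lemma theta_bound:
 assumes p: "p : crows" and z: "z : uhp" and L: "Im z/(norm (rjf p z))\<^sup>2<=L"
 shows "norm (qpow (- r) (row_map p z)*eta (row_map p z))<=exp (2*pi * r*L)*norm (eta z)*norm (rjf p z) powr (1/2)"
proof -
 have "norm (qpow (- r) (row_map p z))<=exp (2*pi * r*L)"
 proof -
  have "2*pi * r*(Im z/(norm (rjf p z))\<^sup>2)<=2*pi * r*L" using L r_pos by (intro mult_left_mono) auto
  then show ?thesis by (simp add: norm_qpow Im_row_map[OF p])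
 qed
 then have "norm (qpow (- r) (row_map p z))*norm (eta (row_map p z))<=exp (2*pi * r*L)*norm (eta (row_map p z))"
  by (rule mult_right_mono) simp
 then show ?thesis unfolding norm_mult norm_eta_row_map(2)[OF p z] by (simp add: mult_ac)
qed

lemma wfun_row_bounds:
 assumes p: "p : crows" and z: "z : uhp"
 shows "\<bar>wfun a (Im (row_map p z))\<bar><=Im z powr (3/2)*norm (rjf p z) powr (- 3)"
  "\<bar>sqrt (Im (row_map p z))*exp (- a*Im (row_map p z))\<bar>/(norm (rjf p z))\<^sup>2<=Im z powr (1/2)*norm (rjf p z) powr (- 3)"
proof -
 define J where "J = norm (rjf p z)"
 have J: "J > 0" using rjf_nonzero[OF p z] by (simp add: J_def)
 have y: "Im z > 0" using z by (simp add: uhp_iff)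
 have Y: "Im (row_map p z) = Im z/J\<^sup>2" "Im z/J\<^sup>2 > 0" using Im_row_map[OF p] J y by (auto simp: J_def)
 show "\<bar>wfun a (Im (row_map p z))\<bar><=Im z powr (3/2)*norm (rjf p z) powr (- 3)"
  using wfun_bounds[OF a_pos Y(2)] scale_powr[OF J y, of "3/2"] unfolding Y(1) J_def[symmetric] by simp
 have P: "J powr (- 3) = 1/J^3" using J powr_minus[of J 3] by (simp add: powr_numeral inverse_eq_divide)
 have S: "sqrt (Im z/J\<^sup>2) = sqrt (Im z)/J" using J by (simp add: real_sqrt_divide)
 have "a*(Im z/J\<^sup>2) >= 0" using a_pos Y(2) by (intro mult_nonneg_nonneg) auto
 then have "exp (- a*(Im z/J\<^sup>2))<=1" by simp
 then have X: "sqrt (Im z)/J^3*exp (- a*(Im z/J\<^sup>2))<=sqrt (Im z)/J^3*1" using y J by (intro mult_left_mono) auto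
 define e where "e = exp (- a*(Im z/J\<^sup>2))"
 have e: "e > 0" by (simp add: e_def)
 have "\<bar>sqrt (Im z)/J*e\<bar>/J\<^sup>2 = sqrt (Im z)/J^3*e"
  using J y e by (simp add: abs_mult power2_eq_square power3_eq_cube)
 with X show "\<bar>sqrt (Im (row_map p z))*exp (- a*Im (row_map p z))\<bar>/(norm (rjf p z))\<^sup>2<=Im z powr (1/2)*norm (rjf p z) powr (- 3)"
  unfolding Y(1) J_def[symmetric] S P e_def[symmetric] using y by (simp add: powr_half_sqrt)
qed

lemma region:
 assumes "0 < y0" "y0<=Im z" "norm z<=R" "p : crows"
 defines "L1 \<equiv> 1/y0+1 + R/y0"
 shows "z : uhp" "L1 > 0" "1<=L1*norm (rjf p z)" "Im z/(norm (rjf p z))\<^sup>2<=R*L1\<^sup>2" "Im z<=R"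
proof -
 show z: "z : uhp" using assms by (simp add: uhp_iff)
 show R: "Im z<=R" using abs_Im_le_cmod[of z] assms by linarith
 have "0 < R/y0" "0 < 1/y0" using assms R by auto
 then show L1: "L1 > 0" unfolding L1_def by linarith
 show 1: "1<=L1*norm (rjf p z)"
  using rowsize_rjf(1)[OF assms(2,1,3), of p] rowsize_ge_1[OF crows_nonzero[OF assms(4)]] unfolding L1_def by linarith
 have J: "norm (rjf p z) > 0" using rjf_nonzero[OF assms(4) z] by simp
 have "1<=(L1*norm (rjf p z))\<^sup>2" using 1 by (rule one_le_power)
 then have "Im z*1<=R*(L1*norm (rjf p z))\<^sup>2" using R assms by (intro mult_mono) auto
 then show "Im z/(norm (rjf p z))\<^sup>2<=R*L1\<^sup>2" using J by (simp add: field_simps power_mult_distrib)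
qed

text \<open>The holomorphic weight 2 series of q^r/eta, with a constant factor V and total exponent
  -5/2.\<close>

sublocale A: poincare 2 "%_. 1" "%_. 0" "%z. qpow r z/eta z" "- 5/2" 0
proof
 fix y0 R :: real assume y0: "0 < y0" "0<=R"
 obtain E where E: "E > 0" "!!z. y0<=Im z ==> norm z<=R ==> norm (eta z)<=E & norm (1/eta z)<=E" using eta_region[OF y0(1)] by blast
 show "\<exists>C. \<forall>p\<in>crows. \<forall>z. y0<=Im z \<longrightarrow> norm z<=R \<longrightarrow>
   norm (qpow r (row_map p z)/eta (row_map p z))/norm (rjf p z)^2<=C*norm (rjf p z) powr (- 5/2) \<and>
   \<bar>1\<bar><=C*norm (rjf p z) powr 0 & \<bar>0\<bar>/(norm (rjf p z))\<^sup>2<=C*norm (rjf p z) powr 0"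
 proof (intro exI[of _ "E+1"] ballI allI impI conjI)
  fix p z assume z: "p : crows" "y0<=Im z" "norm z<=R"
  note rg = region[OF y0(1) z(2,3,1)]
  have "norm (1/eta z)*norm (rjf p z) powr (- 5/2)<=(E+1)*norm (rjf p z) powr (- 5/2)"
   using E(2)[OF z(2,3)] by (intro mult_right_mono) auto
  then show "norm (qpow r (row_map p z)/eta (row_map p z))/norm (rjf p z)^2<=(E+1)*norm (rjf p z) powr (- 5/2)"
   using kernel_bound[OF z(1) rg(1)] by linarith
 qed (use E(1) rjf_nonzero region(1)[OF y0(1)] in auto)
qed (use kernel_hol kernel_T in auto)

text \<open>The series that yields h_m. \<open>vfun_bound\<close> gives J^(1/4) for v, and v'/J^2 is
  locally bounded because v' = O(1/y) at y = Im z/J^2; the total exponent is -9/4.\<close>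

sublocale h: poincare 2 v "vfun_deriv a" "%z. qpow r z/eta z" "- 5/2" "1/4"
proof
 fix y0 R :: real assume y0: "0 < y0" "0<=R"
 obtain E where E: "E > 0" "!!z. y0<=Im z ==> norm z<=R ==> norm (eta z)<=E & norm (1/eta z)<=E" using eta_region[OF y0(1)] by blast
 define L1 where "L1 = 1/y0+1 + R/y0"
 define L where "L = R*L1\<^sup>2+1"
 have L: "L > 0" using y0 by (simp add: L_def add_nonneg_pos)
 obtain K where K: "K >= 0" "!!y. 0 < y ==> y<=L ==> \<bar>v y\<bar><=K*y powr (- 1/8)" using vfun_bound[OF a_pos v_deriv L] by blast
 define M where "M = exp (a*L)/y0*L1 powr (1/4)"
 define C where "C = E + K*y0 powr (- 1/8) + M"
 have M: "M >= 0" "K*y0 powr (- 1/8) >= 0" using y0 K by (simp_all add: M_def)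
 show "\<exists>C. \<forall>p\<in>crows. \<forall>z. y0<=Im z \<longrightarrow> norm z<=R \<longrightarrow>
   norm (qpow r (row_map p z)/eta (row_map p z))/norm (rjf p z)^2<=C*norm (rjf p z) powr (- 5/2) \<and>
   \<bar>v (Im (row_map p z))\<bar><=C*norm (rjf p z) powr (1/4) \<and>
   \<bar>vfun_deriv a (Im (row_map p z))\<bar>/(norm (rjf p z))\<^sup>2<=C*norm (rjf p z) powr (1/4)"
 proof (intro exI[of _ C] ballI allI impI conjI)
  fix p z assume z: "p : crows" "y0<=Im z" "norm z<=R"
  note rg = region[OF y0(1) z(2,3,1), folded L1_def]
  define J where "J = norm (rjf p z)"
  have J: "J > 0" using rjf_nonzero[OF z(1) rg(1)] by (simp add: J_def)
  have y: "Im z > 0" using y0 z by simp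
  have Y: "Im (row_map p z) = Im z/J\<^sup>2" "Im z/J\<^sup>2 > 0" "Im z/J\<^sup>2<=L"
   using Im_row_map[OF z(1)] J y rg(4) by (auto simp: J_def L_def)
  have "norm (1/eta z)*norm (rjf p z) powr (- 5/2)<=C*norm (rjf p z) powr (- 5/2)"
   using E(2)[OF z(2,3)] M by (intro mult_right_mono) (auto simp: C_def)
  then show "norm (qpow r (row_map p z)/eta (row_map p z))/norm (rjf p z)^2<=C*norm (rjf p z) powr (- 5/2)"
   using kernel_bound[OF z(1) rg(1)] by linarith
  have "\<bar>v (Im z/J\<^sup>2)\<bar><=K*(Im z powr (- 1/8)*J powr (1/4))"
   using K(2)[OF Y(2,3)] scale_powr[OF J y, of "- 1/8"] by simp
  also have "...<=K*(y0 powr (- 1/8)*J powr (1/4))"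
   using K(1) y0 z by (intro mult_left_mono mult_right_mono powr_mono2') auto
  also have "... = K*y0 powr (- 1/8)*J powr (1/4)" by simp
  also have "...<=C*J powr (1/4)" using E(1) M by (intro mult_right_mono) (auto simp: C_def)
  finally show "\<bar>v (Im (row_map p z))\<bar><=C*norm (rjf p z) powr (1/4)" by (simp only: Y(1) J_def)
  have "\<bar>vfun_deriv a (Im z/J\<^sup>2)\<bar>/J\<^sup>2<=exp (a*(Im z/J\<^sup>2))/(Im z/J\<^sup>2)/J\<^sup>2"
   using vfun_deriv_bounds[OF a_pos Y(2)] by (intro divide_right_mono) auto
  also have "... = exp (a*(Im z/J\<^sup>2))/Im z" using J by simp
  also have "...<=exp (a*L)/y0"
  proof -
   have "a*(Im z/J\<^sup>2)<=a*L" using a_pos Y(3) by (intro mult_left_mono) auto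
   then show ?thesis using y0 z by (intro frac_le) auto
  qed
  also have "... = exp (a*L)/y0*1" by simp
  also have "...<=exp (a*L)/y0*(L1*J) powr (1/4)"
   using rg(3) y0 ge_one_powr_ge_zero[of "L1*J" "1/4"] by (intro mult_left_mono) (auto simp: J_def)
  also have "... = M*J powr (1/4)" using rg(2) J by (simp add: M_def powr_mult)
  also have "...<=C*J powr (1/4)" using E(1) M by (intro mult_right_mono) (auto simp: C_def)
  finally show "\<bar>vfun_deriv a (Im (row_map p z))\<bar>/(norm (rjf p z))\<^sup>2<=C*norm (rjf p z) powr (1/4)" by (simp only: Y(1) J_def)
 qed
qed (use kernel_hol kernel_T v_deriv in auto)

text \<open>The series of the shadow. w(y) <= y^(3/2) gives J^(-3), \<open>eta\<close> gives
  J^(1/2), and q^(-r) stays bounded since the heights of the transformed points are bounded locally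
  uniformly; the total exponent is again -5/2.\<close>

sublocale T: poincare 0 "wfun a" "%y. sqrt y*exp (- a*y)" "%z. qpow (- r) z*eta z" "1/2" "- 3"
proof
 fix y0 R :: real assume y0: "0 < y0" "0<=R"
 obtain E where E: "E > 0" "!!z. y0<=Im z ==> norm z<=R ==> norm (eta z)<=E & norm (1/eta z)<=E" using eta_region[OF y0(1)] by blast
 define L1 where "L1 = 1/y0+1 + R/y0"
 define M where "M = exp (2*pi * r*(R*L1\<^sup>2))*E"
 define C where "C = M + R powr (3/2) + R powr (1/2)"
 have M: "M >= 0" using E(1) by (simp add: M_def)
 show "\<exists>C. \<forall>p\<in>crows. \<forall>z. y0<=Im z \<longrightarrow> norm z<=R \<longrightarrow>
   norm (qpow (- r) (row_map p z)*eta (row_map p z))/norm (rjf p z)^0<=C*norm (rjf p z) powr (1/2) \<and>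
   \<bar>wfun a (Im (row_map p z))\<bar><=C*norm (rjf p z) powr (- 3) \<and>
   \<bar>sqrt (Im (row_map p z))*exp (- a*Im (row_map p z))\<bar>/(norm (rjf p z))\<^sup>2<=C*norm (rjf p z) powr (- 3)"
 proof (intro exI[of _ C] ballI allI impI conjI)
  fix p z assume z: "p : crows" "y0<=Im z" "norm z<=R"
  note rg = region[OF y0(1) z(2,3,1), folded L1_def]
  have "exp (2*pi * r*(R*L1\<^sup>2))*norm (eta z)<=M" unfolding M_def using E(2)[OF z(2,3)] by (intro mult_left_mono) auto
  also have "M<=C" by (simp add: C_def)
  finally have "exp (2*pi * r*(R*L1\<^sup>2))*norm (eta z)*norm (rjf p z) powr (1/2)<=C*norm (rjf p z) powr (1/2)" by (intro mult_right_mono) auto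
  then show "norm (qpow (- r) (row_map p z)*eta (row_map p z))/norm (rjf p z)^0<=C*norm (rjf p z) powr (1/2)"
   using theta_bound[OF z(1) rg(1,4)] by simp
  have p: "Im z powr (3/2)<=R powr (3/2)" "Im z powr (1/2)<=R powr (1/2)" using rg(5) y0 z by (auto intro!: powr_mono2)
  have "Im z powr (3/2)*norm (rjf p z) powr (- 3)<=C*norm (rjf p z) powr (- 3)"
   using p(1) M by (intro mult_right_mono) (auto simp: C_def intro: order_trans)
  then show "\<bar>wfun a (Im (row_map p z))\<bar><=C*norm (rjf p z) powr (- 3)" using wfun_row_bounds(1)[OF z(1) rg(1)] by linarith
  have "Im z powr (1/2)<=C" using p(2) M powr_ge_zero[of R "3/2"] unfolding C_def by linarith
  then have "Im z powr (1/2)*norm (rjf p z) powr (- 3)<=C*norm (rjf p z) powr (- 3)" by (intro mult_right_mono) auto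
  then show "\<bar>sqrt (Im (row_map p z))*exp (- a*Im (row_map p z))\<bar>/(norm (rjf p z))\<^sup>2<=C*norm (rjf p z) powr (- 3)"
   using wfun_row_bounds(2)[OF z(1) rg(1)] by linarith
 qed
qed (use kernel_hol kernel_T wfun_deriv in auto)

lemma cnj_qpow: "cnj (qpow s z) = of_real (exp (- (4*pi * s)*Im z))*qpow (- s) z"
proof -
 have "cnj (2 * of_real pi*\<i> * of_real s*z) = of_real (- (4*pi * s)*Im z)+2 * of_real pi*\<i> * of_real (- s)*z"
  by (subst (2) complex_eq[of z], subst cnj.code) (simp add: complex_eq_iff algebra_simps)
 then show ?thesis unfolding qpow_def exp_cnj by (simp only: exp_add exp_of_real)
qed

text \<open>V is constant, so the series is holomorphic. It grows at most like 1/eta, that is like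
  q^(-1/24), hence has no pole in q, and holomorphic forms of weight 2 vanish.\<close>

lemma A_F_zero: assumes z: "z : uhp" shows "A.F z = 0"
proof -
 obtain E where E: "E > 0" "!!z. Im z >= 1 ==> norm (1/eta z)<=E*exp ((2*pi/24)*Im z)" using inverse_eta_cusp_bound by blast
 define B where "B y = E*2 powr (5/2)*exp ((2*pi/24)*y)" for y
 obtain K where K: "K > 0" "!!z. Im z >= 1 ==> norm (A.F z - 2 * of_real 1*(qpow r z/eta z))<=K*B (Im z)"
 proof (rule A.F_cusp[of "5/2" B])
  fix p z assume p: "p : crows" and z: "Im z >= 1" and J: "rowsize p<=2*norm (rjf p z)"
  have zu: "z : uhp" using z by (simp add: uhp_iff)
  have "norm (A.t p z) = norm (qpow r (row_map p z)/eta (row_map p z))/norm (rjf p z)^2"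
   by (simp add: A.t_def A.u_def norm_divide norm_power norm_mult)
  also have "...<=norm (1/eta z)*norm (rjf p z) powr (- 5/2)" by (rule kernel_bound[OF p zu])
  also have "...<=(E*exp ((2*pi/24)*Im z))*(2 powr (5/2) * rowsize p powr (- (5/2)))"
   using E(2)[OF z] rowsize_half_powr[OF J p, of "5/2"] E(1) by (intro mult_mono) auto
  finally show "norm (A.t p z)<=B (Im z) * rowsize p powr - (5/2)" by (simp add: B_def mult_ac)
 qed (use E(1) in \<open>auto simp: B_def\<close>)
 have c: "tendsto_cusp (%z. qpow 1 z*A.F z)"
 proof (rule tendsto_cusp_exp[where b = "2*pi - 2*pi/24"])
  fix z assume z: "Im z >= 1"
  have "norm (qpow r z)<=1" using r_pos z by (simp add: norm_qpow)
  then have "norm (qpow r z)*norm (1/eta z)<=1*(E*exp ((2*pi/24)*Im z))" by (intro mult_mono E(2)[OF z]) auto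
  then have "norm (2 * of_real 1*(qpow r z/eta z))<=2*(E*exp ((2*pi/24)*Im z))" by (simp add: norm_divide norm_mult)
  moreover have "norm (A.F z)<=norm (A.F z - 2 * of_real 1*(qpow r z/eta z)) + norm (2 * of_real 1*(qpow r z/eta z))"
   using norm_triangle_sub[of "A.F z" "2 * of_real 1*(qpow r z/eta z)"] by linarith
  ultimately have "norm (A.F z)<=(K*E*2 powr (5/2)+2*E)*exp ((2*pi/24)*Im z)"
   using K(2)[OF z] unfolding B_def by (simp add: algebra_simps)
  from mult_left_mono[OF this, of "exp (- 2*pi*Im z)"]
  have "norm (qpow 1 z*A.F z)<=(K*E*2 powr (5/2)+2*E)*(exp (- 2*pi*Im z)*exp ((2*pi/24)*Im z))"
   by (simp add: norm_mult norm_qpow mult_ac)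
  also have "exp (- 2*pi*Im z)*exp ((2*pi/24)*Im z) = exp (- (2*pi - 2*pi/24)*Im z)"
   unfolding exp_add[symmetric] by (rule arg_cong[of _ _ exp]) (simp add: field_simps)
  finally show "norm (qpow 1 z*A.F z)<=(K*E*2 powr (5/2)+2*E)*exp (- (2*pi - 2*pi/24)*Im z)" .
 qed (use pi_gt_zero in simp)
 have "\<exists>d. (A.F has_field_derivative d) (at z)" if zu: "z : uhp" for z
 proof -
  obtain P where "has_wirt A.F P (\<Sum>\<^sub>\<infinity>p\<in>crows. \<i>/2 * of_real 0 * cnj (1/(rjf p z)\<^sup>2)*A.u p z) z" using A.F_wirt[OF zu] by blast
  then have "has_wirt A.F P 0 z" by simp
  then show ?thesis using has_wirt_zero_imp_field_derivative by blast
 qed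
 then have "A.F holomorphic_on uhp" unfolding holomorphic_on_open[OF open_uhp] by blast
 then show ?thesis using A.F_modular c z by (rule weight2_vanishing)
qed

text \<open>Termwise, the conjugate derivative is Im^(1/2) |eta|^2 times the conjugate of a term of
  \<open>A.F\<close>: e^(-ay) q^(-r) is the conjugate of q^r, and eta = |eta|^2/conj(eta). The
  factor Im^(1/2) |eta|^2 is invariant, leaves the sum, and multiplies the conjugate of 0.\<close>

lemma T_F_hol: "T.F holomorphic_on uhp"
proof -
 have "\<exists>d. (T.F has_field_derivative d) (at z)" if z: "z : uhp" for z
 proof -
  obtain P where P: "has_wirt T.F P (\<Sum>\<^sub>\<infinity>p\<in>crows. \<i>/2 * of_real (sqrt (Im (row_map p z))*exp (- a*Im (row_map p z))) * cnj (1/(rjf p z)\<^sup>2) * T.u p z) z"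
   using T.F_wirt[OF z] by blast
  have e: "\<i>/2 * of_real (sqrt (Im (row_map p z))*exp (- a*Im (row_map p z))) * cnj (1/(rjf p z)\<^sup>2) * T.u p z
    = \<i>/2 * of_real (sqrt (Im z)*(norm (eta z))\<^sup>2) * cnj (A.t p z)" if p: "p : crows" for p
  proof -
   define w where "w = row_map p z"
   have w0: "eta w ~= 0" unfolding w_def by (rule eta_nonzero[OF row_map_uhp[OF p z]])
   have J: "norm (rjf p z) > 0" using rjf_nonzero[OF p z] by simp
   have 1: "of_real (exp (- a*Im w))*qpow (- r) w = cnj (qpow r w)" unfolding cnj_qpow a_def by (simp add: mult.assoc)
   have "complex_of_real ((norm (eta w))\<^sup>2) = eta w * cnj (eta w)" by (simp only: complex_norm_square)
   then have 2: "eta w = of_real ((norm (eta w))\<^sup>2)*(1/cnj (eta w))" using w0 by simp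
   have 3: "sqrt (Im w)*(norm (eta w))\<^sup>2 = sqrt (Im z)*(norm (eta z))\<^sup>2"
    unfolding w_def Im_row_map[OF p] norm_eta_row_map(1)[OF p z] using J by (simp add: real_sqrt_divide)
   have "\<i>/2 * of_real (sqrt (Im w)*exp (- a*Im w)) * cnj (1/(rjf p z)\<^sup>2)*(qpow (- r) w*eta w)
    = \<i>/2 * of_real (sqrt (Im w)) * cnj (1/(rjf p z)\<^sup>2)*(of_real (exp (- a*Im w))*qpow (- r) w)*eta w" by simp
   also have "... = \<i>/2 * of_real (sqrt (Im w)) * cnj (1/(rjf p z)\<^sup>2) * cnj (qpow r w)*(of_real ((norm (eta w))\<^sup>2)*(1/cnj (eta w)))"
    unfolding 1 using 2 by simp
   also have "... = \<i>/2 * of_real (sqrt (Im w)*(norm (eta w))\<^sup>2) * cnj (qpow r w/eta w/(rjf p z)\<^sup>2)" by (simp add: mult_ac)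
   finally show ?thesis unfolding 3 by (simp add: T.u_def A.t_def A.u_def w_def)
  qed
  have "((%p. cnj (A.t p z)) has_sum cnj 0) crows" unfolding has_sum_cnj_iff using A.t_has_sum[OF z] A_F_zero[OF z] by simp
  then have "((%p. \<i>/2 * of_real (sqrt (Im z)*(norm (eta z))\<^sup>2) * cnj (A.t p z)) has_sum (\<i>/2 * of_real (sqrt (Im z)*(norm (eta z))\<^sup>2) * cnj 0)) crows"
   by (rule has_sum_cmult_right)
  then have "((%p. \<i>/2 * of_real (sqrt (Im (row_map p z))*exp (- a*Im (row_map p z))) * cnj (1/(rjf p z)\<^sup>2) * T.u p z) has_sum (\<i>/2 * of_real (sqrt (Im z)*(norm (eta z))\<^sup>2) * cnj 0)) crows"
   by (rule has_sum_congD) (rule e[symmetric])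
  from infsumI[OF this] P have "has_wirt T.F P 0 z" by simp
  then show ?thesis using has_wirt_zero_imp_field_derivative by blast
 qed
 then show ?thesis unfolding holomorphic_on_open[OF open_uhp] by blast
qed

text \<open>The same mechanism one step earlier: e^(ay) q^r is the conjugate of q^(-r), and
  Im^(-5/2) |eta|^(-2) transforms by exactly the power |cz + d|^4 coming from the weight and the
  chain rule. What remains is the conjugate of a term of \<open>T.F\<close>.\<close>

lemma h_F_wirt:
 assumes z: "z : uhp"
 obtains P where "has_wirt h.F P (\<i>/2 * of_real (Im z powr (- 5/2)/(norm (eta z))\<^sup>2) * cnj (T.F z)) z"
proof -
 obtain P where P: "has_wirt h.F P (\<Sum>\<^sub>\<infinity>p\<in>crows. \<i>/2 * of_real (vfun_deriv a (Im (row_map p z))) * cnj (1/(rjf p z)\<^sup>2)*h.u p z) z"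
  using h.F_wirt[OF z] by blast
 have e: "\<i>/2 * of_real (vfun_deriv a (Im (row_map p z))) * cnj (1/(rjf p z)\<^sup>2)*h.u p z
   = \<i>/2 * of_real (Im z powr (- 5/2)/(norm (eta z))\<^sup>2) * cnj (T.t p z)" if p: "p : crows" for p
 proof -
  define w where "w = row_map p z"
  define j where "j = rjf p z"
  define J where "J = norm j"
  have w0: "eta w ~= 0" unfolding w_def by (rule eta_nonzero[OF row_map_uhp[OF p z]])
  have J: "J > 0" using rjf_nonzero[OF p z] by (simp add: J_def j_def)
  have y: "Im z > 0" using z by (simp add: uhp_iff)
  have 1: "of_real (exp (a*Im w))*qpow r w = cnj (qpow (- r) w)" unfolding cnj_qpow a_def by (simp add: mult.assoc)
  have "complex_of_real ((norm (eta w))\<^sup>2) = eta w * cnj (eta w)" by (simp only: complex_norm_square)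
  then have 2: "1/eta w = of_real (1/(norm (eta w))\<^sup>2) * cnj (eta w)" using w0 by simp
  have "complex_of_real (J^4) = (j * cnj j)\<^sup>2" unfolding J_def complex_norm_square[symmetric] by (simp flip: of_real_power power_mult)
  then have 3: "cnj (1/j\<^sup>2)*(1/j\<^sup>2) = of_real (1/J^4)" by (simp add: power_mult_distrib field_simps)
  have 4: "Im w powr (- 5/2)*(1/(norm (eta w))\<^sup>2)*(1/J^4) = Im z powr (- 5/2)/(norm (eta z))\<^sup>2"
   unfolding w_def Im_row_map[OF p] norm_eta_row_map(1)[OF p z] j_def[symmetric] J_def[symmetric] powr_52_scale[OF J y]
   using J eta_nonzero[OF z] by (simp add: field_simps power_numeral_reduce)
  have "\<i>/2 * of_real (vfun_deriv a (Im w)) * cnj (1/j\<^sup>2)*(qpow r w/eta w/j\<^sup>2)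
   = \<i>/2 * of_real (Im w powr (- 5/2)) * of_real (wfun a (Im w))*(cnj (1/j\<^sup>2)*(1/j\<^sup>2))*(of_real (exp (a*Im w))*qpow r w)*(1/eta w)"
   by (simp add: vfun_deriv_def mult_ac)
  also have "... = \<i>/2 * of_real (Im w powr (- 5/2)*(1/(norm (eta w))\<^sup>2)*(1/J^4)) * cnj (of_real (wfun a (Im w))*(qpow (- r) w*eta w))"
   unfolding 1 2 3 of_real_mult complex_cnj_mult complex_cnj_complex_of_real by (simp only: mult_ac)
  finally show ?thesis unfolding 4 by (simp add: h.u_def T.t_def T.u_def w_def j_def)
 qed
 have "((%p. cnj (T.t p z)) has_sum cnj (T.F z)) crows" unfolding has_sum_cnj_iff by (rule T.t_has_sum[OF z])
 then have "((%p. \<i>/2 * of_real (Im z powr (- 5/2)/(norm (eta z))\<^sup>2) * cnj (T.t p z)) has_sum (\<i>/2 * of_real (Im z powr (- 5/2)/(norm (eta z))\<^sup>2) * cnj (T.F z))) crows"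
  by (rule has_sum_cmult_right)
 then have "((%p. \<i>/2 * of_real (vfun_deriv a (Im (row_map p z))) * cnj (1/(rjf p z)\<^sup>2)*h.u p z) has_sum (\<i>/2 * of_real (Im z powr (- 5/2)/(norm (eta z))\<^sup>2) * cnj (T.F z))) crows"
  by (rule has_sum_congD) (rule e[symmetric])
 from infsumI[OF this] P show ?thesis using that by simp
qed

end

section \<open>Identification of the shadow and construction of h_m for positive m\<close>

lemma has_sum_singleton:
 fixes c :: complex
 assumes "k : I" shows "((%n. if n = k then c else 0) has_sum c) I"
 using has_sum_finite_neutralI[of "{k}" I "%n. if n = k then c else 0" c] assms by auto

lemma neg_part_translate:
 assumes sum: "!!z. z : uhp ==> ((%n. nonhol am n z) has_sum N z) negset"
  and z: "z : uhp"
 shows "N (z+1) = cis (pi/12)*N z"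
proof -
 have z1: "z+1 : uhp" using z by (simp add: uhp_iff)
 have "((%n. cis (pi/12)*(nonhol am n z)) has_sum (cis (pi/12)*N z)) negset"
  by (rule has_sum_cmult_right[OF sum[OF z]])
 moreover have "cis (pi/12)*(nonhol am n z)
  = am n * inc_Gamma (1 - 5/2) (pi * of_int n*Im (z+1)/6)*qpow (- of_int n/24) (z+1)" if "n : negset" for n
 proof -
  have "[- n = 1] (mod 24)" using that cong_minus_minus_iff[of n "-1" 24] by simp
  from cis_cong_24[OF this] have c: "cis (2*pi*(- of_int n/24)) = cis (pi/12)" by simp
  have i: "Im (z+1) = Im z" by simp
  show ?thesis unfolding qpow_shift c i by (simp only: mult_ac)
 qed
 ultimately have "((%n. am n * inc_Gamma (1 - 5/2) (pi * of_int n*Im (z+1)/6)*qpow (- of_int n/24) (z+1)) has_sum (cis (pi/12)*N z)) negset"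
  by (rule has_sum_congD)
 then show ?thesis using sum[OF z1] has_sum_unique by blast
qed

context positive_index
begin

text \<open>The main term at the cusp is 2 w(y) q^(-r) eta. Since W - w decays like e^(-3ay/4) and
  q^(-r) grows only like e^(ay/2), w may be replaced by W; then \<open>g_form_char\<close> applies
  to the quotient by 2 W eta.\<close>

lemma T_F_eq:
 assumes W: "W > 0" "K >= 0" "!!y. y > 0 ==> wfun a y<=W" "!!y. y > 0 ==> W<=wfun a y + K*exp (- (3/4 * a)*y)"
  and z: "z : uhp"
 shows "T.F z = of_real (2 * W)*g_form m z*eta z"
proof -
 obtain E where E: "E > 0" "!!z. Im z >= 1 ==> norm (eta z)<=E*exp (- (2*pi/24)*Im z)" using eta_cusp_bound by blast
 define M where "M = exp (2*pi * r)*E*2 powr (5/2)"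
 have M: "M > 0" using E by (simp add: M_def)
 define B where "B y = M*(y powr (3/2)*exp (- (2*pi/24)*y))" for y
 obtain K1 where K1: "K1 > 0" "!!z. Im z >= 1 ==> norm (T.F z - 2 * of_real (wfun a (Im z))*(qpow (- r) z*eta z))<=K1*B (Im z)"
 proof (rule T.F_cusp[of "5/2" B])
  fix p z assume p: "p : crows" and c: "fst p ~= 0" and z: "Im z >= 1" and rs: "rowsize p<=2*norm (rjf p z)"
   and cz: "\<bar>of_int (fst p)\<bar>*Im z<=norm (rjf p z)"
  have zu: "z : uhp" using z by (simp add: uhp_iff)
  define J where "J = norm (rjf p z)"
  have "1<=\<bar>fst p\<bar>" using c by simp
  then have "(1::real)<=\<bar>of_int (fst p)\<bar>" by linarith
  then have "1*Im z<=\<bar>of_int (fst p)\<bar>*Im z" using z by (intro mult_right_mono) auto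
  then have J: "Im z<=J" "1<=J" "0 < J" using cz z unfolding J_def by linarith+
  have "J*1<=J*J" using J by (intro mult_left_mono) auto
  then have "Im z<=J\<^sup>2" using J unfolding power2_eq_square by linarith
  then have Y: "Im z/(norm (rjf p z))\<^sup>2<=1" using J unfolding J_def[symmetric] by (simp add: pos_divide_le_eq)
  have "norm (T.t p z) = \<bar>wfun a (Im (row_map p z))\<bar>*norm (qpow (- r) (row_map p z)*eta (row_map p z))"
   by (simp add: T.t_def T.u_def norm_mult)
  also have "...<=(Im z powr (3/2)*J powr (- 3))*(exp (2*pi * r*1)*norm (eta z)*J powr (1/2))"
   using wfun_row_bounds(1)[OF p zu] theta_bound[OF p zu Y] unfolding J_def by (intro mult_mono) auto
  also have "... = exp (2*pi * r)*Im z powr (3/2)*norm (eta z)*(J powr (- 3)*J powr (1/2))" by simp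
  also have "J powr (- 3)*J powr (1/2) = J powr (- (5/2))" unfolding powr_add[symmetric] by simp
  also have "exp (2*pi * r)*Im z powr (3/2)*norm (eta z)*J powr (- (5/2))
   <=exp (2*pi * r)*Im z powr (3/2)*(E*exp (- (2*pi/24)*Im z))*(2 powr (5/2) * rowsize p powr (- (5/2)))"
   using E rowsize_half_powr[OF rs p, of "5/2"] z unfolding J_def by (intro mult_mono mult_left_mono) auto
  finally show "norm (T.t p z)<=B (Im z) * rowsize p powr - (5/2)" by (simp add: B_def M_def mult_ac)
 qed (use M in \<open>auto simp: B_def\<close>)
 define D where "D z = T.F z - of_real (2 * W)*(qpow (- r) z*eta z)" for z
 define c1 where "c1 = K1*M*(2/(pi/24)\<^sup>2)+2*K*E"
 have Db: "norm (D z)<=c1*exp (- (pi/24)*Im z)" if z: "Im z >= 1" for z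
 proof -
  \<comment> \<open>Half of the exponential decay of \<open>eta\<close> is given up to absorb the
    power y^(3/2).\<close>
  have "Im z powr (3/2)*exp (- (2*pi/24)*Im z)<=(2/(pi/24)\<^sup>2*exp (pi/24*Im z))*exp (- (2*pi/24)*Im z)"
   using quadratic_le_exp[OF z, of "pi/24"] by (intro mult_right_mono) auto
  also have "... = 2/(pi/24)\<^sup>2*exp (- (pi/24)*Im z)"
   unfolding mult.assoc exp_add[symmetric] by simp
  finally have "K1*B (Im z)<=K1*(M*(2/(pi/24)\<^sup>2*exp (- (pi/24)*Im z)))"
   unfolding B_def using K1(1) M by (intro mult_left_mono) auto
  then have 1: "norm (T.F z - 2 * of_real (wfun a (Im z))*(qpow (- r) z*eta z))<=K1*M*(2/(pi/24)\<^sup>2)*exp (- (pi/24)*Im z)"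
   using K1(2)[OF z] by (simp add: mult_ac)
  have y: "Im z > 0" using z by simp
  define X where "X = K*exp (- (3/4 * a)*Im z)"
  have u: "0<=W - wfun a (Im z)" "W - wfun a (Im z)<=X" using W(3,4)[OF y] by (simp_all add: X_def diff_le_eq add.commute)
  have "\<bar>2*(wfun a (Im z) - W)\<bar> = 2*\<bar>W - wfun a (Im z)\<bar>" unfolding abs_mult by (simp add: abs_minus_commute)
  also have "...<=2 * X" using u by (simp only: abs_of_nonneg) simp
  finally have w: "\<bar>2*(wfun a (Im z) - W)\<bar><=2*(K*exp (- (3/4 * a)*Im z))" by (simp only: X_def)
  have q: "norm (qpow (- r) z) = exp (a/2*Im z)" by (simp add: norm_qpow a_def)
  have "\<bar>2*(wfun a (Im z) - W)\<bar>*(norm (qpow (- r) z)*norm (eta z)) \<le>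
    (2*(K*exp (- (3/4 * a)*Im z)))*(exp (a/2*Im z)*(E*exp (- (2*pi/24)*Im z)))"
   unfolding q using W(2) E(2)[OF z] by (intro mult_mono[OF w] mult_left_mono) auto
  also have "... = 2*K*E*exp (- (3/4 * a)*Im z+(a/2*Im z + - (2*pi/24)*Im z))"
   unfolding exp_add by (simp only: mult_ac)
  also have "...<=2*K*E*exp (- (pi/24)*Im z)"
  proof (intro mult_left_mono)
   have "0<=a*Im z" "0<=pi*Im z" using a_pos y by auto
   then show "exp (- (3/4 * a)*Im z+(a/2*Im z + - (2*pi/24)*Im z))<=exp (- (pi/24)*Im z)"
    unfolding exp_le_cancel_iff by (simp add: field_simps)
  qed (use W(2) E(1) in simp)
  finally have 2: "norm (of_real (2*(wfun a (Im z) - W))*(qpow (- r) z*eta z))<=2*K*E*exp (- (pi/24)*Im z)"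
   by (simp only: norm_mult norm_of_real)
  have "D z = (T.F z - 2 * of_real (wfun a (Im z))*(qpow (- r) z*eta z)) + of_real (2*(wfun a (Im z) - W))*(qpow (- r) z*eta z)"
   unfolding D_def by (simp add: algebra_simps)
  then have "norm (D z)<=norm (T.F z - 2 * of_real (wfun a (Im z))*(qpow (- r) z*eta z)) + norm (of_real (2*(wfun a (Im z) - W))*(qpow (- r) z*eta z))"
   by (simp only: norm_triangle_ineq)
  then show ?thesis using 1 2 unfolding c1_def by (simp only: distrib_right)
 qed
 define g where "g z = T.F z/(of_real (2 * W)*eta z)" for z
 have ge: "g z*eta z = T.F z/of_real (2 * W)" if "z : uhp" for z using eta_nonzero[OF that] by (simp add: g_def)
 have "g holomorphic_on uhp"
  unfolding g_def[abs_def] using eta_nonzero W(1) by (intro holomorphic_intros T_F_hol eta_holomorphic) auto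
 moreover have "mweight 0 (%z. g z*eta z)"
  using T.F_modular ge moebius_in_uhp unfolding mweight_def by simp
 moreover have "tendsto_cusp (%z. (g z - qpow (- of_int m/24) z)*eta z)"
 proof (rule tendsto_cusp_exp)
  fix z assume z: "Im z >= 1"
  then have zu: "z : uhp" by (simp add: uhp_iff)
  have r': "- of_int m/24 = - r" by (simp add: r_def)
  have "(g z - qpow (- of_int m/24) z)*eta z = D z/of_real (2 * W)"
   unfolding left_diff_distrib ge[OF zu] r' D_def using W(1) by (simp add: field_simps)
  then have "norm ((g z - qpow (- of_int m/24) z)*eta z) = norm (D z)/(2 * W)" using W(1) by (simp add: norm_divide)
  also have "...<=c1*exp (- (pi/24)*Im z)/(2 * W)" using Db[OF z] W(1) by (intro divide_right_mono) auto
  finally show "norm ((g z - qpow (- of_int m/24) z)*eta z)<=c1/(2 * W)*exp (- (pi/24)*Im z)" by simp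
 qed simp
 ultimately have "g z = g_form m z" using z by (rule g_form_char[OF m])
 then show ?thesis using eta_nonzero[OF z] W(1) by (simp add: g_def field_simps)
qed

text \<open>The rows with nonzero c contribute at most a multiple of 1/eta to the series, which the
  factor \<open>eta\<close> in front reduces to a bounded error.\<close>

lemma h_F_cusp:
 obtains C where "C > 0" "!!z. Im z >= 1 ==> norm (eta z*h.F z - 2 * of_real (v (Im z))*qpow r z)<=C"
proof -
 obtain E where E: "E > 0" "!!z. Im z >= 1 ==> norm (eta z)<=E*exp (- (2*pi/24)*Im z)" using eta_cusp_bound by blast
 obtain E' where E': "E' > 0" "!!z. Im z >= 1 ==> norm (1/eta z)<=E'*exp ((2*pi/24)*Im z)" using inverse_eta_cusp_bound by blast
 obtain K where K: "K >= 0" "!!y. 0 < y ==> y<=1 ==> \<bar>v y\<bar><=K*y powr (- 1/8)" using vfun_bound[OF a_pos v_deriv, of 1] by auto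
 define M where "M = K*E'*2 powr (9/4)"
 have M: "M >= 0" using K E' by (simp add: M_def)
 define B where "B y = M*exp ((2*pi/24)*y)" for y
 obtain K1 where K1: "K1 > 0" "!!z. Im z >= 1 ==> norm (h.F z - 2 * of_real (v (Im z))*(qpow r z/eta z))<=K1*B (Im z)"
 proof (rule h.F_cusp[of "9/4" B])
  fix p z assume p: "p : crows" and c: "fst p ~= 0" and z: "Im z >= 1" and rs: "rowsize p<=2*norm (rjf p z)"
   and cz: "\<bar>of_int (fst p)\<bar>*Im z<=norm (rjf p z)"
  have zu: "z : uhp" using z by (simp add: uhp_iff)
  define J where "J = norm (rjf p z)"
  have "1<=\<bar>fst p\<bar>" using c by simp
  then have "(1::real)<=\<bar>of_int (fst p)\<bar>" by linarith
  then have "1*Im z<=\<bar>of_int (fst p)\<bar>*Im z" using z by (intro mult_right_mono) auto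
  then have J: "Im z<=J" "1<=J" "0 < J" using cz z unfolding J_def by linarith+
  have "J*1<=J*J" using J by (intro mult_left_mono) auto
  then have "Im z<=J\<^sup>2" using J unfolding power2_eq_square by linarith
  then have Y: "Im z/J\<^sup>2<=1" "0 < Im z/J\<^sup>2" using J z by (simp_all add: pos_divide_le_eq)
  have y: "Im z > 0" using z by simp
  have "Im z powr (- 1/8)<=1 powr (- 1/8)" using z by (intro powr_mono2') auto
  then have "K*(Im z powr (- 1/8)*J powr (1/4))<=K*(1*J powr (1/4))" using K(1) by (intro mult_left_mono mult_right_mono) auto
  then have v: "\<bar>v (Im (row_map p z))\<bar><=K*J powr (1/4)"
   using K(2)[OF Y(2,1)] scale_powr[OF J(3) y, of "- 1/8"] unfolding Im_row_map[OF p] J_def[symmetric] by simp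
  have "norm (h.t p z) = \<bar>v (Im (row_map p z))\<bar>*(norm (qpow r (row_map p z)/eta (row_map p z))/norm (rjf p z)^2)"
   by (simp add: h.t_def h.u_def norm_mult norm_divide norm_power)
  also have "...<=(K*J powr (1/4))*(norm (1/eta z)*J powr (- 5/2))"
   using v kernel_bound[OF p zu] K(1) unfolding J_def by (intro mult_mono) auto
  also have "... = K*norm (1/eta z)*(J powr (1/4)*J powr (- 5/2))" by simp
  also have "J powr (1/4)*J powr (- 5/2) = J powr (- (9/4))" unfolding powr_add[symmetric] by simp
  also have "K*norm (1/eta z)*J powr (- (9/4))<=K*(E'*exp ((2*pi/24)*Im z))*(2 powr (9/4) * rowsize p powr (- (9/4)))"
   using K E' rowsize_half_powr[OF rs p, of "9/4"] z unfolding J_def by (intro mult_mono mult_left_mono) auto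
  finally show "norm (h.t p z)<=B (Im z) * rowsize p powr - (9/4)" by (simp add: B_def M_def mult_ac)
 qed (use M in \<open>auto simp: B_def\<close>)
 have "norm (eta z*h.F z - 2 * of_real (v (Im z))*qpow r z)<=E*(K1*M)+1" if z: "Im z >= 1" for z
 proof -
  have "eta z ~= 0" using z by (intro eta_nonzero) (simp add: uhp_iff)
  then have "eta z*h.F z - 2 * of_real (v (Im z))*qpow r z = eta z*(h.F z - 2 * of_real (v (Im z))*(qpow r z/eta z))"
   by (simp add: algebra_simps)
  then have "norm (eta z*h.F z - 2 * of_real (v (Im z))*qpow r z)<=(E*exp (- (2*pi/24)*Im z))*(K1*B (Im z))"
   using E(1) by (simp only: norm_mult) (intro mult_mono E(2)[OF z] K1(2)[OF z], auto)
  also have "... = E*(K1*M)*(exp (- (2*pi/24)*Im z)*exp ((2*pi/24)*Im z))" by (simp add: B_def)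
  also have "exp (- (2*pi/24)*Im z)*exp ((2*pi/24)*Im z) = 1" unfolding exp_add[symmetric] by simp
  finally show ?thesis by simp
 qed
 moreover have "E*(K1*M)+1 > 0" using E(1) K1(1) M by (simp add: add_nonneg_pos)
 ultimately show ?thesis using that by blast
qed

text \<open>The two functions have derivatives that differ by O(e^(ay)(W - w)) = O(e^(ay/4)), so
  their difference is O(y e^(ay/4)), which |q^r| = e^(-ay/2) outweighs. The bound e^y is generous;
  later only its growth rate 1 < 2 pi - 2 pi/24 matters.\<close>

lemma main_term_bound:
 assumes W: "W > 0" "K >= 0" "!!y. y > 0 ==> wfun a y<=W" "!!y. y > 0 ==> W<=wfun a y + K*exp (- (3/4 * a)*y)"
 obtains C where "C > 0" "!!z. Im z >= 1 \<Longrightarrow>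
  norm ((of_real (a powr (- 3/2)/W * v (Im z)) - \<i> * inc_Gamma (- 3/2) (- a*Im z))*qpow r z)<=C*exp (Im z)"
proof -
 define \<kappa> where "\<kappa> = a powr (- 3/2)"
 have \<kappa>: "\<kappa> > 0" using a_pos by (simp add: \<kappa>_def)
 define \<delta> where "\<delta> y = complex_of_real (\<kappa>/W * v y) - \<i> * inc_Gamma (- 3/2) (- a*y)" for y
 define d where "d y = \<kappa>/W * vfun_deriv a y - \<kappa>*y powr (- 5/2)*exp (a*y)" for y
 have \<delta>d: "(\<delta> has_vector_derivative of_real (d y)) (at y)" if y: "y > 0" for y
 proof -
  have "((%y. \<kappa>/W * v y) has_vector_derivative \<kappa>/W * vfun_deriv a y) (at y)"
   using DERIV_cmult[OF v_deriv[OF y], of "\<kappa>/W"] by (simp only: has_real_derivative_iff_has_vector_derivative)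
  then have "((%y. complex_of_real (\<kappa>/W * v y)) has_vector_derivative of_real (\<kappa>/W * vfun_deriv a y)) (at y)"
   using bounded_linear.has_vector_derivative[OF bounded_linear_of_real] by blast
  from has_vector_derivative_diff[OF this ibeta_deriv[OF a_pos y]]
  show ?thesis unfolding \<delta>_def[abs_def] d_def \<kappa>_def of_real_diff .
 qed
 define c where "c = \<kappa>*(K/W)"
 have c: "c >= 0" using \<kappa> W by (simp add: c_def)
 have db: "\<bar>d y\<bar><=c*exp (a/4*y)" if y: "y >= 1" for y
 proof -
  have y0: "y > 0" using y by simp
  have "y powr (- 5/2)<=1 powr (- 5/2)" using y by (intro powr_mono2') auto
  then have p: "y powr (- 5/2)<=1" by simp
  have dy: "d y = - (\<kappa>*(y powr (- 5/2)*(exp (a*y)*((W - wfun a y)/W))))"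
   using W(1) by (simp add: d_def vfun_deriv_def field_simps)
  have w: "0<=(W - wfun a y)/W" "(W - wfun a y)/W<=K*exp (- (3/4 * a)*y)/W"
   using W(1) W(3,4)[OF y0] by (auto intro!: divide_right_mono)
  have "0<=\<kappa>*(y powr (- 5/2)*(exp (a*y)*((W - wfun a y)/W)))"
   by (rule mult_nonneg_nonneg[OF less_imp_le[OF \<kappa>] mult_nonneg_nonneg[OF powr_ge_zero mult_nonneg_nonneg[OF exp_ge_zero w(1)]]])
  then have "\<bar>d y\<bar> = \<kappa>*(y powr (- 5/2)*(exp (a*y)*((W - wfun a y)/W)))" unfolding dy by (simp only: abs_minus_cancel abs_of_nonneg)
  also have "...<=\<kappa>*(1*(exp (a*y)*(K*exp (- (3/4 * a)*y)/W)))"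
   using \<kappa> p w mult_nonneg_nonneg[OF exp_ge_zero[of "a*y"] w(1)] by (intro mult_left_mono mult_mono) auto
  also have "... = c*(exp (a*y)*exp (- (3/4 * a)*y))" by (simp add: c_def)
  also have "exp (a*y)*exp (- (3/4 * a)*y) = exp (a/4*y)"
   unfolding exp_add[symmetric] by (rule arg_cong[of _ _ exp]) (simp add: field_simps)
  finally show ?thesis .
 qed
 have diff: "norm (\<delta> y - \<delta> 1)<=(c*exp (a/4*y))*norm (y - 1)" if y: "y >= 1" for y
 proof (rule differentiable_bound[of "{1..y}" \<delta> "%x h. h *\<^sub>R of_real (d x)"])
  fix x assume x: "x : {1..y}"
  then have "x > 0" by simp
  from \<delta>d[OF this] show "(\<delta> has_derivative (%h. h *\<^sub>R of_real (d x))) (at x within {1..y})"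
   unfolding has_vector_derivative_def by (rule has_derivative_at_withinI)
  have "\<bar>d x\<bar><=c*exp (a/4*x)" using db[of x] x by simp
  also have "...<=c*exp (a/4*y)" using x a_pos c by (intro mult_left_mono) auto
  finally have dx: "\<bar>d x\<bar><=c*exp (a/4*y)" .
  show "onorm (%h::real. h *\<^sub>R complex_of_real (d x))<=c*exp (a/4*y)"
  proof (rule onorm_le)
   fix h :: real
   have "norm (h *\<^sub>R complex_of_real (d x)) = \<bar>d x\<bar>*norm h" by simp
   then show "norm (h *\<^sub>R complex_of_real (d x))<=c*exp (a/4*y)*norm h"
    using mult_right_mono[OF dx norm_ge_zero[of h]] by (simp only:)
  qed
 qed (use y in auto)
 define C where "C = norm (\<delta> 1) + c+1"
 have "norm (\<delta> (Im z)*qpow r z)<=C*exp (Im z)" if z: "Im z >= 1" for z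
 proof -
  define y where "y = Im z"
  have q: "norm (qpow r z) = exp (- (a/2)*y)" by (simp add: norm_qpow a_def y_def)
  have y: "y >= 1" using z by (simp add: y_def)
  have ay: "0<=a*y" using a_pos y by simp
  have "norm (\<delta> y)<=norm (\<delta> 1) + c*exp (a/4*y)*y"
  proof -
   have "c*exp (a/4*y)*norm (y - 1)<=c*exp (a/4*y)*y" using y c by (intro mult_left_mono) auto
   then show ?thesis using diff[OF y] norm_triangle_sub[of "\<delta> y" "\<delta> 1"] by linarith
  qed
  then have "norm (\<delta> y)*exp (- (a/2)*y)<=(norm (\<delta> 1) + c*exp (a/4*y)*y)*exp (- (a/2)*y)"
   by (intro mult_right_mono) auto
  also have "... = norm (\<delta> 1)*exp (- (a/2)*y) + c*y*(exp (a/4*y)*exp (- (a/2)*y))" by (simp add: algebra_simps)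
  also have "exp (a/4*y)*exp (- (a/2)*y) = exp (- (a/4)*y)"
   unfolding exp_add[symmetric] by (rule arg_cong[of _ _ exp]) (simp add: field_simps)
  also have "norm (\<delta> 1)*exp (- (a/2)*y) + c*y*exp (- (a/4)*y)<=norm (\<delta> 1)*1 + c*y*1"
   using ay c y by (intro add_mono mult_left_mono) auto
  also have "...<=norm (\<delta> 1)*exp y + c*exp y"
  proof -
   have "1<=exp y" "y<=exp y" using exp_ge_add_one_self[of y] y by linarith+
   from mult_left_mono[OF this(1) norm_ge_zero[of "\<delta> 1"]] mult_left_mono[OF this(2) c]
   show ?thesis by linarith
  qed
  also have "...<=C*exp y" by (simp add: C_def distrib_right)
  finally show ?thesis by (simp add: norm_mult q y_def)
 qed
 moreover have "C > 0" using c by (simp add: C_def add_nonneg_pos)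
 ultimately show ?thesis using that unfolding \<delta>_def \<kappa>_def by blast
qed

text \<open>\<open>f\<close> comes from the series and has shadow a^(-3/2) g_m, and \<open>N\<close>
  is the termwise nonholomorphic part with the same shadow. Hence f - N is holomorphic; it behaves
  like q^(1/24) under translation and grows at most like e^y, too slowly for a nonpositive
  exponent.\<close>

lemma positive_form_exists:
 obtains f bp bm where "!!z. z \<notin> uhp ==> f z = 0" "transforms_like (5/2) eta_mult f" "hexp f bp bm"
  "!!n. n<=0 ==> bp n = 0" "!!n. n<=0 ==> n ~= - m ==> bm n = 0" "bm (- m) = \<i>"
  "!!z. z : uhp ==> \<exists>P. has_wirt f P (\<i>/2 * of_real (Im z powr (- 5/2)) * cnj (of_real (a powr (- 3/2))*g_form m z)) z"
proof -
 obtain W K where W: "W > 0" "K >= 0" "!!y. y > 0 ==> wfun a y<=W" "!!y. y > 0 ==> W<=wfun a y + K*exp (- (3/4 * a)*y)"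
  using wfun_limit[OF a_pos] by blast
 define \<kappa> where "\<kappa> = a powr (- 3/2)"
 have \<kappa>: "\<kappa> > 0" using a_pos by (simp add: \<kappa>_def)
 \<comment> \<open>The main term of \<open>h.F\<close> is 2 v and \<open>T.F\<close> is 2 W g_m eta.
   The factor a^(-3/2)/(2 W) makes the shadow a^(-3/2) g_m and the main term the one compared with i
   beta.\<close>
 define f where "f = on_uhp (%z. of_real (\<kappa>/W/2)*(eta z*h.F z))"
 have fe: "f z/eta z = of_real (\<kappa>/W/2)*h.F z" if "z : uhp" for z
  using that eta_nonzero[OF that] by (simp add: f_def on_uhp_def)
 have f_mod: "mweight 2 (%z. f z/eta z)"
  using h.F_modular fe moebius_in_uhp unfolding mweight_def by simp
 have f_T: "f (z+1) = cis (pi/12)*f z" if z: "z : uhp" for z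
 proof -
  have "f (z+1)/(cis (pi/12)*eta z) = f z/eta z" using mweight_T[OF f_mod z] by (simp add: eta_translate)
  then show ?thesis using eta_nonzero[OF z] by (simp add: field_simps)
 qed
 have f_wirt: "\<exists>P. has_wirt f P (\<i>/2 * of_real (Im z powr (- 5/2)) * cnj (of_real \<kappa>*g_form m z)) z" if z: "z : uhp" for z
 proof -
  obtain P where P: "has_wirt h.F P (\<i>/2 * of_real (Im z powr (- 5/2)/(norm (eta z))\<^sup>2) * cnj (T.F z)) z" using h_F_wirt[OF z] by blast
  have "(eta has_field_derivative deriv eta z) (at z)" by (rule holomorphic_derivI[OF eta_holomorphic open_uhp z])
  note 1 = has_wirt_cmult[OF has_wirt_mult[OF has_wirt_holomorphic[OF this] P], of "of_real (\<kappa>/W/2)"]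
  define e where "e = eta z"
  have e: "e ~= 0" using eta_nonzero[OF z] by (simp add: e_def)
  have n: "complex_of_real ((norm e)\<^sup>2) = e * cnj e" by (simp only: complex_norm_square)
  have TF: "T.F z = of_real (2 * W)*g_form m z*eta z" by (rule T_F_eq[OF W z])
  have "of_real (\<kappa>/W/2)*(eta z*(\<i>/2 * of_real (Im z powr (- 5/2)/(norm (eta z))\<^sup>2) * cnj (T.F z))+0*h.F z)
   = \<i>/2 * of_real (Im z powr (- 5/2)) * cnj (of_real \<kappa>*g_form m z)"
   unfolding TF e_def[symmetric] of_real_divide n using e W(1) by (simp add: field_simps)
  moreover have "has_wirt f (of_real (\<kappa>/W/2)*(eta z*P + deriv eta z*h.F z))
   (of_real (\<kappa>/W/2)*(eta z*(\<i>/2 * of_real (Im z powr (- 5/2)/(norm (eta z))\<^sup>2) * cnj (T.F z))+0*h.F z)) z"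
   by (rule has_wirt_transform[OF 1 open_uhp z]) (simp add: f_def on_uhp_def)
  ultimately show ?thesis by (simp only:) blast
 qed
 obtain P R where PR: "R holomorphic_on ball 0 1"
  "!!z. z : uhp ==> g_form m z = qpow (- of_int m/24) z + qpow (23/24) z * R (qpow 1 z)"
  using g_form_expansion[OF m] by metis
 obtain b0 where b0: "!!n. n<=0 ==> b0 n = 0"
  "!!z. z : uhp ==> ((%n. b0 n*qpow (of_int n/24) z) has_sum (qpow (of_int 23/24) z * R (qpow 1 z))) {n. [n = 23] (mod 24)}"
  using q_series_sum[OF PR(1), of 23] by auto
 \<comment> \<open>The minus sign reconciles the factor i/2 in the derivative of \<open>f\<close>
   with the factor -i/2 in \<open>neg_part_wirt\<close>.\<close>
 define bt where "bt n = - of_real \<kappa> * b0 n" for n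
 define b where "b n = bt n+(if n = - m then - of_real \<kappa> else 0)" for n
 have mneg: "- m : negset" using m(1) cong_minus_minus_iff[of m 1 24] by simp
 have b0': "((%n. b0 n*qpow (of_int n/24) z) has_sum (qpow (23/24) z * R (qpow 1 z))) negset" if "z : uhp" for z
  using b0(2)[OF that] unfolding negset_eq by simp
 have bts: "((%n. bt n*qpow (of_int n/24) z) has_sum (- of_real \<kappa>*(qpow (23/24) z * R (qpow 1 z)))) negset" if "z : uhp" for z
  using has_sum_cmult_right[OF b0'[OF that], of "- of_real \<kappa>"] by (simp only: bt_def mult.assoc)
 have bs: "((%n. b n*qpow (of_int n/24) z) has_sum (- of_real \<kappa>*g_form m z)) negset" if z: "z : uhp" for z
 proof -
  have "((%n. bt n*qpow (of_int n/24) z+(if n = - m then - of_real \<kappa>*qpow (- of_int m/24) z else 0)) has_sum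
   (- of_real \<kappa>*(qpow (23/24) z * R (qpow 1 z)) + - of_real \<kappa>*qpow (- of_int m/24) z)) negset"
   by (rule has_sum_add[OF bts[OF z] has_sum_singleton[OF mneg]])
  moreover have "- of_real \<kappa>*(qpow (23/24) z * R (qpow 1 z)) + - of_real \<kappa>*qpow (- of_int m/24) z = - of_real \<kappa>*g_form m z"
   unfolding PR(2)[OF z] by (simp add: algebra_simps)
  ultimately have "((%n. bt n*qpow (of_int n/24) z+(if n = - m then - of_real \<kappa>*qpow (- of_int m/24) z else 0)) has_sum (- of_real \<kappa>*g_form m z)) negset"
   by (simp only:)
  then show ?thesis by (rule has_sum_congD) (auto simp: b_def algebra_simps)
 qed
 have bt0: "!!n. n<=0 ==> bt n = 0" using b0(1) by (simp add: bt_def)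
 obtain N0 C0 where N0: "!!z. z : uhp ==> ((%n. (cnj (bt n)/shadow_fac n)*gam n z*qpow (- of_int n/24) z) has_sum N0 z) negset"
  "C0 >= 0" "!!z. Im z >= 1 ==> norm (N0 z)<=C0"
 proof (rule neg_tail[OF bts bt0], goal_cases)
  case (3 N C)
  show ?case by (rule 3(1)[OF 3(2-4)])
 qed
 define am where "am n = cnj (b n)/shadow_fac n" for n
 have am0: "am n = 0" if "n<=0" "n ~= - m" for n using that by (simp add: am_def b_def bt0)
 \<comment> \<open>At index -m the shadow has coefficient -a^(-3/2) in this sign convention;
   division by i a^(-3/2) gives the coefficient i of the exceptional term.\<close>
 have "shadow_fac (- m) = of_real \<kappa>*\<i>" using m(2) by (simp add: shadow_fac_def \<kappa>_def a_eq abs_mult)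
 then have amm: "am (- m) = \<i>" using \<kappa> m(2) by (simp add: am_def b_def bt0 divide_simps)
 define N where "N z = N0 z+\<i> * inc_Gamma (1 - 5/2) (pi * of_int (- m)*Im z/6)*qpow (- of_int (- m)/24) z" for z
 have ams: "((%n. nonhol am n z) has_sum N z) negset" if z: "z : uhp" for z
  unfolding N_def using has_sum_add[OF N0(1)[OF z] has_sum_singleton[OF mneg]]
 proof (rule has_sum_congD)
  fix n assume "n : negset"
  show "(cnj (bt n)/shadow_fac n)*gam n z*qpow (- of_int n/24) z
   +(if n = - m then \<i> * inc_Gamma (1 - 5/2) (pi * of_int (- m)*Im z/6)*qpow (- of_int (- m)/24) z else 0)
   = nonhol am n z"
  proof (cases "n = - m")
   case True
   have "bt (- m) = 0" using m(2) by (intro bt0) simp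
   then show ?thesis unfolding True amm by simp
  qed (simp add: am_def b_def)
 qed
 have fin: "finite {n. n<=0 & [n = -1] (mod 24) & am n ~= 0}"
  by (rule finite_subset[of _ "{- m}"]) (use am0 in auto)
 obtain G p where Gp: "!!z. z : uhp ==> ((%n. cnj (am n * shadow_fac n)*qpow (of_int n/24) z) has_sum G z) negset"
  "!!z. z : uhp ==> has_wirt N (p z) (- \<i>/2 * of_real (Im z powr (- 5/2)) * cnj (G z)) z"
 proof (rule neg_part_wirt[OF fin ams], goal_cases)
  case (2 G p)
  show ?case by (rule 2(1)[OF 2(2-3)])
 qed
 have G: "G z = - of_real \<kappa>*g_form m z" if z: "z : uhp" for z
 proof -
  have "((%n. cnj (am n * shadow_fac n)*qpow (of_int n/24) z) has_sum (- of_real \<kappa>*g_form m z)) negset"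
   using bs[OF z] by (rule has_sum_congD) (use shadow_fac_nonzero negset_nonzero in \<open>simp add: am_def\<close>)
  then show ?thesis using Gp(1)[OF z] has_sum_unique by blast
 qed
 define D where "D z = f z - N z" for z
 have "D holomorphic_on uhp" unfolding holomorphic_on_open[OF open_uhp]
 proof
  fix z assume z: "z : uhp"
  obtain P where P: "has_wirt f P (\<i>/2 * of_real (Im z powr (- 5/2)) * cnj (of_real \<kappa>*g_form m z)) z" using f_wirt[OF z] by blast
  have "\<i>/2 * of_real (Im z powr (- 5/2)) * cnj (of_real \<kappa>*g_form m z) - (- \<i>/2 * of_real (Im z powr (- 5/2)) * cnj (G z)) = 0"
   unfolding G[OF z] by simp
  with has_wirt_diff[OF P Gp(2)[OF z]] have "has_wirt D (P - p z) 0 z" unfolding D_def[abs_def] by (simp only:)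
  then show "\<exists>d. (D has_field_derivative d) (at z)" using has_wirt_zero_imp_field_derivative by blast
 qed
 moreover have D_T: "D (z+1) = cis (pi/12)*D z" if z: "z : uhp" for z
 proof -
  have "N (z+1) = cis (pi/12)*N z" by (rule neg_part_translate[OF ams z])
  then show ?thesis unfolding D_def f_T[OF z] by (simp only: right_diff_distrib)
 qed
 obtain C1 where C1: "C1 > 0" "!!z. Im z >= 1 ==> norm (eta z*h.F z - 2 * of_real (v (Im z))*qpow r z)<=C1" using h_F_cusp by blast
 obtain C2 where C2: "C2 > 0" "!!z. Im z >= 1 ==> norm ((of_real (\<kappa>/W * v (Im z)) - \<i> * inc_Gamma (- 3/2) (- a*Im z))*qpow r z)<=C2*exp (Im z)"
  using main_term_bound[OF W] unfolding \<kappa>_def by blast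
 define C where "C = \<kappa>/W/2*C1 + C2 + C0"
 have Db: "norm (D z)<=C*exp (Im z)" if z: "Im z >= 1" for z
 proof -
  have zu: "z : uhp" using z by (simp add: uhp_iff)
  have tri: "norm (A + B - C)<=norm A + norm B + norm C" for A B C :: complex
   using norm_triangle_ineq[of A B] norm_triangle_ineq4[of "A + B" C] by linarith
  have n: "N z = N0 z+\<i> * inc_Gamma (- 3/2) (- a*Im z)*qpow r z" by (simp add: N_def a_eq r_def mult.commute)
  have "f z = of_real (\<kappa>/W/2)*(eta z*h.F z)" using zu by (simp add: f_def on_uhp_def)
  then have "D z = of_real (\<kappa>/W/2)*(eta z*h.F z - 2 * of_real (v (Im z))*qpow r z)
   +(of_real (\<kappa>/W * v (Im z)) - \<i> * inc_Gamma (- 3/2) (- a*Im z))*qpow r z - N0 z"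
   unfolding D_def n by (simp add: algebra_simps)
  then have "norm (D z)<=norm (of_real (\<kappa>/W/2)*(eta z*h.F z - 2 * of_real (v (Im z))*qpow r z))
   + norm ((of_real (\<kappa>/W * v (Im z)) - \<i> * inc_Gamma (- 3/2) (- a*Im z))*qpow r z) + norm (N0 z)"
   by (simp only: tri)
  moreover have "norm (of_real (\<kappa>/W/2)*(eta z*h.F z - 2 * of_real (v (Im z))*qpow r z))<=\<kappa>/W/2*C1"
   unfolding norm_mult norm_of_real using C1(2)[OF z] \<kappa> W(1) by (simp add: mult_left_mono divide_right_mono)
  ultimately have 1: "norm (D z)<=\<kappa>/W/2*C1 + C2*exp (Im z) + C0" using C2(2)[OF z] N0(3)[OF z] by linarith
  have e: "1<=exp (Im z)" using z by simp
  have "0<=\<kappa>/W/2*C1" using \<kappa> W(1) C1(1) by simp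
  then have "\<kappa>/W/2*C1*1<=\<kappa>/W/2*C1*exp (Im z)" "C0*1<=C0*exp (Im z)"
   using e N0(2) by (intro mult_left_mono; simp)+
  then show ?thesis using 1 unfolding C_def distrib_right by linarith
 qed
 \<comment> \<open>Division by q^(1/24) removes the multiplier of the translation and makes the
   function periodic.\<close>
 define E where "E z = D z/qpow (1/24) z" for z
 have "E holomorphic_on uhp" unfolding E_def[abs_def] by (intro holomorphic_intros calculation qpow_holomorphic) simp
 moreover have "E (z+1) = E z" if "z : uhp" for z unfolding E_def D_T[OF that] qpow_shift by simp
 \<comment> \<open>q^(1 - 1/24) decays at the rate 2 pi - 2 pi/24, which exceeds the growth rate 1
   of \<open>D\<close>. Hence there is no pole in q, and the exponents are 1/24 plus natural
   numbers.\<close>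
 moreover have "tendsto_cusp (%z. qpow 1 z*E z)"
 proof (rule tendsto_cusp_exp[where b = "2*pi - 2*pi/24 - 1"])
  fix z assume z: "Im z >= 1"
  have "norm (qpow 1 z*E z) = norm (D z)*(exp (- (2*pi)*Im z)*exp (2*pi/24*Im z))"
   by (simp add: E_def norm_mult norm_divide norm_qpow exp_minus field_simps)
  also have "...<=(C*exp (Im z))*(exp (- (2*pi)*Im z)*exp (2*pi/24*Im z))"
   using Db[OF z] by (intro mult_right_mono) auto
  also have "... = C*exp (Im z+(- (2*pi)*Im z+2*pi/24*Im z))" unfolding exp_add by (simp only: mult_ac)
  also have "Im z+(- (2*pi)*Im z+2*pi/24*Im z) = - (2*pi - 2*pi/24 - 1)*Im z" by (simp add: field_simps)
  finally show "norm (qpow 1 z*E z)<=C*exp (- (2*pi - 2*pi/24 - 1)*Im z)" .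
 qed (use pi_gt3 in simp)
 ultimately obtain R' where R': "R' holomorphic_on ball 0 1" "!!z. z : uhp ==> E z = R' (qpow 1 z)"
  using qexpansion_exists[of E] by blast
 obtain bp where bp: "!!n. n<=0 ==> bp n = 0"
  "!!z. z : uhp ==> ((%n. bp n*qpow (of_int n/24) z) has_sum (qpow (of_int 1/24) z * R' (qpow 1 z))) posset"
  using q_series_sum[OF R'(1), of 1] by auto
 have "hexp f bp am" unfolding hexp_def
 proof (intro conjI ballI)
  have "{n. n<=0 & [n = 1] (mod 24) & bp n ~= 0} = {}" using bp(1) by auto
  then show "finite {n. n<=0 & [n = 1] (mod 24) & bp n ~= 0}" by (simp only: finite.emptyI)
  show "finite {n. n<=0 & [n = -1] (mod 24) & am n ~= 0}" by (rule fin)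
  fix z assume z: "z : uhp"
  have "D z = qpow (of_int 1/24) z * R' (qpow 1 z)" using R'(2)[OF z] by (simp add: E_def field_simps)
  then have "f z = qpow (of_int 1/24) z * R' (qpow 1 z) + N z" by (simp add: D_def algebra_simps)
  then show "\<exists>s t. ((%n. bp n*qpow (of_int n/24) z) has_sum s) posset \<and>
   ((%n. nonhol am n z) has_sum t) negset & f z = s + t"
   using bp(2)[OF z] ams[OF z] by blast
 qed
 moreover have "transforms_like (5/2) eta_mult f" using f_mod unfolding transforms_like_52 .
 moreover have "!!z. z \<notin> uhp ==> f z = 0" by (simp add: f_def on_uhp_def)
 ultimately show ?thesis using that[of f bp am] bp(1) am0 amm f_wirt unfolding \<kappa>_def by blast
qed

end

section \<open>The basis\<close>

lemma transforms_add_scaled: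
 assumes "transforms_like (5/2) eta_mult f" "transforms_like (5/2) eta_mult g"
 shows "transforms_like (5/2) eta_mult (%z. f z + k*g z)"
proof -
 have 1: "mweight 2 (%z. f z/eta z)" "mweight 2 (%z. g z/eta z)" using assms unfolding transforms_like_52 by blast+
 show ?thesis unfolding transforms_like_52 mweight_def
 proof (intro allI impI)
  fix a b c d :: int and z assume det: "a * d - b * c = 1" and z: "z : uhp"
  define w where "w = moeb a b c d z"
  have "f w/eta w = jf c d z^2*(f z/eta z)" "g w/eta w = jf c d z^2*(g z/eta z)"
   using modular_weightD[OF 1(1) det z] modular_weightD[OF 1(2) det z] by (simp_all add: w_def)
  moreover have "(f w + k*g w)/eta w = f w/eta w + k*(g w/eta w)" by (simp add: add_divide_distrib)
  ultimately have "(f w + k*g w)/eta w = jf c d z^2*(f z/eta z) + k*(jf c d z^2*(g z/eta z))" by (simp only:)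
  also have "... = jf c d z^2*((f z + k*g z)/eta z)" by (simp add: add_divide_distrib distrib_left)
  finally show "(f (moeb a b c d z) + k*g (moeb a b c d z))/eta (moeb a b c d z) = jf c d z^2*((f z + k*g z)/eta z)"
   by (simp only: w_def)
 qed
qed

lemma harmonic_add_scaled:
 assumes "f : weak_harmonic_Maass_forms (5/2)" "g : weak_harmonic_Maass_forms (5/2)"
 shows "(%z. f z + k*g z) : weak_harmonic_Maass_forms (5/2)"
proof -
 obtain ap am bp bm where "hexp f ap am" "hexp g bp bm" using assms unfolding weak_harmonic_iff by blast
 from hexp_add_scaled[OF this, of k] show ?thesis
  using assms transforms_add_scaled[of f g k] unfolding weak_harmonic_iff by auto
qed

lemma hexp_determined:
 assumes "f : weak_harmonic_Maass_forms (5/2)" "g : weak_harmonic_Maass_forms (5/2)" "hexp f ap am" "hexp g bp bm"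
  and "!!n. n : posset ==> n<=0 ==> ap n = bp n" "!!n. n : negset ==> n<=0 ==> am n = bm n"
 shows "f = g"
proof
 fix z
 have "transforms_like (5/2) eta_mult (%z. f z + - 1*g z)"
  using assms(1,2) unfolding weak_harmonic_iff by (intro transforms_add_scaled) blast+
 note v = hexp_vanishing[OF hexp_add_scaled[OF assms(3,4), of "- 1"] this]
 show "f z = g z"
 proof (cases "z : uhp")
  case True
  have "f z + - 1*g z = 0" by (rule v) (use assms(5,6) True in auto)
  then show ?thesis by simp
 qed (use assms(1,2) in \<open>simp add: weak_harmonic_iff\<close>)
qed

lemma beta_eq: "beta_fun (of_int n*y) = inc_Gamma (1 - 5/2) (pi * of_int n*y/6)"
 by (simp add: beta_fun_def mult.assoc)

lemma beta_eq': "beta_fun (- of_int n*y) = inc_Gamma (1 - 5/2) (pi * of_int (- n)*y/6)"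
 using beta_eq[of "- n" y] by simp

lemma extend_sum:
 fixes F :: "int => complex"
 shows "((%n. c n*F n) has_sum s) {n. 0 < n & P n} \<longleftrightarrow> ((%n. (if n > 0 then c n else 0)*F n) has_sum s) {n. P n}"
 by (rule has_sum_cong_neutral) auto

text \<open>For m > 0 the exceptional term i beta(-my) q^(m/24) is the term of index n = -m in the
  nonholomorphic half, which is the only nonpositive index there; for m < 0 the principal part is
  the index m of the holomorphic half.\<close>

lemma h_expansion_hexp:
 assumes m: "[m = 1] (mod 24)" and h: "has_h_expansion m f pp pm"
 shows "hexp f (%n. if n > 0 then pp n else if n = m then 1 else 0)
  (%n. if n > 0 then (if m > 0 then pm n else 0) else if n = - m then \<i> else 0)" (is "hexp f ?ap ?am")
 unfolding hexp_def
proof (intro conjI ballI)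
 show "finite {n. n<=0 & [n = 1] (mod 24) & ?ap n ~= 0}" by (rule finite_subset[of _ "{m}"]) auto
 show "finite {n. n<=0 & [n = -1] (mod 24) & ?am n ~= 0}" by (rule finite_subset[of _ "{- m}"]) auto
 fix z assume z: "z : uhp"
 have mp: "m : posset" using m by simp
 have mn: "- m : negset" using m cong_minus_minus_iff[of m 1 24] by simp
 have m0: "m ~= 0" by (rule posset_nonzero[OF mp])
 let ?g = "%n. gam n z*qpow (- of_int n/24) z"
 show "\<exists>s t. ((%n. ?ap n*qpow (of_int n/24) z) has_sum s) posset \<and>
   ((%n. nonhol ?am n z) has_sum t) negset & f z = s + t"
 proof (cases "m < 0")
  case True
  then obtain s where s: "((%n. pp n*qpow (of_int n/24) z) has_sum s) {n. 0 < n & [n = 1] (mod 24)}" "f z = qpow (of_int m/24) z + s"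
   using h z unfolding has_h_expansion_def by auto
  have "((%n. (if n > 0 then pp n else 0)*qpow (of_int n/24) z+(if n = m then qpow (of_int m/24) z else 0)) has_sum (s + qpow (of_int m/24) z)) posset"
   by (rule has_sum_add[OF s(1)[unfolded extend_sum] has_sum_singleton[OF mp]])
  then have "((%n. ?ap n*qpow (of_int n/24) z) has_sum (s + qpow (of_int m/24) z)) posset"
   by (rule has_sum_congD) (use True in auto)
  moreover have "((%n. nonhol ?am n z) has_sum 0) negset"
   by (rule has_sum_0) (use True in auto)
  moreover have "f z = (s + qpow (of_int m/24) z)+0" using s(2) by simp
  ultimately show ?thesis by blast
 next
  case False
  then have mpos: "m > 0" using m0 by simp
  obtain s t where st: "((%n. pp n*qpow (of_int n/24) z) has_sum s) {n. 0 < n & [n = 1] (mod 24)}"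
   "((%n. pm n * beta_fun (of_int n*Im z)*qpow (- of_int n/24) z) has_sum t) {n. 0 < n & [n = -1] (mod 24)}"
   "f z = s+\<i> * beta_fun (- of_int m*Im z)*qpow (of_int m/24) z + t"
   using bspec[OF h[unfolded has_h_expansion_def] z] False by auto
  have "((%n. ?ap n*qpow (of_int n/24) z) has_sum s) posset"
   using st(1)[unfolded extend_sum] by (rule has_sum_congD) (use mpos in auto)
  moreover have "((%n. nonhol ?am n z) has_sum (t+\<i> * ?g (- m))) negset"
  proof -
   have "((%n. pm n * ?g n) has_sum t) {n. 0 < n & [n = -1] (mod 24)}" using st(2) unfolding beta_eq mult.assoc .
   from has_sum_add[OF this[unfolded extend_sum] has_sum_singleton[OF mn, of "\<i> * ?g (- m)"]]
   show ?thesis by (rule has_sum_congD) (use mpos in auto)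
  qed
  moreover have "f z = s+(t+\<i> * ?g (- m))" using st(3) unfolding beta_eq' by simp
  ultimately show ?thesis by blast
 qed
qed

lemma hexp_h_expansion:
 assumes m: "[m = 1] (mod 24)" "m > 0" and h: "hexp f bp bm"
  and bp: "!!n. n<=0 ==> bp n = 0" and bm: "!!n. n<=0 ==> n ~= - m ==> bm n = 0" "bm (- m) = \<i>"
 shows "has_h_expansion m f bp bm"
 unfolding has_h_expansion_def
proof
 fix z assume z: "z : uhp"
 have mn: "- m : negset" using m cong_minus_minus_iff[of m 1 24] by simp
 let ?g = "%n. gam n z*qpow (- of_int n/24) z"
 obtain s t where st: "((%n. bp n*qpow (of_int n/24) z) has_sum s) posset"
  "((%n. bm n*gam n z*qpow (- of_int n/24) z) has_sum t) negset" "f z = s + t"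
  using h z unfolding hexp_def by blast
 have s: "((%n. bp n*qpow (of_int n/24) z) has_sum s) {n. 0 < n & [n = 1] (mod 24)}"
  unfolding extend_sum using st(1) by (rule has_sum_congD) (auto simp: bp)
 have "((%n. bm n * ?g n) has_sum t) negset" using st(2) unfolding mult.assoc .
 from has_sum_add[OF this has_sum_neg[OF has_sum_singleton[OF mn, of "\<i> * ?g (- m)"]]]
 have "((%n. (if n > 0 then bm n else 0) * ?g n) has_sum (t + - (\<i> * ?g (- m)))) negset"
 proof (rule has_sum_congD)
  fix n assume "n : negset"
  show "bm n * ?g n + - (if n = - m then \<i> * ?g (- m) else 0) = (if n > 0 then bm n else 0) * ?g n"
   using bm(1)[of n] bm(2) m(2) by (cases "n = - m") auto
 qed
 then have "((%n. bm n * ?g n) has_sum (t + - (\<i> * ?g (- m)))) {n. 0 < n & [n = -1] (mod 24)}" unfolding extend_sum .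
 then have t: "((%n. bm n * beta_fun (of_int n*Im z)*qpow (- of_int n/24) z) has_sum (t + - (\<i> * ?g (- m)))) {n. 0 < n & [n = -1] (mod 24)}"
  unfolding beta_eq mult.assoc .
 have "f z = s+\<i> * beta_fun (- of_int m*Im z)*qpow (of_int m/24) z+(t + - (\<i> * ?g (- m)))"
  unfolding beta_eq' st(3) by simp
 then show "if m < 0 then \<exists>s. ((%n. bp n*qpow (of_int n/24) z) has_sum s) {n. 0 < n & [n = 1] (mod 24)} & f z = qpow (of_int m/24) z + s
  else \<exists>s t. ((%n. bp n*qpow (of_int n/24) z) has_sum s) {n. 0 < n & [n = 1] (mod 24)} \<and>
   ((%n. bm n * beta_fun (of_int n*Im z)*qpow (- of_int n/24) z) has_sum t) {n. 0 < n & [n = -1] (mod 24)} \<and>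
   f z = s+\<i> * beta_fun (- of_int m*Im z)*qpow (of_int m/24) z + t"
  using s t m(2) by auto
qed

lemma is_h_form_unique:
 assumes m: "[m = 1] (mod 24)" and "is_h_form m f" "is_h_form m g" shows "f = g"
proof -
 obtain pp pm pp' pm' where "has_h_expansion m f pp pm" "has_h_expansion m g pp' pm'" using assms(2,3) unfolding is_h_form_def by blast
 from h_expansion_hexp[OF m this(1)] h_expansion_hexp[OF m this(2)]
 show ?thesis by (rule hexp_determined[rotated 2]) (use assms(2,3) in \<open>auto simp: is_h_form_def\<close>)
qed

lemma h_form_eqI: "[m = 1] (mod 24) ==> is_h_form m f ==> h_form m = f"
 unfolding h_form_def using is_h_form_unique by (intro the_equality) blast+

lemma negative_h_form:
 assumes m: "[m = 1] (mod 24)" "m < 0"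
 shows "is_h_form m (h_form m)" "h_form m : weakly_holomorphic_forms (5/2) eta_mult"
proof -
 obtain h R where h: "h : weakly_holomorphic_forms (5/2) eta_mult" "R holomorphic_on ball 0 1"
  "!!z. z : uhp ==> h z = qpow (of_int m/24) z + qpow (1/24) z * R (qpow 1 z)"
  using negative_form_exists[OF m] by metis
 obtain b where b: "!!n. n<=0 ==> b n = 0"
  "!!z. z : uhp ==> ((%n. b n*qpow (of_int n/24) z) has_sum (qpow (of_int 1/24) z * R (qpow 1 z))) posset"
  using q_series_sum[OF h(2), of 1] by auto
 have ex: "has_h_expansion m h b (%_. 0)" unfolding has_h_expansion_def
 proof
  fix z assume z: "z : uhp"
  have "((%n. b n*qpow (of_int n/24) z) has_sum (qpow (1/24) z * R (qpow 1 z))) {n. 0 < n & [n = 1] (mod 24)}"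
   unfolding extend_sum using b(2)[OF z] unfolding of_int_1 by (rule has_sum_congD) (auto simp: b(1))
  then show "if m < 0 then \<exists>s. ((%n. b n*qpow (of_int n/24) z) has_sum s) {n. 0 < n & [n = 1] (mod 24)} & h z = qpow (of_int m/24) z + s
   else \<exists>s t. ((%n. b n*qpow (of_int n/24) z) has_sum s) {n. 0 < n & [n = 1] (mod 24)} \<and>
    ((%n. 0 * beta_fun (of_int n*Im z)*qpow (- of_int n/24) z) has_sum t) {n. 0 < n & [n = -1] (mod 24)} \<and>
    h z = s+\<i> * beta_fun (- of_int m*Im z)*qpow (of_int m/24) z + t"
   using h(3)[OF z] m(2) by auto
 qed
 have "h : weak_harmonic_Maass_forms (5/2)"
  using h(1) h_expansion_hexp[OF m(1) ex] unfolding weak_harmonic_iff weakly_holomorphic_forms_def by blast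
 then have i: "is_h_form m h" using ex unfolding is_h_form_def by blast
 show "is_h_form m (h_form m)" "h_form m : weakly_holomorphic_forms (5/2) eta_mult"
  using i h(1) unfolding h_form_eqI[OF m(1) i] by auto
qed

lemma positive_h_form:
 assumes m: "[m = 1] (mod 24)" "m > 0"
 shows "is_h_form m (h_form m)" "xi_op (5/2) (h_form m) = cscale (of_real ((6/(pi * of_int m)) powr (3/2))) (g_form m)"
proof -
 interpret positive_index m by unfold_locales (rule m)+
 obtain f bp bm where f: "!!z. z \<notin> uhp ==> f z = 0" "transforms_like (5/2) eta_mult f" "hexp f bp bm"
  "!!n. n<=0 ==> bp n = 0" "!!n. n<=0 ==> n ~= - m ==> bm n = 0" "bm (- m) = \<i>"
  "!!z. z : uhp ==> \<exists>P. has_wirt f P (\<i>/2 * of_real (Im z powr (- 5/2)) * cnj (of_real (a powr (- 3/2))*g_form m z)) z"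
  using positive_form_exists by blast
 have "f : weak_harmonic_Maass_forms (5/2)" using f(1-3) unfolding weak_harmonic_iff by blast
 then have i: "is_h_form m f" using hexp_h_expansion[OF m f(3-6)] unfolding is_h_form_def by blast
 then show "is_h_form m (h_form m)" unfolding h_form_eqI[OF m(1) i] .
 have k: "(6/(pi * of_int m)) powr (3/2) = a powr (- 3/2)"
 proof -
  have "6/(pi * of_int m) = 1/a" using m(2) by (simp add: a_eq)
  then show ?thesis using a_pos by (simp add: powr_divide powr_minus_divide)
 qed
 show "xi_op (5/2) (h_form m) = cscale (of_real ((6/(pi * of_int m)) powr (3/2))) (g_form m)"
  unfolding h_form_eqI[OF m(1) i] k
 proof
  fix z
  show "xi_op (5/2) f z = cscale (of_real (a powr (- 3/2))) (g_form m) z"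
  proof (cases "z : uhp")
   case True
   then have y: "Im z > 0" by (simp add: uhp_iff)
   obtain P where "has_wirt f P (\<i>/2 * of_real (Im z powr (- 5/2)) * cnj (of_real (a powr (- 3/2))*g_form m z)) z" using f(7)[OF True] by blast
   from has_wirt_dzbar[OF this] have d: "dzbar f z = \<i>/2 * of_real (Im z powr (- 5/2)) * cnj (of_real (a powr (- 3/2))*g_form m z)" .
   have "Im z powr (5/2)*Im z powr (- 5/2) = 1" unfolding powr_add[symmetric] using y by simp
   then have p: "complex_of_real (Im z powr (5/2)) * of_real (Im z powr (- 5/2)) = 1" by (simp only: of_real_mult[symmetric] of_real_1)
   have "xi_op (5/2) f z = (complex_of_real (Im z powr (5/2)) * of_real (Im z powr (- 5/2)))*(of_real (a powr (- 3/2))*g_form m z)"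
    using True unfolding xi_op_def on_uhp_def d by (simp add: complex_eq_iff)
   then show ?thesis unfolding p by (simp add: cscale_def)
  next
   case False
   then show ?thesis using g_form_basic(1)[OF m] by (simp add: xi_op_def on_uhp_def cscale_def)
  qed
 qed
qed

lemma is_h_form_h_form: "[m = 1] (mod 24) ==> is_h_form m (h_form m)"
 using positive_h_form(1) negative_h_form(1) posset_nonzero[of m] by (cases "m > 0") auto

section \<open>Reality of the coefficients\<close>

lemma ephi_cnj:
 assumes "norm x < 1" shows "ephi (cnj x) = cnj (ephi x)"
proof -
 have lim: "(%n. \<Prod>k<n. 1 - x^Suc k) \<longlonglongrightarrow> ephi x" if "norm x < 1" for x
  by (rule tendsto_uniform_limitI[OF ephi_uniform_limit[OF that]]) simp
 have "(%n. cnj (\<Prod>k<n. 1 - x^Suc k)) \<longlonglongrightarrow> cnj (ephi x)" by (rule tendsto_cnj[OF lim[OF assms]])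
 moreover have "cnj (\<Prod>k<n. 1 - x^Suc k) = (\<Prod>k<n. 1 - cnj x^Suc k)" for n by simp
 ultimately have "(%n. \<Prod>k<n. 1 - cnj x^Suc k) \<longlonglongrightarrow> cnj (ephi x)" by (simp only:)
 moreover have "(%n. \<Prod>k<n. 1 - cnj x^Suc k) \<longlonglongrightarrow> ephi (cnj x)" by (rule lim) (use assms in simp)
 ultimately show ?thesis using LIMSEQ_unique by blast
qed

lemma qpow_reflect: "cnj (qpow s (- cnj z)) = qpow s z"
 by (simp add: qpow_def exp_cnj)

lemma reflect_uhp: "- cnj z : uhp \<longleftrightarrow> z : uhp" by (simp add: uhp_iff)

lemma eta_reflect: "z : uhp ==> cnj (eta (- cnj z)) = eta z"
 using ephi_cnj[OF qpow_less_1[of "- cnj z"]] by (simp add: eta_ephi qpow_reflect reflect_uhp flip: ephi_cnj)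

text \<open>The reflection z -> -conj(z) conjugates the matrix (a, b; c, d) into (a, -b; -c, d), and
  \<open>eta\<close> is unchanged because its product has real coefficients.\<close>

lemma transforms_reflect:
 assumes "transforms_like (5/2) eta_mult f"
 shows "transforms_like (5/2) eta_mult (%z. cnj (f (- cnj z)))"
 unfolding transforms_like_52 mweight_def
proof (intro allI impI)
 fix a b c d :: int and z assume det: "a * d - b * c = 1" and z: "z : uhp"
 have mod: "mweight 2 (%z. f z/eta z)" using assms unfolding transforms_like_52 .
 define w where "w = - cnj z"
 have w: "w : uhp" using z by (simp add: w_def reflect_uhp)
 have det': "a * d - (- b)*(- c) = 1" using det by simp
 have 1: "of_int a*w + of_int (- b) = - cnj (of_int a*z + of_int b)" "of_int (- c)*w + of_int d = cnj (of_int c*z + of_int d)"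
  by (simp_all add: w_def)
 have m: "moeb a (- b) (- c) d w = - cnj (moeb a b c d z)" unfolding moebius_int_def 1 complex_cnj_divide by (rule minus_divide_left[symmetric])
 have j: "jf (- c) d w = cnj (jf c d z)" unfolding jf_def 1 ..
 have u: "moeb a b c d z : uhp" by (rule moebius_in_uhp[OF det z])
 have "f (- cnj (moeb a b c d z))/eta (- cnj (moeb a b c d z)) = cnj (jf c d z)^2*(f w/eta w)"
  using modular_weightD[OF mod det' w] unfolding m j .
 then have "cnj (f (- cnj (moeb a b c d z))/eta (- cnj (moeb a b c d z))) = cnj (cnj (jf c d z)^2*(f w/eta w))" by (rule arg_cong)
 then show "cnj (f (- cnj (moeb a b c d z)))/eta (moeb a b c d z) = jf c d z^2*(cnj (f (- cnj z))/eta z)"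
  using eta_reflect[OF u] eta_reflect[OF z] by (simp add: w_def)
qed

text \<open>Subtract the reflected conjugate form. Values of beta at positive arguments are real, so
  the coefficients of the difference are pp - conj(pp) and pm - conj(pm), up to a multiple of
  q^(m/24) from the exceptional term. The difference has no principal part, hence vanishes, and so
  do its coefficients.\<close>

lemma h_coefficients_real:
 assumes m: "[m = 1] (mod 24)" and h: "has_h_expansion m f pp pm" and tr: "transforms_like (5/2) eta_mult f"
  and n: "0 < n" "[n = 1] (mod 24)" "m ~= n"
 shows "pp n : \<real>"
proof -
 \<comment> \<open>For m > 0 this is i beta(-my) minus its conjugate, independent of y by
   \<open>ibeta_Im_const\<close>; the value y = 1 is taken. It enters only the coefficient at n =
   m.\<close>
 define \<kappa> where "\<kappa> = (if m < 0 then 0 else complex_of_real (2*Im (\<i> * inc_Gamma (- 3/2) (- (pi * of_int m/6)*1)))*\<i>)"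
 define D where "D z = f z + - 1 * cnj (f (- cnj z))" for z
 let ?ap = "%n. (if n > 0 then pp n - cnj (pp n) else 0)+(if n = m then \<kappa> else 0)"
 let ?am = "%n. if n > 0 then (if m < 0 then 0 else pm n - cnj (pm n)) else 0"
 have mp: "m : posset" using m by simp
 have hD: "hexp D ?ap ?am" unfolding hexp_def
 proof (intro conjI ballI)
  show "finite {n. n<=0 & [n = 1] (mod 24) & ?ap n ~= 0}" by (rule finite_subset[of _ "{m}"]) auto
  show "finite {n. n<=0 & [n = -1] (mod 24) & ?am n ~= 0}" by (rule finite_subset[of _ "{}"]) auto
  fix z assume z: "z : uhp"
  define w where "w = - cnj z"
  have w: "w : uhp" "Im w = Im z" using z by (simp_all add: w_def reflect_uhp)
  have q: "cnj (qpow s w) = qpow s z" for s unfolding w_def by (rule qpow_reflect)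
  have y: "Im z > 0" using z by (simp add: uhp_iff)
  have pos: "((%n. ?ap n*qpow (of_int n/24) z) has_sum (s + - cnj s'+\<kappa>*qpow (of_int m/24) z)) posset"
   if s: "((%n. pp n*qpow (of_int n/24) z) has_sum s) {n. 0 < n & [n = 1] (mod 24)}"
    "((%n. pp n*qpow (of_int n/24) w) has_sum s') {n. 0 < n & [n = 1] (mod 24)}" for s s'
  proof -
   have "((%n. cnj (pp n*qpow (of_int n/24) w)) has_sum cnj s') {n. 0 < n & [n = 1] (mod 24)}" unfolding has_sum_cnj_iff by (rule s(2))
   then have "((%n. cnj (pp n)*qpow (of_int n/24) z) has_sum cnj s') {n. 0 < n & [n = 1] (mod 24)}" unfolding complex_cnj_mult q .
   from has_sum_add[OF s(1) has_sum_neg[OF this]]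
   have "((%n. (pp n - cnj (pp n))*qpow (of_int n/24) z) has_sum (s + - cnj s')) {n. 0 < n & [n = 1] (mod 24)}"
    by (rule has_sum_congD) (simp add: algebra_simps)
   from has_sum_add[OF this[unfolded extend_sum] has_sum_singleton[OF mp, of "\<kappa>*qpow (of_int m/24) z"]]
   show ?thesis by (rule has_sum_congD) (simp add: distrib_right)
  qed
  show "\<exists>s t. ((%n. ?ap n*qpow (of_int n/24) z) has_sum s) posset \<and>
   ((%n. nonhol ?am n z) has_sum t) negset & D z = s + t"
  proof (cases "m < 0")
   case True
   obtain s where s: "((%n. pp n*qpow (of_int n/24) z) has_sum s) {n. 0 < n & [n = 1] (mod 24)}" "f z = qpow (of_int m/24) z + s"
    using h z True unfolding has_h_expansion_def by auto
   obtain s' where s': "((%n. pp n*qpow (of_int n/24) w) has_sum s') {n. 0 < n & [n = 1] (mod 24)}" "f w = qpow (of_int m/24) w + s'"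
    using h w(1) True unfolding has_h_expansion_def by auto
   have "((%n. nonhol ?am n z) has_sum 0) negset"
    by (rule has_sum_0) (use True in auto)
   moreover have "D z = (s + - cnj s'+\<kappa>*qpow (of_int m/24) z)+0"
    unfolding D_def w_def[symmetric] s(2) s'(2) complex_cnj_add q using True by (simp add: \<kappa>_def)
   ultimately show ?thesis using pos[OF s(1) s'(1)] by blast
  next
   case False
   obtain s t where st: "((%n. pp n*qpow (of_int n/24) z) has_sum s) {n. 0 < n & [n = 1] (mod 24)}"
    "((%n. pm n * beta_fun (of_int n*Im z)*qpow (- of_int n/24) z) has_sum t) {n. 0 < n & [n = -1] (mod 24)}"
    "f z = s+\<i> * beta_fun (- of_int m*Im z)*qpow (of_int m/24) z + t"
    using bspec[OF h[unfolded has_h_expansion_def] z] False by auto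
   obtain s' t' where st': "((%n. pp n*qpow (of_int n/24) w) has_sum s') {n. 0 < n & [n = 1] (mod 24)}"
    "((%n. pm n * beta_fun (of_int n*Im z)*qpow (- of_int n/24) w) has_sum t') {n. 0 < n & [n = -1] (mod 24)}"
    "f w = s'+\<i> * beta_fun (- of_int m*Im z)*qpow (of_int m/24) w + t'"
    using bspec[OF h[unfolded has_h_expansion_def] w(1)] False unfolding w(2) by auto
   have br: "cnj (beta_fun (of_int n*Im z)) = beta_fun (of_int n*Im z)" if "n > 0" for n
   proof -
    have "pi*(of_int n*Im z)/6 > 0" using that y by simp
    from inc_Gamma_pos[OF this] show ?thesis by (simp add: beta_fun_def)
   qed
   have "((%n. cnj (pm n * beta_fun (of_int n*Im z)*qpow (- of_int n/24) w)) has_sum cnj t') {n. 0 < n & [n = -1] (mod 24)}"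
    unfolding has_sum_cnj_iff by (rule st'(2))
   from has_sum_add[OF st(2) has_sum_neg[OF this]]
   have "((%n. (pm n - cnj (pm n))*(gam n z*qpow (- of_int n/24) z)) has_sum (t + - cnj t')) {n. 0 < n & [n = -1] (mod 24)}"
   proof (rule has_sum_congD)
    fix n :: int assume "n : {n. 0 < n & [n = -1] (mod 24)}"
    then have n: "cnj (beta_fun (of_int n*Im z)) = beta_fun (of_int n*Im z)" by (intro br) simp
    show "pm n * beta_fun (of_int n*Im z)*qpow (- of_int n/24) z + - cnj (pm n * beta_fun (of_int n*Im z)*qpow (- of_int n/24) w)
     = (pm n - cnj (pm n))*(gam n z*qpow (- of_int n/24) z)"
     unfolding beta_eq[symmetric] complex_cnj_mult n q by (simp add: algebra_simps)
   qed
   then have "((%n. ?am n*(gam n z*qpow (- of_int n/24) z)) has_sum (t + - cnj t')) negset"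
    unfolding extend_sum by (rule has_sum_congD) (use False in auto)
   then have neg: "((%n. nonhol ?am n z) has_sum (t + - cnj t')) negset"
    unfolding mult.assoc .
   have mm: "pi * of_int m/6 > 0" using False posset_nonzero[OF mp] by simp
   have b: "beta_fun (- of_int m*Im z) = inc_Gamma (- 3/2) (- (pi * of_int m/6)*Im z)" unfolding beta_fun_def by (rule arg_cong) simp
   have ic: "Im (\<i> * inc_Gamma (- 3/2) (- (pi * of_int m/6)*Im z)) = Im (\<i> * inc_Gamma (- 3/2) (- (pi * of_int m/6)*1))"
    by (rule ibeta_Im_const[OF mm y]) simp
   have "\<i> * beta_fun (- of_int m*Im z) - cnj (\<i> * beta_fun (- of_int m*Im z)) = \<kappa>"
    unfolding complex_diff_cnj b ic using False by (simp add: \<kappa>_def)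
   then have k: "\<i> * beta_fun (- of_int m*Im z) = \<kappa> + cnj (\<i> * beta_fun (- of_int m*Im z))" by (simp only: diff_eq_eq)
   define u where "u = \<i> * beta_fun (- of_int m*Im z)"
   have uq: "u*qpow (of_int m/24) z = \<kappa>*qpow (of_int m/24) z + cnj u*qpow (of_int m/24) z"
    using arg_cong[OF k, of "%x. x*qpow (of_int m/24) z"] unfolding u_def distrib_right .
   have "D z = (s + - cnj s'+\<kappa>*qpow (of_int m/24) z)+(t + - cnj t')"
    unfolding D_def w_def[symmetric] st(3) st'(3) u_def[symmetric] complex_cnj_add complex_cnj_mult[of u] q
    using uq by (simp add: algebra_simps)
   then show ?thesis using pos[OF st(1) st'(1)] neg by blast
  qed
 qed
 have trD: "transforms_like (5/2) eta_mult D" unfolding D_def[abs_def] by (rule transforms_add_scaled[OF tr transforms_reflect[OF tr]])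
 have D0: "D z = 0" if "z : uhp" for z
  by (rule hexp_vanishing[OF hD trD _ _ that]) (use posset_nonzero[OF mp] in \<open>auto simp: \<kappa>_def\<close>)
 have "?ap n = 0" by (rule hexp_coeffs_zero(2)[OF hD D0]) (use n in simp_all)
 then have "pp n - cnj (pp n) = 0" using n by simp
 then have "pp n = cnj (pp n)" unfolding right_minus_eq .
 then show ?thesis unfolding Reals_cnj_iff by (rule sym)
qed

section \<open>Independence and spanning\<close>

lemma hexp_sum:
 assumes "finite M" "!!m. m : M ==> hexp (f m) (A m) (B m)"
 shows "hexp (%z. \<Sum>m\<in>M. c m*f m z) (%n. \<Sum>m\<in>M. c m*A m n) (%n. \<Sum>m\<in>M. c m*B m n)"
 using assms
proof (induction M rule: finite_induct)
 case empty
 have "\<exists>s t. ((%n. 0 :: complex) has_sum s) posset & ((%n. 0 :: complex) has_sum t) negset & 0 = s + t"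
  by (intro exI[of _ 0] conjI has_sum_0) simp_all
 then show ?case by (simp add: hexp_def)
next
 case (insert x M)
 have "hexp (%z. (\<Sum>m\<in>M. c m*f m z) + c x*f x z) (%n. (\<Sum>m\<in>M. c m*A m n) + c x*A x n) (%n. (\<Sum>m\<in>M. c m*B m n) + c x*B x n)"
  using insert by (intro hexp_add_scaled) auto
 then show ?case using insert.hyps by (simp add: add.commute)
qed

lemma sum_cscale_apply: "finite M ==> (\<Sum>m\<in>M. cscale (c m) (f m)) z = (\<Sum>m\<in>M. c m*f m z)"
 by (induction M rule: finite_induct) (simp_all add: cscale_def)

text \<open>On nonpositive indices each form has exactly one nonzero coefficient: 1 at m in the
  holomorphic half if m < 0, and i at -m in the other half if m > 0. Linear independence and
  spanning are read off from this dual system.\<close>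

lemma h_form_coefficients:
 obtains A B where "!!m. m : posset ==> hexp (h_form m) (A m) (B m)"
  "!!m n. m : posset ==> n<=0 ==> A m n = (if n = m then 1 else 0)"
  "!!m n. m : posset ==> n<=0 ==> B m n = (if n = - m then \<i> else 0)"
proof -
 have "\<forall>m\<in>posset. \<exists>p. hexp (h_form m) (fst p) (snd p) & (\<forall>n\<le>0. fst p n = (if n = m then 1 else 0)) & (\<forall>n\<le>0. snd p n = (if n = - m then \<i> else 0))"
 proof
  fix m assume "m : posset"
  then have m: "[m = 1] (mod 24)" by simp
  obtain pp pm where "has_h_expansion m (h_form m) pp pm" using is_h_form_h_form[OF m] unfolding is_h_form_def by blast
  from h_expansion_hexp[OF m this]
  show "\<exists>p. hexp (h_form m) (fst p) (snd p) & (\<forall>n\<le>0. fst p n = (if n = m then 1 else 0)) & (\<forall>n\<le>0. snd p n = (if n = - m then \<i> else 0))"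
   by (intro exI[of _ "(%n. if n > 0 then pp n else if n = m then 1 else 0, %n. if n > 0 then (if m > 0 then pm n else 0) else if n = - m then \<i> else 0)"]) auto
 qed
 from bchoice[OF this] obtain p where p: "\<forall>m\<in>posset. hexp (h_form m) (fst (p m)) (snd (p m)) \<and>
  (\<forall>n\<le>0. fst (p m) n = (if n = m then 1 else 0)) & (\<forall>n\<le>0. snd (p m) n = (if n = - m then \<i> else 0))" by blast
 show ?thesis by (rule that[of "%m. fst (p m)" "%m. snd (p m)"]) (use p in auto)
qed

lemma h_forms_independent: "cfun.independent (h_form ` posset)"
proof
 assume "cfun.dependent (h_form ` posset)"
 then obtain t u where t: "finite t" "t \<subseteq> h_form ` posset" "(\<Sum>v\<in>t. cscale (u v) v) = 0" "\<exists>v\<in>t. u v ~= 0"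
  unfolding cfun.dependent_explicit by blast
 obtain M where M: "M \<subseteq> posset" "inj_on h_form M" "t = h_form ` M" using t(2) unfolding subset_image_inj by blast
 have fM: "finite M" using t(1) M(2,3) finite_imageD by blast
 obtain A B where AB: "!!m. m : posset ==> hexp (h_form m) (A m) (B m)"
  "!!m n. m : posset ==> n<=0 ==> A m n = (if n = m then 1 else 0)"
  "!!m n. m : posset ==> n<=0 ==> B m n = (if n = - m then \<i> else 0)"
  using h_form_coefficients by blast
 define c where "c m = u (h_form m)" for m
 have "(\<Sum>m\<in>M. cscale (c m) (h_form m)) = 0" using t(3) unfolding M(3) sum.reindex[OF M(2)] by (simp add: c_def)
 then have z: "(\<Sum>m\<in>M. c m*h_form m z) = 0" for z using sum_cscale_apply[OF fM, of c h_form z] by simp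
 have h: "hexp (%z. \<Sum>m\<in>M. c m*h_form m z) (%n. \<Sum>m\<in>M. c m*A m n) (%n. \<Sum>m\<in>M. c m*B m n)"
  by (rule hexp_sum[OF fM]) (use AB(1) M(1) in blast)
 have "c k = 0" if k: "k : M" for k
 proof (cases "k<=0")
  case True
  have "(\<Sum>m\<in>M. c m*A m k) = 0" by (rule hexp_coeffs_zero(2)[OF h z]) (use k M(1) in blast)
  moreover have "(\<Sum>m\<in>M. c m*A m k) = (\<Sum>m\<in>M. if m = k then c m else 0)"
   using AB(2) M(1) True by (intro sum.cong) auto
  ultimately show ?thesis using fM k by simp
 next
  case False
  have kn: "- k : negset" using k M(1) cong_minus_minus_iff[of k 1 24] by auto
  have "(\<Sum>m\<in>M. c m*B m (- k)) = 0" by (rule hexp_coeffs_zero(1)[OF h z kn])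
  moreover have "(\<Sum>m\<in>M. c m*B m (- k)) = (\<Sum>m\<in>M. if m = k then c m*\<i> else 0)"
   using AB(3) M(1) False by (intro sum.cong) auto
  ultimately show ?thesis using fM k by simp
 qed
 then show False using t(4) unfolding M(3) c_def by blast
qed

lemma h_forms_span: "cfun.span (h_form ` posset) = weak_harmonic_Maass_forms (5/2)"
proof
 have W: "h_form ` posset \<subseteq> weak_harmonic_Maass_forms (5/2)" using is_h_form_h_form unfolding is_h_form_def by auto
 have zero: "0 : weak_harmonic_Maass_forms (5/2)"
 proof -
  have "hexp 0 (%n. 0) (%n. 0)" using hexp_sum[of "{}"] by (simp add: zero_fun_def)
  moreover have "transforms_like (5/2) eta_mult 0" by (simp add: transforms_like_def)
  ultimately show ?thesis unfolding weak_harmonic_iff by auto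
 qed
 have sub: "cfun.subspace (weak_harmonic_Maass_forms (5/2))"
 proof (rule cfun.subspaceI[OF zero])
  fix f g assume "f : weak_harmonic_Maass_forms (5/2)" "g : weak_harmonic_Maass_forms (5/2)"
  from harmonic_add_scaled[OF this, of 1] show "f + g : weak_harmonic_Maass_forms (5/2)" by (simp add: plus_fun_def)
 next
  fix f k assume "f : weak_harmonic_Maass_forms (5/2)"
  from harmonic_add_scaled[OF zero this, of k] show "cscale k f : weak_harmonic_Maass_forms (5/2)" by (simp add: cscale_def)
 qed
 show s: "cfun.span (h_form ` posset) \<subseteq> weak_harmonic_Maass_forms (5/2)" by (rule cfun.span_minimal[OF W sub])
 show "weak_harmonic_Maass_forms (5/2) \<subseteq> cfun.span (h_form ` posset)"
 proof
  fix f assume f: "f : weak_harmonic_Maass_forms (5/2)"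
  then obtain ap am where h: "hexp f ap am" unfolding weak_harmonic_iff by blast
  obtain A B where AB: "!!m. m : posset ==> hexp (h_form m) (A m) (B m)"
   "!!m n. m : posset ==> n<=0 ==> A m n = (if n = m then 1 else 0)"
   "!!m n. m : posset ==> n<=0 ==> B m n = (if n = - m then \<i> else 0)"
   using h_form_coefficients by blast
  define M1 where "M1 = {n. n<=0 & [n = 1] (mod 24) & ap n ~= 0}"
  define M2 where "M2 = {n. n<=0 & [n = -1] (mod 24) & am n ~= 0}"
  \<comment> \<open>A nonpositive index n of the nonholomorphic half is produced by the form of
    index -n, hence the negation.\<close>
  define M where "M = M1 \<union> uminus ` M2"
  have fM: "finite M" using h unfolding M_def M1_def M2_def hexp_def by blast
  have MP: "M \<subseteq> posset"
  proof
   fix n assume "n : M"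
   then consider "n : M1" | k where "n = - k" "k : M2" unfolding M_def by blast
   then show "n : posset" using cong_minus_minus_iff[of _ 1 24] by cases (auto simp: M1_def M2_def cong_minus_minus_iff[of _ "-1", simplified])
  qed
  \<comment> \<open>The coefficient of \<open>h_form m\<close> at index -m is i, whence the division
    by i.\<close>
  define c where "c m = (if m<=0 then ap m else am (- m)/\<i>)" for m
  define g where "g = (\<Sum>m\<in>M. cscale (c m) (h_form m))"
  have gs: "g : cfun.span (h_form ` posset)" unfolding g_def
   by (intro cfun.span_sum cfun.span_scale cfun.span_base) (use MP in blast)
  have "hexp (%z. \<Sum>m\<in>M. c m*h_form m z) (%n. \<Sum>m\<in>M. c m*A m n) (%n. \<Sum>m\<in>M. c m*B m n)"
   by (rule hexp_sum[OF fM]) (use AB(1) MP in blast)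
  moreover have "g = (%z. \<Sum>m\<in>M. c m*h_form m z)" using sum_cscale_apply[OF fM] unfolding g_def by blast
  ultimately have hg: "hexp g (%n. \<Sum>m\<in>M. c m*A m n) (%n. \<Sum>m\<in>M. c m*B m n)" by (simp only:)
  have "f = g"
  proof (rule hexp_determined[OF f subsetD[OF s gs] h hg])
   fix n assume n: "n : posset" "n<=0"
   have "(\<Sum>m\<in>M. c m*A m n) = (\<Sum>m\<in>M. if m = n then c m else 0)" using AB(2) MP n(2) by (intro sum.cong) auto
   also have "... = (if n : M then c n else 0)" using fM by simp
   also have "... = ap n"
   proof (cases "ap n = 0")
    case True
    then show ?thesis using n(2) by (simp add: c_def)
   next
    case False
    then show ?thesis using n by (simp add: c_def M_def M1_def)
   qed
   finally show "ap n = (\<Sum>m\<in>M. c m*A m n)" by simp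
  next
   fix n assume n: "n : negset" "n<=0"
   have n0: "n < 0" using n negset_nonzero[OF n(1)] by simp
   have "(\<Sum>m\<in>M. c m*B m n) = (\<Sum>m\<in>M. if m = - n then c m*\<i> else 0)" using AB(3) MP n(2) by (intro sum.cong) auto
   also have "... = (if - n : M then c (- n)*\<i> else 0)" using fM by simp
   also have "... = am n"
   proof (cases "am n = 0")
    case True
    then show ?thesis using n0 by (simp add: c_def)
   next
    case False
    then have "- n : M" using n by (auto simp: M_def M2_def)
    then show ?thesis using n0 by (simp add: c_def complex_eq_iff)
   qed
   finally show "am n = (\<Sum>m\<in>M. c m*B m n)" by simp
  qed
  then show "f : cfun.span (h_form ` posset)" using gs by simp
 qed
qed

theorem theorem1:
  shows "(\<forall>m::int. [m = 1] (mod 24) \<longrightarrow> (\<exists>!h. is_h_form m h)) \<and>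
    cfun.independent (h_form ` {m. [m = 1] (mod 24)}) \<and>
    cfun.span (h_form ` {m. [m = 1] (mod 24)}) = weak_harmonic_Maass_forms (5/2) \<and>
    (\<forall>m::int. [m = 1] (mod 24) \<and> m < 0 \<longrightarrow>
       h_form m \<in> weakly_holomorphic_forms (5/2) eta_mult) \<and>
    (\<forall>m::int. [m = 1] (mod 24) \<and> m > 0 \<longrightarrow>
       xi_op (5/2) (h_form m) = cscale (of_real ((6 / (pi * of_int m)) powr (3/2))) (g_form m) \<and>
       xi_op (5/2) (h_form m) \<in> weakly_holomorphic_forms (- 1/2) eta_mult_cnj) \<and>
    (\<forall>m::int. [m = 1] (mod 24) \<longrightarrow>
       (\<forall>pp pm n. has_h_expansion m (h_form m) pp pm \<and> 0 < n \<and> [n = 1] (mod 24) \<and> m \<noteq> n \<longrightarrow>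
          pp n \<in> \<real>))"
proof (intro conjI allI impI)
  fix m :: int assume m: "[m = 1] (mod 24)"
  show "\<exists>!h. is_h_form m h" using is_h_form_h_form[OF m] is_h_form_unique[OF m] by blast
next
  fix m :: int assume "[m = 1] (mod 24) \<and> m < 0"
  then show "h_form m \<in> weakly_holomorphic_forms (5/2) eta_mult" using negative_h_form(2) by blast
next
  fix m :: int assume m: "[m = 1] (mod 24) \<and> m > 0"
  then show x: "xi_op (5/2) (h_form m) = cscale (of_real ((6 / (pi * of_int m)) powr (3/2))) (g_form m)" using positive_h_form(2) by blast
  show "xi_op (5/2) (h_form m) \<in> weakly_holomorphic_forms (- 1/2) eta_mult_cnj"
    unfolding x using m by (intro g_form_weakly_holomorphic) auto
next
  fix m :: int and pp pm n
  assume m: "[m = 1] (mod 24)" and h: "has_h_expansion m (h_form m) pp pm \<and> 0 < n \<and> [n = 1] (mod 24) \<and> m \<noteq> n"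
  have "transforms_like (5/2) eta_mult (h_form m)" using is_h_form_h_form[OF m] unfolding is_h_form_def weak_harmonic_iff by blast
  then show "pp n \<in> \<real>" using h_coefficients_real[OF m, of "h_form m" pp pm n] h by blast
qed (fact h_forms_independent h_forms_span)+

end
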